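(* Let $T=2\pi p/q$ with $p,q\in\mathbb{N}^+$, $\gcd(p,q)=1$, and $\Omega=(0,T)\times(0,\pi)$. Assume: (A1) $\alpha,\beta$ are real-valued and belong to $W^3(0,\pi)=\{y\in L^1(0,\pi): y^{(3)}\text{ exists in the weak sense and belongs to }L^1(0,\pi)\}$. (A2) $\eta(0)=1$, $\rho(x)=\rho(0)e^{4\int_0^x\beta(s)\,ds}>1$, $\eta(x)=e^{4\int_0^x\alpha(s)\,ds}$, and $\int_0^\pi(\rho/\eta)^{1/4}\,dx=\pi$. Let $L$ be the beam operator, $\mu_n$ ($n\in\mathbb{N}^+$) and $\vartheta_m$ ($m\in\mathbb{Z}$) the numbers, and $a$ the constant in the eigenvalue asymptotics, all defined in the context. If $a$ is irrational, then the range $R(L)$ of $L$ is closed in $L^2(\Omega)$, $N(L)^\perp=R(L)$, $L^2(\Omega)=R(L)\oplus N(L)$, and $L^{-1}:R(L)\to R(L)$ is a bounded linear operator which is compact. Moreover, $$\|L^{-1}h\|\le\frac1\delta\|h\|,\qquad \langle L^{-1}h,h\rangle\ge-\frac1\gamma\|h\|^2,\qquad \|L^{-1}h\|_{L^\infty(\Omega)}\le C\|h\|\qquad\forall h\in R(L),$$ where $\delta:=\inf\{|\mu_n-\vartheta_m^2|:\mu_n\ne\vartheta_m^2\}$, $\gamma:=\inf\{\vartheta_m^2-\mu_n:\vartheta_m^2>\mu_n\}$ (infima over $m\in\mathbb{Z}$, $n\in\mathbb{N}^+$), and $C$ is a constant independent of $h$.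
   Context: $L^2(\Omega)$ is the weighted space with inner product $\langle u,v\rangle=\int_\Omega u\,\overline{v}\,\rho\,dt\,dx$ and norm $\|\cdot\|$; $L^\infty(\Omega)$ has the essential-supremum norm. Test functions: $\Psi$ is the set of functions $\psi$ that are $C^\infty$ on $\Omega$ (up to the boundary), satisfy $\psi=2(\alpha+\beta)\psi_x+\psi_{xx}=0$ at $x=0$ and $x=\pi$, and satisfy $\psi(0,x)=\psi(T,x)$, $\psi_t(0,x)=\psi_t(T,x)$. Beam operator: $D(L)$ is the set of $u\in L^2(\Omega)$ for which there is $h\in L^2(\Omega)$ with $\int_\Omega u(\rho\psi_{tt}+(\eta\psi_{xx})_{xx})\,dt\,dx=\int_\Omega h\psi\rho\,dt\,dx$ for all $\psi\in\Psi$, and then $Lu:=h$. On $\Psi$ this is $L\psi=\rho^{-1}(\rho\psi_{tt}+(\eta\psi_{xx})_{xx})$. $N(L)$ is the null space of $L$, and $L^{-1}$ denotes the inverse of the restriction of $L$ to $D(L)\cap N(L)^\perp$. Eigenvalues and the constant $a$: $\vartheta_m=2\pi m/T$, $m\in\mathbb{Z}$. Let $\mu_n$, $n\in\mathbb{N}^+$, be the eigenvalues (in nondecreasing order, counted with multiplicity) of the problem $\frac{1}{\rho}(\eta\varphi'')''=\mu\varphi$ on $(0,\pi)$ with $\varphi=2(\alpha+\beta)\varphi'+\varphi''=0$ at $x=0$ and $x=\pi$. It is a known result (Badanin–Korotyaev), which may be taken as given, that under (A1) and (A2) $$\mu_n=n^4+2n^2a+b_n+o\big(\tfrac1n\big)\quad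 (n\to\infty),$$ where $a$ is a real constant (depending on $\alpha,\beta$) and $(b_n)$ is a bounded sequence; in particular $a=\lim_{n\to\infty}(\mu_n-n^4)/(2n^2)$. *)

theory Defs
  imports
    "HOL-Probability.Essential_Supremum"
    "HOL-Library.Function_Algebras"
    "HOL-Library.Landau_Symbols"
begin

section \<open>Square-integrable functions over a measure\<close>

text \<open>
  Elements of the Hilbert space are represented by functions, and equality in the Hilbert space
  is equality almost everywhere.  Accordingly an operator on a subspace is given by its graph on
  representatives, a set of pairs (argument, value) that is single-valued only up to null sets.
\<close>

definition L2_space :: "'a measure \<Rightarrow> ('a \<Rightarrow> complex) set" where
  "L2_space M = {u \<in> borel_measurable M. integrable M (\<lambda>z. (cmod (u z))\<^sup>2)}"

definition L2_eq :: "'a measure \<Rightarrow> ('a \<Rightarrow> complex) \<Rightarrow> ('a \<Rightarrow> complex) \<Rightarrow> bool" where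
  "L2_eq M u v \<longleftrightarrow> (AE z in M. u z = v z)"

definition L2_inner :: "'a measure \<Rightarrow> ('a \<Rightarrow> complex) \<Rightarrow> ('a \<Rightarrow> complex) \<Rightarrow> complex" where
  "L2_inner M u v = (LINT z|M. u z * cnj (v z))"

definition L2_norm :: "'a measure \<Rightarrow> ('a \<Rightarrow> complex) \<Rightarrow> real" where
  "L2_norm M u = sqrt (Re (L2_inner M u u))"

definition Linfty_norm :: "'a measure \<Rightarrow> ('a \<Rightarrow> complex) \<Rightarrow> ereal" where
  "Linfty_norm M u = esssup M (\<lambda>z. ereal (cmod (u z)))"

definition L2_subspace :: "'a measure \<Rightarrow> ('a \<Rightarrow> complex) set \<Rightarrow> bool" where
  "L2_subspace M V \<longleftrightarrow> V \<subseteq> L2_space M \<and> (\<lambda>_. 0) \<in> V \<and>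
     (\<forall>u\<in>V. \<forall>v\<in>V. \<forall>c d. (\<lambda>z. c * u z + d * v z) \<in> V)"

definition L2_closed :: "'a measure \<Rightarrow> ('a \<Rightarrow> complex) set \<Rightarrow> bool" where
  "L2_closed M V \<longleftrightarrow>
     (\<forall>f g. (\<forall>n. f n \<in> V) \<longrightarrow> g \<in> L2_space M \<longrightarrow>
        (\<lambda>n::nat. L2_norm M (\<lambda>z. f n z - g z)) \<longlonglongrightarrow> 0 \<longrightarrow> g \<in> V)"

definition L2_orthogonal :: "'a measure \<Rightarrow> ('a \<Rightarrow> complex) set \<Rightarrow> ('a \<Rightarrow> complex) set" where
  "L2_orthogonal M V = {u \<in> L2_space M. \<forall>v\<in>V. L2_inner M u v = 0}"

definition L2_direct_sum ::
  "'a measure \<Rightarrow> ('a \<Rightarrow> complex) set \<Rightarrow> ('a \<Rightarrow> complex) set \<Rightarrow> bool" where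
  "L2_direct_sum M V W \<longleftrightarrow> L2_subspace M V \<and> L2_subspace M W \<and>
     (\<forall>u\<in>L2_space M. \<exists>v\<in>V. \<exists>w\<in>W. L2_eq M u (\<lambda>z. v z + w z)) \<and>
     (\<forall>u\<in>V \<inter> W. L2_eq M u (\<lambda>_. 0))"

text \<open>\<open>S\<close> is the graph of a bounded linear operator from \<open>V\<close> (its full domain) to \<open>W\<close>.\<close>

definition L2_bounded_linear_graph ::
  "'a measure \<Rightarrow> ('a \<Rightarrow> complex) set \<Rightarrow> ('a \<Rightarrow> complex) set \<Rightarrow>
     (('a \<Rightarrow> complex) \<times> ('a \<Rightarrow> complex)) set \<Rightarrow> bool" where
  "L2_bounded_linear_graph M V W S \<longleftrightarrow>
     L2_subspace M V \<and> L2_subspace M W \<and> Domain S = V \<and> Range S \<subseteq> W \<and>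
     (\<forall>h u h' u'. (h, u) \<in> S \<longrightarrow> (h', u') \<in> S \<longrightarrow> L2_eq M h h' \<longrightarrow> L2_eq M u u') \<and>
     (\<forall>h u h' u' c d. (h, u) \<in> S \<longrightarrow> (h', u') \<in> S \<longrightarrow>
        ((\<lambda>z. c * h z + d * h' z), (\<lambda>z. c * u z + d * u' z)) \<in> S) \<and>
     (\<exists>K. \<forall>(h, u)\<in>S. L2_norm M u \<le> K * L2_norm M h)"

definition L2_compact_graph ::
  "'a measure \<Rightarrow> ('a \<Rightarrow> complex) set \<Rightarrow> (('a \<Rightarrow> complex) \<times> ('a \<Rightarrow> complex)) set \<Rightarrow> bool" where
  "L2_compact_graph M W S \<longleftrightarrow>
     (\<forall>h u K. (\<forall>n::nat. (h n, u n) \<in> S \<and> L2_norm M (h n) \<le> K) \<longrightarrow>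
        (\<exists>r v. strict_mono r \<and> v \<in> W \<and>
           (\<lambda>n::nat. L2_norm M (\<lambda>z. u (r n) z - v z)) \<longlonglongrightarrow> 0))"


section \<open>The Sobolev space of the coefficients\<close>

text \<open>
  Membership in \<open>W3\<close> is insensitive to null sets, whereas the boundary conditions below evaluate
  the coefficients at the end points.  There the coefficients have to be continuous representatives.
\<close>

definition test_function_pi :: "(real \<Rightarrow> real) \<Rightarrow> bool" where
  "test_function_pi \<phi> \<longleftrightarrow>
     (\<forall>k x. ((deriv ^^ k) \<phi>) differentiable (at x)) \<and>
     (\<exists>K. compact K \<and> K \<subseteq> {0<..<pi} \<and> (\<forall>x. x \<notin> K \<longrightarrow> \<phi> x = 0))"

definition W3 :: "(real \<Rightarrow> real) set" where
  "W3 = {y. set_integrable lborel {0<..<pi} y \<and>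
     (\<exists>g. set_integrable lborel {0<..<pi} g \<and>
       (\<forall>\<phi>. test_function_pi \<phi> \<longrightarrow>
          (LBINT x:{0<..<pi}. y x * (deriv ^^ 3) \<phi> x) = - (LBINT x:{0<..<pi}. g x * \<phi> x)))}"


section \<open>The beam operator\<close>

text \<open>Points of \<open>\<Omega>\<close> are pairs \<open>(t, x)\<close>.\<close>

definition beam_domain :: "real \<Rightarrow> (real \<times> real) set" where
  "beam_domain T = {0<..<T} \<times> {0<..<pi}"

definition beam_measure :: "real \<Rightarrow> (real \<Rightarrow> real) \<Rightarrow> (real \<times> real) measure" where
  "beam_measure T \<rho> = density (restrict_space lborel (beam_domain T)) (\<lambda>(t, x). ennreal (\<rho> x))"

text \<open>Derivatives up to the boundary: at end points these are one-sided derivatives.\<close>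

definition D_pi :: "(real \<Rightarrow> complex) \<Rightarrow> real \<Rightarrow> complex" where
  "D_pi f x = vector_derivative f (at x within {0..pi})"

definition dt :: "real \<Rightarrow> (real \<times> real \<Rightarrow> complex) \<Rightarrow> real \<times> real \<Rightarrow> complex" where
  "dt T \<psi> = (\<lambda>(t, x). vector_derivative (\<lambda>s. \<psi> (s, x)) (at t within {0..T}))"

definition dx :: "(real \<times> real \<Rightarrow> complex) \<Rightarrow> real \<times> real \<Rightarrow> complex" where
  "dx \<psi> = (\<lambda>(t, x). D_pi (\<lambda>y. \<psi> (t, y)) x)"

primrec Ck_rect :: "nat \<Rightarrow> real \<Rightarrow> (real \<times> real \<Rightarrow> complex) \<Rightarrow> bool" where
  "Ck_rect 0 T \<psi> \<longleftrightarrow> continuous_on ({0..T} \<times> {0..pi}) \<psi>"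
| "Ck_rect (Suc k) T \<psi> \<longleftrightarrow>
     continuous_on ({0..T} \<times> {0..pi}) \<psi> \<and>
     (\<forall>t\<in>{0..T}. \<forall>x\<in>{0..pi}.
        (\<lambda>s. \<psi> (s, x)) differentiable (at t within {0..T}) \<and>
        (\<lambda>y. \<psi> (t, y)) differentiable (at x within {0..pi})) \<and>
     Ck_rect k T (dt T \<psi>) \<and> Ck_rect k T (dx \<psi>)"

definition beam_test :: "real \<Rightarrow> (real \<Rightarrow> real) \<Rightarrow> (real \<Rightarrow> real) \<Rightarrow> (real \<times> real \<Rightarrow> complex) set" where
  "beam_test T \<alpha> \<beta> = {\<psi>.
     (\<forall>k. Ck_rect k T \<psi>) \<and>
     (\<forall>t\<in>{0..T}. \<forall>x\<in>{0, pi}. \<psi> (t, x) = 0 \<and>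
        2 * complex_of_real (\<alpha> x + \<beta> x) * dx \<psi> (t, x) + dx (dx \<psi>) (t, x) = 0) \<and>
     (\<forall>x\<in>{0..pi}. \<psi> (0, x) = \<psi> (T, x) \<and> dt T \<psi> (0, x) = dt T \<psi> (T, x))}"

text \<open>The pairs \<open>(u, h)\<close> with \<open>u\<close> in the domain of the beam operator and \<open>L u = h\<close>.\<close>

definition beam_graph ::
  "real \<Rightarrow> (real \<Rightarrow> real) \<Rightarrow> (real \<Rightarrow> real) \<Rightarrow> (real \<Rightarrow> real) \<Rightarrow> (real \<Rightarrow> real) \<Rightarrow>
     ((real \<times> real \<Rightarrow> complex) \<times> (real \<times> real \<Rightarrow> complex)) set" where
  "beam_graph T \<alpha> \<beta> \<rho> \<eta> = {(u, h).
     u \<in> L2_space (beam_measure T \<rho>) \<and> h \<in> L2_space (beam_measure T \<rho>) \<and>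
     (\<forall>\<psi>\<in>beam_test T \<alpha> \<beta>.
        (LINT z:beam_domain T|lborel.
           u z * (complex_of_real (\<rho> (snd z)) * dt T (dt T \<psi>) z
                  + dx (dx (\<lambda>w. complex_of_real (\<eta> (snd w)) * dx (dx \<psi>) w)) z))
        = (LINT z:beam_domain T|lborel. h z * \<psi> z * complex_of_real (\<rho> (snd z))))}"

definition beam_range ::
  "real \<Rightarrow> (real \<Rightarrow> real) \<Rightarrow> (real \<Rightarrow> real) \<Rightarrow> (real \<Rightarrow> real) \<Rightarrow> (real \<Rightarrow> real) \<Rightarrow>
     (real \<times> real \<Rightarrow> complex) set" where
  "beam_range T \<alpha> \<beta> \<rho> \<eta> = Range (beam_graph T \<alpha> \<beta> \<rho> \<eta>)"

definition beam_null ::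
  "real \<Rightarrow> (real \<Rightarrow> real) \<Rightarrow> (real \<Rightarrow> real) \<Rightarrow> (real \<Rightarrow> real) \<Rightarrow> (real \<Rightarrow> real) \<Rightarrow>
     (real \<times> real \<Rightarrow> complex) set" where
  "beam_null T \<alpha> \<beta> \<rho> \<eta> = {u. (u, \<lambda>_. 0) \<in> beam_graph T \<alpha> \<beta> \<rho> \<eta>}"

text \<open>
  The inverse of the restriction of \<open>L\<close> to the orthogonal complement of its null space:
  the pairs \<open>(h, u)\<close> with \<open>u\<close> in that complement and \<open>L u = h\<close>.
\<close>

definition beam_inverse_graph ::
  "real \<Rightarrow> (real \<Rightarrow> real) \<Rightarrow> (real \<Rightarrow> real) \<Rightarrow> (real \<Rightarrow> real) \<Rightarrow> (real \<Rightarrow> real) \<Rightarrow>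
     ((real \<times> real \<Rightarrow> complex) \<times> (real \<times> real \<Rightarrow> complex)) set" where
  "beam_inverse_graph T \<alpha> \<beta> \<rho> \<eta> = {(h, u).
     (u, h) \<in> beam_graph T \<alpha> \<beta> \<rho> \<eta> \<and>
     u \<in> L2_orthogonal (beam_measure T \<rho>) (beam_null T \<alpha> \<beta> \<rho> \<eta>)}"


section \<open>Eigenvalues\<close>

text \<open>
  Solutions are set to zero outside the interval, so that distinct elements are distinct as
  functions on the interval and the dimension below is the multiplicity of \<open>\<nu>\<close>.
\<close>

definition beam_eigenspace ::
  "(real \<Rightarrow> real) \<Rightarrow> (real \<Rightarrow> real) \<Rightarrow> (real \<Rightarrow> real) \<Rightarrow> (real \<Rightarrow> real) \<Rightarrow> real \<Rightarrow>
     (real \<Rightarrow> complex) set" where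
  "beam_eigenspace \<alpha> \<beta> \<rho> \<eta> \<nu> = {\<phi>.
     (let m = (\<lambda>x. complex_of_real (\<eta> x) * D_pi (D_pi \<phi>) x) in
       \<phi> differentiable_on {0..pi} \<and> D_pi \<phi> differentiable_on {0..pi} \<and>
       m differentiable_on {0..pi} \<and> D_pi m differentiable_on {0..pi} \<and>
       (\<forall>x\<in>{0<..<pi}. 1 / complex_of_real (\<rho> x) * D_pi (D_pi m) x = complex_of_real \<nu> * \<phi> x)) \<and>
     (\<forall>x\<in>{0, pi}. \<phi> x = 0 \<and>
        2 * complex_of_real (\<alpha> x + \<beta> x) * D_pi \<phi> x + D_pi (D_pi \<phi>) x = 0) \<and>
     (\<forall>x. x \<notin> {0..pi} \<longrightarrow> \<phi> x = 0)}"

text \<open>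
  \<open>\<mu> 1, \<mu> 2, \<dots>\<close> lists the eigenvalues in nondecreasing order, each as often as its multiplicity
  (the complex dimension of the eigenspace).  The value \<open>\<mu> 0\<close> plays no role.  The finiteness
  condition is needed because \<open>card\<close> is \<open>0\<close> on infinite sets.
\<close>

definition beam_eigenvalues ::
  "(real \<Rightarrow> real) \<Rightarrow> (real \<Rightarrow> real) \<Rightarrow> (real \<Rightarrow> real) \<Rightarrow> (real \<Rightarrow> real) \<Rightarrow> (nat \<Rightarrow> real) \<Rightarrow> bool" where
  "beam_eigenvalues \<alpha> \<beta> \<rho> \<eta> \<mu> \<longleftrightarrow>
     mono_on {1..} \<mu> \<and>
     (\<forall>\<nu>. finite {n. 1 \<le> n \<and> \<mu> n = \<nu>} \<and>
        card {n. 1 \<le> n \<and> \<mu> n = \<nu>} =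
          vector_space.dim (\<lambda>(c::complex) \<phi> x. c * \<phi> x) (beam_eigenspace \<alpha> \<beta> \<rho> \<eta> \<nu>))"

definition vartheta :: "real \<Rightarrow> int \<Rightarrow> real" where
  "vartheta T m = 2 * pi * real_of_int m / T"

definition beam_delta :: "real \<Rightarrow> (nat \<Rightarrow> real) \<Rightarrow> real" where
  "beam_delta T \<mu> = Inf {\<bar>\<mu> n - (vartheta T m)\<^sup>2\<bar> | m n. 1 \<le> n \<and> \<mu> n \<noteq> (vartheta T m)\<^sup>2}"

definition beam_gamma :: "real \<Rightarrow> (nat \<Rightarrow> real) \<Rightarrow> real" where
  "beam_gamma T \<mu> = Inf {(vartheta T m)\<^sup>2 - \<mu> n | m n. 1 \<le> n \<and> (vartheta T m)\<^sup>2 > \<mu> n}"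

end

(*
  The functions phi_n(x) exp(i theta_m t) / sqrt T diagonalise L in the weak sense, with eigenvalues
  mu_n - theta_m^2, where (phi_n) is an orthonormal basis of eigenfunctions of the spatial problem.
  Since theta_m^2 = (m q / p)^2 and mu_n = (n^2 + a)^2 + O(1), factoring the difference of squares
  shows that |mu_n - theta_m^2| is small only if |m| q / p - n^2 is close to a; the former has
  denominator p and a is irrational, so |mu_n - theta_m^2| >= c (n^2 + |m|) - B.  Hence only finitely
  many eigenvalues vanish and the others are bounded away from 0, which gives closed range, the norm
  and lower bounds, and compactness.  The gap also makes the sum over (m, n) of
  |phi_n(x)|^2 / (mu_n - theta_m^2)^2 uniformly bounded, which gives the L^infinity bound by
  Cauchy-Schwarz.  This needs only the averaged bound sum_{n <= N} |phi_n(x)|^2 <= C N, which follows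
  from Agmon's interpolation inequality and the energy form, without asymptotics of eigenfunctions.
*)
theory Submission
  imports Defs "HOL-Complex_Analysis.Great_Picard"
begin

section \<open>Semi-inner products on spaces of functions\<close>

text \<open>Two obstacles shape the development. The weak equation may be tested only with functions
  that are smooth up to the boundary, whereas \<open>\<eta>\<close> has finite smoothness, so an
  eigenfunction times an exponential need not be admissible: it is approximated, together with its
  image, by polynomials that satisfy the boundary conditions exactly. Secondly, no completeness of
  an L^2 space enters. In space, the analysis takes place in the pre-Hilbert space of continuous
  functions, where limits come from Arzela-Ascoli or uniform convergence; in space-time, every
  required element is a pointwise absolutely convergent, bounded series, by the same estimate that
  gives the L^infinity bound. Parseval is therefore available, and suffices, for pairs of which one
  member lies in the domain. The hypotheses supply the eigenvalues as numbers with multiplicities;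
  the eigenfunctions come from a variational argument for the resolvent, and the equality of
  multiplicity and dimension attaches them to the numbers. The conditions at the ends contribute
  terms of no fixed sign to the energy form, which interpolation absorbs.\<close>

lemma mult_cnj_cmod: "z * cnj z = (complex_of_real (cmod z))\<^sup>2"
  using complex_norm_square[of z] by simp

text \<open>Definiteness is deliberately absent: functions equal almost everywhere, functions that
  differ only outside \<open>{0..pi}\<close>, and the quadratic form of the resolvent
  \<open>Kop\<close> all lead to forms that are merely semidefinite as given, and Cauchy-Schwarz is
  needed for each of them.\<close>

locale cip_space =
  fixes V :: "('a \<Rightarrow> complex) set"
    and ip :: "('a \<Rightarrow> complex) \<Rightarrow> ('a \<Rightarrow> complex) \<Rightarrow> complex"
  assumes zero_mem: "(\<lambda>_. 0) \<in> V"
    and lin_mem: "\<And>u v c d. u \<in> V \<Longrightarrow> v \<in> V \<Longrightarrow> (\<lambda>z. c * u z + d * v z) \<in> V"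
    and ip_lin: "\<And>u v w c d. u \<in> V \<Longrightarrow> v \<in> V \<Longrightarrow> w \<in> V \<Longrightarrow>
      ip (\<lambda>z. c * u z + d * v z) w = c * ip u w + d * ip v w"
    and ip_cnj: "\<And>u v. u \<in> V \<Longrightarrow> v \<in> V \<Longrightarrow> ip v u = cnj (ip u v)"
    and ip_pos: "\<And>u. u \<in> V \<Longrightarrow> 0 \<le> Re (ip u u)"
begin

lemma ip_lin2:
  assumes "u \<in> V" "v \<in> V" "w \<in> V"
  shows "ip w (\<lambda>z. c * u z + d * v z) = cnj c * ip w u + cnj d * ip w v"
proof -
  have "ip w (\<lambda>z. c * u z + d * v z) = cnj (ip (\<lambda>z. c * u z + d * v z) w)"
    by (rule ip_cnj) (use assms lin_mem in auto)
  also have "\<dots> = cnj c * cnj (ip u w) + cnj d * cnj (ip v w)"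
    by (simp add: ip_lin assms)
  finally show ?thesis using ip_cnj assms by metis
qed

lemma ip_self: "u \<in> V \<Longrightarrow> ip u u = complex_of_real (Re (ip u u))"
  using ip_cnj[of u u] by (auto simp: complex_eq_iff)

lemma ip_zero: "u \<in> V \<Longrightarrow> ip (\<lambda>_. 0) u = 0"
  using ip_lin[of u u u 0 0] by simp

lemma scale_mem: "u \<in> V \<Longrightarrow> (\<lambda>z. c * u z) \<in> V"
  using lin_mem[of u u c 0] by simp

lemma diff_mem: "u \<in> V \<Longrightarrow> v \<in> V \<Longrightarrow> (\<lambda>z. u z - v z) \<in> V"
  using lin_mem[of u v 1 "-1"] by simp

lemma add_mem: "u \<in> V \<Longrightarrow> v \<in> V \<Longrightarrow> (\<lambda>z. u z + v z) \<in> V"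
  using lin_mem[of u v 1 1] by simp

lemma ip_diff: "u \<in> V \<Longrightarrow> v \<in> V \<Longrightarrow> w \<in> V \<Longrightarrow> ip (\<lambda>z. u z - v z) w = ip u w - ip v w"
  using ip_lin[of u v w 1 "-1"] by simp

lemma ip_add: "u \<in> V \<Longrightarrow> v \<in> V \<Longrightarrow> w \<in> V \<Longrightarrow> ip (\<lambda>z. u z + v z) w = ip u w + ip v w"
  using ip_lin[of u v w 1 1] by simp

lemma ip_scale: "u \<in> V \<Longrightarrow> w \<in> V \<Longrightarrow> ip (\<lambda>z. c * u z) w = c * ip u w"
  using ip_lin[of u u w c 0] by simp

lemma ip_scale2: "u \<in> V \<Longrightarrow> w \<in> V \<Longrightarrow> ip w (\<lambda>z. c * u z) = cnj c * ip w u"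
  using ip_lin2[of u u w c 0] by simp

lemma nsq_lin:
  assumes "u \<in> V" "v \<in> V"
  shows "Re (ip (\<lambda>z. c * u z + d * v z) (\<lambda>z. c * u z + d * v z)) =
    (cmod c)\<^sup>2 * Re (ip u u) + (cmod d)\<^sup>2 * Re (ip v v) + 2 * Re (c * cnj d * ip u v)"
proof -
  let ?a = "Re (ip u u)" and ?b = "Re (ip v v)"
  have "ip (\<lambda>z. c * u z + d * v z) (\<lambda>z. c * u z + d * v z) =
    c * (cnj c * ip u u + cnj d * ip u v) + d * (cnj c * ip v u + cnj d * ip v v)"
    using assms by (simp add: ip_lin ip_lin2 lin_mem)
  also have "\<dots> = (c * cnj c) * of_real ?a + (d * cnj d) * of_real ?b + (c * cnj d * ip u v + cnj (c * cnj d * ip u v))"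
    using ip_self assms ip_cnj[of u v] by (simp add: algebra_simps)
  also have "\<dots> = of_real ((cmod c)\<^sup>2 * ?a + (cmod d)\<^sup>2 * ?b + 2 * Re (c * cnj d * ip u v))"
    by (simp add: mult_cnj_cmod complex_add_cnj del: complex_cnj_mult)
  finally show ?thesis by (metis Re_complex_of_real)
qed

lemma nsq_scale: "u \<in> V \<Longrightarrow> Re (ip (\<lambda>z. c * u z) (\<lambda>z. c * u z)) = (cmod c)\<^sup>2 * Re (ip u u)"
  using nsq_lin[of u u c 0] by simp

lemma nsq_diff:
  assumes "u \<in> V" "v \<in> V"
  shows "Re (ip (\<lambda>z. u z - v z) (\<lambda>z. u z - v z)) = Re (ip u u) + Re (ip v v) - 2 * Re (ip u v)"
  using nsq_lin[OF assms, of 1 "-1"] by simp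

lemma cauchy_schwarz:
  assumes "u \<in> V" "v \<in> V"
  shows "(cmod (ip u v))\<^sup>2 \<le> Re (ip u u) * Re (ip v v)"
proof -
  let ?a = "Re (ip u u)" and ?b = "Re (ip v v)" and ?z = "ip u v"
  \<comment> \<open>The squared norm of \<open>u - s * ip u v * v\<close>; this choice of direction
    makes the term linear in \<open>s\<close> real.\<close>
  have key: "0 \<le> ?a + s\<^sup>2 * (cmod ?z)\<^sup>2 * ?b - 2 * s * (cmod ?z)\<^sup>2" for s :: real
  proof -
    have "0 \<le> Re (ip (\<lambda>z. 1 * u z + (- (s * ?z)) * v z) (\<lambda>z. 1 * u z + (- (s * ?z)) * v z))"
      by (intro ip_pos lin_mem assms)
    also have "\<dots> = ?a + s\<^sup>2 * (cmod ?z)\<^sup>2 * ?b + 2 * Re (1 * cnj (- (s * ?z)) * ?z)"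
      by (subst nsq_lin) (use assms in \<open>auto simp: norm_mult power_mult_distrib\<close>)
    also have "1 * cnj (- (s * ?z)) * ?z = - of_real (s * (cmod ?z)\<^sup>2)"
      using mult_cnj_cmod[of ?z] by (simp add: mult.commute)
    finally show ?thesis by simp
  qed
  have b0: "?b \<ge> 0" "?a \<ge> 0" using ip_pos assms by auto
  show ?thesis
  proof (cases "?b = 0")
    \<comment> \<open>A null vector need not be zero here. \<open>key\<close> is then affine in
      \<open>s\<close> and would become negative for large \<open>s\<close> unless
      \<open>ip u v = 0\<close>.\<close>
    case True
    have "cmod ?z = 0"
    proof (rule ccontr)
      assume "cmod ?z \<noteq> 0"
      then have p: "(cmod ?z)\<^sup>2 > 0" by simp
      have "0 \<le> ?a - 2 * ((?a + 1) / (cmod ?z)\<^sup>2) * (cmod ?z)\<^sup>2"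
        using key[of "(?a + 1) / (cmod ?z)\<^sup>2"] True by simp
      also have "\<dots> = ?a - 2 * (?a + 1)" using p by simp
      finally show False using b0 by simp
    qed
    then show ?thesis using b0 by simp
  next
    case False
    then have b: "?b > 0" using b0 by simp
    have "0 \<le> ?a + (1 / ?b)\<^sup>2 * (cmod ?z)\<^sup>2 * ?b - 2 * (1 / ?b) * (cmod ?z)\<^sup>2" by (rule key)
    also have "\<dots> = ?a - (cmod ?z)\<^sup>2 / ?b" using b by (simp add: field_simps power2_eq_square)
    finally show ?thesis using b by (simp add: field_simps)
  qed
qed

lemma cauchy_schwarz_sqrt:
  assumes "u \<in> V" "v \<in> V"
  shows "cmod (ip u v) \<le> sqrt (Re (ip u u)) * sqrt (Re (ip v v))"
  using cauchy_schwarz[OF assms] by (simp add: real_le_rsqrt flip: real_sqrt_mult)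

lemma norm_triangle:
  assumes "u \<in> V" "v \<in> V"
  shows "sqrt (Re (ip (\<lambda>z. u z + v z) (\<lambda>z. u z + v z))) \<le> sqrt (Re (ip u u)) + sqrt (Re (ip v v))"
proof (rule real_le_lsqrt)
  have "Re (ip u v) \<le> sqrt (Re (ip u u)) * sqrt (Re (ip v v))"
    using complex_Re_le_cmod cauchy_schwarz_sqrt[OF assms] order_trans by blast
  then show "Re (ip (\<lambda>z. u z + v z) (\<lambda>z. u z + v z)) \<le> (sqrt (Re (ip u u)) + sqrt (Re (ip v v)))\<^sup>2"
    using nsq_lin[OF assms, of 1 1] ip_pos assms by (simp add: power2_sum)
qed (use ip_pos assms in auto)

lemma sum_mem:
  assumes "finite F" "\<And>i. i \<in> F \<Longrightarrow> e i \<in> V"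
  shows "(\<lambda>z. \<Sum>i\<in>F. c i * e i z) \<in> V"
  using assms
proof (induction F rule: finite_induct)
  case (insert j F)
  then have "(\<lambda>z. c j * e j z + 1 * (\<Sum>i\<in>F. c i * e i z)) \<in> V" by (intro lin_mem) auto
  with insert show ?case by simp
qed (simp add: zero_mem)

lemma ip_sum:
  assumes "finite F" "\<And>i. i \<in> F \<Longrightarrow> e i \<in> V" "w \<in> V"
  shows "ip (\<lambda>z. \<Sum>i\<in>F. c i * e i z) w = (\<Sum>i\<in>F. c i * ip (e i) w)"
  using assms
proof (induction F rule: finite_induct)
  case (insert j F)
  then have "ip (\<lambda>z. c j * e j z + 1 * (\<Sum>i\<in>F. c i * e i z)) w
    = c j * ip (e j) w + 1 * ip (\<lambda>z. \<Sum>i\<in>F. c i * e i z) w" by (intro ip_lin sum_mem) auto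
  with insert show ?case by simp
qed (simp add: ip_zero)

lemma ip_sum2:
  assumes "finite F" "\<And>i. i \<in> F \<Longrightarrow> e i \<in> V" "w \<in> V"
  shows "ip w (\<lambda>z. \<Sum>i\<in>F. c i * e i z) = (\<Sum>i\<in>F. cnj (c i) * ip w (e i))"
proof -
  have "ip w (\<lambda>z. \<Sum>i\<in>F. c i * e i z) = cnj (\<Sum>i\<in>F. c i * ip (e i) w)"
    using ip_cnj[OF sum_mem[OF assms(1,2)] assms(3)] ip_sum[OF assms] by simp
  also have "\<dots> = (\<Sum>i\<in>F. cnj (c i) * ip w (e i))"
    unfolding cnj_sum using assms ip_cnj by (intro sum.cong refl) (metis complex_cnj_mult)
  finally show ?thesis .
qed

definition ortho_fam :: "'i set \<Rightarrow> ('i \<Rightarrow> 'a \<Rightarrow> complex) \<Rightarrow> bool" where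
  "ortho_fam F e \<longleftrightarrow> (\<forall>i\<in>F. e i \<in> V \<and> (\<forall>j\<in>F. ip (e i) (e j) = (if i = j then 1 else 0)))"

lemma ortho_famD:
  assumes "ortho_fam F e" "i \<in> F"
  shows "e i \<in> V" "j \<in> F \<Longrightarrow> ip (e i) (e j) = (if i = j then 1 else 0)"
  using assms by (auto simp: ortho_fam_def)

lemma ip_sum_ortho:
  assumes "ortho_fam F e" "finite F" "j \<in> F"
  shows "ip (\<lambda>z. \<Sum>i\<in>F. c i * e i z) (e j) = c j"
proof -
  have "ip (\<lambda>z. \<Sum>i\<in>F. c i * e i z) (e j) = (\<Sum>i\<in>F. c i * ip (e i) (e j))"
    using assms ortho_famD[OF assms(1)] by (intro ip_sum) auto
  also have "\<dots> = (\<Sum>i\<in>F. if i = j then c j else 0)"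
    using assms ortho_famD[OF assms(1)] by (intro sum.cong) auto
  finally show ?thesis using assms by simp
qed

lemma nsq_sum_ortho:
  assumes "ortho_fam F e" "finite F"
  shows "Re (ip (\<lambda>z. \<Sum>i\<in>F. c i * e i z) (\<lambda>z. \<Sum>i\<in>F. c i * e i z)) = (\<Sum>i\<in>F. (cmod (c i))\<^sup>2)"
proof -
  have "ip (\<lambda>z. \<Sum>i\<in>F. c i * e i z) (\<lambda>z. \<Sum>i\<in>F. c i * e i z)
     = (\<Sum>j\<in>F. cnj (c j) * ip (\<lambda>z. \<Sum>i\<in>F. c i * e i z) (e j))"
    using assms ortho_famD[OF assms(1)] by (intro ip_sum2 sum_mem) auto
  also have "\<dots> = (\<Sum>j\<in>F. of_real ((cmod (c j))\<^sup>2))"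
    using assms by (intro sum.cong refl) (simp add: ip_sum_ortho mult_cnj_cmod mult.commute)
  finally show ?thesis by (simp flip: of_real_sum)
qed

lemma ip_residual_ortho:
  assumes "ortho_fam F e" "finite F" "j \<in> F" "u \<in> V"
  shows "ip (\<lambda>z. u z - (\<Sum>i\<in>F. ip u (e i) * e i z)) (e j) = 0"
  using assms ortho_famD[OF assms(1)] by (subst ip_diff) (auto intro!: sum_mem simp: ip_sum_ortho[OF assms(1,2)])

lemma nsq_residual:
  assumes "ortho_fam F e" "finite F" "u \<in> V"
  shows "Re (ip (\<lambda>z. u z - (\<Sum>i\<in>F. ip u (e i) * e i z)) (\<lambda>z. u z - (\<Sum>i\<in>F. ip u (e i) * e i z)))
    = Re (ip u u) - (\<Sum>i\<in>F. (cmod (ip u (e i)))\<^sup>2)"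
proof -
  let ?s = "\<lambda>z. \<Sum>i\<in>F. ip u (e i) * e i z"
  have mem: "?s \<in> V" using assms ortho_famD[OF assms(1)] by (intro sum_mem) auto
  have "ip u ?s = (\<Sum>i\<in>F. cnj (ip u (e i)) * ip u (e i))"
    using assms ortho_famD[OF assms(1)] by (intro ip_sum2) auto
  also have "\<dots> = of_real (\<Sum>i\<in>F. (cmod (ip u (e i)))\<^sup>2)"
    by (simp add: mult_cnj_cmod mult.commute[of "cnj _"])
  finally have "Re (ip u ?s) = (\<Sum>i\<in>F. (cmod (ip u (e i)))\<^sup>2)" by (metis Re_complex_of_real)
  then show ?thesis
    using nsq_diff[OF assms(3) mem] nsq_sum_ortho[OF assms(1,2)] by simp
qed

lemma bessel:
  assumes "ortho_fam F e" "finite F" "u \<in> V"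
  shows "(\<Sum>i\<in>F. (cmod (ip u (e i)))\<^sup>2) \<le> Re (ip u u)"
proof -
  have "0 \<le> Re (ip (\<lambda>z. u z - (\<Sum>i\<in>F. ip u (e i) * e i z)) (\<lambda>z. u z - (\<Sum>i\<in>F. ip u (e i) * e i z)))"
    using assms ortho_famD[OF assms(1)] by (intro ip_pos diff_mem sum_mem) auto
  then show ?thesis using nsq_residual[OF assms] by simp
qed

end

section \<open>Square-integrable functions\<close>

lemma L2_space_integrable_mult:
  assumes "u \<in> L2_space M" "v \<in> L2_space M"
  shows "integrable M (\<lambda>z. u z * cnj (v z))"
proof (rule Bochner_Integration.integrable_bound[where f="\<lambda>z. (cmod (u z))\<^sup>2 + (cmod (v z))\<^sup>2"])
  show "integrable M (\<lambda>z. (cmod (u z))\<^sup>2 + (cmod (v z))\<^sup>2)" using assms by (auto simp: L2_space_def)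
  have [measurable]: "u \<in> borel_measurable M" "v \<in> borel_measurable M"
    using assms by (auto simp: L2_space_def)
  show "(\<lambda>z. u z * cnj (v z)) \<in> borel_measurable M"
    by (intro borel_measurable_times borel_measurable_continuous_on[of cnj] continuous_intros) auto
  have "x * y \<le> x\<^sup>2 + y\<^sup>2" if "x \<ge> 0" "y \<ge> 0" for x y :: real
  proof -
    have "0 \<le> (x - y)\<^sup>2" by simp
    then have "2 * (x * y) \<le> x\<^sup>2 + y\<^sup>2" by (simp add: power2_eq_square algebra_simps)
    moreover have "0 \<le> x * y" using that by simp
    ultimately show ?thesis by linarith
  qed
  then show "AE z in M. norm (u z * cnj (v z)) \<le> norm ((cmod (u z))\<^sup>2 + (cmod (v z))\<^sup>2)"
    by (intro AE_I2) (simp add: norm_mult)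
qed

lemma L2_space_lin:
  assumes "u \<in> L2_space M" "v \<in> L2_space M"
  shows "(\<lambda>z. c * u z + d * v z) \<in> L2_space M"
proof -
  have [measurable]: "u \<in> borel_measurable M" "v \<in> borel_measurable M"
    using assms by (auto simp: L2_space_def)
  have i: "integrable M (\<lambda>z. (cmod c)\<^sup>2 * (cmod (u z))\<^sup>2 + (cmod d)\<^sup>2 * (cmod (v z))\<^sup>2
      + 2 * Re (c * cnj d * (u z * cnj (v z))))"
    using assms L2_space_integrable_mult[OF assms]
    by (intro Bochner_Integration.integrable_add integrable_mult_right integrable_Re) (auto simp: L2_space_def)
  have "(cmod (a + b))\<^sup>2 = (cmod a)\<^sup>2 + (cmod b)\<^sup>2 + 2 * Re (a * cnj b)" for a b
    by (simp add: cmod_power2) (simp add: power2_eq_square algebra_simps)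
  then have "(cmod (c * u z + d * v z))\<^sup>2 = (cmod c)\<^sup>2 * (cmod (u z))\<^sup>2 + (cmod d)\<^sup>2 * (cmod (v z))\<^sup>2
      + 2 * Re (c * cnj d * (u z * cnj (v z)))" for z
    by (simp only: norm_mult power_mult_distrib complex_cnj_mult mult_ac)
  then have "integrable M (\<lambda>z. (cmod (c * u z + d * v z))\<^sup>2)" using i by presburger
  then show ?thesis unfolding L2_space_def by simp
qed

interpretation L2: cip_space "L2_space M" "L2_inner M" for M :: "'a measure"
proof
  fix u v w :: "'a \<Rightarrow> complex" and c d
  show "(\<lambda>_. 0) \<in> L2_space M" by (simp add: L2_space_def)
  show "Re (L2_inner M u u) \<ge> 0" if "u \<in> L2_space M"
  proof -
    have "L2_inner M u u = complex_of_real (LINT z|M. (cmod (u z))\<^sup>2)"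
      unfolding L2_inner_def by (simp add: mult_cnj_cmod flip: of_real_power)
    then show ?thesis by simp
  qed
  assume uv: "u \<in> L2_space M" "v \<in> L2_space M"
  show "(\<lambda>z. c * u z + d * v z) \<in> L2_space M" using uv by (rule L2_space_lin)
  show "L2_inner M v u = cnj (L2_inner M u v)"
    unfolding L2_inner_def by (subst Bochner_Integration.integral_cnj[symmetric]) (simp add: mult.commute)
  assume w: "w \<in> L2_space M"
  have "L2_inner M (\<lambda>z. c * u z + d * v z) w = (LINT z|M. c * (u z * cnj (w z)) + d * (v z * cnj (w z)))"
    unfolding L2_inner_def by (simp add: algebra_simps)
  also have "\<dots> = c * L2_inner M u w + d * L2_inner M v w"
    unfolding L2_inner_def
    using L2_space_integrable_mult[OF uv(1) w] L2_space_integrable_mult[OF uv(2) w]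
    by (subst Bochner_Integration.integral_add) (auto intro: integrable_mult_right)
  finally show "L2_inner M (\<lambda>z. c * u z + d * v z) w = c * L2_inner M u w + d * L2_inner M v w" .
qed

section \<open>Operators that are diagonal in a complete orthonormal system\<close>

abbreviation L2_ortho :: "'a measure \<Rightarrow> 'i set \<Rightarrow> ('i \<Rightarrow> 'a \<Rightarrow> complex) \<Rightarrow> bool" where
  "L2_ortho M \<equiv> cip_space.ortho_fam (L2_space M) (L2_inner M)"

lemma L2_norm_sq: "u \<in> L2_space M \<Longrightarrow> (L2_norm M u)\<^sup>2 = Re (L2_inner M u u)"
  unfolding L2_norm_def using L2.ip_pos[of u M] by simp

lemma L2_norm_nonneg: "u \<in> L2_space M \<Longrightarrow> 0 \<le> L2_norm M u"
  unfolding L2_norm_def using L2.ip_pos[of u M] by simp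

lemma L2_cauchy_schwarz:
  assumes "u \<in> L2_space M" "v \<in> L2_space M"
  shows "cmod (L2_inner M u v) \<le> L2_norm M u * L2_norm M v"
  unfolding L2_norm_def using L2.cauchy_schwarz_sqrt[OF assms] .

lemma L2_inner_cong_AE:
  assumes "u \<in> L2_space M" "u' \<in> L2_space M" "v \<in> L2_space M" "AE z in M. u z = u' z"
  shows "L2_inner M u v = L2_inner M u' v"
  unfolding L2_inner_def
  by (rule integral_cong_AE) (use assms L2_space_integrable_mult in \<open>auto intro: borel_measurable_integrable\<close>)

text \<open>\<open>bound\<close> is the decisive assumption. Cauchy-Schwarz against it makes every
  series with square-summable coefficients divided by \<open>lam\<close> converge absolutely and
  boundedly at each point. This constructs preimages without Riesz-Fischer, gives the supremum bound
  and, after integration, compactness. Completeness of the system enters only as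
  \<open>total\<close>.\<close>

locale diag_system =
  fixes M :: "'a measure" and e :: "nat \<Rightarrow> 'a \<Rightarrow> complex" and lam :: "nat \<Rightarrow> real" and C :: real
  assumes fin: "finite_measure M"
    and ortho: "L2_ortho M UNIV e"
    and total: "\<And>u. u \<in> L2_space M \<Longrightarrow> (\<And>k. L2_inner M u (e k) = 0) \<Longrightarrow> AE z in M. u z = 0"
    and bound: "\<And>z N. z \<in> space M \<Longrightarrow> (\<Sum>k<N. (cmod (e k z))\<^sup>2 / (lam k)\<^sup>2) \<le> C"
    and zero_fin: "finite {k. lam k = 0}"
begin

abbreviation co :: "('a \<Rightarrow> complex) \<Rightarrow> nat \<Rightarrow> complex" where
  "co u k \<equiv> L2_inner M u (e k)"

lemma e_mem: "e k \<in> L2_space M"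
  using L2.ortho_famD(1)[OF ortho] by simp

lemma e_ip: "co (e j) k = (if j = k then 1 else 0)"
  using L2.ortho_famD(2)[OF ortho] by simp

lemma ortho_on: "L2_ortho M F e"
  using ortho by (simp add: L2.ortho_fam_def)

section \<open>Series weighted by the inverse eigenvalues\<close>

definition square_summable_by :: "(nat \<Rightarrow> complex) \<Rightarrow> real \<Rightarrow> bool" where
  "square_summable_by c B \<longleftrightarrow> (\<forall>N. (\<Sum>k<N. (cmod (c k))\<^sup>2) \<le> B)"

text \<open>Terms with \<open>lam k = 0\<close> vanish, because division by zero yields zero.\<close>

definition ser :: "(nat \<Rightarrow> complex) \<Rightarrow> 'a \<Rightarrow> complex" where
  "ser c z = (\<Sum>k. c k / lam k * e k z)"

definition par :: "(nat \<Rightarrow> complex) \<Rightarrow> nat \<Rightarrow> 'a \<Rightarrow> complex" where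
  "par c N z = (\<Sum>k<N. c k / lam k * e k z)"

lemma bessel_co: "u \<in> L2_space M \<Longrightarrow> square_summable_by (co u) ((L2_norm M u)\<^sup>2)"
  unfolding square_summable_by_def L2_norm_sq using L2.bessel[OF ortho_on] by simp

lemma ssq_nonneg: "square_summable_by c B \<Longrightarrow> 0 \<le> B"
  unfolding square_summable_by_def by (drule spec[of _ 0]) simp

text \<open>Cauchy-Schwarz splits each term into \<open>c k\<close> and
  \<open>e k z / lam k\<close>; the squares of the second factors are what \<open>bound\<close>
  controls.\<close>

lemma abs_partial_bound:
  assumes c: "square_summable_by c B" and z: "z \<in> space M"
  shows "(\<Sum>k<N. cmod (c k / lam k * e k z)) \<le> sqrt (B * C)"
proof (rule real_le_rsqrt)
  have "(\<Sum>k<N. cmod (c k / lam k * e k z)) = (\<Sum>k<N. cmod (c k) * (cmod (e k z) / \<bar>lam k\<bar>))"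
    by (simp add: norm_mult norm_divide)
  also have "(\<dots>)\<^sup>2 \<le> (\<Sum>k<N. (cmod (c k))\<^sup>2) * (\<Sum>k<N. (cmod (e k z) / \<bar>lam k\<bar>)\<^sup>2)"
    by (rule Cauchy_Schwarz_ineq_sum)
  also have "\<dots> \<le> B * C"
    using c bound[OF z, of N] ssq_nonneg[OF c]
    by (intro mult_mono) (auto simp: square_summable_by_def power_divide intro!: sum_nonneg)
  finally show "(\<Sum>k<N. cmod (c k / lam k * e k z))\<^sup>2 \<le> B * C" .
qed

lemma ser_summable:
  assumes c: "square_summable_by c B" and z: "z \<in> space M"
  shows "summable (\<lambda>k. cmod (c k / lam k * e k z))"
  by (rule bounded_imp_summable[where B = "sqrt (B * C)"])
    (use abs_partial_bound[OF c z, of "Suc _"] in \<open>auto simp: lessThan_Suc_atMost\<close>)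

lemma par_bound:
  assumes c: "square_summable_by c B" and z: "z \<in> space M"
  shows "cmod (par c N z) \<le> sqrt (B * C)"
  unfolding par_def by (rule order_trans[OF norm_sum abs_partial_bound[OF c z]])

lemma par_tendsto:
  assumes c: "square_summable_by c B" and z: "z \<in> space M"
  shows "(\<lambda>N. par c N z) \<longlonglongrightarrow> ser c z"
  unfolding par_def ser_def
  using summable_LIMSEQ[OF summable_norm_cancel[OF ser_summable[OF c z]]] .

lemma ser_bound:
  assumes c: "square_summable_by c B" and z: "z \<in> space M"
  shows "cmod (ser c z) \<le> sqrt (B * C)"
  by (rule LIMSEQ_le_const2[OF tendsto_norm[OF par_tendsto[OF c z]]]) (use par_bound[OF c z] in auto)

lemma par_mem: "par c N \<in> L2_space M"
  unfolding par_def using L2.sum_mem[of "{..<N}" e M "\<lambda>k. c k / lam k"] e_mem by simp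

lemma ser_measurable:
  assumes c: "square_summable_by c B"
  shows "ser c \<in> borel_measurable M"
proof (rule borel_measurable_LIMSEQ_metric[where f = "\<lambda>N. par c N"])
  show "par c N \<in> borel_measurable M" for N using par_mem by (simp add: L2_space_def)
qed (rule par_tendsto[OF c])

lemma bounded_mem:
  assumes "f \<in> borel_measurable M" "\<And>z. z \<in> space M \<Longrightarrow> cmod (f z) \<le> B"
  shows "f \<in> L2_space M"
proof -
  have "integrable M (\<lambda>z. (cmod (f z))\<^sup>2)"
  proof (rule finite_measure.integrable_const_bound[OF fin, where B = "B\<^sup>2"])
    show "AE z in M. norm ((cmod (f z))\<^sup>2) \<le> B\<^sup>2"
      using assms(2) by (intro AE_I2) (auto intro: power_mono)
    show "(\<lambda>z. (cmod (f z))\<^sup>2) \<in> borel_measurable M" using assms(1) by measurable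
  qed
  then show ?thesis using assms(1) by (simp add: L2_space_def)
qed

lemma ser_mem: "square_summable_by c B \<Longrightarrow> ser c \<in> L2_space M"
  using bounded_mem[OF ser_measurable ser_bound] by metis

lemma L2_integrable:
  assumes "v \<in> L2_space M" shows "integrable M (\<lambda>z. cmod (v z))"
proof (rule Bochner_Integration.integrable_bound)
  show "integrable M (\<lambda>z. 1 + (cmod (v z))\<^sup>2)"
    using assms finite_measure.integrable_const[OF fin]
    by (intro Bochner_Integration.integrable_add) (auto simp: L2_space_def)
  show "(\<lambda>z. cmod (v z)) \<in> borel_measurable M" using assms by (auto simp: L2_space_def)
  have "x \<le> 1 + x\<^sup>2" for x :: real
  proof -
    have "0 \<le> (x - 1/2)\<^sup>2" by simp
    then show ?thesis by (simp add: power2_eq_square algebra_simps)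
  qed
  then show "AE z in M. norm (cmod (v z)) \<le> norm (1 + (cmod (v z))\<^sup>2)" by (intro AE_I2) simp
qed

text \<open>Dominated convergence with the majorant \<open>sqrt (B * C) * cmod (v z)\<close>, which
  is integrable because the measure is finite.\<close>

lemma ser_ip:
  assumes c: "square_summable_by c B" and v: "v \<in> L2_space M"
  shows "(\<lambda>k. c k / lam k * L2_inner M (e k) v) sums L2_inner M (ser c) v"
proof -
  have [measurable]: "v \<in> borel_measurable M" "\<And>N. par c N \<in> borel_measurable M" "ser c \<in> borel_measurable M"
    using v par_mem ser_mem[OF c] by (auto simp: L2_space_def)
  have cn: "(\<lambda>z. cnj (v z)) \<in> borel_measurable M"
    by (rule borel_measurable_continuous_on[of cnj]) (auto intro: continuous_intros)
  have "(\<lambda>N. LINT z|M. par c N z * cnj (v z)) \<longlonglongrightarrow> (LINT z|M. ser c z * cnj (v z))"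
  proof (rule integral_dominated_convergence[where w = "\<lambda>z. sqrt (B * C) * cmod (v z)"])
    show "integrable M (\<lambda>z. sqrt (B * C) * cmod (v z))" using L2_integrable[OF v] by simp
    show "AE z in M. (\<lambda>N. par c N z * cnj (v z)) \<longlonglongrightarrow> ser c z * cnj (v z)"
      by (intro AE_I2 tendsto_intros par_tendsto[OF c])
    show "AE z in M. norm (par c N z * cnj (v z)) \<le> sqrt (B * C) * cmod (v z)" for N
      by (intro AE_I2) (auto simp: norm_mult intro!: mult_right_mono par_bound[OF c])
  qed (use cn in \<open>auto intro!: borel_measurable_times\<close>)
  moreover have "(LINT z|M. par c N z * cnj (v z)) = (\<Sum>k<N. c k / lam k * L2_inner M (e k) v)" for N
    using L2.ip_sum[of "{..<N}" e M v "\<lambda>k. c k / lam k"] e_mem v by (simp add: par_def L2_inner_def)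
  ultimately show ?thesis by (simp add: sums_def L2_inner_def)
qed

lemma co_ser:
  assumes c: "square_summable_by c B"
  shows "co (ser c) j = c j / lam j"
proof -
  have "(\<lambda>k. c k / lam k * co (e k) j) sums co (ser c) j" by (rule ser_ip[OF c e_mem])
  moreover have "(\<lambda>k. c k / lam k * co (e k) j) = (\<lambda>k. if k = j then c j / lam j else 0)"
    by (auto simp: e_ip)
  ultimately show ?thesis using sums_unique2 sums_single[of j "\<lambda>_. c j / lam j"] by metis
qed

section \<open>The diagonal operator, its null space and its inverse\<close>

definition G :: "(('a \<Rightarrow> complex) \<times> ('a \<Rightarrow> complex)) set" where
  "G = {(u, h). u \<in> L2_space M \<and> h \<in> L2_space M \<and> (\<forall>k. co h k = lam k * co u k)}"

definition nullproj :: "('a \<Rightarrow> complex) \<Rightarrow> 'a \<Rightarrow> complex" where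
  "nullproj u z = (\<Sum>k | lam k = 0. co u k * e k z)"

lemma nullproj_mem: "nullproj u \<in> L2_space M"
  unfolding nullproj_def using L2.sum_mem[of "{k. lam k = 0}" e M "co u"] e_mem zero_fin by simp

lemma nullproj_ip:
  "v \<in> L2_space M \<Longrightarrow> L2_inner M (nullproj u) v = (\<Sum>k | lam k = 0. co u k * L2_inner M (e k) v)"
  unfolding nullproj_def using L2.ip_sum[of "{k. lam k = 0}" e M v "co u"] e_mem zero_fin by simp

lemma co_nullproj: "co (nullproj u) j = (if lam j = 0 then co u j else 0)"
proof -
  have "co (nullproj u) j = (\<Sum>k | lam k = 0. if k = j then co u j else 0)"
    unfolding nullproj_ip[OF e_mem] by (intro sum.cong) (auto simp: e_ip)
  also have "\<dots> = (if lam j = 0 then co u j else 0)" using zero_fin by (simp add: sum.delta)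
  finally show ?thesis .
qed

text \<open>Dividing \<open>co h\<close> by \<open>lam\<close> recovers \<open>co u\<close> wherever
  \<open>lam\<close> is nonzero, and \<open>nullproj\<close> supplies the finitely many other
  coefficients. The difference has no coefficients, so \<open>total\<close> applies. Membership in
  \<open>G\<close> is what makes the pointwise series available.\<close>

lemma G_expand:
  assumes uh: "(u, h) \<in> G"
  shows "AE z in M. u z = ser (co h) z + nullproj u z"
proof -
  have u: "u \<in> L2_space M" and h: "h \<in> L2_space M" and c: "\<And>k. co h k = lam k * co u k"
    using uh by (auto simp: G_def)
  note B = bessel_co[OF h]
  let ?s = "\<lambda>z. ser (co h) z + nullproj u z"
  have s: "?s \<in> L2_space M" by (intro L2.add_mem ser_mem[OF B] nullproj_mem)
  have "AE z in M. u z - ?s z = 0"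
  proof (rule total)
    show "(\<lambda>z. u z - ?s z) \<in> L2_space M" by (intro L2.diff_mem u s)
    show "co (\<lambda>z. u z - ?s z) k = 0" for k
      by (subst L2.ip_diff[OF u s e_mem], subst L2.ip_add[OF ser_mem[OF B] nullproj_mem e_mem])
        (unfold co_ser[OF B] co_nullproj, simp add: c)
  qed
  then show ?thesis by eventually_elim simp
qed

text \<open>Parseval with one factor in the domain of the operator. The pointwise expansion of
  \<open>u\<close> is paired term by term through \<open>ser_ip\<close>, so the other factor
  \<open>v\<close> may be arbitrary.\<close>

lemma G_parseval:
  assumes uh: "(u, h) \<in> G" and v: "v \<in> L2_space M"
  shows "(\<lambda>k. co u k * cnj (co v k)) sums L2_inner M u v"
proof -
  have u: "u \<in> L2_space M" and h: "h \<in> L2_space M" and c: "\<And>k. co h k = lam k * co u k"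
    using uh by (auto simp: G_def)
  note B = bessel_co[OF h]
  have "L2_inner M u v = L2_inner M (\<lambda>z. ser (co h) z + nullproj u z) v"
    by (intro L2_inner_cong_AE u v L2.add_mem ser_mem[OF B] nullproj_mem G_expand[OF uh])
  also have "\<dots> = L2_inner M (ser (co h)) v + L2_inner M (nullproj u) v"
    by (intro L2.ip_add ser_mem[OF B] nullproj_mem v)
  finally have eq: "L2_inner M u v = L2_inner M (ser (co h)) v + L2_inner M (nullproj u) v" .
  have "(\<lambda>k. co h k / lam k * L2_inner M (e k) v + (if k \<in> {k. lam k = 0} then co u k * L2_inner M (e k) v else 0))
     sums L2_inner M u v"
    unfolding eq nullproj_ip[OF v]
    by (intro sums_add ser_ip[OF B v] sums_If_finite_set zero_fin)
  moreover have "L2_inner M (e k) v = cnj (co v k)" for k by (rule L2.ip_cnj[OF v e_mem])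
  ultimately have "(\<lambda>k. co h k / lam k * cnj (co v k) + (if lam k = 0 then co u k * cnj (co v k) else 0))
     sums L2_inner M u v" by (simp cong: if_cong)
  moreover have "(\<lambda>k. co h k / lam k * cnj (co v k) + (if lam k = 0 then co u k * cnj (co v k) else 0))
    = (\<lambda>k. co u k * cnj (co v k))" by (auto simp: c)
  ultimately show ?thesis by simp
qed

definition nulls :: "('a \<Rightarrow> complex) set" where
  "nulls = {u. (u, \<lambda>_. 0) \<in> G}"

definition inv_graph :: "(('a \<Rightarrow> complex) \<times> ('a \<Rightarrow> complex)) set" where
  "inv_graph = {(h, u). (u, h) \<in> G \<and> u \<in> L2_orthogonal M nulls}"

lemma nulls_iff: "u \<in> nulls \<longleftrightarrow> u \<in> L2_space M \<and> (\<forall>k. lam k \<noteq> 0 \<longrightarrow> co u k = 0)"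
  by (auto simp: nulls_def G_def L2.zero_mem L2.ip_zero e_mem)

text \<open>A null function lies in the domain with image zero, so Parseval applies to it and
  reduces orthogonality to coefficients. Conversely, each \<open>e k\<close> with
  \<open>lam k = 0\<close> is itself a null function.\<close>

lemma ortho_nulls: "h \<in> L2_orthogonal M nulls \<longleftrightarrow> h \<in> L2_space M \<and> (\<forall>k. lam k = 0 \<longrightarrow> co h k = 0)"
proof (intro iffI conjI allI impI)
  assume h: "h \<in> L2_orthogonal M nulls"
  then show "h \<in> L2_space M" by (simp add: L2_orthogonal_def)
  fix k assume "lam k = 0"
  then have "e k \<in> nulls" by (auto simp: nulls_iff e_mem e_ip)
  then show "co h k = 0" using h by (simp add: L2_orthogonal_def)
next
  assume h: "h \<in> L2_space M \<and> (\<forall>k. lam k = 0 \<longrightarrow> co h k = 0)"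
  have "L2_inner M h v = 0" if v: "v \<in> nulls" for v
  proof -
    have vm: "v \<in> L2_space M" using v by (simp add: nulls_iff)
    have "(\<lambda>k. co v k * cnj (co h k)) sums L2_inner M v h"
      by (rule G_parseval) (use v h in \<open>auto simp: nulls_def\<close>)
    moreover have "co v k * cnj (co h k) = 0" for k using h v by (cases "lam k = 0") (auto simp: nulls_iff)
    then have "(\<lambda>k. co v k * cnj (co h k)) = (\<lambda>_. 0)" by blast
    ultimately have "L2_inner M v h = 0" using sums_unique2 sums_zero by metis
    then show ?thesis using L2.ip_cnj[OF vm, of h] h by simp
  qed
  then show "h \<in> L2_orthogonal M nulls" using h by (simp add: L2_orthogonal_def)
qed

text \<open>Surjectivity onto the orthogonal complement of the null space: the series is an explicit
  preimage. Closedness of the range thereby becomes closedness of an orthogonal complement.\<close>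

lemma ser_in_inv:
  assumes "h \<in> L2_orthogonal M nulls"
  shows "(h, ser (co h)) \<in> inv_graph"
proof -
  have h: "h \<in> L2_space M" and z: "\<And>k. lam k = 0 \<Longrightarrow> co h k = 0"
    using assms by (auto simp: ortho_nulls)
  note B = bessel_co[OF h]
  show ?thesis
    unfolding inv_graph_def using h z ser_mem[OF B] by (auto simp: G_def ortho_nulls co_ser[OF B])
qed

lemma range_G: "Range G = L2_orthogonal M nulls"
proof
  show "Range G \<subseteq> L2_orthogonal M nulls" by (auto simp: ortho_nulls G_def)
  show "L2_orthogonal M nulls \<subseteq> Range G" using ser_in_inv by (auto simp: inv_graph_def)
qed

lemma subspace_ortho: "L2_subspace M (L2_orthogonal M nulls)"
  unfolding L2_subspace_def
  by (auto simp: ortho_nulls L2.zero_mem L2.ip_zero e_mem L2.lin_mem L2.ip_lin)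

lemma subspace_nulls: "L2_subspace M nulls"
  unfolding L2_subspace_def
  by (auto simp: nulls_iff L2.zero_mem L2.ip_zero e_mem L2.lin_mem L2.ip_lin)

lemma closed_ortho: "L2_closed M (L2_orthogonal M nulls)"
  unfolding L2_closed_def
proof (intro allI impI)
  fix f g assume f: "\<forall>n. f n \<in> L2_orthogonal M nulls" and g: "g \<in> L2_space M"
    and lim: "(\<lambda>n::nat. L2_norm M (\<lambda>z. f n z - g z)) \<longlonglongrightarrow> 0"
  have fm: "f n \<in> L2_space M" for n using f by (auto simp: ortho_nulls)
  have "co g k = 0" if k: "lam k = 0" for k
  proof -
    have "cmod (co g k) \<le> L2_norm M (\<lambda>z. f n z - g z) * L2_norm M (e k)" for n
    proof -
      have "co (\<lambda>z. f n z - g z) k = - co g k"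
        using f k by (subst L2.ip_diff[OF fm g e_mem]) (auto simp: ortho_nulls)
      then show ?thesis
        using L2_cauchy_schwarz[OF L2.diff_mem[OF fm g] e_mem, of n k] by simp
    qed
    moreover have "(\<lambda>n. L2_norm M (\<lambda>z. f n z - g z) * L2_norm M (e k)) \<longlonglongrightarrow> 0 * L2_norm M (e k)"
      by (intro tendsto_intros lim)
    ultimately have "cmod (co g k) \<le> 0" by (intro LIMSEQ_le_const) auto
    then show ?thesis by simp
  qed
  then show "g \<in> L2_orthogonal M nulls" using g by (simp add: ortho_nulls)
qed

lemma direct_sum: "L2_direct_sum M (L2_orthogonal M nulls) nulls"
  unfolding L2_direct_sum_def
proof (intro conjI ballI subspace_ortho subspace_nulls)
  fix u assume u: "u \<in> L2_space M"
  have "(\<lambda>z. u z - nullproj u z) \<in> L2_orthogonal M nulls"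
    using u by (auto simp: ortho_nulls L2.diff_mem nullproj_mem L2.ip_diff e_mem co_nullproj)
  moreover have "nullproj u \<in> nulls" by (auto simp: nulls_iff nullproj_mem co_nullproj)
  moreover have "L2_eq M u (\<lambda>z. (u z - nullproj u z) + nullproj u z)" by (simp add: L2_eq_def)
  ultimately show "\<exists>v\<in>L2_orthogonal M nulls. \<exists>w\<in>nulls. L2_eq M u (\<lambda>z. v z + w z)" by (intro bexI)
next
  fix u assume u: "u \<in> L2_orthogonal M nulls \<inter> nulls"
  then have "AE z in M. u z = 0" by (intro total) (auto simp: ortho_nulls nulls_iff)
  then show "L2_eq M u (\<lambda>_. 0)" by (simp add: L2_eq_def)
qed

lemma invD:
  assumes "(h, u) \<in> inv_graph"
  shows "u \<in> L2_space M" "h \<in> L2_space M" "co u k = co h k / lam k" "(u, h) \<in> G"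
  using assms by (auto simp: inv_graph_def G_def ortho_nulls)

lemma inv_AE:
  assumes "(h, u) \<in> inv_graph"
  shows "AE z in M. u z = ser (co h) z"
proof -
  have "nullproj u z = 0" for z using assms by (simp add: nullproj_def inv_graph_def ortho_nulls)
  then show ?thesis using G_expand[OF invD(4)[OF assms]] by simp
qed

lemma inv_norm_sums:
  assumes "(h, u) \<in> inv_graph"
  shows "(\<lambda>k. (cmod (co h k))\<^sup>2 / (lam k)\<^sup>2) sums (L2_norm M u)\<^sup>2"
proof -
  have "(\<lambda>k. co u k * cnj (co u k)) sums L2_inner M u u"
    by (intro G_parseval[OF invD(4)] invD(1)) (use assms in auto)
  then have "(\<lambda>k. complex_of_real ((cmod (co u k))\<^sup>2)) sums L2_inner M u u"
    by (simp add: mult_cnj_cmod)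
  from sums_Re[OF this] have "(\<lambda>k. (cmod (co u k))\<^sup>2) sums (L2_norm M u)\<^sup>2"
    by (simp only: Re_complex_of_real L2_norm_sq[OF invD(1)[OF assms]])
  then show ?thesis by (simp add: invD(3)[OF assms] norm_divide power_divide)
qed

lemma inv_norm_le:
  assumes d: "0 < d" "\<And>k. lam k \<noteq> 0 \<Longrightarrow> d \<le> \<bar>lam k\<bar>" and hu: "(h, u) \<in> inv_graph"
  shows "L2_norm M u \<le> 1 / d * L2_norm M h"
proof -
  have "(L2_norm M u)\<^sup>2 \<le> (1 / d)\<^sup>2 * (L2_norm M h)\<^sup>2"
  proof (rule LIMSEQ_le_const2[OF inv_norm_sums[OF hu, unfolded sums_def]], intro exI allI impI)
    fix N
    \<comment> \<open>Where \<open>lam k = 0\<close> the quotient is \<open>0\<close> by the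
      convention for division, so only nonzero eigenvalues have to satisfy the lower bound
      \<open>d\<close>.\<close>
    have "(cmod (co h k))\<^sup>2 / (lam k)\<^sup>2 \<le> (1 / d)\<^sup>2 * (cmod (co h k))\<^sup>2" for k
    proof (cases "lam k = 0")
      case False
      have "d\<^sup>2 \<le> \<bar>lam k\<bar>\<^sup>2" using d(1) by (intro power_mono d(2)[OF False]) simp
      then have "d\<^sup>2 \<le> (lam k)\<^sup>2" by simp
      moreover have "0 < (lam k)\<^sup>2" using False by simp
      moreover have "0 < d\<^sup>2" using d(1) by simp
      ultimately have "1 / (lam k)\<^sup>2 \<le> 1 / d\<^sup>2"
        by (intro divide_left_mono mult_pos_pos zero_le_one)
      from mult_right_mono[OF this, of "(cmod (co h k))\<^sup>2"] show ?thesis by (simp add: power_divide)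
    qed simp
    then have "(\<Sum>k<N. (cmod (co h k))\<^sup>2 / (lam k)\<^sup>2) \<le> (1 / d)\<^sup>2 * (\<Sum>k<N. (cmod (co h k))\<^sup>2)"
      unfolding sum_distrib_left by (rule sum_mono)
    also have "\<dots> \<le> (1 / d)\<^sup>2 * (L2_norm M h)\<^sup>2"
      using bessel_co[OF invD(2)[OF hu]] by (intro mult_left_mono) (auto simp: square_summable_by_def)
    finally show "(\<Sum>k<N. (cmod (co h k))\<^sup>2 / (lam k)\<^sup>2) \<le> (1 / d)\<^sup>2 * (L2_norm M h)\<^sup>2" .
  qed
  then have "(L2_norm M u)\<^sup>2 \<le> (1 / d * L2_norm M h)\<^sup>2" by (simp only: power_mult_distrib)
  moreover have "0 \<le> 1 / d * L2_norm M h" using d(1) L2_norm_nonneg[OF invD(2)[OF hu]] by simp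
  ultimately show ?thesis by (rule power2_le_imp_le)
qed

lemma inv_inner:
  assumes g: "0 < g" "\<And>k. lam k < 0 \<Longrightarrow> g \<le> - lam k" and hu: "(h, u) \<in> inv_graph"
  shows "L2_inner M u h \<in> \<real>" "Re (L2_inner M u h) \<ge> - (1 / g) * (L2_norm M h)\<^sup>2"
proof -
  have "(\<lambda>k. co u k * cnj (co h k)) sums L2_inner M u h"
    by (intro G_parseval[OF invD(4)] invD(2)) (use hu in auto)
  moreover have "co u k * cnj (co h k) = of_real ((cmod (co h k))\<^sup>2 / lam k)" for k
    using mult_cnj_cmod[of "co h k"] by (simp add: invD(3)[OF hu])
  ultimately have s: "(\<lambda>k. complex_of_real ((cmod (co h k))\<^sup>2 / lam k)) sums L2_inner M u h" by simp
  from sums_Im[OF this] have "(\<lambda>k. 0::real) sums Im (L2_inner M u h)" by simp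
  then have "Im (L2_inner M u h) = 0" using sums_unique2 sums_zero by metis
  then show "L2_inner M u h \<in> \<real>" by (simp add: complex_is_Real_iff)
  from sums_Re[OF s] have s': "(\<lambda>k. (cmod (co h k))\<^sup>2 / lam k) sums Re (L2_inner M u h)" by simp
  show "Re (L2_inner M u h) \<ge> - (1 / g) * (L2_norm M h)\<^sup>2"
  proof (rule LIMSEQ_le_const[OF s'[unfolded sums_def]], intro exI allI impI)
    fix N
    have "- (1 / g) * (L2_norm M h)\<^sup>2 \<le> - (1 / g) * (\<Sum>k<N. (cmod (co h k))\<^sup>2)"
      using bessel_co[OF invD(2)[OF hu]] g by (intro mult_left_mono_neg) (auto simp: square_summable_by_def)
    also have "\<dots> \<le> (\<Sum>k<N. (cmod (co h k))\<^sup>2 / lam k)"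
      unfolding sum_distrib_left
    proof (rule sum_mono)
      fix k
      \<comment> \<open>Only negative eigenvalues constrain the form from below; positive ones have
        a positive reciprocal, and the reciprocal of \<open>0\<close> is \<open>0\<close>.\<close>
      have "- (1 / g) \<le> 1 / lam k"
      proof (cases "lam k < 0")
        case True
        then have "0 < - lam k" by simp
        then have "1 / (- lam k) \<le> 1 / g" using g(1) g(2)[OF True] by (intro divide_left_mono mult_pos_pos)  auto
        then show ?thesis by simp
      next
        case False
        then have "0 \<le> 1 / lam k" by simp
        moreover have "- (1 / g) \<le> 0" using g by simp
        ultimately show ?thesis by linarith
      qed
      from mult_right_mono[OF this, of "(cmod (co h k))\<^sup>2"]
      show "- (1 / g) * (cmod (co h k))\<^sup>2 \<le> (cmod (co h k))\<^sup>2 / lam k" by simp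
    qed
    finally show "- (1 / g) * (L2_norm M h)\<^sup>2 \<le> (\<Sum>k<N. (cmod (co h k))\<^sup>2 / lam k)" .
  qed
qed

lemma inv_Linfty:
  assumes hu: "(h, u) \<in> inv_graph"
  shows "Linfty_norm M u \<le> ereal (sqrt C * L2_norm M h)"
  unfolding Linfty_norm_def
proof (rule esssup_I)
  have h: "h \<in> L2_space M" by (rule invD(2)[OF hu])
  show "(\<lambda>z. ereal (cmod (u z))) \<in> borel_measurable M" using invD(1)[OF hu] by (auto simp: L2_space_def)
  have "AE z in M. z \<in> space M" by simp
  then show "AE z in M. ereal (cmod (u z)) \<le> ereal (sqrt C * L2_norm M h)"
    using inv_AE[OF hu]
  proof eventually_elim
    case (elim z)
    then show ?case
      using ser_bound[OF bessel_co[OF h], of z] L2_norm_nonneg[OF h]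
      by (simp add: real_sqrt_mult mult.commute)
  qed
qed

lemma inv_bounded_linear:
  assumes d: "0 < d" "\<And>k. lam k \<noteq> 0 \<Longrightarrow> d \<le> \<bar>lam k\<bar>"
  shows "L2_bounded_linear_graph M (L2_orthogonal M nulls) (L2_orthogonal M nulls) inv_graph"
  unfolding L2_bounded_linear_graph_def
proof (intro conjI subspace_ortho allI impI)
  show "Domain inv_graph = L2_orthogonal M nulls"
  proof
    show "Domain inv_graph \<subseteq> L2_orthogonal M nulls"
      unfolding range_G[symmetric] by (auto simp: inv_graph_def)
  qed (use ser_in_inv in auto)
  show "Range inv_graph \<subseteq> L2_orthogonal M nulls" by (auto simp: inv_graph_def)
  show "\<exists>K. \<forall>(h, u)\<in>inv_graph. L2_norm M u \<le> K * L2_norm M h" using inv_norm_le[OF d] by blast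
next
  fix h u h' u' assume hu: "(h, u) \<in> inv_graph" "(h', u') \<in> inv_graph" and eq: "L2_eq M h h'"
  have "co h k = co h' k" for k
    using invD(2)[OF hu(1)] invD(2)[OF hu(2)] eq by (intro L2_inner_cong_AE e_mem) (auto simp: L2_eq_def)
  then have "co h = co h'" by auto
  then show "L2_eq M u u'" using inv_AE[OF hu(1)] inv_AE[OF hu(2)] by (auto simp: L2_eq_def)
next
  fix h u h' u' c d assume hu: "(h, u) \<in> inv_graph" "(h', u') \<in> inv_graph"
  show "((\<lambda>z. c * h z + d * h' z), (\<lambda>z. c * u z + d * u' z)) \<in> inv_graph"
    using hu by (auto simp: inv_graph_def G_def ortho_nulls L2.lin_mem L2.ip_lin e_mem algebra_simps)
qed

text \<open>Integrates \<open>bound\<close> over the space, each \<open>e k\<close> having norm one;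
  in other words, the inverse is a Hilbert-Schmidt operator. The series serves as majorant in
  \<open>inv_compact\<close>.\<close>

lemma summable_inverse_lam: "summable (\<lambda>k. 1 / (lam k)\<^sup>2)"
proof (rule bounded_imp_summable)
  interpret finite_measure M by (rule fin)
  fix N
  have ei: "integrable M (\<lambda>z. (cmod (e k z))\<^sup>2)" for k using e_mem[of k] by (simp add: L2_space_def)
  have e1: "(LINT z|M. (cmod (e k z))\<^sup>2) = 1" for k
  proof -
    have "complex_of_real (LINT z|M. (cmod (e k z))\<^sup>2) = co (e k) k"
      unfolding L2_inner_def by (simp add: mult_cnj_cmod flip: of_real_power)
    also have "\<dots> = of_real 1" by (simp add: e_ip)
    finally show ?thesis using of_real_eq_iff by blast
  qed
  have "(\<Sum>k\<le>N. 1 / (lam k)\<^sup>2) = (LINT z|M. (\<Sum>k<Suc N. (cmod (e k z))\<^sup>2 / (lam k)\<^sup>2))"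
    using ei e1 by (subst Bochner_Integration.integral_sum) (auto simp: lessThan_Suc_atMost)
  also have "\<dots> \<le> (LINT z|M. C)"
    using bound ei
    by (intro integral_mono) (auto intro!: Bochner_Integration.integrable_sum simp del: sum.lessThan_Suc)
  finally show "(\<Sum>k\<le>N. 1 / (lam k)\<^sup>2) \<le> (LINT z|M. C)" .
qed simp

text \<open>A diagonal subsequence makes all coefficients of \<open>h\<close> converge. After
  division by \<open>lam\<close>, Tannery's theorem with the majorant from
  \<open>summable_inverse_lam\<close> turns this into norm convergence of the preimages.\<close>

lemma inv_compact: "L2_compact_graph M (L2_orthogonal M nulls) inv_graph"
  unfolding L2_compact_graph_def
proof (intro allI impI)
  fix h u K assume hu: "\<forall>n::nat. (h n, u n) \<in> inv_graph \<and> L2_norm M (h n) \<le> K"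
  have hm: "h n \<in> L2_space M" for n using hu invD(2) by blast
  have K0: "0 \<le> K" using hu L2_norm_nonneg[OF hm] order_trans by blast
  have ss: "square_summable_by (co (h n)) (K\<^sup>2)" for n
    using bessel_co[OF hm, of n] hu L2_norm_nonneg[OF hm, of n] power_mono[of "L2_norm M (h n)" K 2]
    unfolding square_summable_by_def by (meson order_trans)
  have single: "(cmod (c k))\<^sup>2 \<le> B" if "square_summable_by c B" for c k B
  proof -
    have "(cmod (c k))\<^sup>2 \<le> (\<Sum>j<Suc k. (cmod (c j))\<^sup>2)" by (rule member_le_sum) auto
    then show ?thesis using that unfolding square_summable_by_def by (meson order_trans)
  qed
  have bnd: "cmod (co (h n) k) \<le> K" for n k
    by (rule power2_le_imp_le[OF single[OF ss] K0])
  obtain r where r: "strict_mono (r :: nat \<Rightarrow> nat)" "\<And>k. k \<in> UNIV \<Longrightarrow> \<exists>l. (\<lambda>n. co (h (r n)) k) \<longlonglongrightarrow> l"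
    by (rule function_convergent_subsequence[of UNIV "\<lambda>n k. co (h n) k" K]) (use bnd in auto)
  then have "\<forall>k. \<exists>l. (\<lambda>n. co (h (r n)) k) \<longlonglongrightarrow> l" by simp
  then obtain c where c: "\<And>k. (\<lambda>n. co (h (r n)) k) \<longlonglongrightarrow> c k" by metis
  \<comment> \<open>The limit coefficients inherit the bound on finite sums, so \<open>ser c\<close>
    is a legitimate candidate for the limit although no function with coefficients \<open>c\<close>
    has been exhibited.\<close>
  have sc: "square_summable_by c (K\<^sup>2)"
    unfolding square_summable_by_def
  proof
    fix N
    have "(\<lambda>n. \<Sum>k<N. (cmod (co (h (r n)) k))\<^sup>2) \<longlonglongrightarrow> (\<Sum>k<N. (cmod (c k))\<^sup>2)"
      by (intro tendsto_intros c)
    then show "(\<Sum>k<N. (cmod (c k))\<^sup>2) \<le> K\<^sup>2"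
      by (rule LIMSEQ_le_const2) (use ss in \<open>auto simp: square_summable_by_def\<close>)
  qed
  define v where "v = ser c"
  have vm: "v \<in> L2_space M" unfolding v_def by (rule ser_mem[OF sc])
  have vco: "co v k = c k / lam k" for k unfolding v_def by (rule co_ser[OF sc])
  have nrm: "(\<lambda>k. (cmod (co (h (r n)) k - c k))\<^sup>2 / (lam k)\<^sup>2) sums (L2_norm M (\<lambda>z. u (r n) z - v z))\<^sup>2" for n
  proof -
    define d where "d k = co (h (r n)) k - c k" for k
    have hu': "(h (r n), u (r n)) \<in> inv_graph" using hu by blast
    have um: "u (r n) \<in> L2_space M" by (rule invD(1)[OF hu'])
    have dm: "(\<lambda>z. u (r n) z - v z) \<in> L2_space M" by (intro L2.diff_mem um vm)
    have dco: "co (\<lambda>z. u (r n) z - v z) k = d k / lam k" for k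
      by (subst L2.ip_diff[OF um vm e_mem]) (simp add: vco invD(3)[OF hu'] d_def diff_divide_distrib)
    \<comment> \<open>Any finite bound would do; it licenses the series \<open>ser d\<close> for the
      difference.\<close>
    have sd: "square_summable_by d (2 * (K\<^sup>2 + K\<^sup>2))"
      unfolding square_summable_by_def
    proof
      fix N
      have "(cmod (x - y))\<^sup>2 \<le> 2 * (cmod x)\<^sup>2 + 2 * (cmod y)\<^sup>2" for x y
      proof -
        have "(cmod (x - y))\<^sup>2 \<le> (cmod x + cmod y)\<^sup>2" by (intro power_mono norm_triangle_ineq4) auto
        also have "\<dots> \<le> 2 * (cmod x)\<^sup>2 + 2 * (cmod y)\<^sup>2"
          using zero_le_power2[of "cmod x - cmod y"] by (simp add: power2_eq_square algebra_simps)
        finally show ?thesis .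
      qed
      then have "(\<Sum>k<N. (cmod (d k))\<^sup>2) \<le> (\<Sum>k<N. 2 * (cmod (co (h (r n)) k))\<^sup>2 + 2 * (cmod (c k))\<^sup>2)"
        unfolding d_def by (intro sum_mono)
      also have "\<dots> \<le> 2 * (K\<^sup>2 + K\<^sup>2)"
        using spec[OF ss[of "r n", unfolded square_summable_by_def], of N]
          spec[OF sc[unfolded square_summable_by_def], of N]
        by (simp add: sum.distrib flip: sum_distrib_left)
      finally show "(\<Sum>k<N. (cmod (d k))\<^sup>2) \<le> 2 * (K\<^sup>2 + K\<^sup>2)" .
    qed
    have ae: "AE z in M. u (r n) z - v z = ser d z"
    proof -
      have "AE z in M. (u (r n) z - v z) - ser d z = 0"
      proof (rule total)
        show "(\<lambda>z. (u (r n) z - v z) - ser d z) \<in> L2_space M" by (intro L2.diff_mem dm ser_mem[OF sd])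
        show "co (\<lambda>z. (u (r n) z - v z) - ser d z) k = 0" for k
          by (subst L2.ip_diff[OF dm ser_mem[OF sd] e_mem]) (simp add: dco co_ser[OF sd])
      qed
      then show ?thesis by eventually_elim simp
    qed
    have "L2_inner M (\<lambda>z. u (r n) z - v z) (\<lambda>z. u (r n) z - v z) = L2_inner M (ser d) (\<lambda>z. u (r n) z - v z)"
      by (intro L2_inner_cong_AE dm ser_mem[OF sd] ae)
    moreover have "(\<lambda>k. d k / lam k * L2_inner M (e k) (\<lambda>z. u (r n) z - v z)) sums L2_inner M (ser d) (\<lambda>z. u (r n) z - v z)"
      by (rule ser_ip[OF sd dm])
    moreover have "L2_inner M (e k) (\<lambda>z. u (r n) z - v z) = cnj (d k / lam k)" for k
      using L2.ip_cnj[OF dm e_mem, of k] dco by simp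
    ultimately have "(\<lambda>k. d k / lam k * cnj (d k / lam k)) sums L2_inner M (\<lambda>z. u (r n) z - v z) (\<lambda>z. u (r n) z - v z)"
      by simp
    then have "(\<lambda>k. complex_of_real ((cmod (d k / lam k))\<^sup>2)) sums L2_inner M (\<lambda>z. u (r n) z - v z) (\<lambda>z. u (r n) z - v z)"
      by (simp only: mult_cnj_cmod of_real_power)
    from sums_Re[OF this] have "(\<lambda>k. (cmod (d k / lam k))\<^sup>2) sums (L2_norm M (\<lambda>z. u (r n) z - v z))\<^sup>2"
      by (simp only: Re_complex_of_real L2_norm_sq[OF dm])
    then show ?thesis unfolding d_def by (simp add: norm_divide power_divide)
  qed
  have lim2: "(\<lambda>n. \<Sum>k. (cmod (co (h (r n)) k - c k))\<^sup>2 / (lam k)\<^sup>2) \<longlonglongrightarrow> (\<Sum>k. 0)"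
  proof (rule tannerys_theorem[THEN conjunct2, THEN conjunct2])
    show "(\<lambda>n. (cmod (co (h (r n)) k - c k))\<^sup>2 / (lam k)\<^sup>2) \<longlonglongrightarrow> 0" for k
    proof -
      have "(\<lambda>n. (cmod (co (h (r n)) k - c k))\<^sup>2 * inverse ((lam k)\<^sup>2)) \<longlonglongrightarrow> (cmod (c k - c k))\<^sup>2 * inverse ((lam k)\<^sup>2)"
        by (intro tendsto_intros c)
      then show ?thesis by (simp add: divide_inverse)
    qed
    show "\<forall>\<^sub>F (k, n) in at_top \<times>\<^sub>F sequentially. norm ((cmod (co (h (r n)) k - c k))\<^sup>2 / (lam k)\<^sup>2) \<le> (2 * K)\<^sup>2 * (1 / (lam k)\<^sup>2)"
    proof (rule always_eventually, clarify)
      fix k n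
      have "cmod (c k) \<le> K" by (rule power2_le_imp_le[OF single[OF sc] K0])
      then have "cmod (co (h (r n)) k - c k) \<le> 2 * K"
        using bnd[of "r n" k] norm_triangle_ineq4[of "co (h (r n)) k" "c k"] by linarith
      then have "(cmod (co (h (r n)) k - c k))\<^sup>2 \<le> (2 * K)\<^sup>2" by (intro power_mono) auto
      then show "norm ((cmod (co (h (r n)) k - c k))\<^sup>2 / (lam k)\<^sup>2) \<le> (2 * K)\<^sup>2 * (1 / (lam k)\<^sup>2)"
        by (simp add: divide_right_mono)
    qed
    show "summable (\<lambda>k. (2 * K)\<^sup>2 * (1 / (lam k)\<^sup>2))" by (intro summable_mult summable_inverse_lam)
  qed simp
  have "(\<lambda>n. (L2_norm M (\<lambda>z. u (r n) z - v z))\<^sup>2) \<longlonglongrightarrow> 0"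
    using lim2 sums_unique[OF nrm] by simp
  then have "(\<lambda>n. sqrt ((L2_norm M (\<lambda>z. u (r n) z - v z))\<^sup>2)) \<longlonglongrightarrow> sqrt 0" by (rule tendsto_real_sqrt)
  moreover have "L2_norm M (\<lambda>z. u (r n) z - v z) \<ge> 0" for n
    using invD(1) hu vm by (intro L2_norm_nonneg L2.diff_mem) auto
  ultimately have "(\<lambda>n. L2_norm M (\<lambda>z. u (r n) z - v z)) \<longlonglongrightarrow> 0" by simp
  moreover have "v \<in> L2_orthogonal M nulls" using vm vco by (auto simp: ortho_nulls)
  ultimately show "\<exists>r v. strict_mono r \<and> v \<in> L2_orthogonal M nulls \<and>
      (\<lambda>n::nat. L2_norm M (\<lambda>z. u (r n) z - v z)) \<longlonglongrightarrow> 0"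
    using r(1) by (intro exI[of _ r] exI[of _ v] conjI)
qed

end

section \<open>The fourth-order boundary value problem\<close>

text \<open>Values outside \<open>{0..pi}\<close> are unrestricted, so elements are compared on the
  interval only.\<close>

definition VC :: "(real \<Rightarrow> complex) set" where
  "VC = {f. continuous_on {0..pi} f}"

text \<open>Weight \<open>1\<close> gives the pairing in which integration by parts takes place,
  weight \<open>\<rho>\<close> the one in which eigenfunctions are orthogonal;
  \<open>ipw_rho\<close> moves between the two.\<close>

definition ipw :: "(real \<Rightarrow> real) \<Rightarrow> (real \<Rightarrow> complex) \<Rightarrow> (real \<Rightarrow> complex) \<Rightarrow> complex" where
  "ipw r f g = integral {0..pi} (\<lambda>x. of_real (r x) * (f x * cnj (g x)))"

lemma VC_D: "f \<in> VC \<Longrightarrow> continuous_on {0..pi} f" by (simp add: VC_def)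

lemma cont_cnj: "continuous_on S f \<Longrightarrow> continuous_on S (\<lambda>x. cnj (f x))"
  by (intro continuous_intros)

lemma ipw_cip:
  assumes r: "continuous_on {0..pi} r" "\<And>x. x \<in> {0..pi} \<Longrightarrow> 0 \<le> r x"
  shows "cip_space VC (ipw r)"
proof
  show "(\<lambda>_. 0) \<in> VC" by (simp add: VC_def)
  fix u v w c d
  assume u: "u \<in> VC"
  have int: "(\<lambda>x. of_real (r x) * (f x * cnj (g x))) integrable_on {0..pi}" if "f \<in> VC" "g \<in> VC" for f g
    using that r unfolding VC_def by (intro integrable_continuous_interval continuous_intros) auto
  have "0 \<le> integral {0..pi} (\<lambda>x. r x * (cmod (u x))\<^sup>2)"
    using r u by (intro integral_nonneg integrable_continuous_interval continuous_intros) (auto simp: VC_def)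
  also have "\<dots> = Re (ipw r u u)"
  proof -
    have "Re (ipw r u u) = integral {0..pi} (\<lambda>x. Re (of_real (r x) * (u x * cnj (u x))))"
      unfolding ipw_def
      using integral_linear[OF int[OF u u] bounded_linear_Re] by (simp add: o_def)
    also have "\<dots> = integral {0..pi} (\<lambda>x. r x * (cmod (u x))\<^sup>2)"
      by (simp add: mult_cnj_cmod flip: of_real_power)
    finally show ?thesis by simp
  qed
  finally show "0 \<le> Re (ipw r u u)" .
  assume v: "v \<in> VC"
  show "(\<lambda>z. c * u z + d * v z) \<in> VC"
    using u v unfolding VC_def by (auto intro!: continuous_intros)
  show "ipw r v u = cnj (ipw r u v)"
    unfolding ipw_def integral_cnj by (simp add: mult_ac)
  assume w: "w \<in> VC"
  have "ipw r (\<lambda>z. c * u z + d * v z) w = integral {0..pi} (\<lambda>x. c * (of_real (r x) * (u x * cnj (w x)))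
      + d * (of_real (r x) * (v x * cnj (w x))))"
    unfolding ipw_def by (simp add: algebra_simps)
  also have "\<dots> = c * ipw r u w + d * ipw r v w"
    unfolding ipw_def using int[OF u w] int[OF v w]
    by (subst integral_add) (auto intro!: integrable_on_mult_right)
  finally show "ipw r (\<lambda>z. c * u z + d * v z) w = c * ipw r u w + d * ipw r v w" .
qed

lemma ipw_self:
  assumes r: "continuous_on {0..pi} r" and u: "u \<in> VC"
  shows "Re (ipw r u u) = integral {0..pi} (\<lambda>x. r x * (cmod (u x))\<^sup>2)"
proof -
  have int: "(\<lambda>x. of_real (r x) * (u x * cnj (u x))) integrable_on {0..pi}"
    using u r unfolding VC_def by (intro integrable_continuous_interval continuous_intros) auto
  have "Re (ipw r u u) = integral {0..pi} (\<lambda>x. Re (of_real (r x) * (u x * cnj (u x))))"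
    unfolding ipw_def
    using integral_linear[OF int bounded_linear_Re] by (simp add: o_def)
  also have "\<dots> = integral {0..pi} (\<lambda>x. r x * (cmod (u x))\<^sup>2)"
    by (simp add: mult_cnj_cmod flip: of_real_power)
  finally show ?thesis .
qed

lemma continuous_nonneg_integral_zero:
  fixes f :: "real \<Rightarrow> real"
  assumes "continuous_on {0..pi} f" "\<And>x. x \<in> {0..pi} \<Longrightarrow> 0 \<le> f x" "integral {0..pi} f = 0" "x \<in> {0..pi}"
  shows "f x = 0"
  using integral_eq_0_iff[of 0 pi f] assms by auto

section \<open>Integration by parts and interpolation inequalities\<close>

interpretation I1: cip_space VC "ipw (\<lambda>_. 1)"
  by (rule ipw_cip) auto

abbreviation n2 :: "(real \<Rightarrow> complex) \<Rightarrow> real" where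
  "n2 f \<equiv> sqrt (Re (ipw (\<lambda>_. 1) f f))"

lemma n2_nonneg: "f \<in> VC \<Longrightarrow> 0 \<le> n2 f"
  using I1.ip_pos[of f] by simp

lemma n2_sq: "f \<in> VC \<Longrightarrow> (n2 f)\<^sup>2 = Re (ipw (\<lambda>_. 1) f f)"
  using I1.ip_pos[of f] by simp

lemma n2_int: "f \<in> VC \<Longrightarrow> (n2 f)\<^sup>2 = integral {0..pi} (\<lambda>x. (cmod (f x))\<^sup>2)"
  by (subst n2_sq) (auto simp: ipw_self)

text \<open>Derivatives are required in the interior only, because that is all that
  \<open>chain\<close> provides for \<open>m1\<close>.\<close>

lemma ibp:
  fixes f g f' g' :: "real \<Rightarrow> complex"
  assumes c: "continuous_on {0..pi} f" "continuous_on {0..pi} g"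
      "continuous_on {0..pi} f'" "continuous_on {0..pi} g'"
    and d: "\<And>x. x \<in> {0<..<pi} \<Longrightarrow> (f has_vector_derivative f' x) (at x)"
      "\<And>x. x \<in> {0<..<pi} \<Longrightarrow> (g has_vector_derivative g' x) (at x)"
  shows "integral {0..pi} (\<lambda>x. f' x * g x) = f pi * g pi - f 0 * g 0 - integral {0..pi} (\<lambda>x. f x * g' x)"
proof -
  have "((\<lambda>x. f x * g' x + f' x * g x) has_integral (f pi * g pi - f 0 * g 0)) {0..pi}"
    by (rule fundamental_theorem_of_calculus_interior)
      (auto intro!: continuous_intros c has_vector_derivative_mult d)
  moreover have "((\<lambda>x. f x * g' x) has_integral integral {0..pi} (\<lambda>x. f x * g' x)) {0..pi}"
    by (intro integrable_integral integrable_continuous_interval continuous_intros c)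
  ultimately have "((\<lambda>x. (f x * g' x + f' x * g x) - f x * g' x) has_integral
     (f pi * g pi - f 0 * g 0 - integral {0..pi} (\<lambda>x. f x * g' x))) {0..pi}"
    by (rule has_integral_diff)
  then show ?thesis by (simp add: integral_unique)
qed

lemma has_vector_derivative_cnj':
  "(f has_vector_derivative f') F \<Longrightarrow> ((\<lambda>x. cnj (f x)) has_vector_derivative cnj f') F"
  by (rule bounded_linear.has_vector_derivative[OF bounded_linear_cnj])

text \<open>The derivative of \<open>|f|^2\<close> is \<open>2 Re (f cnj f')\<close>. Its integral
  over a subinterval is at most that of \<open>2 |f| |f'|\<close> over the whole interval, to which
  Cauchy-Schwarz applies. The base point \<open>y\<close> stays free: averaging over it gives
  \<open>agmon\<close>, and a zero of \<open>f\<close> removes the first term.\<close>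

lemma agmon_diff:
  fixes f f' :: "real \<Rightarrow> complex"
  assumes f: "f \<in> VC" "f' \<in> VC"
    and d: "\<And>x. x \<in> {0..pi} \<Longrightarrow> (f has_vector_derivative f' x) (at x within {0..pi})"
    and xy: "x \<in> {0..pi}" "y \<in> {0..pi}"
  shows "(cmod (f x))\<^sup>2 \<le> (cmod (f y))\<^sup>2 + 2 * n2 f * n2 f'"
proof -
  let ?h = "\<lambda>t. 2 * Re (f t * cnj (f' t))"
  let ?H = "\<lambda>t. 2 * (cmod (f t) * cmod (f' t))"
  have cont: "continuous_on {0..pi} ?h" "continuous_on {0..pi} ?H"
    using f by (auto simp: VC_def intro!: continuous_intros)
  have sq: "(cmod z)\<^sup>2 = Re (z * cnj z)" for z by (simp add: mult_cnj_cmod flip: of_real_power)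
  have der: "((\<lambda>t. (cmod (f t))\<^sup>2) has_vector_derivative ?h t) (at t within {0..pi})" if "t \<in> {0..pi}" for t
  proof -
    have "((\<lambda>t. f t * cnj (f t)) has_vector_derivative (f t * cnj (f' t) + f' t * cnj (f t))) (at t within {0..pi})"
      by (intro has_vector_derivative_mult has_vector_derivative_cnj' d that)
    from bounded_linear.has_vector_derivative[OF bounded_linear_Re this]
    show ?thesis unfolding sq by (simp add: algebra_simps)
  qed
  have tot: "integral {a..b} ?H \<le> integral {0..pi} ?H" if "0 \<le> a" "b \<le> pi" for a b
    using that cont(2)
    by (intro integral_subset_le integrable_continuous_interval)
      (auto intro: continuous_on_subset)
  have sub: "\<bar>(cmod (f b))\<^sup>2 - (cmod (f a))\<^sup>2\<bar> \<le> integral {0..pi} ?H" if "0 \<le> a" "a \<le> b" "b \<le> pi" for a b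
  proof -
    have hi: "(?h has_integral (cmod (f b))\<^sup>2 - (cmod (f a))\<^sup>2) {a..b}"
      by (rule fundamental_theorem_of_calculus[OF that(2)], rule has_vector_derivative_within_subset[OF der])
        (use that in auto)
    have "norm (integral {a..b} ?h) \<le> integral {a..b} ?H"
    proof (rule integral_norm_bound_integral)
      show "?h integrable_on {a..b}" using hi by blast
      show "?H integrable_on {a..b}"
        using that by (intro integrable_continuous_interval continuous_on_subset[OF cont(2)]) auto
      fix t
      have "\<bar>Re (f t * cnj (f' t))\<bar> \<le> cmod (f t * cnj (f' t))" by (rule abs_Re_le_cmod)
      then show "norm (?h t) \<le> ?H t" by (simp add: norm_mult)
    qed
    also have "\<dots> \<le> integral {0..pi} ?H" by (rule tot) (use that in auto)
    finally show ?thesis using hi by (simp add: integral_unique)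
  qed
  have "\<bar>(cmod (f x))\<^sup>2 - (cmod (f y))\<^sup>2\<bar> \<le> integral {0..pi} ?H"
    using sub[of x y] sub[of y x] xy by (cases "x \<le> y") (auto simp: abs_minus_commute)
  also have "\<dots> \<le> 2 * (n2 f * n2 f')"
  proof -
    let ?a = "\<lambda>t. complex_of_real (cmod (f t))" and ?b = "\<lambda>t. complex_of_real (cmod (f' t))"
    have m: "?a \<in> VC" "?b \<in> VC" using f by (auto simp: VC_def intro!: continuous_intros)
    have "ipw (\<lambda>_. 1) ?a ?b = complex_of_real (integral {0..pi} (\<lambda>t. cmod (f t) * cmod (f' t)))"
    proof -
      have "(\<lambda>t. cmod (f t) * cmod (f' t)) integrable_on {0..pi}"
        using f by (intro integrable_continuous_interval) (auto simp: VC_def intro!: continuous_intros)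
      from integral_linear[OF this bounded_linear_of_real[where 'a = complex]]
      show ?thesis unfolding ipw_def by (simp add: o_def)
    qed
    then have "integral {0..pi} (\<lambda>t. cmod (f t) * cmod (f' t)) \<le> cmod (ipw (\<lambda>_. 1) ?a ?b)"
      by simp
    also have "\<dots> \<le> n2 ?a * n2 ?b" by (rule I1.cauchy_schwarz_sqrt[OF m])
    also have "n2 ?a * n2 ?b = n2 f * n2 f'" using f m by (simp add: ipw_self)
    finally show ?thesis by simp
  qed
  finally show ?thesis by linarith
qed

text \<open>\<open>agmon_diff\<close> averaged over \<open>y\<close>. The factor
  \<open>1 / pi\<close> that the average puts on the first term is estimated by
  \<open>1\<close>.\<close>

lemma agmon:
  fixes f f' :: "real \<Rightarrow> complex"
  assumes f: "f \<in> VC" "f' \<in> VC"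
    and d: "\<And>x. x \<in> {0..pi} \<Longrightarrow> (f has_vector_derivative f' x) (at x within {0..pi})"
    and x: "x \<in> {0..pi}"
  shows "(cmod (f x))\<^sup>2 \<le> (n2 f)\<^sup>2 + 2 * n2 f * n2 f'"
proof -
  have nn: "0 \<le> n2 f * n2 f'" using n2_nonneg f by simp
  have c: "continuous_on {0..pi} (\<lambda>y. (cmod (f y))\<^sup>2)" using f by (auto simp: VC_def intro!: continuous_intros)
  have "integral {0..pi} (\<lambda>y. (cmod (f x))\<^sup>2) \<le> integral {0..pi} (\<lambda>y. (cmod (f y))\<^sup>2 + 2 * n2 f * n2 f')"
    by (intro integral_le integrable_continuous_interval continuous_on_add continuous_on_const c agmon_diff[OF f d x])
  also have "\<dots> = (n2 f)\<^sup>2 + pi * (2 * n2 f * n2 f')"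
    unfolding n2_int[OF f(1)]
    by (subst integral_add) (use f in \<open>auto intro!: integrable_continuous_interval continuous_intros simp: VC_def\<close>)
  finally have "pi * (cmod (f x))\<^sup>2 \<le> (n2 f)\<^sup>2 + pi * (2 * n2 f * n2 f')" by simp
  also have "(n2 f)\<^sup>2 \<le> pi * (n2 f)\<^sup>2" using pi_gt3 mult_right_mono[of 1 pi "(n2 f)\<^sup>2"] by simp
  finally have "pi * (cmod (f x))\<^sup>2 \<le> pi * ((n2 f)\<^sup>2 + 2 * n2 f * n2 f')" by (simp add: algebra_simps)
  then show ?thesis by (rule mult_left_le_imp_le) simp
qed

lemma young: "0 < e \<Longrightarrow> x * y \<le> e / 8 * x\<^sup>2 + 2 / e * y\<^sup>2" for x y e :: real
proof -
  assume e: "0 < e"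
  have "0 \<le> (e * x - 4 * y)\<^sup>2 / (8 * e)" using e by simp
  also have "\<dots> = e / 8 * x\<^sup>2 + 2 / e * y\<^sup>2 - x * y"
    using e by (simp add: field_simps power2_eq_square)
  finally show ?thesis by simp
qed

text \<open>\<open>A\<close>, \<open>B\<close>, \<open>D\<close> stand for the norms of a function
  and of its first two derivatives, \<open>Q\<close> for the energy. End terms of size
  \<open>B^2 + 2 * B * D\<close> are absorbed by three uses of Young's inequality, each giving up
  \<open>e / 8\<close> of the leading term, while \<open>B^2 \<le> A * D\<close> eliminates
  \<open>B\<close>.\<close>

lemma coercive_real:
  fixes e g A B D Q :: real
  assumes e: "0 < e" and g: "0 \<le> g" and nn: "0 \<le> A" "0 \<le> B" "0 \<le> D"
    and BAD: "B\<^sup>2 \<le> A * D" and h: "e * D\<^sup>2 \<le> Q + g * (B\<^sup>2 + 2 * B * D)"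
  shows "e / 2 * D\<^sup>2 \<le> Q + (2 / e * g\<^sup>2 + 2 / e * (8 * g\<^sup>2 / e)\<^sup>2) * A\<^sup>2"
proof -
  have 1: "g * B\<^sup>2 \<le> e / 8 * D\<^sup>2 + 2 / e * (g * A)\<^sup>2"
  proof -
    have "g * B\<^sup>2 \<le> D * (g * A)" using mult_left_mono[OF BAD g] by (simp add: mult_ac)
    also have "\<dots> \<le> e / 8 * D\<^sup>2 + 2 / e * (g * A)\<^sup>2" by (rule young[OF e])
    finally show ?thesis .
  qed
  have 2: "g * (2 * B * D) \<le> e / 8 * D\<^sup>2 + (8 * g\<^sup>2 / e) * B\<^sup>2"
    using young[OF e, of D "2 * g * B"] by (simp add: power_mult_distrib mult_ac)
  have 3: "(8 * g\<^sup>2 / e) * B\<^sup>2 \<le> e / 8 * D\<^sup>2 + 2 / e * ((8 * g\<^sup>2 / e) * A)\<^sup>2"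
  proof -
    have "(8 * g\<^sup>2 / e) * B\<^sup>2 \<le> (8 * g\<^sup>2 / e) * (A * D)"
      using e by (intro mult_left_mono BAD) simp
    also have "\<dots> = D * ((8 * g\<^sup>2 / e) * A)" by simp
    also have "\<dots> \<le> e / 8 * D\<^sup>2 + 2 / e * ((8 * g\<^sup>2 / e) * A)\<^sup>2" by (rule young[OF e])
    finally show ?thesis .
  qed
  have "0 \<le> e / 8 * D\<^sup>2" using e by simp
  moreover have "(2 / e * g\<^sup>2 + 2 / e * (8 * g\<^sup>2 / e)\<^sup>2) * A\<^sup>2 = 2 / e * (g * A)\<^sup>2 + 2 / e * ((8 * g\<^sup>2 / e) * A)\<^sup>2"
    by (simp only: power_mult_distrib distrib_right mult.assoc)
  moreover have "g * (B\<^sup>2 + 2 * B * D) = g * B\<^sup>2 + g * (2 * B * D)" by (simp only: distrib_left)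
  moreover have "e / 2 * D\<^sup>2 = e * D\<^sup>2 - 4 * (e / 8 * D\<^sup>2)" by simp
  ultimately show ?thesis using 1 2 3 h by linarith
qed

text \<open>\<open>c0\<close> and \<open>cp\<close> are the coefficients of the end conditions once
  these are multiplied by \<open>\<eta>\<close> and written for the moment
  \<open>\<eta> * \<phi>''\<close>. Continuity and lower bounds of the coefficients suffice for the
  whole spectral theory in space.\<close>

locale beam_ode =
  fixes \<rho> \<eta> :: "real \<Rightarrow> real" and c0 cp :: real
  assumes rho_cont: "continuous_on {0..pi} \<rho>" and rho_gt: "\<And>x. x \<in> {0..pi} \<Longrightarrow> 1 < \<rho> x"
    and eta_cont: "continuous_on {0..pi} \<eta>" and eta_pos: "\<And>x. x \<in> {0..pi} \<Longrightarrow> 0 < \<eta> x"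
begin

sublocale IR: cip_space VC "ipw \<rho>"
  by (rule ipw_cip) (use rho_cont rho_gt in \<open>auto intro: less_imp_le order_less_trans zero_less_one\<close>)

abbreviation nr :: "(real \<Rightarrow> complex) \<Rightarrow> real" where
  "nr f \<equiv> sqrt (Re (ipw \<rho> f f))"

lemma nr_nonneg: "f \<in> VC \<Longrightarrow> 0 \<le> nr f" using IR.ip_pos[of f] by simp
lemma nr_sq: "f \<in> VC \<Longrightarrow> (nr f)\<^sup>2 = Re (ipw \<rho> f f)" using IR.ip_pos[of f] by simp

definition elo :: real where "elo = (SOME e. 0 < e \<and> (\<forall>x\<in>{0..pi}. e \<le> \<eta> x))"
definition rhi :: real where "rhi = (SOME r. 0 < r \<and> (\<forall>x\<in>{0..pi}. \<rho> x \<le> r))"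

lemma elo: "0 < elo" "\<And>x. x \<in> {0..pi} \<Longrightarrow> elo \<le> \<eta> x"
proof -
  have "\<exists>x\<in>{0..pi}. \<forall>y\<in>{0..pi}. \<eta> x \<le> \<eta> y"
    by (rule continuous_attains_inf) (use eta_cont in auto)
  then have "\<exists>e. 0 < e \<and> (\<forall>x\<in>{0..pi}. e \<le> \<eta> x)" using eta_pos by blast
  then have "0 < elo \<and> (\<forall>x\<in>{0..pi}. elo \<le> \<eta> x)" unfolding elo_def by (rule someI_ex)
  then show "0 < elo" "\<And>x. x \<in> {0..pi} \<Longrightarrow> elo \<le> \<eta> x" by auto
qed

lemma rhi: "0 < rhi" "\<And>x. x \<in> {0..pi} \<Longrightarrow> \<rho> x \<le> rhi"
proof -
  have "\<exists>x\<in>{0..pi}. \<forall>y\<in>{0..pi}. \<rho> y \<le> \<rho> x"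
    by (rule continuous_attains_sup) (use rho_cont in auto)
  then have "\<exists>r. 0 < r \<and> (\<forall>x\<in>{0..pi}. \<rho> x \<le> r)"
    using rho_gt order_less_trans[OF zero_less_one] by blast
  then have "0 < rhi \<and> (\<forall>x\<in>{0..pi}. \<rho> x \<le> rhi)" unfolding rhi_def by (rule someI_ex)
  then show "0 < rhi" "\<And>x. x \<in> {0..pi} \<Longrightarrow> \<rho> x \<le> rhi" by auto
qed

lemma n2_le_nr:
  assumes "f \<in> VC" shows "n2 f \<le> nr f"
proof -
  have "integral {0..pi} (\<lambda>x. 1 * (cmod (f x))\<^sup>2) \<le> integral {0..pi} (\<lambda>x. \<rho> x * (cmod (f x))\<^sup>2)"
    using assms rho_cont rho_gt less_imp_le
    by (intro integral_le integrable_continuous_interval continuous_intros mult_right_mono) (auto simp: VC_def)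
  then show ?thesis using assms rho_cont by (simp add: ipw_self)
qed

lemma nr_zero:
  assumes "f \<in> VC" "nr f = 0" "x \<in> {0..pi}" shows "f x = 0"
proof -
  have "integral {0..pi} (\<lambda>x. \<rho> x * (cmod (f x))\<^sup>2) = 0" using assms rho_cont by (simp add: ipw_self)
  then have "\<rho> x * (cmod (f x))\<^sup>2 = 0"
    using assms rho_cont rho_gt less_imp_le[OF order_less_trans[OF zero_less_one]]
    by (intro continuous_nonneg_integral_zero[of "\<lambda>x. \<rho> x * (cmod (f x))\<^sup>2"])
      (auto simp: VC_def intro!: continuous_intros mult_nonneg_nonneg)
  then show ?thesis using rho_gt[OF assms(3)] by simp
qed

text \<open>The fourth-order expression as a first-order system: \<open>\<phi>1\<close>,
  \<open>m\<close>, \<open>m1\<close>, \<open>w\<close> are the successive \<open>\<phi>'\<close>,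
  \<open>\<eta> \<phi>''\<close>, \<open>(\<eta> \<phi>'')'\<close>,
  \<open>(\<eta> \<phi>'')''\<close>. In this form no derivative of \<open>\<eta>\<close> occurs.
  The last equation is asked for in the open interval, as in the eigenvalue problem; since
  \<open>w\<close> is continuous, the ends follow (\<open>chain_end_deriv\<close>).\<close>

definition chain where
  "chain \<phi> \<phi>1 m m1 w \<longleftrightarrow>
     (\<forall>x\<in>{0..pi}. (\<phi> has_vector_derivative \<phi>1 x) (at x within {0..pi}) \<and>
        (\<phi>1 has_vector_derivative (m x / of_real (\<eta> x))) (at x within {0..pi}) \<and>
        (m has_vector_derivative m1 x) (at x within {0..pi})) \<and>
     m1 \<in> VC \<and> w \<in> VC \<and> (\<forall>x\<in>{0<..<pi}. (m1 has_vector_derivative w x) (at x))"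

definition bvp where
  "bvp \<phi> \<phi>1 m m1 w \<longleftrightarrow> chain \<phi> \<phi>1 m m1 w \<and> \<phi> 0 = 0 \<and> \<phi> pi = 0 \<and>
     m 0 = - of_real c0 * \<phi>1 0 \<and> m pi = - of_real cp * \<phi>1 pi"

lemma chainD:
  assumes "chain \<phi> \<phi>1 m m1 w"
  shows "\<phi> \<in> VC" "\<phi>1 \<in> VC" "m \<in> VC" "m1 \<in> VC" "w \<in> VC" "(\<lambda>x. m x / of_real (\<eta> x)) \<in> VC"
    "x \<in> {0..pi} \<Longrightarrow> (\<phi> has_vector_derivative \<phi>1 x) (at x within {0..pi})"
    "x \<in> {0..pi} \<Longrightarrow> (\<phi>1 has_vector_derivative (m x / of_real (\<eta> x))) (at x within {0..pi})"
    "x \<in> {0..pi} \<Longrightarrow> (m has_vector_derivative m1 x) (at x within {0..pi})"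
    "x \<in> {0<..<pi} \<Longrightarrow> (m1 has_vector_derivative w x) (at x)"
proof -
  show *: "\<phi> \<in> VC" "\<phi>1 \<in> VC" "m \<in> VC" "m1 \<in> VC" "w \<in> VC"
    using assms unfolding chain_def VC_def by (auto intro!: continuous_on_vector_derivative)
  have "\<eta> x \<noteq> 0" if "x \<in> {0..pi}" for x using eta_pos[OF that] by simp
  then show "(\<lambda>x. m x / of_real (\<eta> x)) \<in> VC"
    using *(3) eta_cont unfolding VC_def by (auto intro!: continuous_intros)
qed (use assms in \<open>auto simp: chain_def\<close>)

lemma within_interior:
  "x \<in> {0<..<pi} \<Longrightarrow> (f has_vector_derivative d) (at x within {0..pi}) \<Longrightarrow> (f has_vector_derivative d) (at x)"
  for x :: real
  by (simp add: at_within_Icc_at)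

lemma chain_lin:
  assumes "chain \<phi> \<phi>1 m m1 w" "chain \<psi> \<psi>1 n n1 v"
  shows "chain (\<lambda>x. c * \<phi> x + d * \<psi> x) (\<lambda>x. c * \<phi>1 x + d * \<psi>1 x) (\<lambda>x. c * m x + d * n x)
    (\<lambda>x. c * m1 x + d * n1 x) (\<lambda>x. c * w x + d * v x)"
  unfolding chain_def
proof (intro conjI ballI)
  fix x assume x: "x \<in> {0..pi}"
  show "((\<lambda>x. c * \<phi> x + d * \<psi> x) has_vector_derivative c * \<phi>1 x + d * \<psi>1 x) (at x within {0..pi})"
    by (intro has_vector_derivative_add has_vector_derivative_mult_right chainD(7)[OF assms(1) x] chainD(7)[OF assms(2) x])
  show "((\<lambda>x. c * m x + d * n x) has_vector_derivative c * m1 x + d * n1 x) (at x within {0..pi})"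
    by (intro has_vector_derivative_add has_vector_derivative_mult_right chainD(9)[OF assms(1) x] chainD(9)[OF assms(2) x])
  have "((\<lambda>x. c * \<phi>1 x + d * \<psi>1 x) has_vector_derivative c * (m x / of_real (\<eta> x)) + d * (n x / of_real (\<eta> x)))
      (at x within {0..pi})"
    by (intro has_vector_derivative_add has_vector_derivative_mult_right chainD(8)[OF assms(1) x] chainD(8)[OF assms(2) x])
  then show "((\<lambda>x. c * \<phi>1 x + d * \<psi>1 x) has_vector_derivative (c * m x + d * n x) / of_real (\<eta> x)) (at x within {0..pi})"
    by (simp add: add_divide_distrib)
next
  fix x assume x: "x \<in> {0<..<pi}"
  show "((\<lambda>x. c * m1 x + d * n1 x) has_vector_derivative c * w x + d * v x) (at x)"
    by (intro has_vector_derivative_add has_vector_derivative_mult_right chainD(10)[OF assms(1) x] chainD(10)[OF assms(2) x])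
qed (use chainD[OF assms(1)] chainD[OF assms(2)] IR.lin_mem in auto)

lemma bvp_lin:
  assumes "bvp \<phi> \<phi>1 m m1 w" "bvp \<psi> \<psi>1 n n1 v"
  shows "bvp (\<lambda>x. c * \<phi> x + d * \<psi> x) (\<lambda>x. c * \<phi>1 x + d * \<psi>1 x) (\<lambda>x. c * m x + d * n x)
    (\<lambda>x. c * m1 x + d * n1 x) (\<lambda>x. c * w x + d * v x)"
  using assms chain_lin unfolding bvp_def by (simp add: algebra_simps)

lemma chain_green:
  assumes "chain \<phi> \<phi>1 m m1 w" "chain \<psi> \<psi>1 n n1 v"
  shows "ipw (\<lambda>_. 1) w \<psi> = m1 pi * cnj (\<psi> pi) - m1 0 * cnj (\<psi> 0) - (m pi * cnj (\<psi>1 pi) - m 0 * cnj (\<psi>1 0))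
    + integral {0..pi} (\<lambda>x. m x * cnj (n x) / of_real (\<eta> x))"
proof -
  note a = chainD[OF assms(1)] and b = chainD[OF assms(2)]
  have "ipw (\<lambda>_. 1) w \<psi> = integral {0..pi} (\<lambda>x. w x * cnj (\<psi> x))" by (simp add: ipw_def)
  also have "\<dots> = m1 pi * cnj (\<psi> pi) - m1 0 * cnj (\<psi> 0) - integral {0..pi} (\<lambda>x. m1 x * cnj (\<psi>1 x))"
    using a b by (intro ibp cont_cnj has_vector_derivative_cnj')
      (auto simp: VC_def intro: within_interior)
  also have "integral {0..pi} (\<lambda>x. m1 x * cnj (\<psi>1 x)) =
     m pi * cnj (\<psi>1 pi) - m 0 * cnj (\<psi>1 0) - integral {0..pi} (\<lambda>x. m x * cnj (n x / of_real (\<eta> x)))"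
    using a b by (intro ibp cont_cnj has_vector_derivative_cnj')
      (auto simp: VC_def intro: within_interior)
  finally show ?thesis by simp
qed

lemma bvp_green:
  assumes "bvp \<phi> \<phi>1 m m1 w" "bvp \<psi> \<psi>1 n n1 v"
  shows "ipw (\<lambda>_. 1) w \<psi> = of_real cp * (\<phi>1 pi * cnj (\<psi>1 pi)) - of_real c0 * (\<phi>1 0 * cnj (\<psi>1 0))
    + integral {0..pi} (\<lambda>x. m x * cnj (n x) / of_real (\<eta> x))"
  using chain_green[of \<phi> \<phi>1 m m1 w \<psi> \<psi>1 n n1 v] assms unfolding bvp_def by simp

text \<open>The right side of \<open>bvp_green\<close> is Hermitian in the two systems, because
  \<open>\<eta>\<close>, \<open>c0\<close> and \<open>cp\<close> are real.\<close>

lemma bvp_symmetric: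
  assumes "bvp \<phi> \<phi>1 m m1 w" "bvp \<psi> \<psi>1 n n1 v"
  shows "ipw (\<lambda>_. 1) w \<psi> = ipw (\<lambda>_. 1) \<phi> v"
proof -
  have "ipw (\<lambda>_. 1) \<phi> v = cnj (ipw (\<lambda>_. 1) v \<phi>)"
    using assms by (intro I1.ip_cnj) (auto simp: bvp_def dest: chainD)
  also have "\<dots> = ipw (\<lambda>_. 1) w \<psi>"
    unfolding bvp_green[OF assms] bvp_green[OF assms(2,1)] by (simp add: integral_cnj mult_ac)
  finally show ?thesis by simp
qed

text \<open>The constant of \<open>coercive_real\<close> for \<open>e = elo\<close> and
  \<open>g = |c0| + |cp|\<close>.\<close>

definition K0 :: real where
  "K0 = 2 / elo * (\<bar>c0\<bar> + \<bar>cp\<bar>)\<^sup>2 + 2 / elo * (8 * (\<bar>c0\<bar> + \<bar>cp\<bar>)\<^sup>2 / elo)\<^sup>2"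

lemma K0_nonneg: "0 \<le> K0" unfolding K0_def using elo(1) by simp

text \<open>Both end values of \<open>\<phi>\<close> vanish, so \<open>\<phi>'\<close> paired with
  itself is minus \<open>\<phi>\<close> paired with \<open>\<phi>''\<close>; Cauchy-Schwarz does the
  rest.\<close>

lemma interp1:
  assumes "chain \<phi> \<phi>1 m m1 w" "\<phi> 0 = 0" "\<phi> pi = 0"
  shows "(n2 \<phi>1)\<^sup>2 \<le> n2 \<phi> * n2 (\<lambda>x. m x / of_real (\<eta> x))"
proof -
  note a = chainD[OF assms(1)]
  have "ipw (\<lambda>_. 1) \<phi>1 \<phi>1 = integral {0..pi} (\<lambda>x. \<phi>1 x * cnj (\<phi>1 x))" by (simp add: ipw_def)
  also have "\<dots> = \<phi> pi * cnj (\<phi>1 pi) - \<phi> 0 * cnj (\<phi>1 0) - integral {0..pi} (\<lambda>x. \<phi> x * cnj (m x / of_real (\<eta> x)))"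
    by (rule ibp) (use a in \<open>auto simp: VC_def simp del: complex_cnj_divide
        intro!: cont_cnj has_vector_derivative_cnj' intro: within_interior\<close>)
  also have "\<dots> = - ipw (\<lambda>_. 1) \<phi> (\<lambda>x. m x / of_real (\<eta> x))" using assms by (simp add: ipw_def)
  finally have "(n2 \<phi>1)\<^sup>2 = Re (- ipw (\<lambda>_. 1) \<phi> (\<lambda>x. m x / of_real (\<eta> x)))" unfolding n2_sq[OF a(2)] by simp
  also have "\<dots> \<le> cmod (- ipw (\<lambda>_. 1) \<phi> (\<lambda>x. m x / of_real (\<eta> x)))" by (rule complex_Re_le_cmod)
  also have "\<dots> \<le> n2 \<phi> * n2 (\<lambda>x. m x / of_real (\<eta> x))"
    using I1.cauchy_schwarz_sqrt[OF a(1) a(6)] by simp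
  finally show ?thesis .
qed

text \<open>A Garding inequality. By \<open>bvp_green\<close> the energy is the integral of
  \<open>|m|^2 / \<eta>\<close> plus end terms in \<open>|\<phi>1|^2\<close> of unknown sign.
  Agmon's inequality bounds these by \<open>B^2 + 2 * B * D\<close>, and
  \<open>coercive_real\<close> absorbs them at the price of \<open>K0\<close> times the squared norm
  of \<open>\<phi>\<close>.\<close>

lemma coercive:
  assumes b: "bvp \<phi> \<phi>1 m m1 w"
  shows "elo / 2 * (n2 (\<lambda>x. m x / of_real (\<eta> x)))\<^sup>2 \<le> Re (ipw (\<lambda>_. 1) w \<phi>) + K0 * (nr \<phi>)\<^sup>2"
proof -
  have ch: "chain \<phi> \<phi>1 m m1 w" "\<phi> 0 = 0" "\<phi> pi = 0" using b by (auto simp: bvp_def)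
  note a = chainD[OF ch(1)]
  let ?D = "n2 (\<lambda>x. m x / of_real (\<eta> x))" and ?B = "n2 \<phi>1" and ?A = "n2 \<phi>"
  have enz: "\<eta> x \<noteq> 0" if "x \<in> {0..pi}" for x using eta_pos[OF that] by simp
  have sup: "(cmod (\<phi>1 x))\<^sup>2 \<le> ?B\<^sup>2 + 2 * ?B * ?D" if "x \<in> {0..pi}" for x
    by (rule agmon[OF a(2) a(6) a(8) that])
  have int: "(\<lambda>x. m x * cnj (m x) / of_real (\<eta> x)) integrable_on {0..pi}"
    using a eta_cont enz by (intro integrable_continuous_interval continuous_intros) (auto simp: VC_def)
  have "elo * ?D\<^sup>2 = integral {0..pi} (\<lambda>x. elo * (cmod (m x / of_real (\<eta> x)))\<^sup>2)"
    unfolding n2_int[OF a(6)] by simp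
  also have "\<dots> \<le> integral {0..pi} (\<lambda>x. Re (m x * cnj (m x) / of_real (\<eta> x)))"
  proof (rule integral_le)
    show "(\<lambda>x. elo * (cmod (m x / of_real (\<eta> x)))\<^sup>2) integrable_on {0..pi}"
      using continuous_on_norm[OF VC_D[OF a(6)]]
      by (intro integrable_continuous_interval continuous_on_mult continuous_on_const continuous_on_power)
    show "(\<lambda>x. Re (m x * cnj (m x) / of_real (\<eta> x))) integrable_on {0..pi}"
      using integrable_linear[OF int bounded_linear_Re] by (simp add: o_def)
    fix x assume x: "x \<in> {0..pi}"
    have "m x * cnj (m x) / of_real (\<eta> x) = of_real ((cmod (m x))\<^sup>2 / \<eta> x)" by (simp add: mult_cnj_cmod)
    then have "Re (m x * cnj (m x) / of_real (\<eta> x)) = (cmod (m x))\<^sup>2 / \<eta> x"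
      by (simp only: Re_complex_of_real)
    moreover have "elo * (cmod (m x / of_real (\<eta> x)))\<^sup>2 \<le> \<eta> x * (cmod (m x / of_real (\<eta> x)))\<^sup>2"
      using elo(2)[OF x] by (intro mult_right_mono) auto
    moreover have "\<eta> x * (cmod (m x / of_real (\<eta> x)))\<^sup>2 = (cmod (m x))\<^sup>2 / \<eta> x"
      using eta_pos[OF x] by (simp add: norm_divide power_divide power2_eq_square)
    ultimately show "elo * (cmod (m x / of_real (\<eta> x)))\<^sup>2 \<le> Re (m x * cnj (m x) / of_real (\<eta> x))"
      by (simp only:)
  qed
  also have "\<dots> = Re (integral {0..pi} (\<lambda>x. m x * cnj (m x) / of_real (\<eta> x)))"
    using integral_linear[OF int bounded_linear_Re] by (simp add: o_def)
  also have "\<dots> = Re (ipw (\<lambda>_. 1) w \<phi>) - cp * (cmod (\<phi>1 pi))\<^sup>2 + c0 * (cmod (\<phi>1 0))\<^sup>2"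
    unfolding bvp_green[OF b b] mult_cnj_cmod by (simp flip: of_real_power)
  also have "\<dots> \<le> Re (ipw (\<lambda>_. 1) w \<phi>) + (\<bar>c0\<bar> + \<bar>cp\<bar>) * (?B\<^sup>2 + 2 * ?B * ?D)"
  proof -
    have "- cp * (cmod (\<phi>1 pi))\<^sup>2 \<le> \<bar>cp\<bar> * (?B\<^sup>2 + 2 * ?B * ?D)"
      using sup[of pi] by (intro mult_mono) auto
    moreover have "c0 * (cmod (\<phi>1 0))\<^sup>2 \<le> \<bar>c0\<bar> * (?B\<^sup>2 + 2 * ?B * ?D)"
      using sup[of 0] by (intro mult_mono) auto
    ultimately show ?thesis by (simp add: algebra_simps)
  qed
  finally have "elo / 2 * ?D\<^sup>2 \<le> Re (ipw (\<lambda>_. 1) w \<phi>) + K0 * ?A\<^sup>2"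
    unfolding K0_def
    by (intro coercive_real[where B = ?B]) (use elo(1) n2_nonneg a interp1[OF ch] in auto)
  also have "\<dots> \<le> Re (ipw (\<lambda>_. 1) w \<phi>) + K0 * (nr \<phi>)\<^sup>2"
    using n2_le_nr[OF a(1)] n2_nonneg[OF a(1)] K0_nonneg
    by (intro add_left_mono mult_left_mono power_mono) auto
  finally show ?thesis .
qed

text \<open>Shifting the operator by \<open>kap\<close> lifts its lower bound from
  \<open>- K0\<close> to \<open>1\<close>, which makes the resolvent a contraction.\<close>

definition kap :: real where "kap = K0 + 1"

lemma ipw_rho: "ipw (\<lambda>_. 1) (\<lambda>x. of_real (\<rho> x) * f x) g = ipw \<rho> f g"
  unfolding ipw_def by (simp add: mult_ac)

lemma rho_VC: "f \<in> VC \<Longrightarrow> (\<lambda>x. of_real (\<rho> x) * f x) \<in> VC"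
  using rho_cont unfolding VC_def by (auto intro!: continuous_intros)

text \<open>The hypothesis on \<open>w\<close> says that the shifted operator maps
  \<open>\<phi>\<close> to \<open>f\<close>. Inserted into \<open>coercive\<close>, it leaves
  \<open>kap - K0 = 1\<close> times the squared norm of \<open>\<phi>\<close> on the left.\<close>

lemma resolvent_bound:
  assumes b: "bvp \<phi> \<phi>1 m m1 w" and w: "\<And>x. x \<in> {0..pi} \<Longrightarrow> w x = of_real (\<rho> x) * (f x - of_real kap * \<phi> x)"
    and f: "f \<in> VC"
  shows "elo / 2 * (n2 (\<lambda>x. m x / of_real (\<eta> x)))\<^sup>2 + (nr \<phi>)\<^sup>2 \<le> Re (ipw \<rho> f \<phi>)"
    "nr \<phi> \<le> nr f" "elo / 2 * (n2 (\<lambda>x. m x / of_real (\<eta> x)))\<^sup>2 \<le> (nr f)\<^sup>2"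
proof -
  have a: "\<phi> \<in> VC" using b by (auto simp: bvp_def dest: chainD)
  have "ipw (\<lambda>_. 1) w \<phi> = ipw (\<lambda>_. 1) (\<lambda>x. of_real (\<rho> x) * (f x - of_real kap * \<phi> x)) \<phi>"
    unfolding ipw_def using w by (intro integral_cong) auto
  also have "\<dots> = ipw \<rho> f \<phi> - of_real kap * ipw \<rho> \<phi> \<phi>"
    unfolding ipw_rho using IR.ip_lin[OF f a a, of 1 "- of_real kap"] by simp
  finally have "Re (ipw (\<lambda>_. 1) w \<phi>) = Re (ipw \<rho> f \<phi>) - kap * (nr \<phi>)\<^sup>2" using a by (simp add: nr_sq)
  then show 1: "elo / 2 * (n2 (\<lambda>x. m x / of_real (\<eta> x)))\<^sup>2 + (nr \<phi>)\<^sup>2 \<le> Re (ipw \<rho> f \<phi>)"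
    using coercive[OF b] by (simp add: kap_def algebra_simps)
  also have 2: "Re (ipw \<rho> f \<phi>) \<le> nr f * nr \<phi>"
    using complex_Re_le_cmod IR.cauchy_schwarz_sqrt[OF f a] order_trans by blast
  finally have 3: "elo / 2 * (n2 (\<lambda>x. m x / of_real (\<eta> x)))\<^sup>2 + (nr \<phi>)\<^sup>2 \<le> nr f * nr \<phi>" .
  have D0: "0 \<le> elo / 2 * (n2 (\<lambda>x. m x / of_real (\<eta> x)))\<^sup>2" using elo(1) by simp
  show 4: "nr \<phi> \<le> nr f"
  proof (rule ccontr)
    assume "\<not> ?thesis"
    then have l: "nr f < nr \<phi>" by simp
    then have "0 < nr \<phi>" using nr_nonneg[OF f] by simp
    then have "nr f * nr \<phi> < nr \<phi> * nr \<phi>" using l by (rule mult_strict_right_mono[rotated])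
    then show False using 3 D0 by (simp add: power2_eq_square)
  qed
  have "nr f * nr \<phi> \<le> nr f * nr f" using 4 nr_nonneg[OF f] by (rule mult_left_mono)
  then show "elo / 2 * (n2 (\<lambda>x. m x / of_real (\<eta> x)))\<^sup>2 \<le> (nr f)\<^sup>2"
    using 3 zero_le_power2[of "nr \<phi>"] unfolding power2_eq_square by linarith
qed

end

section \<open>The resolvent of the boundary value problem\<close>

definition prim :: "(real \<Rightarrow> complex) \<Rightarrow> real \<Rightarrow> complex" where
  "prim f x = integral {0..x} f"

lemma prim_0 [simp]: "prim f 0 = 0" by (simp add: prim_def)

lemma prim_deriv:
  assumes "f \<in> VC" "x \<in> {0..pi}"
  shows "(prim f has_vector_derivative f x) (at x within {0..pi})"
  using integral_has_vector_derivative[of 0 pi f x] assms by (simp add: VC_def prim_def[abs_def])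

lemma prim_VC: "f \<in> VC \<Longrightarrow> prim f \<in> VC"
  unfolding VC_def by (auto intro!: continuous_on_vector_derivative[OF prim_deriv] simp: VC_def)

lemma prim_integrable: "f \<in> VC \<Longrightarrow> x \<in> {0..pi} \<Longrightarrow> f integrable_on {0..x}"
  by (intro integrable_continuous_interval) (auto simp: VC_def intro: continuous_on_subset)

lemma prim_lin:
  assumes "f \<in> VC" "g \<in> VC" "x \<in> {0..pi}"
  shows "prim (\<lambda>x. c * f x + d * g x) x = c * prim f x + d * prim g x"
  unfolding prim_def using prim_integrable[OF assms(1,3)] prim_integrable[OF assms(2,3)]
  by (subst integral_add) (auto intro!: integrable_on_mult_right)

lemma prim_cong:
  assumes "\<And>y. y \<in> {0..pi} \<Longrightarrow> f y = g y" "x \<in> {0..pi}"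
  shows "prim f x = prim g x"
  unfolding prim_def using assms by (intro integral_cong) auto

lemma prim_bound:
  assumes f: "f \<in> VC" and b: "\<And>s. s \<in> {0..pi} \<Longrightarrow> cmod (f s) \<le> M * s ^ j / fact j" and x: "x \<in> {0..pi}"
  shows "cmod (prim f x) \<le> M * x ^ Suc j / fact (Suc j)"
proof -
  have hi: "((\<lambda>s. M * s ^ j / fact j) has_integral (M * x ^ Suc j / fact (Suc j) - M * 0 ^ Suc j / fact (Suc j))) {0..x}"
  proof (rule fundamental_theorem_of_calculus)
    fix s :: real
    have "((\<lambda>s. M * s ^ Suc j / fact (Suc j)) has_real_derivative M * (real (Suc j) * s ^ j) / fact (Suc j)) (at s within {0..x})"
      by (intro derivative_eq_intros) auto
    moreover have "M * (real (Suc j) * s ^ j) / fact (Suc j) = M * s ^ j / fact j"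
      by (simp add: field_simps del: of_nat_Suc)
    ultimately show "((\<lambda>s. M * s ^ Suc j / fact (Suc j)) has_vector_derivative M * s ^ j / fact j) (at s within {0..x})"
      by (simp add: has_real_derivative_iff_has_vector_derivative)
  qed (use x in auto)
  have "norm (integral {0..x} f) \<le> integral {0..x} (\<lambda>s. M * s ^ j / fact j)"
    by (rule integral_norm_bound_integral) (use prim_integrable[OF f x] hi b x in auto)
  also have "\<dots> = M * x ^ Suc j / fact (Suc j)" unfolding integral_unique[OF hi] by simp
  finally show ?thesis by (simp add: prim_def)
qed

context beam_ode
begin

text \<open>The first component \<open>\<phi>\<close> of the system with right-hand side
  \<open>w\<close> and vanishing data at \<open>0\<close>.\<close>

definition PP :: "(real \<Rightarrow> complex) \<Rightarrow> real \<Rightarrow> complex" where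
  "PP w = prim (prim (\<lambda>r. prim (prim w) r / of_real (\<eta> r)))"

lemma div_eta_VC: "f \<in> VC \<Longrightarrow> (\<lambda>r. f r / of_real (\<eta> r)) \<in> VC"
  using eta_cont eta_pos unfolding VC_def by (force intro!: continuous_intros)

lemma PP_VC: "w \<in> VC \<Longrightarrow> PP w \<in> VC"
  unfolding PP_def by (intro prim_VC div_eta_VC)

lemma PP_lin:
  assumes "f \<in> VC" "g \<in> VC" "x \<in> {0..pi}"
  shows "PP (\<lambda>x. c * f x + d * g x) x = c * PP f x + d * PP g x"
proof -
  have 1: "prim (\<lambda>x. c * f x + d * g x) x = c * prim f x + d * prim g x" if "x \<in> {0..pi}" for x
    using prim_lin assms that by blast
  have 2: "prim (prim (\<lambda>x. c * f x + d * g x)) x = c * prim (prim f) x + d * prim (prim g) x" if "x \<in> {0..pi}" for x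
    using prim_cong[OF 1 that] prim_lin[OF prim_VC prim_VC that] assms by simp
  have 3: "prim (\<lambda>r. prim (prim (\<lambda>x. c * f x + d * g x)) r / of_real (\<eta> r)) x
     = c * prim (\<lambda>r. prim (prim f) r / of_real (\<eta> r)) x + d * prim (\<lambda>r. prim (prim g) r / of_real (\<eta> r)) x"
    if "x \<in> {0..pi}" for x
  proof -
    have "prim (\<lambda>r. prim (prim (\<lambda>x. c * f x + d * g x)) r / of_real (\<eta> r)) x =
      prim (\<lambda>r. c * (prim (prim f) r / of_real (\<eta> r)) + d * (prim (prim g) r / of_real (\<eta> r))) x"
      by (rule prim_cong) (use that 2 in \<open>auto simp: add_divide_distrib\<close>)
    then show ?thesis using prim_lin[OF div_eta_VC div_eta_VC that] prim_VC assms by simp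
  qed
  show ?thesis unfolding PP_def
    using prim_cong[OF 3 assms(3)] prim_lin[OF prim_VC prim_VC assms(3)] assms prim_VC div_eta_VC by simp
qed

text \<open>The shape \<open>M * s ^ j / fact j\<close> survives each primitive with
  \<open>j\<close> raised by one; the division by \<open>\<eta>\<close> costs the factor
  \<open>1 / elo\<close>.\<close>

lemma PP_bound:
  assumes f: "f \<in> VC" and b: "\<And>s. s \<in> {0..pi} \<Longrightarrow> cmod (f s) \<le> M * s ^ j / fact j" and x: "x \<in> {0..pi}"
  shows "cmod (PP f x) \<le> M / elo * x ^ (j + 4) / fact (j + 4)"
proof -
  have 1: "cmod (prim f s) \<le> M * s ^ Suc j / fact (Suc j)" if "s \<in> {0..pi}" for s
    by (rule prim_bound[OF f b that])
  have 2: "cmod (prim (prim f) s) \<le> M * s ^ Suc (Suc j) / fact (Suc (Suc j))" if "s \<in> {0..pi}" for s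
    by (rule prim_bound[OF prim_VC[OF f] 1 that])
  have 3: "cmod (prim (prim f) s / of_real (\<eta> s)) \<le> M / elo * s ^ Suc (Suc j) / fact (Suc (Suc j))"
    if "s \<in> {0..pi}" for s
  proof -
    have "cmod (prim (prim f) s / of_real (\<eta> s)) = cmod (prim (prim f) s) / \<eta> s"
      using eta_pos[OF that] by (simp add: norm_divide)
    also have "\<dots> \<le> (M * s ^ Suc (Suc j) / fact (Suc (Suc j))) / elo"
      using elo(1) elo(2)[OF that] 2[OF that] by (intro frac_le) (auto intro: order_trans[OF norm_ge_zero])
    finally show ?thesis by (simp add: field_simps)
  qed
  have 4: "cmod (prim (\<lambda>s. prim (prim f) s / of_real (\<eta> s)) s) \<le> M / elo * s ^ Suc (Suc (Suc j)) / fact (Suc (Suc (Suc j)))"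
    if "s \<in> {0..pi}" for s
    by (rule prim_bound[OF div_eta_VC[OF prim_VC[OF prim_VC[OF f]]] 3 that])
  have "cmod (prim (prim (\<lambda>s. prim (prim f) s / of_real (\<eta> s))) x) \<le> M / elo * x ^ Suc (Suc (Suc (Suc j))) / fact (Suc (Suc (Suc (Suc j))))"
    by (rule prim_bound[OF prim_VC[OF div_eta_VC[OF prim_VC[OF prim_VC[OF f]]]] 4 x])
  then show ?thesis unfolding PP_def by (simp add: numeral_eq_Suc)
qed

text \<open>The integral operator that remains when \<open>\<phi> = base + PP w\<close> is inserted
  into \<open>w = \<rho> * (f - kap * \<phi>)\<close>.\<close>

definition JJ :: "(real \<Rightarrow> complex) \<Rightarrow> real \<Rightarrow> complex" where
  "JJ w x = of_real (- kap * \<rho> x) * PP w x"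

lemma kap_pos: "0 < kap" using K0_nonneg by (simp add: kap_def)

lemma JJ_VC: "w \<in> VC \<Longrightarrow> JJ w \<in> VC"
  using PP_VC[of w] rho_cont unfolding JJ_def[abs_def] VC_def by (auto intro!: continuous_intros)

lemma JJ_lin:
  assumes "f \<in> VC" "g \<in> VC" "x \<in> {0..pi}"
  shows "JJ (\<lambda>x. c * f x + d * g x) x = c * JJ f x + d * JJ g x"
  unfolding JJ_def PP_lin[OF assms] by (simp add: algebra_simps)

definition LL :: real where "LL = kap * rhi / elo"

lemma LL_pos: "0 < LL" unfolding LL_def using kap_pos rhi(1) elo(1) by simp

lemma JJ_bound:
  assumes f: "f \<in> VC" and b: "\<And>s. s \<in> {0..pi} \<Longrightarrow> cmod (f s) \<le> M * s ^ j / fact j" and x: "x \<in> {0..pi}"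
  shows "cmod (JJ f x) \<le> (LL * M) * x ^ (j + 4) / fact (j + 4)"
proof -
  have P: "cmod (PP f x) \<le> M / elo * x ^ (j + 4) / fact (j + 4)" by (rule PP_bound[OF f b x])
  have r: "0 < \<rho> x" using rho_gt[OF x] by simp
  have "cmod (JJ f x) = kap * \<rho> x * cmod (PP f x)"
    unfolding JJ_def using kap_pos r by (simp add: norm_mult abs_mult)
  also have "\<dots> \<le> kap * rhi * (M / elo * x ^ (j + 4) / fact (j + 4))"
    using kap_pos r rhi(2)[OF x] rhi(1) P by (intro mult_mono) auto
  finally show ?thesis by (simp add: LL_def)
qed

text \<open>Neumann series. Four integrations per application produce the factor
  \<open>x ^ (4 * k) / fact (4 * k)\<close>, so the series converges uniformly however large
  \<open>LL\<close> is.\<close>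

lemma volterra:
  assumes g: "g \<in> VC"
  obtains w where "w \<in> VC" "\<And>x. x \<in> {0..pi} \<Longrightarrow> w x = g x + JJ w x"
proof -
  define W where "W k = (JJ ^^ k) g" for k
  have W0: "W 0 = g" and WS: "W (Suc k) = JJ (W k)" for k by (auto simp: W_def)
  have WV: "W k \<in> VC" for k by (induction k) (auto simp: W0 WS g JJ_VC)
  obtain F where F: "\<And>x. x \<in> {0..pi} \<Longrightarrow> cmod (g x) \<le> F"
  proof -
    have "compact (g ` {0..pi})" using g by (intro compact_continuous_image) (auto simp: VC_def)
    then have "bounded (g ` {0..pi})" by (rule compact_imp_bounded)
    then obtain a where "\<forall>x\<in>{0..pi}. cmod (g x) \<le> a" by (auto simp: bounded_iff)
    then show ?thesis by (intro that[of a]) auto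
  qed
  have F0: "0 \<le> F" using order_trans[OF norm_ge_zero F[of 0]] by simp
  have bnd: "cmod (W k x) \<le> (LL ^ k * F) * x ^ (4 * k) / fact (4 * k)" if "x \<in> {0..pi}" for k x
    using that
  proof (induction k arbitrary: x)
    case 0 then show ?case using F by (simp add: W0)
  next
    case (Suc k)
    have "cmod (JJ (W k) x) \<le> (LL * (LL ^ k * F)) * x ^ (4 * k + 4) / fact (4 * k + 4)"
      by (rule JJ_bound[OF WV Suc.IH Suc.prems])
    then show ?case by (simp only: WS mult_Suc_right power_Suc add.commute[of 4] mult.assoc)
  qed
  \<comment> \<open>Replacing \<open>fact (4 * k)\<close> by the smaller \<open>fact k\<close> turns
    the majorant into an exponential series.\<close>
  have bnd2: "cmod (W k x) \<le> F * ((LL * pi ^ 4) ^ k / fact k)" if x: "x \<in> {0..pi}" for k x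
  proof -
    have "(LL ^ k * F) * x ^ (4 * k) / fact (4 * k) \<le> (LL ^ k * F) * pi ^ (4 * k) / fact k"
      using x LL_pos F0 by (intro frac_le mult_left_mono power_mono fact_mono) auto
    also have "\<dots> = F * ((LL * pi ^ 4) ^ k / fact k)" by (simp add: power_mult power_mult_distrib)
    finally show ?thesis using bnd[OF x, of k] by linarith
  qed
  define w where "w x = (\<Sum>k. W k x)" for x
  have ul: "uniform_limit {0..pi} (\<lambda>n x. \<Sum>i<n. W i x) w sequentially"
    unfolding w_def
  proof (rule Weierstrass_m_test)
    show "summable (\<lambda>k. F * ((LL * pi ^ 4) ^ k / fact k))"
      using summable_exp_generic[of "LL * pi ^ 4"] by (intro summable_mult) (simp add: field_simps)
  qed (use bnd2 in auto)
  have SV: "(\<lambda>x. \<Sum>i<n. W i x) \<in> VC" for n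
    using IR.sum_mem[of "{..<n}" W "\<lambda>_. 1"] WV by simp
  have wV: "w \<in> VC" unfolding VC_def
    using uniform_limit_theorem[OF _ ul] SV by (auto simp: VC_def)
  have JS: "JJ (\<lambda>x. \<Sum>i<n. W i x) x = (\<Sum>i<n. W (Suc i) x)" if "x \<in> {0..pi}" for n x
  proof (induction n)
    case 0 show ?case using JJ_lin[OF IR.zero_mem IR.zero_mem that, of 0 0] by simp
  next
    case (Suc n)
    have "JJ (\<lambda>x. \<Sum>i<Suc n. W i x) x = JJ (\<lambda>x. 1 * (\<Sum>i<n. W i x) + 1 * W n x) x" by simp
    also have "\<dots> = JJ (\<lambda>x. \<Sum>i<n. W i x) x + JJ (W n) x" using JJ_lin[OF SV WV that, of 1 n 1 n] by simp
    finally show ?case using Suc by (simp add: WS)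
  qed
  have "w x = g x + JJ w x" if x: "x \<in> {0..pi}" for x
  proof -
    have l1: "(\<lambda>n. \<Sum>i<Suc n. W i x) \<longlonglongrightarrow> w x"
      using tendsto_uniform_limitI[OF ul x] by (rule LIMSEQ_Suc)
    have e1: "(\<Sum>i<Suc n. W i x) = g x + JJ (\<lambda>x. \<Sum>i<n. W i x) x" for n
      unfolding JS[OF x] by (subst sum.lessThan_Suc_shift) (simp add: W0)
    \<comment> \<open>\<open>JJ_bound\<close> with \<open>j = 0\<close> expresses the continuity of
      \<open>JJ\<close> under uniform convergence.\<close>
    have l2: "(\<lambda>n. JJ (\<lambda>x. \<Sum>i<n. W i x) x) \<longlonglongrightarrow> JJ w x"
    proof (rule LIMSEQ_I)
      fix r :: real assume r: "0 < r"
      define C where "C = LL * pi ^ 4 / fact 4"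
      have C0: "0 < C" unfolding C_def using LL_pos by simp
      define e where "e = r / (2 * C)"
      have e: "0 < e" using r C0 by (simp add: e_def)
      have ev: "\<forall>\<^sub>F n in sequentially. \<forall>x\<in>{0..pi}. dist (\<Sum>i<n. W i x) (w x) < e"
        using ul e unfolding uniform_limit_iff by blast
      then obtain N where "\<forall>n\<ge>N. \<forall>x\<in>{0..pi}. dist (\<Sum>i<n. W i x) (w x) < e"
        unfolding eventually_sequentially by blast
      then have N: "\<And>n y. n \<ge> N \<Longrightarrow> y \<in> {0..pi} \<Longrightarrow> dist (\<Sum>i<n. W i y) (w y) < e" by blast
      have "norm (JJ (\<lambda>x. \<Sum>i<n. W i x) x - JJ w x) < r" if n: "n \<ge> N" for n
      proof -
        have "JJ (\<lambda>x. \<Sum>i<n. W i x) x - JJ w x = JJ (\<lambda>x. 1 * (\<Sum>i<n. W i x) + (-1) * w x) x"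
          using JJ_lin[OF SV wV x, of 1 n "-1"] by simp
        also have "cmod \<dots> \<le> (LL * e) * x ^ (0 + 4) / fact (0 + 4)"
        proof (rule JJ_bound[OF _ _ x])
          show "(\<lambda>x. 1 * (\<Sum>i<n. W i x) + (-1) * w x) \<in> VC" by (intro IR.lin_mem SV wV)
          show "cmod (1 * (\<Sum>i<n. W i s) + (-1) * w s) \<le> e * s ^ 0 / fact 0" if "s \<in> {0..pi}" for s
            using N[OF n that] by (simp add: dist_norm)
        qed
        also have "\<dots> = (LL * e) * x ^ 4 / fact 4" by simp
        also have "\<dots> \<le> (LL * e) * pi ^ 4 / fact 4"
          using x LL_pos e by (intro divide_right_mono mult_left_mono power_mono) (auto simp: power_mono)
        also have "\<dots> = C * e" by (simp add: C_def)
        also have "\<dots> < r" using r C0 by (simp add: e_def)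
        finally show ?thesis .
      qed
      then show "\<exists>no. \<forall>n\<ge>no. norm (JJ (\<lambda>x. \<Sum>i<n. W i x) x - JJ w x) < r" by blast
    qed
    have "(\<lambda>n. \<Sum>i<Suc n. W i x) \<longlonglongrightarrow> g x + JJ w x"
      unfolding e1 by (intro tendsto_intros l2)
    then show ?thesis using LIMSEQ_unique[OF l1] by simp
  qed
  then show thesis using that wV by blast
qed

text \<open>The prescribed data satisfy both conditions at \<open>0\<close> for every
  \<open>b\<close> and \<open>d\<close>; these two numbers remain free for shooting at
  \<open>pi\<close>. The unknown of the Volterra equation is the top quantity \<open>w\<close>, from
  which all others are obtained by integration.\<close>

lemma ivp:
  assumes f: "f \<in> VC"
  obtains \<phi> \<phi>1 m m1 w where "chain \<phi> \<phi>1 m m1 w" "\<phi> 0 = 0" "\<phi>1 0 = b" "m 0 = - of_real c0 * b" "m1 0 = d"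
    "\<And>x. x \<in> {0..pi} \<Longrightarrow> w x = of_real (\<rho> x) * (f x - of_real kap * \<phi> x)"
proof -
  define m0 :: "real \<Rightarrow> complex" where "m0 q = - of_real c0 * b + d * of_real q" for q
  have m0V: "m0 \<in> VC" unfolding m0_def VC_def by (auto intro!: continuous_intros)
  define \<phi>0 where "\<phi>0 s = b + prim (\<lambda>r. m0 r / of_real (\<eta> r)) s" for s
  have p0V: "\<phi>0 \<in> VC" using prim_VC[OF div_eta_VC[OF m0V]] unfolding \<phi>0_def VC_def by (auto intro!: continuous_intros)
  define base where "base = prim \<phi>0"
  have baseV: "base \<in> VC" unfolding base_def by (rule prim_VC[OF p0V])
  define g where "g x = of_real (\<rho> x) * (1 * f x + (- of_real kap) * base x)" for x
  have gV: "g \<in> VC" unfolding g_def by (intro rho_VC IR.lin_mem f baseV)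
  obtain w where w: "w \<in> VC" "\<And>x. x \<in> {0..pi} \<Longrightarrow> w x = g x + JJ w x" using volterra[OF gV] by blast
  define m1 where "m1 x = d + prim w x" for x
  define m where "m x = m0 x + prim (prim w) x" for x
  define \<phi>1 where "\<phi>1 x = \<phi>0 x + prim (\<lambda>r. prim (prim w) r / of_real (\<eta> r)) x" for x
  define \<phi> where "\<phi> x = base x + PP w x" for x
  have dp: "((\<lambda>x. c + prim h x) has_vector_derivative h x) (at x within {0..pi})"
    if "h \<in> VC" "x \<in> {0..pi}" for h c x
    using has_vector_derivative_add[OF has_vector_derivative_const prim_deriv[OF that], of c] by simp
  have dm0: "(m0 has_vector_derivative d) (at x within {0..pi})" for x
    unfolding m0_def by (auto intro!: derivative_eq_intros)
  have ch: "chain \<phi> \<phi>1 m m1 w" unfolding chain_def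
  proof (intro conjI ballI w(1))
    fix x assume x: "x \<in> {0..pi}"
    show "(\<phi> has_vector_derivative \<phi>1 x) (at x within {0..pi})"
      unfolding \<phi>_def \<phi>1_def base_def PP_def
      by (intro has_vector_derivative_add prim_deriv p0V prim_VC div_eta_VC w x)
    have "(\<phi>1 has_vector_derivative (m0 x / of_real (\<eta> x) + prim (prim w) x / of_real (\<eta> x))) (at x within {0..pi})"
      unfolding \<phi>1_def \<phi>0_def
      by (intro has_vector_derivative_add dp prim_deriv prim_VC div_eta_VC w x m0V)
    then show "(\<phi>1 has_vector_derivative m x / of_real (\<eta> x)) (at x within {0..pi})"
      by (simp add: m_def add_divide_distrib)
    show "(m has_vector_derivative m1 x) (at x within {0..pi})"
      unfolding m_def m1_def by (intro has_vector_derivative_add dm0 prim_deriv prim_VC w x)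
  next
    show "m1 \<in> VC" using prim_VC[OF w(1)] unfolding m1_def VC_def by (auto intro!: continuous_intros)
    fix x assume x: "x \<in> {0<..<pi}"
    show "(m1 has_vector_derivative w x) (at x)"
      unfolding m1_def by (rule within_interior[OF x dp]) (use x w in auto)
  qed
  have wf: "w x = of_real (\<rho> x) * (f x - of_real kap * \<phi> x)" if "x \<in> {0..pi}" for x
    using w(2)[OF that] by (simp add: g_def JJ_def \<phi>_def algebra_simps)
  show thesis
    by (rule that[OF ch _ _ _ _ wf]) (auto simp: \<phi>_def \<phi>1_def \<phi>0_def base_def PP_def m_def m0_def m1_def)
qed

lemma vder_zero:
  assumes "\<And>y. y \<in> {0..pi} \<Longrightarrow> f y = (0::complex)" "(f has_vector_derivative d) (at x within {0..pi})" "x \<in> {0..pi}"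
  shows "d = 0"
proof -
  have "((\<lambda>_. 0) has_vector_derivative d) (at x within {0..pi})"
    by (rule has_vector_derivative_transform[OF assms(3) _ assms(2)]) (use assms(1) in auto)
  then show ?thesis
    using vector_derivative_unique_within_closed_interval[of 0 pi x "\<lambda>_. 0::complex" d 0] assms(3) by auto
qed

lemma chain_zero:
  assumes ch: "chain \<phi> \<phi>1 m m1 w" and z: "\<And>y. y \<in> {0..pi} \<Longrightarrow> \<phi> y = 0" and x: "x \<in> {0..pi}"
  shows "\<phi>1 x = 0" "m x = 0" "m1 x = 0" "w x = 0"
proof -
  note a = chainD[OF ch]
  have 1: "\<phi>1 y = 0" if "y \<in> {0..pi}" for y by (rule vder_zero[OF z a(7)]) (use that in auto)
  have 2: "m y = 0" if "y \<in> {0..pi}" for y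
  proof -
    have "m y / of_real (\<eta> y) = 0" by (rule vder_zero[OF 1 a(8)]) (use that in auto)
    then show ?thesis using eta_pos[OF that] by auto
  qed
  have 3: "m1 y = 0" if "y \<in> {0..pi}" for y by (rule vder_zero[OF 2 a(9)]) (use that in auto)
  have 4: "w y = 0" if "y \<in> {0<..<pi}" for y
    by (rule vder_zero[OF 3 has_vector_derivative_at_within[OF a(10)]]) (use that in auto)
  have "continuous_on (closure {0<..<pi}) w" using a(5) by (simp add: VC_def)
  then show "w x = 0" using 4 continuous_constant_on_closure[of "{0<..<pi}" w 0 x] x by auto
  show "\<phi>1 x = 0" "m x = 0" "m1 x = 0" using 1 2 3 x by auto
qed

definition res :: "(real \<Rightarrow> complex) \<Rightarrow> (real \<Rightarrow> complex) \<Rightarrow> bool" where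
  "res f \<phi> \<longleftrightarrow> (\<exists>\<phi>1 m m1 w. bvp \<phi> \<phi>1 m m1 w \<and>
     (\<forall>x\<in>{0..pi}. w x = of_real (\<rho> x) * (f x - of_real kap * \<phi> x)))"

text \<open>Shooting: a particular solution plus the two homogeneous ones with data
  \<open>(1, 0)\<close> and \<open>(0, 1)\<close>. The two conditions at \<open>pi\<close> form a
  linear system. A kernel vector would give a solution for \<open>f = 0\<close>, which
  \<open>resolvent_bound\<close> forces to vanish, so the determinant is nonzero.\<close>

lemma res_exists:
  assumes f: "f \<in> VC"
  shows "\<exists>\<phi>. res f \<phi>"
proof -
  obtain y0 y01 n0 n01 w0 where y0: "chain y0 y01 n0 n01 w0" "y0 0 = 0" "y01 0 = 0" "n0 0 = - of_real c0 * 0" "n01 0 = 0"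
    and w0: "\<And>x. x \<in> {0..pi} \<Longrightarrow> w0 x = of_real (\<rho> x) * (f x - of_real kap * y0 x)"
    using ivp[OF f, of 0 0] by metis
  obtain y1 y11 n1 n11 w1 where y1: "chain y1 y11 n1 n11 w1" "y1 0 = 0" "y11 0 = 1" "n1 0 = - of_real c0 * 1" "n11 0 = 0"
    and w1: "\<And>x. x \<in> {0..pi} \<Longrightarrow> w1 x = of_real (\<rho> x) * (0 - of_real kap * y1 x)"
    using ivp[OF IR.zero_mem, of 1 0] by metis
  obtain y2 y21 n2 n21 w2 where y2: "chain y2 y21 n2 n21 w2" "y2 0 = 0" "y21 0 = 0" "n2 0 = - of_real c0 * 0" "n21 0 = 1"
    and w2: "\<And>x. x \<in> {0..pi} \<Longrightarrow> w2 x = of_real (\<rho> x) * (0 - of_real kap * y2 x)"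
    using ivp[OF IR.zero_mem, of 0 1] by metis
  define R1 where "R1 = y1 pi" define R2 where "R2 = y2 pi"
  define S1 where "S1 = n1 pi + of_real cp * y11 pi" define S2 where "S2 = n2 pi + of_real cp * y21 pi"
  have triv: "s = 0 \<and> t = 0" if st: "s * R1 + t * R2 = 0" "s * S1 + t * S2 = 0" for s t
  proof -
    note ch = chain_lin[OF y1(1) y2(1), of s t]
    let ?y = "\<lambda>x. s * y1 x + t * y2 x"
    have b: "bvp ?y (\<lambda>x. s * y11 x + t * y21 x) (\<lambda>x. s * n1 x + t * n2 x) (\<lambda>x. s * n11 x + t * n21 x)
       (\<lambda>x. s * w1 x + t * w2 x)"
    proof -
      have "s * n1 pi + t * n2 pi = - of_real cp * (s * y11 pi + t * y21 pi)"
        using st(2) unfolding S1_def S2_def mult_minus_left eq_neg_iff_add_eq_0 by (simp add: algebra_simps)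
      then show ?thesis unfolding bvp_def using ch y1 y2 st(1) by (simp add: R1_def R2_def algebra_simps)
    qed
    have "nr ?y \<le> nr (\<lambda>_. 0)"
      by (rule resolvent_bound(2)[OF b _ IR.zero_mem]) (simp add: w1 w2 algebra_simps)
    also have "\<dots> = 0" by (simp add: IR.ip_zero IR.zero_mem)
    finally have "nr ?y = 0" using nr_nonneg[OF chainD(1)[OF ch]] by simp
    then have z: "?y x = 0" if "x \<in> {0..pi}" for x using nr_zero[OF chainD(1)[OF ch]] that by blast
    show ?thesis using chain_zero(1,3)[OF ch z, of 0] y1 y2 by simp
  qed
  define \<Delta> where "\<Delta> = R1 * S2 - R2 * S1"
  \<comment> \<open>A vanishing determinant makes \<open>(R2, - R1)\<close> and
    \<open>(S2, - S1)\<close> kernel vectors. Both are then zero, so the whole matrix is zero and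
    \<open>(1, 0)\<close> is a nonzero kernel vector.\<close>
  have "\<Delta> \<noteq> 0"
  proof
    assume D: "\<Delta> = 0"
    have "R2 = 0 \<and> - R1 = 0" by (rule triv) (use D in \<open>auto simp: \<Delta>_def algebra_simps\<close>)
    moreover have "S2 = 0 \<and> - S1 = 0" by (rule triv) (use D in \<open>auto simp: \<Delta>_def algebra_simps\<close>)
    ultimately show False using triv[of 1 0] by simp
  qed
  define R0 where "R0 = y0 pi" define S0 where "S0 = n0 pi + of_real cp * y01 pi"
  \<comment> \<open>Cramer's rule for the two conditions at \<open>pi\<close>.\<close>
  define s where "s = (R2 * S0 - R0 * S2) / \<Delta>"
  define t where "t = (R0 * S1 - R1 * S0) / \<Delta>"
  have e1: "R0 + s * R1 + t * R2 = 0" and e2: "S0 + s * S1 + t * S2 = 0"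
    unfolding s_def t_def using \<open>\<Delta> \<noteq> 0\<close> by (auto simp: field_simps) (auto simp: \<Delta>_def algebra_simps)
  note ch = chain_lin[OF y0(1) chain_lin[OF y1(1) y2(1), of s t], of 1 1]
  have b: "bvp (\<lambda>x. 1 * y0 x + 1 * (s * y1 x + t * y2 x)) (\<lambda>x. 1 * y01 x + 1 * (s * y11 x + t * y21 x))
    (\<lambda>x. 1 * n0 x + 1 * (s * n1 x + t * n2 x)) (\<lambda>x. 1 * n01 x + 1 * (s * n11 x + t * n21 x))
       (\<lambda>x. 1 * w0 x + 1 * (s * w1 x + t * w2 x))"
  proof -
    have "1 * n0 pi + 1 * (s * n1 pi + t * n2 pi) = - of_real cp * (1 * y01 pi + 1 * (s * y11 pi + t * y21 pi))"
      using e2 unfolding S0_def S1_def S2_def mult_minus_left eq_neg_iff_add_eq_0 by (simp add: algebra_simps)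
    then show ?thesis unfolding bvp_def using ch y0 y1 y2 e1 by (simp add: R1_def R2_def R0_def algebra_simps)
  qed
  then show ?thesis unfolding res_def
    by (intro exI conjI, assumption) (simp add: w0 w1 w2 algebra_simps)
qed

end

section \<open>Completeness of the eigenfunctions\<close>

context beam_ode
begin

lemma has_vd_cong:
  assumes "\<And>y. y \<in> {0..pi} \<Longrightarrow> f y = g y" "x \<in> {0..pi}" "(f has_vector_derivative d) (at x within {0..pi})"
  shows "(g has_vector_derivative d) (at x within {0..pi})"
  by (rule has_vector_derivative_transform[OF assms(2) _ assms(3)]) (use assms(1) in auto)

lemma VC_cong:
  assumes "f \<in> VC" "\<And>y. y \<in> {0..pi} \<Longrightarrow> f y = g y" shows "g \<in> VC"
  using continuous_on_eq[OF VC_D[OF assms(1)] assms(2)] by (simp add: VC_def)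

lemma bvp_cong:
  assumes b: "bvp \<phi> \<phi>1 m m1 w" and e: "\<And>y. y \<in> {0..pi} \<Longrightarrow> \<phi> y = \<psi> y"
    and v: "\<And>y. y \<in> {0..pi} \<Longrightarrow> w y = v y"
  shows "bvp \<psi> \<phi>1 m m1 v"
proof -
  have ch: "chain \<phi> \<phi>1 m m1 w" using b by (simp add: bvp_def)
  note a = chainD[OF ch]
  have "chain \<psi> \<phi>1 m m1 v"
    unfolding chain_def using a has_vd_cong[OF e] VC_cong[OF a(5) v] v by auto
  then show ?thesis using b e[of 0] e[of pi] by (auto simp: bvp_def)
qed

lemma res_VC: "res f \<phi> \<Longrightarrow> \<phi> \<in> VC"
  unfolding res_def bvp_def using chainD(1) by blast

lemma res_cong:
  assumes "res f \<phi>" "\<And>x. x \<in> {0..pi} \<Longrightarrow> f x = g x" "\<And>x. x \<in> {0..pi} \<Longrightarrow> \<phi> x = \<psi> x"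
  shows "res g \<psi>"
  using assms(1) unfolding res_def
proof (elim exE conjE)
  fix \<phi>1 m m1 w assume b: "bvp \<phi> \<phi>1 m m1 w" and w: "\<forall>x\<in>{0..pi}. w x = of_real (\<rho> x) * (f x - of_real kap * \<phi> x)"
  show "\<exists>\<phi>1 m m1 w. bvp \<psi> \<phi>1 m m1 w \<and> (\<forall>x\<in>{0..pi}. w x = of_real (\<rho> x) * (g x - of_real kap * \<psi> x))"
    by (intro exI conjI, rule bvp_cong[OF b assms(3) refl]) (use w assms in auto)
qed

lemma res_lin:
  assumes "res f \<phi>" "res g \<psi>"
  shows "res (\<lambda>x. c * f x + d * g x) (\<lambda>x. c * \<phi> x + d * \<psi> x)"
proof -
  obtain \<phi>1 m m1 w where b: "bvp \<phi> \<phi>1 m m1 w" "\<forall>x\<in>{0..pi}. w x = of_real (\<rho> x) * (f x - of_real kap * \<phi> x)"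
    using assms(1) unfolding res_def by blast
  obtain \<psi>1 n n1 v where b': "bvp \<psi> \<psi>1 n n1 v" "\<forall>x\<in>{0..pi}. v x = of_real (\<rho> x) * (g x - of_real kap * \<psi> x)"
    using assms(2) unfolding res_def by blast
  show ?thesis unfolding res_def
    by (intro exI conjI, rule bvp_lin[OF b(1) b'(1), of c d]) (simp add: b(2)[rule_format] b'(2)[rule_format] algebra_simps)
qed

lemma res_bounds:
  assumes "res f \<phi>" "f \<in> VC"
  shows "nr \<phi> \<le> nr f" "(nr \<phi>)\<^sup>2 \<le> Re (ipw \<rho> f \<phi>)"
proof -
  obtain \<phi>1 m m1 w where b: "bvp \<phi> \<phi>1 m m1 w" "\<And>x. x\<in>{0..pi} \<Longrightarrow> w x = of_real (\<rho> x) * (f x - of_real kap * \<phi> x)"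
    using assms(1) unfolding res_def by blast
  show "nr \<phi> \<le> nr f" by (rule resolvent_bound(2)[OF b assms(2)])
  have "0 \<le> elo / 2 * (n2 (\<lambda>x. m x / of_real (\<eta> x)))\<^sup>2" using elo(1) by simp
  then show "(nr \<phi>)\<^sup>2 \<le> Re (ipw \<rho> f \<phi>)" using resolvent_bound(1)[OF b assms(2)] by linarith
qed

lemma nr_zero_fun: "nr (\<lambda>_. 0) = 0" by (simp add: IR.ip_zero IR.zero_mem)

lemma res_unique:
  assumes "res f \<phi>" "res f \<psi>" "f \<in> VC" "x \<in> {0..pi}"
  shows "\<phi> x = \<psi> x"
proof -
  have r: "res (\<lambda>_. 0) (\<lambda>x. 1 * \<phi> x + (-1) * \<psi> x)"
    by (rule res_cong[OF res_lin[OF assms(1,2), of 1 "-1"]]) auto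
  have "nr (\<lambda>x. 1 * \<phi> x + (-1) * \<psi> x) = 0"
    using res_bounds(1)[OF r IR.zero_mem] nr_nonneg[OF res_VC[OF r]] nr_zero_fun by simp
  from nr_zero[OF res_VC[OF r] this assms(4)] show ?thesis by simp
qed

lemma res_zero_imp:
  assumes "res f \<phi>" "\<And>x. x \<in> {0..pi} \<Longrightarrow> \<phi> x = 0" "x \<in> {0..pi}"
  shows "f x = 0"
proof -
  obtain \<phi>1 m m1 w where b: "bvp \<phi> \<phi>1 m m1 w" "\<And>x. x\<in>{0..pi} \<Longrightarrow> w x = of_real (\<rho> x) * (f x - of_real kap * \<phi> x)"
    using assms(1) unfolding res_def by blast
  have "w x = 0" by (rule chain_zero(4)[OF _ assms(2,3)]) (use b in \<open>auto simp: bvp_def\<close>)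
  then show ?thesis using b(2)[OF assms(3)] rho_gt[OF assms(3)] assms(2)[OF assms(3)] by simp
qed

text \<open>Extension by zero makes the solution unique as a function on all reals, so that
  linearity in \<open>Kop_lin\<close> is an equation between functions.\<close>

definition Kop :: "(real \<Rightarrow> complex) \<Rightarrow> real \<Rightarrow> complex" where
  "Kop f x = (if x \<in> {0..pi} then (SOME \<phi>. res f \<phi>) x else 0)"

lemma Kop_res: "f \<in> VC \<Longrightarrow> res f (Kop f)"
  using res_exists[of f] someI_ex[of "res f"] res_cong[of f "SOME \<phi>. res f \<phi>" f "Kop f"]
  by (simp add: Kop_def)

lemma Kop_VC: "f \<in> VC \<Longrightarrow> Kop f \<in> VC" using Kop_res res_VC by blast

lemma Kop_eqI:
  assumes "f \<in> VC" "res f \<phi>" "\<And>x. x \<notin> {0..pi} \<Longrightarrow> \<phi> x = 0"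
  shows "Kop f = \<phi>"
proof
  fix x show "Kop f x = \<phi> x"
    using res_unique[OF Kop_res[OF assms(1)] assms(2) assms(1), of x] assms(3)[of x]
    by (cases "x \<in> {0..pi}") (auto simp: Kop_def)
qed

lemma Kop_lin:
  assumes "f \<in> VC" "g \<in> VC"
  shows "Kop (\<lambda>x. c * f x + d * g x) = (\<lambda>x. c * Kop f x + d * Kop g x)"
  by (rule Kop_eqI[OF IR.lin_mem[OF assms] res_lin[OF Kop_res[OF assms(1)] Kop_res[OF assms(2)]]])
    (auto simp: Kop_def)

lemma res_symmetric:
  assumes "res f \<phi>" "res g \<psi>" "f \<in> VC" "g \<in> VC"
  shows "ipw \<rho> f \<psi> = ipw \<rho> \<phi> g"
proof -
  note V = res_VC[OF assms(1)] res_VC[OF assms(2)]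
  obtain \<phi>1 m m1 w where b: "bvp \<phi> \<phi>1 m m1 w" "\<And>x. x \<in> {0..pi} \<Longrightarrow> w x = of_real (\<rho> x) * (f x - of_real kap * \<phi> x)"
    using assms(1) unfolding res_def by blast
  obtain \<psi>1 n n1 v where b': "bvp \<psi> \<psi>1 n n1 v" "\<And>x. x \<in> {0..pi} \<Longrightarrow> v x = of_real (\<rho> x) * (g x - of_real kap * \<psi> x)"
    using assms(2) unfolding res_def by blast
  have "ipw (\<lambda>_. 1) w \<psi> = ipw \<rho> (\<lambda>x. f x - of_real kap * \<phi> x) \<psi>"
    unfolding ipw_rho[symmetric] by (unfold ipw_def, rule integral_cong) (simp add: b(2))
  also have "\<dots> = ipw \<rho> f \<psi> - of_real kap * ipw \<rho> \<phi> \<psi>"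
    using IR.ip_lin[OF assms(3) V(1) V(2), of 1 "- of_real kap"] by simp
  finally have 1: "ipw (\<lambda>_. 1) w \<psi> = ipw \<rho> f \<psi> - of_real kap * ipw \<rho> \<phi> \<psi>" .
  have "ipw (\<lambda>_. 1) \<phi> v = ipw \<rho> \<phi> (\<lambda>x. g x - of_real kap * \<psi> x)"
    unfolding ipw_def by (rule integral_cong) (simp add: b'(2))
  also have "\<dots> = ipw \<rho> \<phi> g - of_real kap * ipw \<rho> \<phi> \<psi>"
    using IR.ip_lin2[OF assms(4) V(2) V(1), of 1 "- of_real kap"] by simp
  finally show ?thesis using 1 bvp_symmetric[OF b(1) b'(1)] by simp
qed

text \<open>The quadratic form of the resolvent is itself a semi-inner product. Its Cauchy-Schwarz
  inequality relates the norm of \<open>Kop g\<close> to the largest Rayleigh quotient in the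
  completeness proof.\<close>

sublocale IK: cip_space VC "\<lambda>f g. ipw \<rho> (Kop f) g"
proof
  show "(\<lambda>_. 0) \<in> VC" by (rule IR.zero_mem)
  fix u v w c d assume u: "u \<in> VC"
  have "0 \<le> Re (ipw \<rho> u (Kop u))" using res_bounds(2)[OF Kop_res[OF u] u] zero_le_power2 order_trans by blast
  then show "0 \<le> Re (ipw \<rho> (Kop u) u)" using res_symmetric[OF Kop_res[OF u] Kop_res[OF u] u u] by simp
  assume v: "v \<in> VC"
  show "(\<lambda>z. c * u z + d * v z) \<in> VC" by (rule IR.lin_mem[OF u v])
  show "ipw \<rho> (Kop v) u = cnj (ipw \<rho> (Kop u) v)"
    using res_symmetric[OF Kop_res[OF v] Kop_res[OF u] v u] IR.ip_cnj[OF Kop_VC[OF u] v] by simp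
  assume w: "w \<in> VC"
  show "ipw \<rho> (Kop (\<lambda>z. c * u z + d * v z)) w = c * ipw \<rho> (Kop u) w + d * ipw \<rho> (Kop v) w"
    unfolding Kop_lin[OF u v] by (rule IR.ip_lin[OF Kop_VC[OF u] Kop_VC[OF v] w])
qed

text \<open>Zero outside the interval, as in the definition of \<open>beam_eigenspace\<close>.\<close>

definition eig :: "real \<Rightarrow> (real \<Rightarrow> complex) \<Rightarrow> bool" where
  "eig \<nu> \<phi> \<longleftrightarrow> (\<exists>\<phi>1 m m1. bvp \<phi> \<phi>1 m m1 (\<lambda>x. of_real (\<rho> x) * (of_real \<nu> * \<phi> x))) \<and>
     (\<forall>x. x \<notin> {0..pi} \<longrightarrow> \<phi> x = 0)"

lemma eig_VC: "eig \<nu> \<phi> \<Longrightarrow> \<phi> \<in> VC"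
  unfolding eig_def bvp_def using chainD(1) by blast

lemma eig_res:
  assumes "eig \<nu> \<phi>" shows "res (\<lambda>x. of_real (\<nu> + kap) * \<phi> x) \<phi>"
proof -
  obtain \<phi>1 m m1 where "bvp \<phi> \<phi>1 m m1 (\<lambda>x. of_real (\<rho> x) * (of_real \<nu> * \<phi> x))"
    using assms unfolding eig_def by blast
  then show ?thesis unfolding res_def by (intro exI conjI, assumption) (simp add: algebra_simps)
qed

lemma uniform_nr_tendsto:
  assumes f: "\<And>n. f n \<in> VC" "g \<in> VC"
    and u: "\<And>e. 0 < e \<Longrightarrow> \<exists>N. \<forall>n x. n \<ge> N \<and> x \<in> {0..pi} \<longrightarrow> norm (f n x - g x) < e"
  shows "(\<lambda>n. nr (\<lambda>x. f n x - g x)) \<longlonglongrightarrow> 0"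
proof (rule LIMSEQ_I)
  fix r :: real assume r: "0 < r"
  define e where "e = r / (2 * sqrt (rhi * pi))"
  have sp: "0 < sqrt (rhi * pi)" using rhi(1) by simp
  have e: "0 < e" unfolding e_def using r sp by simp
  obtain N where N: "\<forall>n x. n \<ge> N \<and> x \<in> {0..pi} \<longrightarrow> norm (f n x - g x) < e" using u[OF e] by blast
  have "norm (nr (\<lambda>x. f n x - g x) - 0) < r" if n: "n \<ge> N" for n
  proof -
    have m: "(\<lambda>x. f n x - g x) \<in> VC" by (rule IR.diff_mem[OF f])
    have "Re (ipw \<rho> (\<lambda>x. f n x - g x) (\<lambda>x. f n x - g x)) = integral {0..pi} (\<lambda>x. \<rho> x * (cmod (f n x - g x))\<^sup>2)"
      by (rule ipw_self[OF rho_cont m])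
    also have "\<dots> \<le> integral {0..pi} (\<lambda>x. rhi * e\<^sup>2)"
    proof (rule integral_le)
      show "(\<lambda>x. \<rho> x * (cmod (f n x - g x))\<^sup>2) integrable_on {0..pi}"
        using f rho_cont by (intro integrable_continuous_interval continuous_intros) (auto simp: VC_def)
      fix x assume x: "x \<in> {0..pi}"
      show "\<rho> x * (cmod (f n x - g x))\<^sup>2 \<le> rhi * e\<^sup>2"
        using rhi(1) rho_gt[OF x] rhi(2)[OF x] N n x by (intro mult_mono power_mono) (auto intro: less_imp_le)
    qed auto
    also have "\<dots> = (e * sqrt (rhi * pi))\<^sup>2" using rhi(1) by (simp add: power_mult_distrib)
    finally have "nr (\<lambda>x. f n x - g x) \<le> e * sqrt (rhi * pi)" using e sp by (intro real_le_lsqrt) auto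
    also have "\<dots> < r" using r sp by (simp add: e_def)
    finally show ?thesis using nr_nonneg[OF m] by simp
  qed
  then show "\<exists>no. \<forall>n\<ge>no. norm (nr (\<lambda>x. f n x - g x) - 0) < r" by blast
qed

text \<open>Data in the unit ball give bounded second derivatives by \<open>resolvent_bound\<close>,
  hence first derivatives bounded in the norm by \<open>interp1\<close> and in the supremum by
  Agmon. The images are uniformly Lipschitz and vanish at \<open>0\<close>; Arzela-Ascoli yields a
  continuous limit, which keeps the argument inside \<open>VC\<close>.\<close>

lemma res_compact:
  assumes f: "\<And>n::nat. f n \<in> VC" "\<And>n. nr (f n) \<le> 1"
  obtains g k where "g \<in> VC" "strict_mono (k :: nat \<Rightarrow> nat)"
    "(\<lambda>n. nr (\<lambda>x. Kop (f (k n)) x - g x)) \<longlonglongrightarrow> 0"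
proof -
  define D where "D = sqrt (2 / elo)"
  have D0: "0 \<le> D" unfolding D_def using elo(1) by simp
  define L where "L = sqrt (D + 2 * sqrt D * D)"
  have L0: "0 \<le> L" unfolding L_def using D0 by simp
  have lip: "cmod (Kop (f n) y - Kop (f n) x) \<le> L * \<bar>y - x\<bar>" if xy: "x \<in> {0..pi}" "y \<in> {0..pi}" for n x y
  proof -
    define \<phi> where "\<phi> = Kop (f n)"
    obtain \<phi>1 m m1 w where b: "bvp \<phi> \<phi>1 m m1 w" "\<And>x. x\<in>{0..pi} \<Longrightarrow> w x = of_real (\<rho> x) * (f n x - of_real kap * \<phi> x)"
      using Kop_res[OF f(1)[of n]] unfolding res_def \<phi>_def by blast
    have ch: "chain \<phi> \<phi>1 m m1 w" "\<phi> 0 = 0" "\<phi> pi = 0" using b by (auto simp: bvp_def)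
    note a = chainD[OF ch(1)]
    let ?D = "n2 (\<lambda>x. m x / of_real (\<eta> x))"
    have "elo / 2 * ?D\<^sup>2 \<le> 1"
      using resolvent_bound(3)[OF b f(1)] power_mono[OF f(2) nr_nonneg[OF f(1)], of n 2] by simp
    then have "?D\<^sup>2 \<le> 2 / elo" using elo(1) by (simp add: field_simps)
    then have D: "?D \<le> D" unfolding D_def by (rule real_le_rsqrt)
    have A: "n2 \<phi> \<le> 1"
      using n2_le_nr[OF a(1)] resolvent_bound(2)[OF b f(1)] f(2)[of n] by linarith
    have "(n2 \<phi>1)\<^sup>2 \<le> n2 \<phi> * ?D" by (rule interp1[OF ch])
    also have "\<dots> \<le> 1 * D" using A D n2_nonneg[OF a(1)] n2_nonneg[OF a(6)] by (intro mult_mono) auto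
    finally have B2: "(n2 \<phi>1)\<^sup>2 \<le> D" by simp
    then have B: "n2 \<phi>1 \<le> sqrt D" by (rule real_le_rsqrt)
    have bd: "cmod (\<phi>1 t) \<le> L" if "t \<in> {0..pi}" for t
      unfolding L_def
    proof (rule real_le_rsqrt)
      have "(cmod (\<phi>1 t))\<^sup>2 \<le> (n2 \<phi>1)\<^sup>2 + 2 * n2 \<phi>1 * ?D" by (rule agmon[OF a(2) a(6) a(8) that])
      also have "\<dots> \<le> D + 2 * sqrt D * D"
        using B B2 D D0 n2_nonneg[OF a(2)] n2_nonneg[OF a(6)] by (intro add_mono mult_mono) auto
      finally show "(cmod (\<phi>1 t))\<^sup>2 \<le> D + 2 * sqrt D * D" .
    qed
    have *: "cmod (\<phi> t - \<phi> s) \<le> L * (t - s)" if "0 \<le> s" "s \<le> t" "t \<le> pi" for s t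
    proof -
      have "(\<phi>1 has_integral (\<phi> t - \<phi> s)) {s..t}"
        by (rule fundamental_theorem_of_calculus[OF that(2)], rule has_vector_derivative_within_subset[OF a(7)])
          (use that in auto)
      from has_integral_bound_real[OF L0 finite.emptyI this] show ?thesis using bd that by auto
    qed
    show ?thesis
      unfolding \<phi>_def[symmetric] using *[of x y] *[of y x] xy
      by (cases "x \<le> y") (auto simp: norm_minus_commute)
  qed
  have K0: "Kop (f n) 0 = 0" for n using Kop_res[OF f(1)[of n]] unfolding res_def bvp_def by auto
  obtain g k where g: "continuous_on {0..pi} g" "strict_mono (k :: nat \<Rightarrow> nat)"
    "\<And>e. 0 < e \<Longrightarrow> \<exists>N. \<forall>n x. n \<ge> N \<and> x \<in> {0..pi} \<longrightarrow> norm (Kop (f (k n)) x - g x) < e"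
  proof (rule Arzela_Ascoli[of "{0..pi}" "\<lambda>n. Kop (f n)" "L * pi"])
    show "norm (Kop (f n) x) \<le> L * pi" if "x \<in> {0..pi}" for n x
    proof -
      have "norm (Kop (f n) x) \<le> L * \<bar>x - 0\<bar>" using lip[of 0 x n] that K0 by simp
      also have "\<dots> \<le> L * pi" using that L0 by (intro mult_left_mono) auto
      finally show ?thesis .
    qed
    show "\<exists>d. 0 < d \<and> (\<forall>n y. y \<in> {0..pi} \<and> norm (x - y) < d \<longrightarrow> norm (Kop (f n) x - Kop (f n) y) < e)"
      if "x \<in> {0..pi}" "0 < e" for x e
    proof (intro exI[of _ "e / (L + 1)"] conjI allI impI)
      show "0 < e / (L + 1)" using that L0 by simp
      fix n y assume y: "y \<in> {0..pi} \<and> norm (x - y) < e / (L + 1)"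
      have "norm (Kop (f n) x - Kop (f n) y) \<le> L * \<bar>x - y\<bar>" using lip[of y x n] that y by simp
      also have "\<dots> \<le> (L + 1) * \<bar>x - y\<bar>" by (intro mult_right_mono) auto
      also have "\<dots> < e" using y L0 by (simp add: pos_less_divide_eq mult.commute)
      finally show "norm (Kop (f n) x - Kop (f n) y) < e" .
    qed
  qed auto
  show thesis
    by (rule that[of g k]) (use g uniform_nr_tendsto[of "\<lambda>n. Kop (f (k n))" g] Kop_VC f in \<open>auto simp: VC_def\<close>)
qed

lemma ip_tendsto:
  assumes f: "\<And>n. f n \<in> VC" "g \<in> VC" "h \<in> VC" and l: "(\<lambda>n. nr (\<lambda>x. f n x - g x)) \<longlonglongrightarrow> 0"
  shows "(\<lambda>n. ipw \<rho> (f n) h) \<longlonglongrightarrow> ipw \<rho> g h"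
proof -
  have "(\<lambda>n. ipw \<rho> (f n) h - ipw \<rho> g h) \<longlonglongrightarrow> 0"
  proof (rule Lim_null_comparison)
    show "\<forall>\<^sub>F n in sequentially. norm (ipw \<rho> (f n) h - ipw \<rho> g h) \<le> nr (\<lambda>x. f n x - g x) * nr h"
      using IR.cauchy_schwarz_sqrt[OF IR.diff_mem[OF f(1,2)] f(3)] IR.ip_diff[OF f(1,2,3)] by auto
    show "(\<lambda>n. nr (\<lambda>x. f n x - g x) * nr h) \<longlonglongrightarrow> 0" using tendsto_mult_left_zero[OF l] by simp
  qed
  then show ?thesis by (rule LIM_zero_cancel)
qed

definition WW :: "(real \<Rightarrow> complex) set" where
  "WW = {f \<in> VC. \<forall>\<nu> \<psi>. eig \<nu> \<psi> \<longrightarrow> ipw \<rho> f \<psi> = 0}"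

lemma WW_Kop:
  assumes "f \<in> WW" shows "Kop f \<in> WW"
proof -
  have f: "f \<in> VC" using assms by (simp add: WW_def)
  have "ipw \<rho> (Kop f) \<psi> = 0" if e: "eig \<nu> \<psi>" for \<nu> \<psi>
  proof -
    note \<psi> = eig_VC[OF e]
    have "ipw \<rho> (Kop f) (\<lambda>x. of_real (\<nu> + kap) * \<psi> x) = ipw \<rho> f \<psi>"
      using res_symmetric[OF Kop_res[OF f] eig_res[OF e] f IR.scale_mem[OF \<psi>]] by simp
    also have "\<dots> = 0" using assms e by (simp add: WW_def)
    finally have "of_real (\<nu> + kap) * ipw \<rho> (Kop f) \<psi> = 0"
      using IR.ip_scale2[OF \<psi> Kop_VC[OF f], of "of_real (\<nu> + kap)"] by simp
    then have "ipw \<rho> (Kop f) \<psi> = 0 \<or> \<nu> + kap = 0" by (simp only: mult_eq_0_iff of_real_eq_0_iff disj_commute)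
    then consider "ipw \<rho> (Kop f) \<psi> = 0" | "\<nu> + kap = 0" by blast
    then show ?thesis
    proof cases
      \<comment> \<open>The value \<open>- kap\<close> has no eigenfunction of positive norm: the
        resolvent would send \<open>0\<close> to \<open>\<psi>\<close>.\<close>
      case 2
      have "res (\<lambda>_. 0) \<psi>" using eig_res[OF e] 2 by simp
      then have "nr \<psi> = 0" using res_bounds(1)[OF _ IR.zero_mem] nr_nonneg[OF \<psi>] nr_zero_fun by force
      then show ?thesis using IR.cauchy_schwarz_sqrt[OF Kop_VC[OF f] \<psi>] by simp
    qed
  qed
  then show ?thesis using Kop_VC[OF f] by (simp add: WW_def)
qed

lemma WW_scale: "f \<in> WW \<Longrightarrow> (\<lambda>x. c * f x) \<in> WW"
  by (auto simp: WW_def IR.scale_mem IR.ip_scale eig_VC)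

text \<open>Hilbert's variational argument on the invariant subspace \<open>WW\<close>. If the
  supremum \<open>k\<close> of the Rayleigh quotients of \<open>Kop\<close> were positive, the
  images of a maximising sequence would subconverge to a solution of \<open>Kop g = k g\<close>.
  Being a limit of functions orthogonal to all eigenfunctions, \<open>g\<close> would have norm
  zero, contradicting \<open>k > 0\<close>. Hence \<open>Kop\<close> vanishes on \<open>WW\<close>,
  and it is injective.\<close>

lemma eigenfunctions_total_continuous:
  assumes fW: "f \<in> WW" and x: "x \<in> {0..pi}"
  shows "f x = 0"
proof -
  define S where "S = {Re (ipw \<rho> (Kop g) g) | g. g \<in> WW \<and> nr g \<le> 1}"
  have WV: "g \<in> VC" if "g \<in> WW" for g using that by (simp add: WW_def)
  have Kle: "Re (ipw \<rho> (Kop g) g) \<le> nr (Kop g) * nr g" if "g \<in> VC" for g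
    using complex_Re_le_cmod IR.cauchy_schwarz_sqrt[OF Kop_VC[OF that] that] order_trans by blast
  have Kn: "nr (Kop g) \<le> nr g" if "g \<in> VC" for g by (rule res_bounds(1)[OF Kop_res[OF that] that])
  have S1: "s \<le> 1" if "s \<in> S" for s
  proof -
    obtain g where g: "s = Re (ipw \<rho> (Kop g) g)" "g \<in> WW" "nr g \<le> 1" using \<open>s \<in> S\<close> unfolding S_def by blast
    have "s \<le> nr (Kop g) * nr g" using Kle[OF WV[OF g(2)]] g(1) by simp
    also have "\<dots> \<le> 1 * 1"
      using Kn[OF WV[OF g(2)]] g(3) nr_nonneg[OF WV[OF g(2)]] by (intro mult_mono) auto
    finally show ?thesis by simp
  qed
  have bdd: "bdd_above S" using S1 by (rule bdd_aboveI)
  have W0: "(\<lambda>_. 0) \<in> WW" by (auto simp: WW_def IR.zero_mem IR.ip_zero eig_VC)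
  have Sne: "S \<noteq> {}" unfolding S_def using W0 nr_zero_fun by force
  define k where "k = Sup S"
  have kle: "Re (ipw \<rho> (Kop g) g) \<le> k * (nr g)\<^sup>2" if g: "g \<in> WW" for g
  proof (cases "nr g = 0")
    case True
    then show ?thesis using Kle[OF WV[OF g]] by simp
  next
    case False
    then have p: "0 < nr g" using nr_nonneg[OF WV[OF g]] by simp
    let ?c = "complex_of_real (1 / nr g)"
    have V: "(\<lambda>x. ?c * g x) \<in> VC" by (rule IR.scale_mem[OF WV[OF g]])
    have "Re (ipw \<rho> (\<lambda>x. ?c * g x) (\<lambda>x. ?c * g x)) = (1 / nr g)\<^sup>2 * (nr g)\<^sup>2"
      unfolding IR.nsq_scale[OF WV[OF g]] nr_sq[OF WV[OF g]] using p by (simp add: norm_divide)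
    also have "\<dots> = 1" using p by (simp add: power_divide)
    finally have n1: "nr (\<lambda>x. ?c * g x) = 1" by simp
    then have "Re (ipw \<rho> (Kop (\<lambda>x. ?c * g x)) (\<lambda>x. ?c * g x)) \<in> S"
      unfolding S_def
      by (intro CollectI exI[of _ "\<lambda>x. ?c * g x"] conjI refl WW_scale[OF g] eq_refl[OF n1])
    then have "Re (ipw \<rho> (Kop (\<lambda>x. ?c * g x)) (\<lambda>x. ?c * g x)) \<le> k" unfolding k_def by (rule cSup_upper[OF _ bdd])
    then have "(1 / nr g)\<^sup>2 * Re (ipw \<rho> (Kop g) g) \<le> k"
      unfolding IK.nsq_scale[OF WV[OF g]] using p by (simp add: norm_divide)
    then show ?thesis using p by (simp add: power_divide field_simps)
  qed
  have k0: "0 \<le> k"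
  proof -
    have "0 \<in> S" unfolding S_def using W0 nr_zero_fun IK.ip_zero[OF IR.zero_mem] by force
    then show ?thesis unfolding k_def by (rule cSup_upper[OF _ bdd])
  qed
  \<comment> \<open>Cauchy-Schwarz for the form of \<open>Kop\<close>, applied to \<open>g\<close>
    and \<open>Kop g\<close>; \<open>kle\<close> bounds the factor that belongs to
    \<open>Kop g\<close>.\<close>
  have Ksq: "(nr (Kop g))\<^sup>2 \<le> k * Re (ipw \<rho> (Kop g) g)" if g: "g \<in> WW" for g
  proof -
    let ?q = "Re (ipw \<rho> (Kop g) g)" and ?h = "Kop g"
    have h: "?h \<in> WW" by (rule WW_Kop[OF g])
    have q0: "0 \<le> ?q" by (rule IK.ip_pos[OF WV[OF g]])
    have "((nr ?h)\<^sup>2)\<^sup>2 \<le> (cmod (ipw \<rho> (Kop g) ?h))\<^sup>2"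
      unfolding nr_sq[OF WV[OF h]] using IR.ip_pos[OF WV[OF h]] by (intro power_mono complex_Re_le_cmod) auto
    also have "\<dots> \<le> ?q * Re (ipw \<rho> (Kop ?h) ?h)" by (rule IK.cauchy_schwarz[OF WV[OF g] WV[OF h]])
    also have "\<dots> \<le> ?q * (k * (nr ?h)\<^sup>2)" by (intro mult_left_mono kle h q0)
    finally have *: "(nr ?h)\<^sup>2 * (nr ?h)\<^sup>2 \<le> (k * ?q) * (nr ?h)\<^sup>2" by (simp add: power2_eq_square mult_ac)
    show ?thesis
    proof (cases "nr ?h = 0")
      case True then show ?thesis using k0 q0 by simp
    next
      case False
      then have "0 < (nr ?h)\<^sup>2" by simp
      with * show ?thesis by (rule mult_right_le_imp_le)
    qed
  qed
  have "k = 0"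
  proof (rule ccontr)
    assume "k \<noteq> 0"
    then have kp: "0 < k" using k0 by simp
    have "\<exists>g. g \<in> WW \<and> nr g \<le> 1 \<and> k - 1 / real (Suc n) < Re (ipw \<rho> (Kop g) g)" for n
    proof -
      have "k - 1 / real (Suc n) < Sup S" unfolding k_def by simp
      then obtain s where "s \<in> S" "k - 1 / real (Suc n) < s" using less_cSupD[OF Sne] by blast
      then show ?thesis unfolding S_def by blast
    qed
    then obtain F where F: "\<And>n. F n \<in> WW" "\<And>n. nr (F n) \<le> 1"
      "\<And>n. k - 1 / real (Suc n) < Re (ipw \<rho> (Kop (F n)) (F n))" by metis
    note FV = WV[OF F(1)]
    obtain g r where g: "g \<in> VC" "strict_mono (r :: nat \<Rightarrow> nat)"
      and lim: "(\<lambda>n. nr (\<lambda>x. Kop (F (r n)) x - g x)) \<longlonglongrightarrow> 0"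
      using res_compact[of F] FV F(2) by blast
    \<comment> \<open>The defect of \<open>F n\<close> as an eigenvector for \<open>k\<close>. By
      \<open>Ksq\<close> its squared norm is at most \<open>k\<close> times the amount by which the
      Rayleigh value of \<open>F n\<close> falls short of \<open>k\<close>.\<close>
    define E where "E n = (\<lambda>x. Kop (F n) x - of_real k * F n x)" for n
    have EV: "E n \<in> VC" for n
      unfolding E_def by (intro IR.diff_mem IR.scale_mem Kop_VC FV)
    have Esq: "(nr (E n))\<^sup>2 \<le> k * (1 / real (Suc n))" for n
    proof -
      let ?q = "Re (ipw \<rho> (Kop (F n)) (F n))"
      have "(nr (E n))\<^sup>2 = (nr (Kop (F n)))\<^sup>2 + k\<^sup>2 * (nr (F n))\<^sup>2 - 2 * k * ?q"
      proof -
        have "Re (ipw \<rho> (E n) (E n)) = Re (ipw \<rho> (Kop (F n)) (Kop (F n))) + k\<^sup>2 * Re (ipw \<rho> (F n) (F n)) - 2 * k * ?q"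
          unfolding E_def using IR.nsq_lin[OF Kop_VC[OF FV] FV, of 1 n "- of_real k" n] by simp
        then show ?thesis unfolding nr_sq[OF EV] nr_sq[OF FV] nr_sq[OF Kop_VC[OF FV]] .
      qed
      also have "\<dots> \<le> k * ?q + k\<^sup>2 * 1 - 2 * k * ?q"
        using Ksq[OF F(1)] F(2)[of n] nr_nonneg[OF FV, of n]
        by (intro diff_right_mono add_mono mult_left_mono) (auto simp: power_le_one)
      also have "\<dots> = k * (k - ?q)" by (simp add: power2_eq_square algebra_simps)
      also have "\<dots> \<le> k * (1 / real (Suc n))" using F(3)[of n] kp by (intro mult_left_mono) auto
      finally show ?thesis .
    qed
    have Elim: "(\<lambda>n. nr (E n)) \<longlonglongrightarrow> 0"
    proof -
      have "(\<lambda>n. k * (1 / real (Suc n))) \<longlonglongrightarrow> k * 0"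
        using LIMSEQ_inverse_real_of_nat by (intro tendsto_mult tendsto_const) (simp add: inverse_eq_divide)
      then have kl: "(\<lambda>n. k * (1 / real (Suc n))) \<longlonglongrightarrow> 0" by (simp only: mult_zero_right)
      have "(\<lambda>n. (nr (E n))\<^sup>2) \<longlonglongrightarrow> 0"
      proof (rule Lim_null_comparison[OF always_eventually[OF allI] kl])
        show "norm ((nr (E n))\<^sup>2) \<le> k * (1 / real (Suc n))" for n
          using Esq[of n] by (simp only: real_norm_def abs_power2)
      qed
      then have "(\<lambda>n. sqrt ((nr (E n))\<^sup>2)) \<longlonglongrightarrow> sqrt 0" by (rule tendsto_real_sqrt)
      then show ?thesis using nr_nonneg[OF EV] by simp
    qed
    have Er: "(\<lambda>n. nr (E (r n))) \<longlonglongrightarrow> 0" using LIMSEQ_subseq_LIMSEQ[OF Elim g(2)] by (simp add: o_def)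
    define Z where "Z = (\<lambda>x. Kop g x - of_real k * g x)"
    have ZV: "Z \<in> VC" unfolding Z_def by (intro IR.diff_mem IR.scale_mem Kop_VC g)
    have "nr Z \<le> (1 + k) * nr (\<lambda>x. Kop (F (r n)) x - g x) + nr (E (r n))" for n
    proof -
      define h where "h = (\<lambda>x. Kop (F (r n)) x - g x)"
      have hV: "h \<in> VC" unfolding h_def by (intro IR.diff_mem Kop_VC FV g)
      have KhV: "Kop h \<in> VC" "Kop (E (r n)) \<in> VC" by (intro Kop_VC hV EV)+
      \<comment> \<open>With \<open>h = Kop (F (r n)) - g\<close> all terms containing
        \<open>F (r n)\<close> cancel, so the eigenvalue equation of the limit is obtained without
        convergence of \<open>F (r n)\<close> itself.\<close>
      have eq: "Z x = - 1 * Kop h x + 1 * (1 * Kop (E (r n)) x + of_real k * h x)" for x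
      proof -
        have 1: "Kop h = (\<lambda>x. 1 * Kop (Kop (F (r n))) x + (-1) * Kop g x)"
          using Kop_lin[OF Kop_VC[OF FV] g(1), of 1 "r n" "-1"] by (simp add: h_def)
        have 2: "Kop (E (r n)) = (\<lambda>x. 1 * Kop (Kop (F (r n))) x + (- of_real k) * Kop (F (r n)) x)"
          using Kop_lin[OF Kop_VC[OF FV] FV, of 1 "r n" "- of_real k" "r n"] by (simp add: E_def)
        show ?thesis unfolding Z_def 1 2 by (simp add: h_def algebra_simps)
      qed
      have V1: "(\<lambda>x. 1 * Kop (E (r n)) x + of_real k * h x) \<in> VC" by (intro IR.lin_mem KhV hV)
      have V2: "(\<lambda>x. - 1 * Kop h x) \<in> VC" "(\<lambda>x. of_real k * h x) \<in> VC" by (intro IR.scale_mem KhV hV)+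
      have "nr Z = nr (\<lambda>x. - 1 * Kop h x + (1 * Kop (E (r n)) x + of_real k * h x))" unfolding ext[of Z, OF eq] by (simp only: mult_1_left)
      also have "\<dots> \<le> nr (\<lambda>x. - 1 * Kop h x) + nr (\<lambda>x. 1 * Kop (E (r n)) x + of_real k * h x)"
        by (rule IR.norm_triangle[OF V2(1) V1])
      finally have "nr Z \<le> nr (\<lambda>x. - 1 * Kop h x) + nr (\<lambda>x. 1 * Kop (E (r n)) x + of_real k * h x)" .
      moreover have "nr (\<lambda>x. 1 * Kop (E (r n)) x + of_real k * h x) \<le> nr (Kop (E (r n))) + nr (\<lambda>x. of_real k * h x)"
        using IR.norm_triangle[OF KhV(2) V2(2)] by simp
      moreover have "nr (\<lambda>x. of_real k * h x) = k * nr h"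
        unfolding IR.nsq_scale[OF hV] using k0 by (simp add: real_sqrt_mult)
      moreover have "nr (\<lambda>x. - 1 * Kop h x) = nr (Kop h)"
        unfolding IR.nsq_scale[OF KhV(1)] by simp
      ultimately have "nr Z \<le> nr (Kop h) + (nr (Kop (E (r n))) + k * nr h)" by linarith
      then have "nr Z \<le> nr h + (nr (E (r n)) + k * nr h)" using Kn[OF hV] Kn[OF EV, of "r n"] by linarith
      then show ?thesis unfolding h_def[symmetric] distrib_right mult_1_left by linarith
    qed
    note Zle = this
    have "(\<lambda>n. (1 + k) * nr (\<lambda>x. Kop (F (r n)) x - g x) + nr (E (r n))) \<longlonglongrightarrow> (1 + k) * 0 + 0"
      by (intro tendsto_add tendsto_mult tendsto_const lim Er)
    then have "nr Z \<le> (1 + k) * 0 + 0" by (rule LIMSEQ_le_const) (use Zle in blast)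
    then have "nr Z = 0" using nr_nonneg[OF ZV] by simp
    then have Kg: "Kop g y = of_real k * g y" if "y \<in> {0..pi}" for y
      using nr_zero[OF ZV _ that] by (simp add: Z_def)
    \<comment> \<open>\<open>Kop g / k\<close> rather than \<open>g\<close>: the two agree on the
      interval, but the former vanishes outside and comes with its derivatives.\<close>
    define \<psi> where "\<psi> x = Kop g x / of_real k" for x
    have \<psi>g: "\<psi> y = g y" if "y \<in> {0..pi}" for y using Kg[OF that] kp by (simp add: \<psi>_def)
    have "eig (1 / k - kap) \<psi>" unfolding eig_def
    proof
      obtain \<phi>1 m m1 w where b: "bvp (Kop g) \<phi>1 m m1 w" "\<And>x. x\<in>{0..pi} \<Longrightarrow> w x = of_real (\<rho> x) * (g x - of_real kap * Kop g x)"
        using Kop_res[OF g(1)] unfolding res_def by blast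
      have "bvp \<psi> (\<lambda>x. (1 / of_real k) * \<phi>1 x + 0 * \<phi>1 x) (\<lambda>x. (1 / of_real k) * m x + 0 * m x) (\<lambda>x. (1 / of_real k) * m1 x + 0 * m1 x)
        (\<lambda>x. of_real (\<rho> x) * (of_real (1 / k - kap) * \<psi> x))"
      proof (rule bvp_cong[OF bvp_lin[OF b(1) b(1), of "1 / of_real k" 0]])
        show "1 / of_real k * Kop g y + 0 * Kop g y = \<psi> y" for y by (simp add: \<psi>_def)
        fix y assume y: "y \<in> {0..pi}"
        show "1 / of_real k * w y + 0 * w y = of_real (\<rho> y) * (of_real (1 / k - kap) * \<psi> y)"
          unfolding b(2)[OF y] \<psi>_def using Kg[OF y] kp by (simp add: field_simps)
      qed
      then show "\<exists>\<phi>1 m m1. bvp \<psi> \<phi>1 m m1 (\<lambda>x. of_real (\<rho> x) * (of_real (1 / k - kap) * \<psi> x))" by blast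
      show "\<forall>x. x \<notin> {0..pi} \<longrightarrow> \<psi> x = 0" by (auto simp: \<psi>_def Kop_def)
    qed
    then have orth: "ipw \<rho> (Kop (F (r n))) \<psi> = 0" for n using WW_Kop[OF F(1)] by (auto simp: WW_def)
    have \<psi>V: "\<psi> \<in> VC" using VC_cong[OF g(1)] \<psi>g by simp
    have "(\<lambda>n. ipw \<rho> (Kop (F (r n))) \<psi>) \<longlonglongrightarrow> ipw \<rho> g \<psi>"
      by (rule ip_tendsto[OF _ g(1) \<psi>V lim]) (intro Kop_VC FV)
    then have "ipw \<rho> g \<psi> = 0" unfolding orth by (simp add: LIMSEQ_const_iff)
    moreover have "ipw \<rho> g \<psi> = ipw \<rho> g g" unfolding ipw_def by (intro integral_cong) (simp add: \<psi>g)
    ultimately have g0: "nr g = 0" by simp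
    \<comment> \<open>The Rayleigh value of \<open>F (r n)\<close> is at most the norm of its image,
      and that norm tends to the norm of \<open>g\<close>, now known to be zero.\<close>
    have "k - 1 / real (Suc (r n)) \<le> nr (\<lambda>x. Kop (F (r n)) x - g x)" for n
    proof -
      let ?K = "Kop (F (r n))"
      have "k - 1 / real (Suc (r n)) \<le> nr ?K * nr (F (r n))"
        using F(3)[of "r n"] Kle[OF FV, of "r n"] by linarith
      also have "\<dots> \<le> nr ?K * 1" by (intro mult_left_mono F(2) nr_nonneg Kop_VC FV)
      also have "nr ?K = nr (\<lambda>x. (?K x - g x) + g x)" by simp
      also have "nr (\<lambda>x. (?K x - g x) + g x) * 1 \<le> nr (\<lambda>x. ?K x - g x) + nr g"
        using IR.norm_triangle[OF IR.diff_mem[OF Kop_VC[OF FV] g(1)] g(1)] by simp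
      finally show ?thesis using g0 by simp
    qed
    note kr = this
    have "(\<lambda>n. k - 1 / real (Suc (r n))) \<longlonglongrightarrow> k - 0"
      using LIMSEQ_subseq_LIMSEQ[OF LIMSEQ_inverse_real_of_nat g(2)]
      by (intro tendsto_diff tendsto_const) (simp add: o_def inverse_eq_divide)
    then have "k - 0 \<le> 0" by (rule LIMSEQ_le[OF _ lim]) (use kr in blast)
    then show False using kp by simp
  qed
  then have "nr (Kop f) = 0" using Ksq[OF fW] by simp
  then have "Kop f y = 0" if "y \<in> {0..pi}" for y using nr_zero[OF Kop_VC[OF WV[OF fW]] _ that] by blast
  then show ?thesis by (rule res_zero_imp[OF Kop_res[OF WV[OF fW]] _ x])
qed

end

section \<open>An orthonormal basis of eigenfunctions\<close>

lemma pow4_le_imp_le: "x ^ 4 \<le> y ^ 4 \<Longrightarrow> 0 \<le> y \<Longrightarrow> x \<le> y" for x y :: real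
  using power_le_imp_le_base[of x 3 y] by simp

context beam_ode
begin

lemma bvp_zero: "bvp (\<lambda>_. 0) (\<lambda>_. 0) (\<lambda>_. 0) (\<lambda>_. 0) (\<lambda>_. 0)"
  unfolding bvp_def chain_def by (auto simp: IR.zero_mem)

lemma bvp_sum:
  assumes "finite F" "\<And>i. i \<in> F \<Longrightarrow> bvp (f i) (f1 i) (m i) (m1 i) (w i)"
  shows "bvp (\<lambda>x. \<Sum>i\<in>F. c i * f i x) (\<lambda>x. \<Sum>i\<in>F. c i * f1 i x) (\<lambda>x. \<Sum>i\<in>F. c i * m i x)
    (\<lambda>x. \<Sum>i\<in>F. c i * m1 i x) (\<lambda>x. \<Sum>i\<in>F. c i * w i x)"
  using assms
proof (induction F rule: finite_induct)
  case empty then show ?case using bvp_zero by simp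
next
  case (insert j F)
  have "bvp (\<lambda>x. c j * f j x + 1 * (\<Sum>i\<in>F. c i * f i x)) (\<lambda>x. c j * f1 j x + 1 * (\<Sum>i\<in>F. c i * f1 i x))
     (\<lambda>x. c j * m j x + 1 * (\<Sum>i\<in>F. c i * m i x)) (\<lambda>x. c j * m1 j x + 1 * (\<Sum>i\<in>F. c i * m1 i x))
     (\<lambda>x. c j * w j x + 1 * (\<Sum>i\<in>F. c i * w i x))"
    using insert by (intro bvp_lin) auto
  then show ?case using insert(1,2) by simp
qed

text \<open>
  The combination of the eigenfunctions with coefficients \<open>cnj (e i x)\<close> takes the value of its
  squared norm at \<open>x\<close>, so the bound follows from the interpolation inequality for its supremum.
\<close>

lemma cluster_bound:
  assumes F: "finite F" and e: "IR.ortho_fam F e" "\<And>i. i \<in> F \<Longrightarrow> eig (\<nu> i) (e i)"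
    and \<Lambda>: "\<And>i. i \<in> F \<Longrightarrow> \<nu> i \<le> \<Lambda>" and x: "x \<in> {0..pi}" and pos: "0 \<le> \<Lambda> + K0"
  shows "(\<Sum>i\<in>F. (cmod (e i x))\<^sup>2) ^ 4 \<le> 32 / elo * (\<Lambda> + K0)"
proof -
  define s where "s = (\<Sum>i\<in>F. (cmod (e i x))\<^sup>2)"
  define c where "c i = cnj (e i x)" for i
  have "\<forall>i\<in>F. \<exists>f1 m m1. bvp (e i) f1 m m1 (\<lambda>x. of_real (\<rho> x) * (of_real (\<nu> i) * e i x))"
    using e(2) unfolding eig_def by blast
  then obtain f1 m m1 where b: "\<And>i. i \<in> F \<Longrightarrow> bvp (e i) (f1 i) (m i) (m1 i) (\<lambda>x. of_real (\<rho> x) * (of_real (\<nu> i) * e i x))"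
    by metis
  have eV: "e i \<in> VC" if "i \<in> F" for i using IR.ortho_famD(1)[OF e(1) that] .
  let ?f = "\<lambda>x. \<Sum>i\<in>F. c i * e i x"
  have bs: "bvp ?f (\<lambda>x. \<Sum>i\<in>F. c i * f1 i x) (\<lambda>x. \<Sum>i\<in>F. c i * m i x)
    (\<lambda>x. \<Sum>i\<in>F. c i * m1 i x) (\<lambda>x. \<Sum>i\<in>F. c i * (of_real (\<rho> x) * (of_real (\<nu> i) * e i x)))"
    by (rule bvp_sum[OF F b])
  have ch: "chain ?f (\<lambda>x. \<Sum>i\<in>F. c i * f1 i x) (\<lambda>x. \<Sum>i\<in>F. c i * m i x)
    (\<lambda>x. \<Sum>i\<in>F. c i * m1 i x) (\<lambda>x. \<Sum>i\<in>F. c i * (of_real (\<rho> x) * (of_real (\<nu> i) * e i x)))"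
    "?f 0 = 0" "?f pi = 0" using bs unfolding bvp_def by auto
  note a = chainD[OF ch(1)]
  have s0: "0 \<le> s" unfolding s_def by (intro sum_nonneg) auto
  have fx: "?f x = of_real s"
    unfolding s_def c_def of_real_sum by (intro sum.cong refl) (simp add: mult.commute[of "cnj _"] mult_cnj_cmod)
  have nf: "(nr ?f)\<^sup>2 = s"
    using nr_sq[OF a(1)] IR.nsq_sum_ortho[OF e(1) F, of c] by (simp only: s_def c_def complex_mod_cnj)
  let ?g = "\<lambda>x. \<Sum>i\<in>F. (c i * of_real (\<nu> i)) * e i x"
  have gV: "?g \<in> VC" by (rule IR.sum_mem[OF F eV])
  have "ipw (\<lambda>_. 1) (\<lambda>x. \<Sum>i\<in>F. c i * (of_real (\<rho> x) * (of_real (\<nu> i) * e i x))) ?f = ipw \<rho> ?g ?f"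
    unfolding ipw_rho[symmetric] by (simp add: sum_distrib_left mult_ac)
  also have "\<dots> = (\<Sum>i\<in>F. cnj (c i) * ipw \<rho> ?g (e i))" by (rule IR.ip_sum2[OF F eV gV])
  also have "\<dots> = (\<Sum>i\<in>F. of_real (\<nu> i * (cmod (c i))\<^sup>2))"
  proof (intro sum.cong refl)
    fix i assume i: "i \<in> F"
    have "cnj (c i) * ipw \<rho> ?g (e i) = of_real (\<nu> i) * (c i * cnj (c i))"
      unfolding IR.ip_sum_ortho[OF e(1) F i] by (simp only: mult_ac)
    then show "cnj (c i) * ipw \<rho> ?g (e i) = of_real (\<nu> i * (cmod (c i))\<^sup>2)"
      by (simp only: mult_cnj_cmod of_real_mult of_real_power)
  qed
  finally have "Re (ipw (\<lambda>_. 1) (\<lambda>x. \<Sum>i\<in>F. c i * (of_real (\<rho> x) * (of_real (\<nu> i) * e i x))) ?f)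
    = (\<Sum>i\<in>F. \<nu> i * (cmod (c i))\<^sup>2)" by (simp flip: of_real_sum)
  also have "\<dots> \<le> (\<Sum>i\<in>F. \<Lambda> * (cmod (c i))\<^sup>2)" by (intro sum_mono mult_right_mono \<Lambda>) auto
  also have "\<dots> = \<Lambda> * s" unfolding s_def c_def by (simp add: sum_distrib_left)
  finally have co: "elo / 2 * (n2 (\<lambda>x. (\<Sum>i\<in>F. c i * m i x) / of_real (\<eta> x)))\<^sup>2 \<le> \<Lambda> * s + K0 * s"
    using coercive[OF bs] nf by simp
  define A where "A = n2 ?f"
  define B where "B = n2 (\<lambda>x. \<Sum>i\<in>F. c i * f1 i x)"
  define D where "D = n2 (\<lambda>x. (\<Sum>i\<in>F. c i * m i x) / of_real (\<eta> x))"
  have nn: "0 \<le> A" "0 \<le> B" "0 \<le> D" unfolding A_def B_def D_def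
    by (rule n2_nonneg[OF a(1)], rule n2_nonneg[OF a(2)], rule n2_nonneg[OF a(6)])
  have A2: "A\<^sup>2 \<le> s"
  proof -
    have "A\<^sup>2 \<le> (nr ?f)\<^sup>2" using n2_le_nr[OF a(1)] nn(1) unfolding A_def by (intro power_mono) auto
    then show ?thesis using nf by simp
  qed
  have B2: "B\<^sup>2 \<le> A * D" unfolding A_def B_def D_def by (rule interp1[OF ch])
  have D2: "D\<^sup>2 \<le> 2 / elo * ((\<Lambda> + K0) * s)"
  proof -
    have "elo / 2 * D\<^sup>2 \<le> (\<Lambda> + K0) * s" using co unfolding D_def[symmetric] by (simp add: algebra_simps)
    then show ?thesis using elo(1) by (simp add: field_simps)
  qed
  \<comment> \<open>The base point \<open>0\<close> is a zero of the combination, so the first term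
    of \<open>agmon_diff\<close> drops out.\<close>
  have s2: "s\<^sup>2 \<le> 2 * A * B"
    using agmon_diff[OF a(1) a(2) a(7) x, of 0] fx s0 ch(2) unfolding A_def B_def by simp
  \<comment> \<open>The eighth power clears all roots when \<open>s2\<close>, \<open>B2\<close>,
    \<open>A2\<close> and \<open>D2\<close> are chained. Cancelling \<open>s ^ 4\<close> leaves the
    first power of \<open>\<Lambda> + K0\<close>, so \<open>s\<close> grows only like its fourth
    root.\<close>
  have "s ^ 8 = ((s\<^sup>2)\<^sup>2)\<^sup>2" by simp
  also have "\<dots> \<le> ((2 * A * B)\<^sup>2)\<^sup>2" using s2 by (intro power_mono) auto
  also have "\<dots> = 16 * A ^ 4 * (B\<^sup>2)\<^sup>2" by (simp add: power_mult_distrib flip: power_mult)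
  also have "\<dots> \<le> 16 * A ^ 4 * (A * D)\<^sup>2" using B2 by (intro mult_left_mono power_mono) auto
  also have "\<dots> = 16 * (A\<^sup>2) ^ 3 * D\<^sup>2" by (simp add: power2_eq_square eval_nat_numeral)
  also have "\<dots> \<le> 16 * s ^ 3 * (2 / elo * ((\<Lambda> + K0) * s))"
    using A2 D2 s0 by (intro mult_mono power_mono mult_nonneg_nonneg) auto
  also have "\<dots> = (32 / elo * (\<Lambda> + K0)) * s ^ 4" by (simp add: eval_nat_numeral)
  finally have *: "s ^ 4 * s ^ 4 \<le> (32 / elo * (\<Lambda> + K0)) * s ^ 4" by (simp flip: power_add)
  have "s ^ 4 \<le> 32 / elo * (\<Lambda> + K0)"
  proof (cases "s = 0")
    case True then show ?thesis using pos elo(1) by simp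
  next
    case False
    then have "0 < s ^ 4" using s0 by simp
    with * show ?thesis by (rule mult_right_le_imp_le)
  qed
  then show ?thesis by (simp add: s_def)
qed

text \<open>Integrating \<open>cluster_bound\<close> against \<open>\<rho>\<close> counts an
  orthonormal family. The bound provides the maximal family in \<open>eig_ortho_basis\<close> and
  thereby the finite dimension of the eigenspace.\<close>

lemma ortho_eig_card_bounded:
  "\<exists>B. \<forall>F. finite F \<longrightarrow> IR.ortho_fam F (\<lambda>f. f) \<longrightarrow> (\<forall>f\<in>F. eig \<nu> f) \<longrightarrow> card F \<le> (B::nat)"
proof -
  define \<Lambda> where "\<Lambda> = \<bar>\<nu>\<bar>"
  \<comment> \<open>The summand \<open>1\<close> ensures \<open>q \<le> q ^ 4\<close>, which avoids
    fourth roots.\<close>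
  define q where "q = 1 + 32 / elo * (\<Lambda> + K0)"
  have q1: "1 \<le> q" unfolding q_def \<Lambda>_def using elo(1) K0_nonneg by simp
  have "real (card F) \<le> rhi * q * pi"
    if F: "finite F" "IR.ortho_fam F (\<lambda>f. f)" "\<forall>f\<in>F. eig \<nu> f" for F
  proof -
    have sb: "(\<Sum>f\<in>F. (cmod (f x))\<^sup>2) \<le> q" if x: "x \<in> {0..pi}" for x
    proof -
      let ?s = "\<Sum>f\<in>F. (cmod (f x))\<^sup>2"
      have "?s ^ 4 \<le> 32 / elo * (\<Lambda> + K0)"
        by (rule cluster_bound[OF F(1,2), of "\<lambda>_. \<nu>"]) (use F x K0_nonneg in \<open>auto simp: \<Lambda>_def\<close>)
      then have "?s ^ 4 \<le> q" by (simp add: q_def)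
      moreover have "q \<le> q ^ 4" using power_increasing[of 1 4 q] q1 by simp
      ultimately have "?s ^ 4 \<le> q ^ 4" by linarith
      moreover have "0 \<le> q" using q1 by linarith
      ultimately show ?thesis by (rule pow4_le_imp_le)
    qed
    have fV: "f \<in> VC" if "f \<in> F" for f using eig_VC F(3) that by blast
    have ci: "(\<lambda>x. \<rho> x * (cmod (f x))\<^sup>2) integrable_on {0..pi}" if "f \<in> F" for f
      using fV[OF that] rho_cont by (intro integrable_continuous_interval continuous_intros) (auto simp: VC_def)
    have "real (card F) = (\<Sum>f\<in>F. Re (ipw \<rho> f f))"
      using IR.ortho_famD(2)[OF F(2)] by simp
    also have "\<dots> = integral {0..pi} (\<lambda>x. \<Sum>f\<in>F. \<rho> x * (cmod (f x))\<^sup>2)"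
      using F(1) ci fV by (subst integral_sum) (auto intro!: sum.cong ipw_self rho_cont)
    also have "\<dots> \<le> integral {0..pi} (\<lambda>x. rhi * q)"
    proof (rule integral_le)
      show "(\<lambda>x. \<Sum>f\<in>F. \<rho> x * (cmod (f x))\<^sup>2) integrable_on {0..pi}" by (intro integrable_sum F ci)
      fix x assume x: "x \<in> {0..pi}"
      have "(\<Sum>f\<in>F. \<rho> x * (cmod (f x))\<^sup>2) = \<rho> x * (\<Sum>f\<in>F. (cmod (f x))\<^sup>2)" by (simp add: sum_distrib_left)
      also have "\<dots> \<le> rhi * q"
        using sb[OF x] rhi(1) rhi(2)[OF x] by (intro mult_mono) (auto intro!: sum_nonneg)
      finally show "(\<Sum>f\<in>F. \<rho> x * (cmod (f x))\<^sup>2) \<le> rhi * q" .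
    qed auto
    finally show ?thesis by (simp add: mult_ac)
  qed
  then have "\<forall>F. finite F \<longrightarrow> IR.ortho_fam F (\<lambda>f. f) \<longrightarrow> (\<forall>f\<in>F. eig \<nu> f) \<longrightarrow> card F \<le> nat \<lfloor>rhi * q * pi\<rfloor>"
    by (auto simp: le_nat_floor)
  then show ?thesis by blast
qed

lemma eig_lin: "eig \<nu> f \<Longrightarrow> eig \<nu> g \<Longrightarrow> eig \<nu> (\<lambda>x. c * f x + d * g x)"
  unfolding eig_def
proof (elim conjE exE, intro conjI)
  fix f1 m m1 g1 n n1
  assume b: "bvp f f1 m m1 (\<lambda>x. of_real (\<rho> x) * (of_real \<nu> * f x))" "bvp g g1 n n1 (\<lambda>x. of_real (\<rho> x) * (of_real \<nu> * g x))"
  show "\<exists>\<phi>1 m m1. bvp (\<lambda>x. c * f x + d * g x) \<phi>1 m m1 (\<lambda>x. of_real (\<rho> x) * (of_real \<nu> * (c * f x + d * g x)))"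
    by (intro exI, rule bvp_cong[OF bvp_lin[OF b, of c d] refl]) (simp add: algebra_simps)
qed auto

lemma eig_sum:
  assumes "finite F" "\<And>i. i \<in> F \<Longrightarrow> eig \<nu> (e i)"
  shows "eig \<nu> (\<lambda>x. \<Sum>i\<in>F. c i * e i x)"
  using assms
proof (induction F rule: finite_induct)
  case empty
  show ?case unfolding eig_def using bvp_zero by auto
next
  case (insert j F)
  have "eig \<nu> (\<lambda>x. c j * e j x + 1 * (\<Sum>i\<in>F. c i * e i x))" using insert by (intro eig_lin) auto
  then show ?case using insert(1,2) by simp
qed

lemma eig_zero_fun: "eig \<nu> f \<Longrightarrow> nr f = 0 \<Longrightarrow> f = (\<lambda>_. 0)"
proof
  fix x assume e: "eig \<nu> f" "nr f = 0"
  show "f x = 0" using nr_zero[OF eig_VC[OF e(1)] e(2), of x] e(1) by (cases "x \<in> {0..pi}") (auto simp: eig_def)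
qed

text \<open>Take an orthonormal family of maximal cardinality. A residual of positive norm,
  normalised, could be added to it; a residual of norm zero is the zero function, since
  eigenfunctions vanish outside the interval.\<close>

lemma eig_ortho_basis:
  obtains B where "finite B" "IR.ortho_fam B (\<lambda>f. f)" "\<And>f. f \<in> B \<Longrightarrow> eig \<nu> f"
    "\<And>f. eig \<nu> f \<Longrightarrow> f = (\<lambda>x. \<Sum>b\<in>B. ipw \<rho> f b * b x)"
proof -
  define P where "P F \<longleftrightarrow> finite F \<and> IR.ortho_fam F (\<lambda>f. f) \<and> (\<forall>f\<in>F. eig \<nu> f)" for F :: "(real \<Rightarrow> complex) set"
  obtain N where N: "\<And>F. P F \<Longrightarrow> card F \<le> N" using ortho_eig_card_bounded[of \<nu>] unfolding P_def by blast
  have "P {}" by (simp add: P_def IR.ortho_fam_def)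
  then obtain B where B: "P B" "\<And>F. P F \<Longrightarrow> card F \<le> card B"
    using ex_has_greatest_nat[of P "{}" card "Suc N"] N by (metis le_imp_less_Suc)
  have fin: "finite B" and o: "IR.ortho_fam B (\<lambda>f. f)" and e: "\<And>f. f \<in> B \<Longrightarrow> eig \<nu> f" using B(1) by (auto simp: P_def)
  have "f = (\<lambda>x. \<Sum>b\<in>B. ipw \<rho> f b * b x)" if f: "eig \<nu> f" for f
  proof -
    define r where "r = (\<lambda>x. f x - (\<Sum>b\<in>B. ipw \<rho> f b * b x))"
    have es: "eig \<nu> (\<lambda>x. \<Sum>b\<in>B. ipw \<rho> f b * b x)"
      by (rule eig_sum[OF fin]) (rule e)
    have er: "eig \<nu> r" using eig_lin[OF f es, of 1 "-1"] by (simp add: r_def)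
    have rV: "r \<in> VC" by (rule eig_VC[OF er])
    have ro: "ipw \<rho> r b = 0" if "b \<in> B" for b
      unfolding r_def using IR.ip_residual_ortho[OF o fin that eig_VC[OF f]] by simp
    have "nr r = 0"
    proof (rule ccontr)
      assume "nr r \<noteq> 0"
      then have p: "0 < nr r" using nr_nonneg[OF rV] by simp
      define u where "u = (\<lambda>x. of_real (1 / nr r) * r x)"
      have uV: "u \<in> VC" unfolding u_def by (rule IR.scale_mem[OF rV])
      have eu: "eig \<nu> u" using eig_lin[OF er er, of "of_real (1 / nr r)" 0] by (simp add: u_def)
      have "Re (ipw \<rho> u u) = (1 / nr r)\<^sup>2 * (nr r)\<^sup>2"
        unfolding u_def IR.nsq_scale[OF rV] nr_sq[OF rV] using p by (simp add: norm_divide)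
      also have "\<dots> = 1" using p by (simp add: power_divide)
      finally have uu: "ipw \<rho> u u = 1" using IR.ip_self[OF uV] by simp
      have ub: "ipw \<rho> u b = 0" if "b \<in> B" for b
        unfolding u_def IR.ip_scale[OF rV eig_VC[OF e[OF that]]] ro[OF that] by simp
      have bu: "ipw \<rho> b u = 0" if "b \<in> B" for b
        using IR.ip_cnj[OF uV eig_VC[OF e[OF that]]] ub[OF that] by simp
      have "u \<notin> B" using ub uu by force
      moreover have "P (insert u B)"
        unfolding P_def IR.ortho_fam_def
      proof (intro conjI ballI)
        fix f g assume fg: "f \<in> insert u B" "g \<in> insert u B"
        show "f \<in> VC" using fg uV eig_VC e by auto
        show "ipw \<rho> f g = (if f = g then 1 else 0)"
          using fg \<open>u \<notin> B\<close> uu ub bu IR.ortho_famD(2)[OF o] by auto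
      qed (use fin e eu in auto)
      ultimately show False using B(2)[of "insert u B"] fin by simp
    qed
    then have "r = (\<lambda>_. 0)" by (rule eig_zero_fun[OF er])
    then show ?thesis unfolding r_def by (metis eq_iff_diff_eq_0)
  qed
  then show thesis using that fin o e by blast
qed

section \<open>Multiplicity and dimension\<close>

lemma fun_vector_space: "vector_space (\<lambda>(c::complex) (\<phi>::real \<Rightarrow> complex) x. c * \<phi> x)"
  by unfold_locales (auto simp: fun_eq_iff algebra_simps)

lemma sum_fun_apply: "(\<Sum>i\<in>F. g i) x = (\<Sum>i\<in>F. g i x)" for g :: "'i \<Rightarrow> real \<Rightarrow> complex"
  by (induction F rule: infinite_finite_induct) auto

text \<open>Orthonormality gives independence and the expansion gives spanning. The dimension is
  taken in the space of all complex functions on the reals, where elements that vanish outside the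
  interval are compared faithfully.\<close>

lemma dim_ortho_basis:
  assumes fin: "finite B" and o: "IR.ortho_fam B (\<lambda>f. f)" and e: "B \<subseteq> E"
    and rep: "\<And>f. f \<in> E \<Longrightarrow> f = (\<lambda>x. \<Sum>b\<in>B. ipw \<rho> f b * b x)"
  shows "vector_space.dim (\<lambda>(c::complex) \<phi> x. c * \<phi> x) E = card B"
proof -
  interpret vs: vector_space "\<lambda>(c::complex) (\<phi>::real \<Rightarrow> complex) x. c * \<phi> x" by (rule fun_vector_space)
  have BV: "b \<in> VC" if "b \<in> B" for b using IR.ortho_famD(1)[OF o that] .
  have "\<not> vs.dependent B"
  proof
    assume "vs.dependent B"
    then obtain u v where u: "v \<in> B" "u v \<noteq> 0" "(\<Sum>v\<in>B. (\<lambda>x. u v * v x)) = 0"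
      unfolding vs.dependent_finite[OF fin] by auto
    have "(\<lambda>x. \<Sum>b\<in>B. u b * b x) = (\<lambda>_. 0)" using u(3) by (auto simp: fun_eq_iff sum_fun_apply)
    then have "ipw \<rho> (\<lambda>_. 0) v = u v" using IR.ip_sum_ortho[OF o fin u(1), of u] by simp
    then show False using u IR.ip_zero[OF BV[OF u(1)]] by simp
  qed
  moreover have "E \<subseteq> vs.span B"
  proof
    fix f assume f: "f \<in> E"
    have "f = (\<Sum>b\<in>B. (\<lambda>x. ipw \<rho> f b * b x))" using rep[OF f] by (auto simp: fun_eq_iff sum_fun_apply)
    moreover have "(\<Sum>b\<in>B. (\<lambda>x. ipw \<rho> f b * b x)) \<in> vs.span B"
      by (intro vs.span_sum vs.span_scale vs.span_base)
    ultimately show "f \<in> vs.span B" by simp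
  qed
  ultimately have "vs.dim E = card B"
    using e by (intro vs.dim_eq_card) (auto simp: vs.span_eq intro: vs.span_base)
  then show ?thesis .
qed

lemma eig_ortho_distinct:
  assumes "eig \<nu> f" "eig \<nu>' g" "\<nu> \<noteq> \<nu>'"
  shows "ipw \<rho> f g = 0"
proof -
  note V = eig_VC[OF assms(1)] eig_VC[OF assms(2)]
  have "ipw \<rho> (\<lambda>x. of_real (\<nu> + kap) * f x) g = ipw \<rho> f (\<lambda>x. of_real (\<nu>' + kap) * g x)"
    by (rule res_symmetric[OF eig_res[OF assms(1)] eig_res[OF assms(2)]]) (intro IR.scale_mem V)+
  then show ?thesis using IR.ip_scale[OF V] IR.ip_scale2[OF V(2,1)] assms(3) by simp
qed

text \<open>For each \<open>\<nu>\<close> the indices with that value and an orthonormal basis of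
  its eigenspace are equally many; the bijections, glued over all \<open>\<nu>\<close>, label the
  eigenfunctions by the given sequence. A value that is not listed has an empty basis, so
  orthogonality to the labelled functions already implies membership in \<open>WW\<close>.\<close>

lemma eigenbasis_exists:
  assumes cnt: "\<And>\<nu>. finite {n. 1 \<le> n \<and> \<mu> n = \<nu>} \<and>
        card {n. 1 \<le> n \<and> \<mu> n = \<nu>} = vector_space.dim (\<lambda>(c::complex) \<phi> x. c * \<phi> x) (Collect (eig \<nu>))"
  obtains \<phi> :: "nat \<Rightarrow> real \<Rightarrow> complex" where "IR.ortho_fam {1..} \<phi>" "\<And>n. 1 \<le> n \<Longrightarrow> eig (\<mu> n) (\<phi> n)"
    "\<And>f x. f \<in> VC \<Longrightarrow> (\<And>n. 1 \<le> n \<Longrightarrow> ipw \<rho> f (\<phi> n) = 0) \<Longrightarrow> x \<in> {0..pi} \<Longrightarrow> f x = 0"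
proof -
  define I where "I \<nu> = {n. 1 \<le> n \<and> \<mu> n = \<nu>}" for \<nu>
  have "\<forall>\<nu>. \<exists>B. finite B \<and> IR.ortho_fam B (\<lambda>f. f) \<and> (\<forall>f\<in>B. eig \<nu> f) \<and>
     (\<forall>f. eig \<nu> f \<longrightarrow> f = (\<lambda>x. \<Sum>b\<in>B. ipw \<rho> f b * b x))"
  proof
    fix \<nu>
    show "\<exists>B. finite B \<and> IR.ortho_fam B (\<lambda>f. f) \<and> (\<forall>f\<in>B. eig \<nu> f) \<and>
      (\<forall>f. eig \<nu> f \<longrightarrow> f = (\<lambda>x. \<Sum>b\<in>B. ipw \<rho> f b * b x))"
      by (rule eig_ortho_basis[of \<nu>], intro exI conjI ballI allI impI)
  qed
  from choice[OF this] obtain B where "\<forall>\<nu>. finite (B \<nu>) \<and> IR.ortho_fam (B \<nu>) (\<lambda>f. f) \<and> (\<forall>f\<in>B \<nu>. eig \<nu> f) \<and>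
     (\<forall>f. eig \<nu> f \<longrightarrow> f = (\<lambda>x. \<Sum>b\<in>B \<nu>. ipw \<rho> f b * b x))" ..
  then have B: "\<And>\<nu>. finite (B \<nu>)" "\<And>\<nu>. IR.ortho_fam (B \<nu>) (\<lambda>f. f)" "\<And>\<nu> f. f \<in> B \<nu> \<Longrightarrow> eig \<nu> f"
    "\<And>\<nu> f. eig \<nu> f \<Longrightarrow> f = (\<lambda>x. \<Sum>b\<in>B \<nu>. ipw \<rho> f b * b x)" by simp_all
  have "card (I \<nu>) = card (B \<nu>)" for \<nu>
    using dim_ortho_basis[OF B(1,2), of \<nu> "Collect (eig \<nu>)"] B(3,4) cnt unfolding I_def by auto
  then have "\<forall>\<nu>. \<exists>h. bij_betw h (I \<nu>) (B \<nu>)"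
    using B(1) cnt by (intro allI finite_same_card_bij) (auto simp: I_def)
  then obtain h where h: "\<And>\<nu>. bij_betw (h \<nu>) (I \<nu>) (B \<nu>)" by metis
  define \<phi> where "\<phi> n = h (\<mu> n) n" for n
  have \<phi>B: "\<phi> n \<in> B (\<mu> n)" if "1 \<le> n" for n
    using bij_betwE[OF h[of "\<mu> n"]] that by (auto simp: \<phi>_def I_def)
  have e: "eig (\<mu> n) (\<phi> n)" if "1 \<le> n" for n by (rule B(3)[OF \<phi>B[OF that]])
  have "IR.ortho_fam {1..} \<phi>" unfolding IR.ortho_fam_def
  proof (intro ballI conjI)
    fix n m :: nat assume nm: "n \<in> {1..}" "m \<in> {1..}"
    show "\<phi> n \<in> VC" using eig_VC e nm by auto
    show "ipw \<rho> (\<phi> n) (\<phi> m) = (if n = m then 1 else 0)"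
    proof (cases "\<mu> n = \<mu> m")
      case True
      have "\<phi> n = \<phi> m \<longleftrightarrow> n = m"
        using bij_betw_imp_inj_on[OF h[of "\<mu> n"]] True nm by (auto simp: \<phi>_def I_def inj_on_def)
      then show ?thesis using IR.ortho_famD(2)[OF B(2)[of "\<mu> n"], of "\<phi> n" "\<phi> m"] \<phi>B[of n] \<phi>B[of m] True nm by auto
    next
      case False then show ?thesis using eig_ortho_distinct[OF e e False] nm by auto
    qed
  qed
  moreover have "f x = 0" if f: "f \<in> VC" "\<And>n. 1 \<le> n \<Longrightarrow> ipw \<rho> f (\<phi> n) = 0" and x: "x \<in> {0..pi}" for f x
  proof (rule eigenfunctions_total_continuous[OF _ x])
    have "ipw \<rho> f \<psi> = 0" if \<psi>: "eig \<nu> \<psi>" for \<nu> \<psi>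
    proof -
      have b0: "ipw \<rho> f b = 0" if b: "b \<in> B \<nu>" for b
      proof -
        obtain n where "n \<in> I \<nu>" "b = h \<nu> n" using h[of \<nu>] b by (auto simp: bij_betw_def)
        then show ?thesis using f(2)[of n] by (auto simp: \<phi>_def I_def)
      qed
      have "ipw \<rho> f (\<lambda>x. \<Sum>b\<in>B \<nu>. ipw \<rho> \<psi> b * b x) = (\<Sum>b\<in>B \<nu>. cnj (ipw \<rho> \<psi> b) * ipw \<rho> f b)"
        by (rule IR.ip_sum2[OF B(1) _ f(1)]) (use B(3) eig_VC in blast)
      also have "\<dots> = 0" using b0 by simp
      finally show ?thesis using B(4)[OF \<psi>] by simp
    qed
    then show "f \<in> WW" using f by (simp add: WW_def)
  qed
  ultimately show thesis using that e by blast
qed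

end

text \<open>Summation by parts in inductive form: the linear growth of the partial sums
  \<open>T N\<close> is traded for telescoping differences of \<open>2 * C / N\<close>.\<close>

lemma abel_bound:
  fixes s :: "nat \<Rightarrow> real"
  assumes s: "\<And>n. 0 \<le> s n" and S: "\<And>N. 1 \<le> N \<Longrightarrow> (\<Sum>n=1..N. s n) \<le> C * real N" and M: "1 \<le> M" and C: "0 \<le> C"
  shows "(\<Sum>n=M..N. s n / (real n)\<^sup>2) \<le> 3 * C / real M"
proof (cases "M \<le> N")
  case True
  define T where "T N = (\<Sum>n=1..N. s n)" for N
  \<comment> \<open>The first term carries the partial sum at the current upper end; the second
    collects what is lost each time its denominator grows.\<close>
  have "(\<Sum>n=M..N. s n / (real n)\<^sup>2) \<le> T N / (real N)\<^sup>2 + 2 * C * (1 / real M - 1 / real N)"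
    using True
  proof (induction N rule: dec_induct)
    case base
    have "s M \<le> T M" unfolding T_def using M s by (intro member_le_sum) auto
    then show ?case by (simp add: divide_right_mono)
  next
    case (step N)
    define x where "x = real N"
    have x1: "1 \<le> x" using step M by (simp add: x_def)
    have nz: "x \<noteq> 0" "x + 1 \<noteq> 0" using x1 by auto
    have TS: "T (Suc N) = T N + s (Suc N)" using M step by (simp add: T_def)
    have "T N * (1 / x\<^sup>2 - 1 / (x + 1)\<^sup>2) \<le> (C * x) * (1 / x\<^sup>2 - 1 / (x + 1)\<^sup>2)"
    proof (rule mult_right_mono)
      show "T N \<le> C * x" using S[of N] step M by (simp add: T_def x_def)
      have "1 / (x + 1)\<^sup>2 \<le> 1 / x\<^sup>2" using x1 by (intro divide_left_mono power_mono mult_pos_pos zero_less_power) auto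
      then show "0 \<le> 1 / x\<^sup>2 - 1 / (x + 1)\<^sup>2" by simp
    qed
    also have "\<dots> = C * ((2 * x + 1) / (x * (x + 1)\<^sup>2))"
    proof -
      have "1 / x\<^sup>2 - 1 / (x + 1)\<^sup>2 = (2 * x + 1) / (x\<^sup>2 * (x + 1)\<^sup>2)"
      proof -
        have "1 / x\<^sup>2 - 1 / (x + 1)\<^sup>2 = ((x + 1)\<^sup>2 - x\<^sup>2) / (x\<^sup>2 * (x + 1)\<^sup>2)"
          using nz by (simp add: diff_divide_distrib)
        also have "(x + 1)\<^sup>2 - x\<^sup>2 = 2 * x + 1" by (simp add: power2_eq_square algebra_simps)
        finally show ?thesis .
      qed
      then show ?thesis using x1 by (simp add: power2_eq_square)
    qed
    also have "\<dots> \<le> C * (2 * (1 / x - 1 / (x + 1)))"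
    proof (rule mult_left_mono[OF _ C])
      have "2 * (1 / x - 1 / (x + 1)) - (2 * x + 1) / (x * (x + 1)\<^sup>2) = 1 / (x * (x + 1)\<^sup>2)"
      proof -
        define D where "D = x * (x + 1)\<^sup>2"
        have "1 / x - 1 / (x + 1) = (x + 1) / D"
          unfolding D_def using nz by (simp add: divide_simps power2_eq_square)
        then have "2 * (1 / x - 1 / (x + 1)) - (2 * x + 1) / D = (2 * (x + 1) - (2 * x + 1)) / D"
          by (simp only: diff_divide_distrib times_divide_eq_right)
        then show ?thesis by (simp add: D_def)
      qed
      moreover have "0 \<le> 1 / (x * (x + 1)\<^sup>2)" using x1 by simp
      ultimately show "(2 * x + 1) / (x * (x + 1)\<^sup>2) \<le> 2 * (1 / x - 1 / (x + 1))" by linarith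
    qed
    finally have k: "T N / x\<^sup>2 - T N / (x + 1)\<^sup>2 \<le> 2 * C * (1 / x - 1 / (x + 1))" by (simp add: algebra_simps)
    have "(\<Sum>n=M..Suc N. s n / (real n)\<^sup>2) = (\<Sum>n=M..N. s n / (real n)\<^sup>2) + s (Suc N) / (x + 1)\<^sup>2"
      using step by (simp add: x_def add.commute)
    also have "\<dots> \<le> T N / x\<^sup>2 + 2 * C * (1 / real M - 1 / x) + s (Suc N) / (x + 1)\<^sup>2"
      using step.IH by (simp add: x_def)
    also have "\<dots> \<le> T (Suc N) / (x + 1)\<^sup>2 + 2 * C * (1 / real M - 1 / (x + 1))"
      using k by (simp add: TS add_divide_distrib algebra_simps)
    finally show ?case by (simp add: x_def add.commute)
  qed
  also have "T N / (real N)\<^sup>2 \<le> C * real N / (real N)\<^sup>2"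
    using S[of N] True M by (intro divide_right_mono) (auto simp: T_def)
  also have "\<dots> = C / real N" by (simp add: power2_eq_square)
  also have "C / real N + 2 * C * (1 / real M - 1 / real N) \<le> C / real M + 2 * C * (1 / real M)"
    using C True M by (intro add_mono mult_left_mono divide_left_mono) auto
  finally show ?thesis by simp
qed (use C M in auto)

text \<open>Two crude consequences of the asymptotics are kept: quartic growth from above, for the
  averaged pointwise bound, and \<open>n ^ 2\<close> from below beyond some \<open>n0\<close>, for
  the convergence of expansions.\<close>

locale beam_basis = beam_ode +
  fixes \<phi> :: "nat \<Rightarrow> real \<Rightarrow> complex" and \<mu> :: "nat \<Rightarrow> real" and n0 :: nat and Cm :: real
  assumes basis_ortho: "IR.ortho_fam {1..} \<phi>"
    and basis_eig: "\<And>n. 1 \<le> n \<Longrightarrow> eig (\<mu> n) (\<phi> n)"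
    and basis_total: "\<And>f x. f \<in> VC \<Longrightarrow> (\<And>n. 1 \<le> n \<Longrightarrow> ipw \<rho> f (\<phi> n) = 0) \<Longrightarrow> x \<in> {0..pi} \<Longrightarrow> f x = 0"
    and growth_low: "\<And>n. n0 \<le> n \<Longrightarrow> (real n)\<^sup>2 \<le> \<mu> n"
    and growth_up: "\<And>n. 1 \<le> n \<Longrightarrow> \<mu> n \<le> Cm * real n ^ 4" and Cm_pos: "0 < Cm"
begin

lemma basis_VC: "1 \<le> n \<Longrightarrow> \<phi> n \<in> VC" using eig_VC basis_eig by blast

definition CB :: real where "CB = 1 + 32 / elo * (Cm + K0)"

lemma CB_ge: "1 \<le> CB" unfolding CB_def using elo(1) K0_nonneg Cm_pos by simp

text \<open>\<open>cluster_bound\<close> at the energy level \<open>Cm * N ^ 4\<close>, whose fourth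
  root is linear in \<open>N\<close>.\<close>

lemma basis_sum_bound:
  assumes x: "x \<in> {0..pi}" and N: "1 \<le> N"
  shows "(\<Sum>n=1..N. (cmod (\<phi> n x))\<^sup>2) \<le> CB * real N"
proof -
  let ?s = "\<Sum>n=1..N. (cmod (\<phi> n x))\<^sup>2"
  have "?s ^ 4 \<le> 32 / elo * (Cm * real N ^ 4 + K0)"
  proof (rule cluster_bound[where \<nu> = \<mu>])
    show "IR.ortho_fam {1..N} \<phi>" using basis_ortho by (simp add: IR.ortho_fam_def)
    show "\<mu> n \<le> Cm * real N ^ 4" if "n \<in> {1..N}" for n
    proof -
      have "\<mu> n \<le> Cm * real n ^ 4" using growth_up that by simp
      also have "\<dots> \<le> Cm * real N ^ 4" using that Cm_pos by (intro mult_left_mono power_mono) auto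
      finally show ?thesis .
    qed
  qed (use x basis_eig K0_nonneg Cm_pos in auto)
  also have "\<dots> \<le> 32 / elo * (Cm * real N ^ 4 + K0 * real N ^ 4)"
  proof -
    have "1 \<le> real N ^ 4" using N by simp
    then have "K0 * 1 \<le> K0 * real N ^ 4" using K0_nonneg by (intro mult_left_mono)
    then show ?thesis using elo(1) by (intro mult_left_mono) auto
  qed
  also have "\<dots> \<le> CB ^ 1 * real N ^ 4"
  proof -
    have "y * (Cm * z + K0 * z) \<le> (1 + y * (Cm + K0)) * z" if "0 \<le> z" for y z :: real
      using that by (simp add: algebra_simps)
    from this[of "real N ^ 4" "32 / elo"] show ?thesis by (simp only: CB_def power_one_right zero_le_power of_nat_0_le_iff)
  qed
  also have "\<dots> \<le> CB ^ 4 * real N ^ 4" by (intro mult_right_mono power_increasing CB_ge) auto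
  finally have "?s ^ 4 \<le> (CB * real N) ^ 4" by (simp add: power_mult_distrib)
  then show ?thesis by (rule pow4_le_imp_le) (use CB_ge in simp)
qed

lemma basis_weighted_bound:
  assumes x: "x \<in> {0..pi}" and M: "1 \<le> M"
  shows "(\<Sum>n=M..N. (cmod (\<phi> n x))\<^sup>2 / (real n)\<^sup>2) \<le> 3 * CB / real M"
  by (rule abel_bound) (use basis_sum_bound[OF x] M CB_ge in auto)

text \<open>Moving the operator onto \<open>\<phi> n\<close> shows that \<open>\<mu> n\<close> times
  a coefficient of \<open>g\<close> is a coefficient of \<open>h\<close>, so beyond
  \<open>n0\<close> the coefficients of \<open>g\<close> gain a factor \<open>1 / n\<close>. Bessel
  for \<open>h\<close> and \<open>basis_weighted_bound\<close> then make the tails uniformly small,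
  and \<open>basis_total\<close> identifies the continuous limit with \<open>g\<close>.\<close>

lemma basis_expansion:
  assumes b: "bvp g g1 m m1 w" and w: "\<And>x. x \<in> {0..pi} \<Longrightarrow> w x = of_real (\<rho> x) * h x" and h: "h \<in> VC"
  shows "uniform_limit {0..pi} (\<lambda>N x. \<Sum>n=1..N. ipw \<rho> g (\<phi> n) * \<phi> n x) g sequentially"
proof -
  have gV: "g \<in> VC" using b chainD(1) by (auto simp: bvp_def)
  define c where "c n = ipw \<rho> g (\<phi> n)" for n
  have coef: "of_real (\<mu> n) * c n = ipw \<rho> h (\<phi> n)" if n: "1 \<le> n" for n
  proof -
    obtain f1 k k1 where e: "bvp (\<phi> n) f1 k k1 (\<lambda>x. of_real (\<rho> x) * (of_real (\<mu> n) * \<phi> n x))"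
      using basis_eig[OF n] unfolding eig_def by blast
    have "ipw \<rho> h (\<phi> n) = ipw (\<lambda>_. 1) w (\<phi> n)"
      unfolding ipw_rho[symmetric] by (unfold ipw_def, rule integral_cong) (simp add: w)
    also have "\<dots> = ipw (\<lambda>_. 1) g (\<lambda>x. of_real (\<rho> x) * (of_real (\<mu> n) * \<phi> n x))" by (rule bvp_symmetric[OF b e])
    also have "\<dots> = of_real (\<mu> n) * c n"
      unfolding c_def ipw_def by (simp add: mult_ac integral_mult_right[symmetric] del: integral_mult_right)
    finally show ?thesis by simp
  qed
  define S where "S N x = (\<Sum>n=1..N. c n * \<phi> n x)" for N x
  have SV: "S N \<in> VC" for N
    unfolding S_def using basis_VC by (intro IR.sum_mem) auto
  define R where "R = nr h"
  have R0: "0 \<le> R" unfolding R_def by (rule nr_nonneg[OF h])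
  have tail: "cmod (\<Sum>n=M..N. c n * \<phi> n x) \<le> R * sqrt (3 * CB / real M)"
    if M: "1 \<le> M" "n0 \<le> M" and x: "x \<in> {0..pi}" for M N x
  proof -
    have "cmod (\<Sum>n=M..N. c n * \<phi> n x) \<le> (\<Sum>n=M..N. cmod (ipw \<rho> h (\<phi> n)) * (cmod (\<phi> n x) / (real n)))"
    proof (rule order_trans[OF norm_sum sum_mono])
      fix n assume "n \<in> {M..N}"
      then have n: "1 \<le> n" "n0 \<le> n" using M by auto
      have n1: "real n \<le> \<mu> n"
      proof -
        have "real n \<le> (real n)\<^sup>2" using n by (simp add: power2_eq_square)
        then show ?thesis using growth_low[OF n(2)] by linarith
      qed
      have "real n * cmod (c n) \<le> cmod (ipw \<rho> h (\<phi> n))"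
        unfolding coef[OF n(1), symmetric] using n1 n by (simp add: norm_mult mult_right_mono)
      then have "cmod (c n) \<le> cmod (ipw \<rho> h (\<phi> n)) / real n" using n by (simp add: field_simps)
      from mult_right_mono[OF this, of "cmod (\<phi> n x)"]
      show "cmod (c n * \<phi> n x) \<le> cmod (ipw \<rho> h (\<phi> n)) * (cmod (\<phi> n x) / real n)" by (simp add: norm_mult)
    qed
    also have "\<dots> \<le> sqrt ((\<Sum>n=M..N. (cmod (ipw \<rho> h (\<phi> n)))\<^sup>2) * (\<Sum>n=M..N. (cmod (\<phi> n x) / real n)\<^sup>2))"
      by (intro real_le_rsqrt Cauchy_Schwarz_ineq_sum)
    also have "\<dots> \<le> sqrt (R\<^sup>2 * (3 * CB / real M))"
    proof (intro real_sqrt_le_mono mult_mono)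
      show "(\<Sum>n=M..N. (cmod (ipw \<rho> h (\<phi> n)))\<^sup>2) \<le> R\<^sup>2"
        unfolding R_def nr_sq[OF h] using M basis_ortho by (intro IR.bessel h) (auto simp: IR.ortho_fam_def)
      show "(\<Sum>n=M..N. (cmod (\<phi> n x) / real n)\<^sup>2) \<le> 3 * CB / real M"
        using basis_weighted_bound[OF x M(1), of N] by (simp add: power_divide)
    qed (auto intro!: sum_nonneg)
    also have "\<dots> = R * sqrt (3 * CB / real M)"
      by (simp only: real_sqrt_mult[of "R\<^sup>2"] real_sqrt_abs abs_of_nonneg[OF R0])
    finally show ?thesis .
  qed
  have cauchy: "uniformly_Cauchy_on {0..pi} S"
    unfolding uniformly_Cauchy_on_def
  proof (intro allI impI)
    fix e :: real assume e: "0 < e"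
    have "(\<lambda>M. R * sqrt (3 * CB * inverse (real (Suc M)))) \<longlonglongrightarrow> R * sqrt (3 * CB * 0)"
      by (intro tendsto_intros LIMSEQ_inverse_real_of_nat)
    then have "(\<lambda>M. R * sqrt (3 * CB * inverse (real (Suc M)))) \<longlonglongrightarrow> 0" by simp
    from order_tendstoD(2)[OF this e] obtain M0 where
      M0: "\<And>M. M \<ge> M0 \<Longrightarrow> R * sqrt (3 * CB * inverse (real (Suc M))) < e"
      by (auto simp: eventually_sequentially)
    have main: "dist (S m x) (S n x) < e" if x: "x \<in> {0..pi}" and mn: "max M0 n0 \<le> m" "m \<le> n" for x m n
    proof -
      have "S n x = S m x + (\<Sum>k=Suc m..n. c k * \<phi> k x)"
        using sum.ub_add_nat[of 1 m "\<lambda>k. c k * \<phi> k x" "n - m"] mn by (simp add: S_def)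
      then have "dist (S m x) (S n x) = cmod (\<Sum>k=Suc m..n. c k * \<phi> k x)" by (simp add: dist_norm)
      also have "\<dots> \<le> R * sqrt (3 * CB / real (Suc m))" by (rule tail) (use mn x in auto)
      also have "\<dots> < e" using M0[of m] mn by (simp add: divide_inverse)
      finally show ?thesis .
    qed
    show "\<exists>M. \<forall>x\<in>{0..pi}. \<forall>m\<ge>M. \<forall>n\<ge>M. dist (S m x) (S n x) < e"
    proof (intro exI[of _ "max M0 n0"] ballI allI impI)
      fix x m n assume "x \<in> {0..pi}" "m \<ge> max M0 n0" "n \<ge> max M0 n0"
      then show "dist (S m x) (S n x) < e"
        using main[of x m n] main[of x n m] by (cases "m \<le> n") (auto simp: dist_commute)
    qed
  qed
  then obtain s where s: "uniform_limit {0..pi} S s sequentially"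
    using Cauchy_uniformly_convergent[OF cauchy] by (auto simp: uniformly_convergent_on_def)
  have sV: "s \<in> VC" unfolding VC_def
    using uniform_limit_theorem[OF _ s] SV by (auto simp: VC_def)
  have lim: "(\<lambda>N. nr (\<lambda>x. S N x - s x)) \<longlonglongrightarrow> 0"
  proof (rule uniform_nr_tendsto[OF SV sV])
    fix e :: real assume "0 < e"
    then have "\<forall>\<^sub>F n in sequentially. \<forall>x\<in>{0..pi}. dist (S n x) (s x) < e" using s unfolding uniform_limit_iff by blast
    then show "\<exists>N. \<forall>n x. n \<ge> N \<and> x \<in> {0..pi} \<longrightarrow> norm (S n x - s x) < e"
      unfolding eventually_sequentially dist_norm by blast
  qed
  have "s x = g x" if x: "x \<in> {0..pi}" for x
  proof -
    have "(\<lambda>x. s x - g x) x = 0"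
    proof (rule basis_total[OF IR.diff_mem[OF sV gV] _ x])
      fix k :: nat assume k: "1 \<le> k"
      have "(\<lambda>N. ipw \<rho> (S N) (\<phi> k)) \<longlonglongrightarrow> ipw \<rho> s (\<phi> k)" by (rule ip_tendsto[OF SV sV basis_VC[OF k] lim])
      note l1 = this
      have "\<forall>\<^sub>F N in sequentially. ipw \<rho> (S N) (\<phi> k) = c k"
        unfolding eventually_sequentially
      proof (intro exI[of _ k] allI impI)
        fix N assume "k \<le> N"
        then show "ipw \<rho> (S N) (\<phi> k) = c k"
          unfolding S_def using basis_ortho k by (intro IR.ip_sum_ortho) (auto simp: IR.ortho_fam_def)
      qed
      then have "(\<lambda>N. ipw \<rho> (S N) (\<phi> k)) \<longlonglongrightarrow> c k" by (rule tendsto_eventually)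
      then have "ipw \<rho> s (\<phi> k) = c k" by (rule LIMSEQ_unique[OF l1])
      then show "ipw \<rho> (\<lambda>x. s x - g x) (\<phi> k) = 0"
        using IR.ip_diff[OF sV gV basis_VC[OF k]] by (simp add: c_def)
    qed
    then show ?thesis by simp
  qed
  then have "uniform_limit {0..pi} S g sequentially"
    by (rule iffD1[OF uniform_limit_cong'[OF refl] s])
  then show ?thesis unfolding S_def c_def .
qed

end

section \<open>Regularity of the coefficients\<close>

text \<open>A class closed under differentiation that contains the standard bump
  (\<open>P = 1\<close>, \<open>k = 0\<close>): a derivative replaces the polynomial and raises the
  power of \<open>(x - a) * (b - x)\<close> by two, so every iterate of \<open>deriv\<close> has
  this shape.\<close>

definition bump :: "real \<Rightarrow> real \<Rightarrow> real poly \<Rightarrow> nat \<Rightarrow> real \<Rightarrow> real" where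
  "bump a b P k x = (if a < x \<and> x < b
     then poly P x / ((x - a) * (b - x)) ^ k * exp (- 1 / ((x - a) * (b - x))) else 0)"

text \<open>Compares with a single term, of degree \<open>k + 2\<close>, of the exponential series
  at \<open>1 / q\<close>. The surplus \<open>q ^ 2\<close> is what yields derivative zero at the
  ends of the support.\<close>

lemma exp_inverse_le:
  assumes "0 < (q::real)" shows "exp (- 1 / q) / q ^ k \<le> fact (k + 2) * q\<^sup>2"
proof -
  have p: "(1 / q) ^ (k + 2) / fact (k + 2) \<le> exp (1 / q)"
    using summable_exp[of "1 / q"] assms
    unfolding exp_def
    by (intro order_trans[OF _ sum_le_suminf[OF summable_exp_generic, of "{k + 2}"]])
       (auto simp: divide_inverse mult.commute)
  have "exp (- 1 / q) = 1 / exp (1 / q)" by (simp add: exp_minus divide_inverse)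
  also have "\<dots> \<le> 1 / ((1 / q) ^ (k + 2) / fact (k + 2))"
    using p assms by (intro divide_left_mono mult_pos_pos) auto
  also have "\<dots> = fact (k + 2) * q ^ (k + 2)" using assms by (simp add: power_divide)
  finally have "exp (- 1 / q) / q ^ k \<le> fact (k + 2) * q ^ (k + 2) / q ^ k"
    using assms by (intro divide_right_mono) auto
  also have "\<dots> = fact (k + 2) * q\<^sup>2" using assms by (simp add: power_add power2_eq_square)
  finally show ?thesis .
qed

lemma bump_quadratic:
  assumes "a < b"
  obtains C where "\<And>x. \<bar>bump a b P k x\<bar> \<le> C * ((x - a) * (b - x))\<^sup>2" "0 \<le> C"
proof -
  have "compact (poly P ` {a..b})" by (intro compact_continuous_image continuous_intros) auto
  then have "bounded (poly P ` {a..b})" by (rule compact_imp_bounded)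
  then obtain M where "\<forall>y\<in>poly P ` {a..b}. norm y \<le> M" unfolding bounded_iff by blast
  then have M: "\<And>x. x \<in> {a..b} \<Longrightarrow> \<bar>poly P x\<bar> \<le> M" by auto
  have M0: "0 \<le> M" using M[of a] assms by (auto intro: order_trans[OF abs_ge_zero])
  have "\<bar>bump a b P k x\<bar> \<le> (M * fact (k + 2)) * ((x - a) * (b - x))\<^sup>2" for x
  proof (cases "a < x \<and> x < b")
    case True
    define q where "q = (x - a) * (b - x)"
    have q: "0 < q" unfolding q_def using True by simp
    have "\<bar>bump a b P k x\<bar> = \<bar>poly P x\<bar> * (exp (- 1 / q) / q ^ k)"
      using True q by (simp add: bump_def q_def[symmetric] abs_mult)
    also have "\<dots> \<le> M * (fact (k + 2) * q\<^sup>2)"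
      using M[of x] True M0 q by (intro mult_mono exp_inverse_le) auto
    finally show ?thesis by (simp add: q_def mult.assoc)
  next
    case False
    then have "bump a b P k x = 0" by (auto simp: bump_def)
    moreover have "0 \<le> (M * fact (k + 2)) * ((x - a) * (b - x))\<^sup>2"
      using M0 by (intro mult_nonneg_nonneg) auto
    ultimately show ?thesis by simp
  qed
  then show thesis using that M0 by (metis mult_nonneg_nonneg fact_ge_zero)
qed

lemma deriv_zero_quadratic:
  assumes "\<And>y. \<bar>f y\<bar> \<le> C * ((y - x) * g y)\<^sup>2" "isCont g x" "0 \<le> C"
  shows "(f has_real_derivative 0) (at x)"
proof -
  have f0: "f x = 0" using assms(1)[of x] by simp
  have "((\<lambda>y. (f y - f x) / (y - x)) \<longlongrightarrow> 0) (at x)"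
  proof (rule Lim_null_comparison)
    have "((\<lambda>y. C * \<bar>y - x\<bar> * (g y)\<^sup>2) \<longlongrightarrow> C * \<bar>x - x\<bar> * (g x)\<^sup>2) (at x)"
      using assms(2) by (intro tendsto_intros) (auto simp: isCont_def)
    then show "((\<lambda>y. C * \<bar>y - x\<bar> * (g y)\<^sup>2) \<longlongrightarrow> 0) (at x)" by simp
    show "\<forall>\<^sub>F y in at x. norm ((f y - f x) / (y - x)) \<le> C * \<bar>y - x\<bar> * (g y)\<^sup>2"
      unfolding eventually_at_filter
    proof (rule always_eventually, intro allI impI)
      fix y assume "y \<noteq> x"
      then have p: "0 < \<bar>y - x\<bar>" by simp
      have "norm ((f y - f x) / (y - x)) = \<bar>f y\<bar> / \<bar>y - x\<bar>" using f0 by simp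
      also have "\<dots> \<le> (C * ((y - x) * g y)\<^sup>2) / \<bar>y - x\<bar>" using p by (intro divide_right_mono assms) auto
      also have "\<dots> = C * \<bar>y - x\<bar> * (g y)\<^sup>2"
      proof -
        have "((y - x) * g y)\<^sup>2 = \<bar>y - x\<bar> * (\<bar>y - x\<bar> * (g y)\<^sup>2)"
          by (simp add: power_mult_distrib power2_eq_square flip: abs_mult)
        then show ?thesis using p by simp
      qed
      finally show "norm ((f y - f x) / (y - x)) \<le> C * \<bar>y - x\<bar> * (g y)\<^sup>2" .
    qed
  qed
  then show ?thesis by (simp add: has_field_derivative_iff)
qed

text \<open>Inside, this is the quotient rule. At \<open>a\<close> and \<open>b\<close> the
  quadratic bound gives derivative zero, which is also the value of the formula there.\<close>

lemma bump_deriv: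
  assumes ab: "a < b"
  shows "\<exists>Q. \<forall>x. (bump a b P k has_real_derivative bump a b Q (k + 2) x) (at x)"
proof -
  define q where "q = [:- a, 1:] * [:b, - 1:]"
  \<comment> \<open>Numerator of the derivative of \<open>P / q ^ k * exp (- 1 / q)\<close> over the
    denominator \<open>q ^ (k + 2)\<close>.\<close>
  define Q where "Q = pderiv P * q * q - smult (real k) (P * pderiv q * q) + P * pderiv q"
  have pq: "poly q x = (x - a) * (b - x)" for x by (simp add: q_def algebra_simps)
  obtain C where C: "\<And>x. \<bar>bump a b P k x\<bar> \<le> C * ((x - a) * (b - x))\<^sup>2" "0 \<le> C"
    using bump_quadratic[OF ab, of P k] by blast
  have "(bump a b P k has_real_derivative bump a b Q (k + 2) x) (at x)" for x
  proof -
    consider "a < x \<and> x < b" | "x < a" | "b < x" | "x = a" | "x = b" by linarith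
    then show ?thesis
    proof cases
      case 1
      define z where "z = poly q x"
      define p where "p = poly P x" define p' where "p' = poly (pderiv P) x" define z' where "z' = poly (pderiv q) x"
      have z: "0 < z" unfolding z_def pq using 1 by simp
      have "((\<lambda>x. poly P x / poly q x ^ k * exp (- 1 / poly q x)) has_real_derivative
         ((p' * z ^ k - p * (real k * z ^ (k - 1) * z')) / (z ^ k * z ^ k) * exp (- 1 / z)
          + p / z ^ k * (exp (- 1 / z) * (z' / z\<^sup>2)))) (at x)"
      proof -
        have 1: "((\<lambda>x. poly P x / poly q x ^ k) has_real_derivative
            (p' * z ^ k - p * (real k * z ^ (k - 1) * z')) / (z ^ k * z ^ k)) (at x)"
          using z unfolding z_def p_def p'_def z'_def by (auto intro!: derivative_eq_intros)
        have 2: "((\<lambda>x. exp (- 1 / poly q x)) has_real_derivative exp (- 1 / z) * (z' / z\<^sup>2)) (at x)"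
          using z unfolding z_def z'_def by (auto intro!: derivative_eq_intros simp: power2_eq_square)
        show ?thesis using DERIV_mult[OF 1 2] unfolding p_def z_def by (simp only: mult_ac)
      qed
      moreover have "(p' * z ^ k - p * (real k * z ^ (k - 1) * z')) / (z ^ k * z ^ k) * exp (- 1 / z)
          + p / z ^ k * (exp (- 1 / z) * (z' / z\<^sup>2)) = poly Q x / z ^ (k + 2) * exp (- 1 / z)"
      proof -
        have e: "real k * z ^ (k - 1) = real k * z ^ k / z" using z by (cases k) auto
        have pQ: "poly Q x = p' * z * z - real k * (p * z' * z) + p * z'"
          by (simp add: Q_def z_def p_def p'_def z'_def)
        have "(p' * z ^ k - p * (real k * z ^ (k - 1) * z')) / (z ^ k * z ^ k) + p / z ^ k * (z' / z\<^sup>2)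
           = poly Q x / z ^ (k + 2)"
          unfolding e pQ using z by (simp add: field_simps power_add power2_eq_square)
        from arg_cong[OF this, of "\<lambda>t. t * exp (- 1 / z)"] show ?thesis by (simp add: algebra_simps)
      qed
      ultimately have d: "((\<lambda>x. poly P x / poly q x ^ k * exp (- 1 / poly q x)) has_real_derivative
         poly Q x / z ^ (k + 2) * exp (- 1 / z)) (at x)" by simp
      have "(bump a b P k has_real_derivative poly Q x / z ^ (k + 2) * exp (- 1 / z)) (at x)"
        by (rule has_field_derivative_transform_within_open[OF d, of "{a<..<b}"])
          (use 1 in \<open>auto simp: bump_def pq\<close>)
      moreover have "bump a b Q (k + 2) x = poly Q x / z ^ (k + 2) * exp (- 1 / z)"
        using 1 by (simp add: bump_def z_def pq)
      ultimately show ?thesis by simp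
    next
      case 2
      have "(bump a b P k has_real_derivative 0) (at x)"
        by (rule has_field_derivative_transform_within_open[of "\<lambda>_. 0" 0 x "{..<a}"]) (use 2 in \<open>auto simp: bump_def\<close>)
      then show ?thesis using 2 by (simp add: bump_def)
    next
      case 3
      have "(bump a b P k has_real_derivative 0) (at x)"
        by (rule has_field_derivative_transform_within_open[of "\<lambda>_. 0" 0 x "{b<..}"]) (use 3 in \<open>auto simp: bump_def\<close>)
      then show ?thesis using 3 by (simp add: bump_def)
    next
      case 4
      have "(bump a b P k has_real_derivative 0) (at x)"
        by (rule deriv_zero_quadratic[of _ C _ "\<lambda>y. b - y"]) (use C 4 in auto)
      then show ?thesis using 4 by (simp add: bump_def)
    next
      case 5
      have "(bump a b P k has_real_derivative 0) (at x)"
      proof (rule deriv_zero_quadratic[of _ C _ "\<lambda>y. a - y"])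
        fix y
        have "((y - x) * (a - y))\<^sup>2 = ((y - a) * (b - y))\<^sup>2" using 5 by (simp add: power2_eq_square algebra_simps)
        then show "\<bar>bump a b P k y\<bar> \<le> C * ((y - x) * (a - y))\<^sup>2" using C(1)[of y] by simp
      qed (use C in auto)
      then show ?thesis using 5 by (simp add: bump_def)
    qed
  qed
  then show ?thesis by blast
qed

lemma bump_deriv_iter:
  assumes "a < b" shows "\<exists>Q m. (deriv ^^ k) (bump a b P 0) = bump a b Q m"
proof (induction k)
  case 0 show ?case by auto
next
  case (Suc k)
  then obtain Q m where Q: "(deriv ^^ k) (bump a b P 0) = bump a b Q m" by blast
  obtain Q' where "\<forall>x. (bump a b Q m has_real_derivative bump a b Q' (m + 2) x) (at x)"
    using bump_deriv[OF assms] by blast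
  then have "deriv (bump a b Q m) = bump a b Q' (m + 2)" by (auto intro: DERIV_imp_deriv)
  then show ?case using Q by auto
qed

lemma bump_test:
  assumes "0 < a" "a < b" "b < pi" shows "test_function_pi (bump a b 1 0)"
  unfolding test_function_pi_def
proof (intro conjI allI)
  fix k x
  obtain Q m where Q: "(deriv ^^ k) (bump a b 1 0) = bump a b Q m" using bump_deriv_iter[OF assms(2)] by blast
  show "(deriv ^^ k) (bump a b 1 0) differentiable (at x)"
    unfolding Q using bump_deriv[OF assms(2), of Q m] real_differentiable_def by blast
  show "\<exists>K. compact K \<and> K \<subseteq> {0<..<pi} \<and> (\<forall>x. x \<notin> K \<longrightarrow> bump a b 1 0 x = 0)"
    using assms by (intro exI[of _ "{a..b}"]) (auto simp: bump_def)
qed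

lemma bump_pos: "a < x \<Longrightarrow> x < b \<Longrightarrow> 0 < bump a b 1 0 x" and bump_nonneg: "0 \<le> bump a b 1 0 x"
  and bump_outside: "x \<notin> {a<..<b} \<Longrightarrow> bump a b 1 0 x = 0"
  by (auto simp: bump_def)

section \<open>Calculus of test functions\<close>

lemma test_diff: "test_function_pi f \<Longrightarrow> ((deriv ^^ k) f) differentiable (at x)"
  by (simp add: test_function_pi_def)

lemma test_DERIV: "test_function_pi f \<Longrightarrow> ((deriv ^^ k) f has_real_derivative (deriv ^^ Suc k) f x) (at x)"
  using test_diff[of f k x] DERIV_deriv_iff_real_differentiable by simp

lemma test_DERIV0: "test_function_pi f \<Longrightarrow> (f has_real_derivative deriv f x) (at x)"
  using test_DERIV[of f 0 x] by simp

lemma test_cont: "test_function_pi f \<Longrightarrow> continuous_on S ((deriv ^^ k) f)"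
  using test_DERIV[of f k] by (intro continuous_at_imp_continuous_on) (blast intro: DERIV_isCont)

lemma test_zero: 
  assumes "test_function_pi f" "x \<notin> {0<..<pi}" shows "(deriv ^^ k) f x = 0"
proof -
  obtain K where K: "compact K" "K \<subseteq> {0<..<pi}" "\<And>x. x \<notin> K \<Longrightarrow> f x = 0"
    using assms unfolding test_function_pi_def by blast
  have oK: "open (- K)" using compact_imp_closed[OF K(1)] by auto
  have "\<forall>x. x \<notin> K \<longrightarrow> (deriv ^^ k) f x = 0"
  proof (induction k)
    case (Suc k)
    show ?case
    proof (intro allI impI)
      fix x assume x: "x \<notin> K"
      have "((deriv ^^ k) f has_real_derivative 0) (at x)"
        by (rule has_field_derivative_transform_within_open[of "\<lambda>_. 0" 0 x "- K"])
          (use x Suc oK in auto)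
      then show "(deriv ^^ Suc k) f x = 0" by (simp add: DERIV_imp_deriv)
    qed
  qed (use K in auto)
  then show ?thesis using K assms by blast
qed

lemma test_lin_deriv:
  assumes "test_function_pi f" "test_function_pi g"
  shows "(deriv ^^ k) (\<lambda>x. f x + c * g x) = (\<lambda>x. (deriv ^^ k) f x + c * (deriv ^^ k) g x)"
proof (induction k)
  case (Suc k)
  have "deriv (\<lambda>x. (deriv ^^ k) f x + c * (deriv ^^ k) g x) x = (deriv ^^ Suc k) f x + c * (deriv ^^ Suc k) g x" for x
    by (rule DERIV_imp_deriv) (intro DERIV_add DERIV_cmult test_DERIV assms)
  then show ?case using Suc by auto
qed simp

lemma test_lin:
  assumes "test_function_pi f" "test_function_pi g"
  shows "test_function_pi (\<lambda>x. f x + c * g x)"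
proof -
  obtain K where K: "compact K" "K \<subseteq> {0<..<pi}" "\<forall>x. x \<notin> K \<longrightarrow> f x = 0"
    using assms(1) unfolding test_function_pi_def by blast
  obtain L where L: "compact L" "L \<subseteq> {0<..<pi}" "\<forall>x. x \<notin> L \<longrightarrow> g x = 0"
    using assms(2) unfolding test_function_pi_def by blast
  show ?thesis
    unfolding test_function_pi_def test_lin_deriv[OF assms]
    using K L test_diff[OF assms(1)] test_diff[OF assms(2)]
    by (intro conjI allI exI[of _ "K \<union> L"] differentiable_add differentiable_mult differentiable_const) (auto simp: compact_Un)
qed

text \<open>The primitive from \<open>0\<close> vanishes to the left of the support, and the zero
  integral makes it vanish to the right as well.\<close>

lemma test_antideriv:
  assumes f: "test_function_pi f" and i: "integral {0..pi} f = 0"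
  obtains F where "test_function_pi F" "deriv F = f"
proof -
  obtain K where K: "compact K" "K \<subseteq> {0<..<pi}" "\<And>x. x \<notin> K \<Longrightarrow> f x = 0"
    using f unfolding test_function_pi_def by blast
  obtain a b where ab: "0 < a" "a < b" "b < pi" "K \<subseteq> {a..b}"
  proof (cases "K = {}")
    case True then show ?thesis using that[of 1 2] pi_gt3 by auto
  next
    case False
    obtain u v where uv: "u \<in> K" "\<forall>x\<in>K. u \<le> x" "v \<in> K" "\<forall>x\<in>K. x \<le> v"
      using compact_attains_inf[OF K(1) False] compact_attains_sup[OF K(1) False] by blast
    have "u \<in> {0<..<pi}" "v \<in> {0<..<pi}" "u \<le> v" using uv K by auto
    \<comment> \<open>The right end is moved halfway towards \<open>pi\<close>, so that
      \<open>a < b\<close> even if the support is a single point.\<close>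
    then show ?thesis using uv that[of u "(v + pi) / 2"] by force
  qed
  define F where "F x = integral {0..x} f" for x
  have cf: "continuous_on S f" for S using test_cont[OF f, of S 0] by simp
  have Fl: "F x = 0" if "x < a" for x
  proof -
    have "integral {0..x} f = integral {0..x} (\<lambda>_. 0)" by (intro integral_cong K(3)) (use that ab in auto)
    then show ?thesis by (simp add: F_def)
  qed
  have Fr: "F x = 0" if "b < x" for x
  proof -
    have z: "integral {b..y} f = 0" if "b \<le> y" for y
    proof -
      have "integral {b..y} f = integral {b..y} (\<lambda>_. 0)"
        by (rule integral_spike[of "{b}"]) (auto intro!: K(3) dest!: subsetD[OF ab(4)])
      then show ?thesis by simp
    qed
    have s: "integral {0..y} f = integral {0..b} f" if "b \<le> y" for y
    proof -
      have "0 \<le> b" using ab by simp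
      from Henstock_Kurzweil_Integration.integral_combine[OF this that integrable_continuous_interval[OF cf]]
      show ?thesis using z[OF that] by simp
    qed
    show ?thesis unfolding F_def using s[of x] s[of pi] that ab i by simp
  qed
  have D: "(F has_real_derivative f x) (at x)" for x
  proof -
    consider "x < a" | "b < x" | "a \<le> x \<and> x \<le> b" by linarith
    then show ?thesis
    proof cases
      case 1
      have "(F has_real_derivative 0) (at x)"
        by (rule has_field_derivative_transform_within_open[of "\<lambda>_. 0" 0 x "{..<a}"]) (use 1 Fl in auto)
      moreover have "f x = 0" using 1 ab by (intro K(3)) auto
      ultimately show ?thesis by simp
    next
      case 2
      have "(F has_real_derivative 0) (at x)"
        by (rule has_field_derivative_transform_within_open[of "\<lambda>_. 0" 0 x "{b<..}"]) (use 2 Fr in auto)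
      moreover have "f x = 0" using 2 ab by (intro K(3)) auto
      ultimately show ?thesis by simp
    next
      case 3
      then have x: "x \<in> {0<..<pi}" using ab by auto
      have "(F has_real_derivative f x) (at x within {0..pi})"
        unfolding F_def[abs_def] by (rule integral_has_real_derivative[OF cf]) (use x in auto)
      then show ?thesis using x by (simp add: at_within_Icc_at)
    qed
  qed
  have dF: "deriv F = f" using D by (auto intro: DERIV_imp_deriv)
  have "((deriv ^^ k) F) differentiable (at x)" for k x
  proof (cases k)
    case 0 then show ?thesis using D real_differentiable_def by auto
  next
    case (Suc j)
    then have "(deriv ^^ k) F = (deriv ^^ j) f" by (simp add: funpow_swap1 dF)
    then show ?thesis using test_diff[OF f] by simp
  qed
  moreover have "F x = 0" if "x \<notin> {a..b}" for x using Fl Fr that by force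
  ultimately have "test_function_pi F"
    unfolding test_function_pi_def using ab by (intro conjI allI exI[of _ "{a..b}"]) auto
  then show thesis using that dF by blast
qed

lemma test_ibp:
  assumes f: "test_function_pi f" and w: "\<And>x. x \<in> {0..pi} \<Longrightarrow> (w has_real_derivative w' x) (at x within {0..pi})"
    and c: "continuous_on {0..pi} w'"
  shows "integral {0..pi} (\<lambda>x. w x * (deriv ^^ Suc k) f x) = - integral {0..pi} (\<lambda>x. w' x * (deriv ^^ k) f x)"
proof -
  have cw: "continuous_on {0..pi} w" using w by (intro DERIV_continuous_on) auto
  have "((\<lambda>x. w x * (deriv ^^ Suc k) f x + w' x * (deriv ^^ k) f x) has_integral
     (w pi * (deriv ^^ k) f pi - w 0 * (deriv ^^ k) f 0)) {0..pi}"
  proof (rule fundamental_theorem_of_calculus)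
    fix x assume x: "x \<in> {0..pi}"
    show "((\<lambda>x. w x * (deriv ^^ k) f x) has_vector_derivative w x * (deriv ^^ Suc k) f x + w' x * (deriv ^^ k) f x) (at x within {0..pi})"
      unfolding has_real_derivative_iff_has_vector_derivative[symmetric]
      using DERIV_mult[OF w[OF x] has_field_derivative_at_within[OF test_DERIV[OF f, of k x]]]
      by (simp add: add.commute mult.commute)
  qed simp
  then have "((\<lambda>x. w x * (deriv ^^ Suc k) f x + w' x * (deriv ^^ k) f x) has_integral 0) {0..pi}"
    using test_zero[OF f] by simp
  then have "integral {0..pi} (\<lambda>x. w x * (deriv ^^ Suc k) f x + w' x * (deriv ^^ k) f x) = 0" by (rule integral_unique)
  moreover have "(\<lambda>x. w x * (deriv ^^ Suc k) f x) integrable_on {0..pi}"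
    by (intro integrable_continuous_interval continuous_on_mult cw test_cont f)
  moreover have "(\<lambda>x. w' x * (deriv ^^ k) f x) integrable_on {0..pi}"
    by (intro integrable_continuous_interval continuous_on_mult c test_cont f)
  ultimately show ?thesis by (simp add: integral_add)
qed

text \<open>The du Bois-Reymond argument: subtracting a multiple of a fixed bump makes a test
  function mean-free, hence the derivative of a test function, to which \<open>z\<close> applies.
  The constant \<open>c\<close> is the pairing for the bump divided by its integral.\<close>

lemma weak_step:
  assumes w: "continuous_on {0..pi} w"
    and z: "\<And>f. test_function_pi f \<Longrightarrow> integral {0..pi} (\<lambda>x. w x * (deriv ^^ Suc k) f x) = 0"
  obtains c where "\<And>f. test_function_pi f \<Longrightarrow> integral {0..pi} (\<lambda>x. w x * (deriv ^^ k) f x) = c * integral {0..pi} f"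
proof -
  define \<theta> where "\<theta> = bump 1 2 1 0"
  have t: "test_function_pi \<theta>" unfolding \<theta>_def using pi_gt3 by (intro bump_test) auto
  have ct: "continuous_on {0..pi} \<theta>" using test_cont[OF t, of _ 0] by simp
  define I where "I = integral {0..pi} \<theta>"
  have I: "I \<noteq> 0"
  proof
    assume "I = 0"
    then have "\<theta> (3/2) = 0" unfolding I_def
      using pi_gt3 by (intro continuous_nonneg_integral_zero[OF ct]) (auto simp: \<theta>_def bump_nonneg)
    then show False using bump_pos[of 1 "3/2" 2] by (simp add: \<theta>_def)
  qed
  define c where "c = integral {0..pi} (\<lambda>x. w x * (deriv ^^ k) \<theta> x) / I"
  have "integral {0..pi} (\<lambda>x. w x * (deriv ^^ k) f x) = c * integral {0..pi} f" if f: "test_function_pi f" for f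
  proof -
    define s where "s = - integral {0..pi} f / I"
    have g: "test_function_pi (\<lambda>x. f x + s * \<theta> x)" by (rule test_lin[OF f t])
    have cf: "continuous_on {0..pi} f" using test_cont[OF f, of _ 0] by simp
    have "integral {0..pi} (\<lambda>x. f x + s * \<theta> x) = integral {0..pi} f + s * I"
      unfolding I_def using cf ct by (subst integral_add) (auto intro!: integrable_continuous_interval continuous_intros)
    also have "\<dots> = 0" using I by (simp add: s_def)
    finally obtain F where F: "test_function_pi F" "deriv F = (\<lambda>x. f x + s * \<theta> x)"
      using test_antideriv[OF g] by blast
    have "(deriv ^^ Suc k) F = (\<lambda>x. (deriv ^^ k) f x + s * (deriv ^^ k) \<theta> x)"
      using test_lin_deriv[OF f t, of k s] by (simp add: funpow_swap1 F(2))
    then have "integral {0..pi} (\<lambda>x. w x * ((deriv ^^ k) f x + s * (deriv ^^ k) \<theta> x)) = 0" using z[OF F(1)] by simp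
    moreover have "integral {0..pi} (\<lambda>x. w x * ((deriv ^^ k) f x + s * (deriv ^^ k) \<theta> x)) =
       integral {0..pi} (\<lambda>x. w x * (deriv ^^ k) f x + s * (w x * (deriv ^^ k) \<theta> x))"
      by (simp add: algebra_simps)
    moreover have "\<dots> = integral {0..pi} (\<lambda>x. w x * (deriv ^^ k) f x) + s * integral {0..pi} (\<lambda>x. w x * (deriv ^^ k) \<theta> x)"
      using w test_cont[OF f] test_cont[OF t]
      by (subst integral_add) (auto intro!: integrable_continuous_interval continuous_intros)
    ultimately show ?thesis using I by (simp add: s_def c_def field_simps)
  qed
  then show thesis using that by blast
qed

text \<open>A bump concentrated where the continuous function \<open>w\<close> has one sign would
  give a nonzero integral.\<close>

lemma weak_zero:
  assumes w: "continuous_on {0..pi} w"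
    and z: "\<And>f. test_function_pi f \<Longrightarrow> integral {0..pi} (\<lambda>x. w x * f x) = 0" and x: "x \<in> {0<..<pi}"
  shows "w x = (0::real)"
proof (rule ccontr)
  have pos: False if u: "continuous_on {0..pi} u" "0 < u x"
    and zu: "\<And>f. test_function_pi f \<Longrightarrow> integral {0..pi} (\<lambda>x. u x * f x) = 0" for u :: "real \<Rightarrow> real"
  proof -
    have "isCont u x" using continuous_on_interior[OF u(1), of x] x by simp
    then obtain d where d: "0 < d" "\<And>y. \<bar>y - x\<bar> < d \<Longrightarrow> \<bar>u y - u x\<bar> < u x"
      using u(2) unfolding continuous_at_eps_delta by (metis real_norm_def dist_real_def)
    define e where "e = min d (min x (pi - x)) / 2"
    have e: "0 < e" "e < d" "e < x" "e < pi - x" unfolding e_def using d x by auto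
    define f where "f = bump (x - e) (x + e) 1 0"
    have t: "test_function_pi f" unfolding f_def using e by (intro bump_test) auto
    have "continuous_on {0..pi} (\<lambda>y. u y * f y)" using test_cont[OF t, of _ 0] u by (auto intro!: continuous_intros)
    moreover have "0 \<le> u y * f y" for y
    proof (cases "y \<in> {x - e<..<x + e}")
      case True
      then have "\<bar>u y - u x\<bar> < u x" using e by (intro d) auto
      then show ?thesis unfolding f_def by (intro mult_nonneg_nonneg bump_nonneg) auto
    next
      case False then show ?thesis by (simp add: f_def bump_outside)
    qed
    ultimately have "u x * f x = 0"
      using continuous_nonneg_integral_zero[of "\<lambda>y. u y * f y" x] zu[OF t] x by auto
    moreover have "0 < f x" unfolding f_def using e by (intro bump_pos) auto
    ultimately show False using u(2) by simp
  qed
  assume "w x \<noteq> 0"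
  then consider "0 < w x" | "0 < - w x" by linarith
  then show False
  proof cases
    case 1 then show ?thesis using pos[OF w] z by blast
  next
    case 2 then show ?thesis using pos[of "\<lambda>x. - w x"] z w by (auto intro: continuous_intros)
  qed
qed

text \<open>Since \<open>g\<close> is only integrable, its primitive is not differentiated
  pointwise; the integration by parts is Fubini over the triangle \<open>s < x\<close>.\<close>

lemma primitive_weak_derivative:
  fixes g :: "real \<Rightarrow> real"
  assumes g: "set_integrable lborel {0<..<pi} g" and f: "test_function_pi f"
  shows "integral {0..pi} (\<lambda>x. integral {0..x} g * deriv f x) = - (LBINT x:{0<..<pi}. g x * f x)"
proof -
  define g0 where "g0 s = indicator {0<..<pi} s * g s" for s
  have g0i: "integrable lborel g0" using g unfolding set_integrable_def g0_def by simp
  have [measurable]: "g0 \<in> borel_measurable borel" using g0i by simp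
  define \<psi> where "\<psi> x = indicator {0..pi} x * deriv f x" for x
  have cd: "continuous_on S (deriv f)" for S using test_cont[OF f, of S 1] by simp
  have psi_i: "integrable lborel \<psi>"
    using borel_integrable_compact[of "{0..pi}" "deriv f"] cd unfolding \<psi>_def by (simp add: set_integrable_def)
  have [measurable]: "\<psi> \<in> borel_measurable borel" using psi_i by simp
  have [measurable]: "\<psi> \<in> borel_measurable lborel" "g0 \<in> borel_measurable lborel" using psi_i g0i by auto
  define h where "h s x = g0 s * (indicator {s<..} x * \<psi> x)" for s x
  have hm: "(\<lambda>(s, x). h s x) \<in> borel_measurable (lborel \<Otimes>\<^sub>M lborel)"
  proof -
    have "(\<lambda>(s, x). h s x) = (\<lambda>z. if fst z < snd z then g0 (fst z) * \<psi> (snd z) else 0)"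
      by (auto simp: h_def fun_eq_iff)
    also have "\<dots> \<in> borel_measurable (lborel \<Otimes>\<^sub>M lborel)" by measurable
    finally show ?thesis .
  qed
  have int: "integrable (lborel \<Otimes>\<^sub>M lborel) (\<lambda>(s, x). h s x)"
  proof (rule lborel_pair.Fubini_integrable[OF hm])
    have ii: "integrable lborel (\<lambda>x. indicator {s<..} x * \<psi> x)" for s
      using integrable_mult_indicator[OF _ psi_i, of "{s<..}"] by simp
    show "AE s in lborel. integrable lborel (\<lambda>x. case (s, x) of (s, x) \<Rightarrow> h s x)"
      unfolding h_def using ii by simp
    show "integrable lborel (\<lambda>s. LINT x|lborel. norm (case (s, x) of (s, x) \<Rightarrow> h s x))"
    proof (rule Bochner_Integration.integrable_bound)
      show "integrable lborel (\<lambda>s. norm (g0 s) * (LINT x|lborel. norm (\<psi> x)))" using g0i by (intro integrable_mult_left integrable_norm)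
      show "(\<lambda>s. LINT x|lborel. norm (case (s, x) of (s, x) \<Rightarrow> h s x)) \<in> borel_measurable lborel"
        using lborel.borel_measurable_lebesgue_integral[of "\<lambda>s x. norm (h s x)" lborel] measurable_compose[OF hm borel_measurable_norm]
        by (simp add: case_prod_beta)
      have "(LINT x|lborel. norm (indicator {s<..} x * \<psi> x)) \<le> (LINT x|lborel. norm (\<psi> x))" for s
        using ii[of s] psi_i by (intro integral_mono integrable_norm) (auto simp: indicator_def)
      then have "(LINT x|lborel. norm (h s x)) \<le> norm (g0 s) * (LINT x|lborel. norm (\<psi> x))" for s
        unfolding h_def norm_mult[of "g0 s"] integral_mult_right_zero by (intro mult_left_mono) auto
      then show "AE s in lborel. norm (LINT x|lborel. norm (case (s, x) of (s, x) \<Rightarrow> h s x)) \<le> norm (norm (g0 s) * (LINT x|lborel. norm (\<psi> x)))"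
        by (intro AE_I2) (auto simp: integral_nonneg_AE)
    qed
  qed
  have 1: "(LINT s|lborel. h s x) = indicator {0..pi} x * (integral {0..x} g * deriv f x)" for x
  proof (cases "x \<in> {0..pi}")
    case True
    have "set_integrable lborel {0<..<x} g"
      by (rule set_integrable_subset[OF g]) (use True in auto)
    then have e: "(LBINT s:{0<..<x}. g s) = integral {0..x} g"
      by (simp add: set_borel_integral_eq_integral integral_open_interval_real)
    have "h s x = indicator {0<..<x} s *\<^sub>R g s * \<psi> x" for s
      using True by (auto simp: h_def g0_def indicator_def)
    then have "(LINT s|lborel. h s x) = (LBINT s:{0<..<x}. g s) * \<psi> x"
      unfolding set_lebesgue_integral_def by (simp only: integral_mult_left_zero)
    then show ?thesis using True e by (simp add: \<psi>_def)
  next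
    case False then show ?thesis by (simp add: h_def \<psi>_def)
  qed
  have 2: "(LINT x|lborel. h s x) = - (indicator {0<..<pi} s *\<^sub>R (g s * f s))" for s
  proof (cases "s \<in> {0<..<pi}")
    case True
    have si: "set_integrable lborel {s..pi} (deriv f)"
      using borel_integrable_compact[of "{s..pi}" "deriv f"] cd by (simp add: set_integrable_def)
    have "(LINT x|lborel. h s x) = g s * (LINT x|lborel. indicator {s<..} x * \<psi> x)"
      unfolding h_def using True by (simp add: g0_def)
    also have "(LINT x|lborel. indicator {s<..} x * \<psi> x) = (LBINT x:{s..pi}. deriv f x)"
      unfolding set_lebesgue_integral_def
    proof (rule integral_cong_AE)
      have "AE x in lborel. x \<noteq> s" by (rule AE_lborel_singleton)
      then show "AE x in lborel. indicator {s<..} x * \<psi> x = indicator {s..pi} x *\<^sub>R deriv f x"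
        by eventually_elim (use True in \<open>auto simp: \<psi>_def indicator_def\<close>)
      show "(\<lambda>x. indicator {s..pi} x *\<^sub>R deriv f x) \<in> borel_measurable lborel"
        using si unfolding set_integrable_def by simp
    qed measurable
    also have "\<dots> = integral {s..pi} (deriv f)" by (rule set_borel_integral_eq_integral(2)[OF si])
    also have "\<dots> = f pi - f s"
    proof (rule integral_unique, rule fundamental_theorem_of_calculus)
      show "(f has_vector_derivative deriv f x) (at x within {s..pi})" for x
        using has_field_derivative_at_within[OF test_DERIV0[OF f]]
        by (simp add: has_real_derivative_iff_has_vector_derivative)
    qed (use True in auto)
    also have "f pi = 0" using test_zero[OF f, of pi 0] by simp
    finally show ?thesis using True by simp
  next
    case False then show ?thesis by (simp add: h_def g0_def)
  qed
  have cG: "continuous_on {0..pi} (\<lambda>x. integral {0..x} g * deriv f x)"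
  proof (intro continuous_on_mult cd indefinite_integral_continuous_1)
    show "g integrable_on {0..pi}"
      using set_borel_integral_eq_integral(1)[OF g] by (simp add: integrable_on_open_interval_real)
  qed
  have si: "set_integrable lborel {0..pi} (\<lambda>x. integral {0..x} g * deriv f x)"
    using borel_integrable_compact[OF _ cG] by (simp add: set_integrable_def)
  have "integral {0..pi} (\<lambda>x. integral {0..x} g * deriv f x) = (LBINT x:{0..pi}. integral {0..x} g * deriv f x)"
    by (rule set_borel_integral_eq_integral(2)[OF si, symmetric])
  also have "\<dots> = (LINT x|lborel. LINT s|lborel. h s x)" unfolding 1 set_lebesgue_integral_def by simp
  also have "\<dots> = (LINT s|lborel. LINT x|lborel. h s x)"
    using lborel_pair.Fubini_integral[of h] int by simp
  also have "\<dots> = - (LBINT x:{0<..<pi}. g x * f x)" unfolding 2 set_lebesgue_integral_def by simp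
  finally show ?thesis .
qed

text \<open>Three primitives of the weak third derivative \<open>g\<close> give \<open>G3\<close>,
  and three rounds of \<open>weak_step\<close> show that \<open>y - G3\<close> is a quadratic
  polynomial. Continuity of \<open>y\<close> makes this a pointwise statement up to the ends. One
  derivative is extracted, because the second derivative of \<open>\<eta>\<close> involves
  \<open>\<alpha>'\<close>.\<close>

lemma W3_C1:
  assumes y: "y \<in> W3" and c: "continuous_on {0..pi} y"
  obtains y' where "continuous_on {0..pi} y'" "\<And>x. x \<in> {0..pi} \<Longrightarrow> (y has_real_derivative y' x) (at x within {0..pi})"
proof -
  obtain g where g: "set_integrable lborel {0<..<pi} g"
    and wd: "\<And>f. test_function_pi f \<Longrightarrow>
      (LBINT x:{0<..<pi}. y x * (deriv ^^ 3) f x) = - (LBINT x:{0<..<pi}. g x * f x)"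
    using y unfolding W3_def by blast
  define G1 where "G1 x = integral {0..x} g" for x
  define G2 where "G2 x = integral {0..x} G1" for x
  define G3 where "G3 x = integral {0..x} G2" for x
  have c1: "continuous_on {0..pi} G1"
    unfolding G1_def using set_borel_integral_eq_integral(1)[OF g]
    by (intro indefinite_integral_continuous_1) (simp add: integrable_on_open_interval_real)
  have d2: "(G2 has_real_derivative G1 x) (at x within {0..pi})" if "x \<in> {0..pi}" for x
    unfolding G2_def[abs_def] by (rule integral_has_real_derivative[OF c1 that])
  have c2: "continuous_on {0..pi} G2" using d2 by (rule DERIV_continuous_on)
  have d3: "(G3 has_real_derivative G2 x) (at x within {0..pi})" if "x \<in> {0..pi}" for x
    unfolding G3_def[abs_def] by (rule integral_has_real_derivative[OF c2 that])
  have c3: "continuous_on {0..pi} G3" using d3 by (rule DERIV_continuous_on)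
  define w where "w x = y x - G3 x" for x
  have cw: "continuous_on {0..pi} w" unfolding w_def by (intro continuous_intros c c3)
  have z3: "integral {0..pi} (\<lambda>x. w x * (deriv ^^ Suc 2) f x) = 0" if f: "test_function_pi f" for f
  proof -
    have cy: "continuous_on {0..pi} (\<lambda>x. y x * (deriv ^^ 3) f x)" by (intro continuous_on_mult c test_cont f)
    have "set_integrable lborel {0<..<pi} (\<lambda>x. y x * (deriv ^^ 3) f x)"
      by (rule set_integrable_subset[of _ "{0..pi}"])
        (use borel_integrable_compact[OF _ cy] in \<open>auto simp: set_integrable_def\<close>)
    then have "integral {0..pi} (\<lambda>x. y x * (deriv ^^ 3) f x) = - (LBINT x:{0<..<pi}. g x * f x)"
      using wd[OF f] set_borel_integral_eq_integral(2) integral_open_interval_real by metis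
    also have "\<dots> = integral {0..pi} (\<lambda>x. G1 x * deriv f x)"
      using primitive_weak_derivative[OF g f] by (simp add: G1_def)
    also have "\<dots> = - integral {0..pi} (\<lambda>x. G2 x * (deriv ^^ 2) f x)"
      using test_ibp[OF f d2 c1, of 1] by (simp add: numeral_2_eq_2)
    also have "\<dots> = integral {0..pi} (\<lambda>x. G3 x * (deriv ^^ 3) f x)"
      using test_ibp[OF f d3 c2, of 2] by (simp add: numeral_3_eq_3 numeral_2_eq_2)
    finally have e: "integral {0..pi} (\<lambda>x. y x * (deriv ^^ 3) f x) = integral {0..pi} (\<lambda>x. G3 x * (deriv ^^ 3) f x)" .
    have "integral {0..pi} (\<lambda>x. w x * (deriv ^^ 3) f x) =
      integral {0..pi} (\<lambda>x. y x * (deriv ^^ 3) f x) - integral {0..pi} (\<lambda>x. G3 x * (deriv ^^ 3) f x)"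
      unfolding w_def left_diff_distrib
      by (intro integral_diff integrable_continuous_interval continuous_on_mult c c3 test_cont f)
    then show ?thesis using e by (simp add: numeral_3_eq_3 numeral_2_eq_2)
  qed
  obtain a2 where a2: "\<And>f. test_function_pi f \<Longrightarrow> integral {0..pi} (\<lambda>x. w x * (deriv ^^ 2) f x) = a2 * integral {0..pi} f"
    using weak_step[OF cw z3] by blast
  \<comment> \<open>Two integrations by parts turn \<open>a2 * x ^ 2 / 2\<close> against a second
    derivative into \<open>a2\<close> times the integral, so \<open>w2\<close> annihilates second
    derivatives.\<close>
  define w2 where "w2 x = w x - a2 * x\<^sup>2 / 2" for x
  have cw2: "continuous_on {0..pi} w2" unfolding w2_def by (intro continuous_intros cw) auto
  have z2: "integral {0..pi} (\<lambda>x. w2 x * (deriv ^^ Suc 1) f x) = 0" if f: "test_function_pi f" for f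
  proof -
    have "integral {0..pi} (\<lambda>x. (a2 * x\<^sup>2 / 2) * (deriv ^^ Suc 1) f x) = - integral {0..pi} (\<lambda>x. (a2 * x) * (deriv ^^ 1) f x)"
      by (rule test_ibp[OF f]) (auto intro!: derivative_eq_intros continuous_intros)
    moreover have "integral {0..pi} (\<lambda>x. (a2 * x) * (deriv ^^ Suc 0) f x) = - integral {0..pi} (\<lambda>x. a2 * (deriv ^^ 0) f x)"
      by (rule test_ibp[OF f]) (auto intro!: derivative_eq_intros continuous_intros)
    ultimately have "integral {0..pi} (\<lambda>x. (a2 * x\<^sup>2 / 2) * (deriv ^^ 2) f x) = a2 * integral {0..pi} f"
      by (simp add: numeral_2_eq_2)
    moreover have "integral {0..pi} (\<lambda>x. w2 x * (deriv ^^ 2) f x) = integral {0..pi} (\<lambda>x. w x * (deriv ^^ 2) f x)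
        - integral {0..pi} (\<lambda>x. (a2 * x\<^sup>2 / 2) * (deriv ^^ 2) f x)"
      unfolding w2_def left_diff_distrib
      by (intro integral_diff integrable_continuous_interval continuous_on_mult continuous_intros cw test_cont f) auto
    ultimately show ?thesis using a2[OF f] by (simp add: numeral_2_eq_2)
  qed
  obtain a1 where a1: "\<And>f. test_function_pi f \<Longrightarrow> integral {0..pi} (\<lambda>x. w2 x * (deriv ^^ 1) f x) = a1 * integral {0..pi} f"
    using weak_step[OF cw2 z2] by blast
  \<comment> \<open>A single integration by parts changes the sign, hence
    \<open>+ a1 * x\<close>.\<close>
  define w3 where "w3 x = w2 x + a1 * x" for x
  have cw3: "continuous_on {0..pi} w3" unfolding w3_def by (intro continuous_intros cw2)
  have z1: "integral {0..pi} (\<lambda>x. w3 x * (deriv ^^ Suc 0) f x) = 0" if f: "test_function_pi f" for f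
  proof -
    have "integral {0..pi} (\<lambda>x. (a1 * x) * (deriv ^^ Suc 0) f x) = - integral {0..pi} (\<lambda>x. a1 * (deriv ^^ 0) f x)"
      by (rule test_ibp[OF f]) (auto intro!: derivative_eq_intros continuous_intros)
    moreover have "integral {0..pi} (\<lambda>x. w3 x * (deriv ^^ Suc 0) f x) = integral {0..pi} (\<lambda>x. w2 x * (deriv ^^ Suc 0) f x)
        + integral {0..pi} (\<lambda>x. (a1 * x) * (deriv ^^ Suc 0) f x)"
      unfolding w3_def distrib_right
      by (intro integral_add integrable_continuous_interval continuous_on_mult continuous_intros cw2 test_cont f)
    ultimately show ?thesis using a1[OF f] by simp
  qed
  obtain a0 where a0: "\<And>f. test_function_pi f \<Longrightarrow> integral {0..pi} (\<lambda>x. w3 x * (deriv ^^ 0) f x) = a0 * integral {0..pi} f"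
    using weak_step[OF cw3 z1] by blast
  define w4 where "w4 x = w3 x - a0" for x
  have cw4: "continuous_on {0..pi} w4" unfolding w4_def by (intro continuous_intros cw3)
  have z0: "integral {0..pi} (\<lambda>x. w4 x * f x) = 0" if f: "test_function_pi f" for f
  proof -
    have cf: "continuous_on {0..pi} f" using test_cont[OF f, of _ 0] by simp
    have "integral {0..pi} (\<lambda>x. w4 x * f x) = integral {0..pi} (\<lambda>x. w3 x * f x) - integral {0..pi} (\<lambda>x. a0 * f x)"
      unfolding w4_def left_diff_distrib
      by (intro integral_diff integrable_continuous_interval continuous_on_mult continuous_intros cw3 cf)
    then show ?thesis using a0[OF f] by simp
  qed
  have w4i: "w4 x = 0" if "x \<in> {0<..<pi}" for x by (rule weak_zero[OF cw4 z0 that])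
  have w40: "w4 x = 0" if "x \<in> {0..pi}" for x
    using continuous_constant_on_closure[of "{0<..<pi}" w4 0 x] cw4 w4i that by auto
  have eq: "G3 x + a2 * x\<^sup>2 / 2 - a1 * x + a0 = y x" if "x \<in> {0..pi}" for x
    using w40[OF that] by (simp add: w4_def w3_def w2_def w_def)
  show thesis
  proof (rule that[of "\<lambda>x. G2 x + a2 * x - a1"])
    show "continuous_on {0..pi} (\<lambda>x. G2 x + a2 * x - a1)" by (intro continuous_intros c2)
    fix x assume x: "x \<in> {0..pi}"
    have "((\<lambda>x. G3 x + a2 * x\<^sup>2 / 2 - a1 * x + a0) has_real_derivative G2 x + a2 * x - a1) (at x within {0..pi})"
      by (auto intro!: derivative_eq_intros d3[OF x])
    then show "(y has_real_derivative G2 x + a2 * x - a1) (at x within {0..pi})"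
      by (rule has_field_derivative_transform_within[OF _ zero_less_one x]) (use eq in auto)
  qed
qed

section \<open>Distances between the eigenvalues\<close>

text \<open>\<open>a * p\<close> is not an integer, so its fractional part keeps a positive distance
  from \<open>0\<close> and from \<open>1\<close>.\<close>

lemma irrational_gap:
  assumes "(a::real) \<notin> \<rat>" "0 < (p::nat)"
  obtains d where "0 < d" "\<And>j::int. d \<le> \<bar>a + of_int j / of_nat p\<bar>"
proof -
  define x where "x = a * real p"
  have "x \<notin> \<int>"
  proof
    assume "x \<in> \<int>"
    then have "x / real p \<in> \<rat>" by (intro Rats_divide) (auto elim: Ints_cases)
    then show False using assms by (simp add: x_def)
  qed
  then have f: "0 < frac x" "frac x < 1" by (auto simp: frac_lt_1 frac_gt_0_iff)
  define d where "d = min (frac x) (1 - frac x) / real p"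
  have "d \<le> \<bar>a + of_int j / of_nat p\<bar>" for j :: int
  proof -
    have "min (frac x) (1 - frac x) \<le> \<bar>x + of_int j\<bar>"
    proof (cases "0 \<le> \<lfloor>x\<rfloor> + j")
      case True
      then have "(0::real) \<le> of_int (\<lfloor>x\<rfloor> + j)" by (simp only: of_int_0_le_iff)
      then show ?thesis using f by (simp add: frac_def)
    next
      case False
      then have "\<lfloor>x\<rfloor> + j \<le> -1" by simp
      then have "of_int (\<lfloor>x\<rfloor> + j) \<le> (-1::real)" by linarith
      then show ?thesis using f by (simp add: frac_def)
    qed
    moreover have "\<bar>a + of_int j / of_nat p\<bar> = \<bar>x + of_int j\<bar> / real p"
    proof -
      have "a + of_int j / of_nat p = (x + of_int j) / real p"
        using assms(2) by (simp add: x_def field_simps)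
      then show ?thesis by (simp add: abs_divide)
    qed
    ultimately show ?thesis unfolding d_def using assms(2) by (simp add: divide_right_mono)
  qed
  moreover have "0 < d" unfolding d_def using f assms(2) by simp
  ultimately show thesis using that by blast
qed

text \<open>The little-o statement controls all but finitely many indices and \<open>S\<close>
  collects the others. A uniform bound on the remainder is the form in which the asymptotics enter
  the gap estimate.\<close>

lemma remainder_bounded:
  fixes \<mu> b :: "nat \<Rightarrow> real"
  assumes "bounded (range b)"
    "(\<lambda>n. \<mu> n - (real n ^ 4 + 2 * (real n)\<^sup>2 * a + b n)) \<in> o(\<lambda>n. 1 / real n)"
  obtains R where "0 \<le> R" "\<And>n. \<bar>\<mu> n - (real n ^ 4 + 2 * (real n)\<^sup>2 * a)\<bar> \<le> R"
proof -
  define f where "f n = \<mu> n - (real n ^ 4 + 2 * (real n)\<^sup>2 * a + b n)" for n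
  obtain B where B: "\<And>n. \<bar>b n\<bar> \<le> B" using assms(1) by (auto simp: bounded_iff)
  have "\<forall>\<^sub>F n in sequentially. norm (f n) \<le> 1 * norm (1 / real n)"
    using landau_o.smallD[OF assms(2), of 1] by (simp add: f_def)
  then obtain N where N: "\<And>n. n \<ge> N \<Longrightarrow> \<bar>f n\<bar> \<le> \<bar>1 / real n\<bar>" by (auto simp: eventually_sequentially)
  define S where "S = (\<Sum>n<N. \<bar>f n\<bar>)"
  have fb: "\<bar>f n\<bar> \<le> S + 1" for n
  proof (cases "n < N")
    case True
    then have "\<bar>f n\<bar> \<le> S" unfolding S_def by (intro member_le_sum) auto
    then show ?thesis by simp
  next
    case False
    then have "\<bar>f n\<bar> \<le> \<bar>1 / real n\<bar>" using N by simp
    also have "\<dots> \<le> 1" by (cases "n = 0") auto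
    moreover have "0 \<le> S" unfolding S_def by (intro sum_nonneg) auto
    ultimately show ?thesis by linarith
  qed
  show thesis
  proof (rule that[of "S + 1 + B"])
    show "0 \<le> S + 1 + B" using fb[of 0] B[of 0] by linarith
    show "\<bar>\<mu> n - (real n ^ 4 + 2 * (real n)\<^sup>2 * a)\<bar> \<le> S + 1 + B" for n
      using fb[of n] B[of n] unfolding f_def by linarith
  qed
qed

lemma eigenvalue_growth:
  fixes \<mu> :: "nat \<Rightarrow> real"
  assumes R: "0 \<le> R" "\<And>n. \<bar>\<mu> n - (real n ^ 4 + 2 * (real n)\<^sup>2 * a)\<bar> \<le> R"
  obtains C n0 where "0 < C" "\<And>n. 1 \<le> n \<Longrightarrow> \<mu> n \<le> C * real n ^ 4" "\<And>n. n0 \<le> n \<Longrightarrow> (real n)\<^sup>2 \<le> \<mu> n"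
proof -
  define C where "C = 1 + 2 * \<bar>a\<bar> + R"
  have C: "1 \<le> C" unfolding C_def using R(1) by simp
  have up: "\<mu> n \<le> C * real n ^ 4" if n: "1 \<le> n" for n
  proof -
    have 1: "1 \<le> real n ^ 4" using n by simp
    have 2: "(real n)\<^sup>2 \<le> real n ^ 4" using n by (intro power_increasing) auto
    have "\<mu> n \<le> real n ^ 4 + 2 * (real n)\<^sup>2 * a + R" using R(2)[of n] by linarith
    also have "2 * (real n)\<^sup>2 * a \<le> 2 * \<bar>a\<bar> * (real n)\<^sup>2"
      using mult_left_mono[OF abs_ge_self[of a], of "2 * (real n)\<^sup>2"] by (simp add: mult_ac)
    also have "\<dots> \<le> 2 * \<bar>a\<bar> * real n ^ 4" using 2 by (intro mult_left_mono) auto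
    also have "R \<le> R * real n ^ 4" using mult_left_mono[OF 1 R(1)] by simp
    finally show ?thesis by (simp add: C_def algebra_simps)
  qed
  \<comment> \<open>For \<open>n \<ge> C\<close> one has \<open>n ^ 4 \<ge> C * n ^ 2\<close>, and
    \<open>C\<close> contains the \<open>1\<close> to be kept as well as \<open>2 * |a|\<close> and
    \<open>R\<close>, which pay for the lower terms.\<close>
  define n0 where "n0 = Suc (nat \<lceil>C\<rceil>)"
  have low: "(real n)\<^sup>2 \<le> \<mu> n" if n: "n0 \<le> n" for n
  proof -
    have nC: "C \<le> real n" using n unfolding n0_def by linarith
    define y where "y = (real n)\<^sup>2"
    have y1: "real n \<le> y" unfolding y_def using nC C by (simp add: power2_eq_square)
    have y4: "real n ^ 4 = y * y" unfolding y_def by (simp add: power2_eq_square eval_nat_numeral)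
    have "y * y \<ge> C * y" using nC C y1 by (intro mult_right_mono) auto
    also have "C * y = y + 2 * \<bar>a\<bar> * y + R * y" by (simp add: C_def algebra_simps)
    finally have "y + 2 * \<bar>a\<bar> * y + R * y \<le> y * y" .
    moreover have "R \<le> R * y" using mult_left_mono[of 1 y R] R(1) y1 nC C by simp
    moreover have "- (2 * \<bar>a\<bar> * y) \<le> 2 * y * a"
      using mult_left_mono[of "- \<bar>a\<bar>" a "2 * y"] y1 nC C by (simp add: mult_ac)
    moreover have "real n ^ 4 + 2 * (real n)\<^sup>2 * a - R \<le> \<mu> n" using R(2)[of n] by linarith
    ultimately show ?thesis unfolding y4 y_def[symmetric] by linarith
  qed
  show thesis by (rule that[of C n0]) (use C up low in auto)
qed

lemma eigenvalue_gap:
  fixes \<mu> :: "nat \<Rightarrow> real" and p q :: nat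
  assumes R: "0 \<le> R" "\<And>n. \<bar>\<mu> n - (real n ^ 4 + 2 * (real n)\<^sup>2 * a)\<bar> \<le> R"
    and a: "a \<notin> \<rat>" and pq: "0 < p" "0 < q" and T: "T = 2 * pi * real p / real q"
  obtains c B where "0 < c" "0 \<le> B" "\<And>m n. c * ((real n)\<^sup>2 + \<bar>of_int m\<bar>) - B \<le> \<bar>\<mu> n - (vartheta T m)\<^sup>2\<bar>"
proof -
  obtain d where d: "0 < d" "\<And>j::int. d \<le> \<bar>a + of_int j / of_nat p\<bar>" using irrational_gap[OF a pq(1)] by blast
  define r where "r = real q / real p"
  have r: "0 < r" unfolding r_def using pq by simp
  have th: "vartheta T m = r * of_int m" for m
    unfolding vartheta_def T r_def using pq by (simp add: field_simps)
  define c where "c = d * min 1 r"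
  have c: "0 < c" unfolding c_def using d r by simp
  \<comment> \<open>The three losses: \<open>d * |a|\<close> from the lower bound of the large
    factor, \<open>R\<close> from the remainder, \<open>a ^ 2\<close> from completing the
    square.\<close>
  define B where "B = d * \<bar>a\<bar> + R + a\<^sup>2"
  have B: "0 \<le> B" unfolding B_def using d R by simp
  have "c * ((real n)\<^sup>2 + \<bar>of_int m\<bar>) - B \<le> \<bar>\<mu> n - (vartheta T m)\<^sup>2\<bar>" for m n
  proof -
    define y where "y = (real n)\<^sup>2"
    define t where "t = \<bar>vartheta T m\<bar>"
    have t: "t = r * \<bar>of_int m\<bar>" unfolding t_def th using r by (simp add: abs_mult)
    have y0: "0 \<le> y" unfolding y_def by simp
    have y4: "real n ^ 4 = y\<^sup>2" unfolding y_def by simp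
    \<comment> \<open>\<open>t\<close> equals \<open>|m| * q / p\<close>, so \<open>y - t\<close> is
      a fraction with denominator \<open>p\<close> and \<open>irrational_gap\<close>
      applies.\<close>
    have "d \<le> \<bar>y + a - t\<bar>"
    proof -
      have "y - t = of_int (int n * int n * int p - \<bar>m\<bar> * int q) / of_nat p"
        unfolding t y_def r_def using pq by (simp add: field_simps power2_eq_square)
      then have "y + a - t = a + of_int (int n * int n * int p - \<bar>m\<bar> * int q) / of_nat p" by linarith
      then show ?thesis using d(2) by metis
    qed
    moreover have "y + t - \<bar>a\<bar> \<le> \<bar>y + a + t\<bar>" by linarith
    ultimately have "d * (y + t - \<bar>a\<bar>) \<le> \<bar>y + a - t\<bar> * \<bar>y + a + t\<bar>"
    proof (cases "0 \<le> y + t - \<bar>a\<bar>")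
      case False
      then have "d * (y + t - \<bar>a\<bar>) \<le> 0" using d by (simp add: mult_le_0_iff)
      moreover have "0 \<le> \<bar>y + a - t\<bar> * \<bar>y + a + t\<bar>" by simp
      ultimately show ?thesis by linarith
    qed (use d in \<open>auto intro!: mult_mono\<close>)
    also have "\<dots> = \<bar>(y + a)\<^sup>2 - t\<^sup>2\<bar>" by (simp add: power2_eq_square algebra_simps flip: abs_mult)
    also have "(y + a)\<^sup>2 - t\<^sup>2 = (\<mu> n - (vartheta T m)\<^sup>2) - (\<mu> n - (y\<^sup>2 + 2 * y * a)) + a\<^sup>2"
      unfolding t_def by (simp add: power2_eq_square algebra_simps flip: abs_mult)
    also have "\<bar>\<dots>\<bar> \<le> \<bar>\<mu> n - (vartheta T m)\<^sup>2\<bar> + R + a\<^sup>2"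
      using R(2)[of n] zero_le_power2[of a] unfolding y4 y_def[symmetric] by linarith
    finally have 1: "d * (y + t) - B \<le> \<bar>\<mu> n - (vartheta T m)\<^sup>2\<bar>" unfolding B_def by (simp add: algebra_simps)
    have "min 1 r * (y + \<bar>of_int m\<bar>) \<le> y + t"
    proof -
      have "min 1 r * y \<le> 1 * y" by (intro mult_right_mono y0) auto
      moreover have "min 1 r * \<bar>of_int m\<bar> \<le> t" unfolding t by (intro mult_right_mono) auto
      ultimately show ?thesis by (simp add: distrib_left)
    qed
    from mult_left_mono[OF this, of d] have "c * (y + \<bar>of_int m\<bar>) \<le> d * (y + t)"
      unfolding c_def using d by (simp add: mult.assoc)
    then show ?thesis using 1 unfolding y_def by linarith
  qed
  then show thesis using that c B by blast
qed

lemma finite_sublevel: "finite {(m::int, n::nat). (real n)\<^sup>2 + \<bar>of_int m\<bar> \<le> (s::real)}"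
proof (rule finite_subset)
  show "{(m, n). (real n)\<^sup>2 + \<bar>of_int m\<bar> \<le> s} \<subseteq> {- \<lceil>\<bar>s\<bar>\<rceil>..\<lceil>\<bar>s\<bar>\<rceil>} \<times> {..nat \<lceil>\<bar>s\<bar>\<rceil>}"
  proof clarify
    fix m :: int and n :: nat assume a: "(real n)\<^sup>2 + \<bar>of_int m\<bar> \<le> s"
    have "real n \<le> (real n)\<^sup>2" by (cases n) (auto simp: power2_eq_square)
    moreover have "0 \<le> (real n)\<^sup>2" by simp
    moreover have "s \<le> \<bar>s\<bar>" by simp
    ultimately have "real n \<le> \<bar>s\<bar>" "\<bar>of_int m :: real\<bar> \<le> \<bar>s\<bar>" using a by linarith+
    then show "m \<in> {- \<lceil>\<bar>s\<bar>\<rceil>..\<lceil>\<bar>s\<bar>\<rceil>} \<and> n \<in> {..nat \<lceil>\<bar>s\<bar>\<rceil>}" by (auto simp: ceiling_le_iff le_ceiling_iff) linarith+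
  qed
qed auto

text \<open>The loss \<open>B\<close> is traded for a smaller factor: once
  \<open>n ^ 2 + |m|\<close> exceeds \<open>s0 + 1\<close> it is at most half of the main term, and
  the finitely many remaining nonresonant pairs have a positive minimum \<open>e\<close>. Both
  infima inherit the resulting bound.\<close>

lemma eigenvalue_gap_consequences:
  fixes \<mu> :: "nat \<Rightarrow> real"
  assumes c: "0 < c" "0 \<le> B" and gap: "\<And>m n. c * ((real n)\<^sup>2 + \<bar>of_int m\<bar>) - B \<le> \<bar>\<mu> n - (vartheta T m)\<^sup>2\<bar>"
    and T: "0 < T"
  obtains c' where "0 < c'"
    "\<And>m n. 1 \<le> n \<Longrightarrow> \<mu> n \<noteq> (vartheta T m)\<^sup>2 \<Longrightarrow> c' * ((real n)\<^sup>2 + \<bar>of_int m\<bar>) \<le> \<bar>\<mu> n - (vartheta T m)\<^sup>2\<bar>"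
    "0 < beam_delta T \<mu>" "0 < beam_gamma T \<mu>"
    "\<And>m n. 1 \<le> n \<Longrightarrow> \<mu> n \<noteq> (vartheta T m)\<^sup>2 \<Longrightarrow> beam_delta T \<mu> \<le> \<bar>\<mu> n - (vartheta T m)\<^sup>2\<bar>"
    "\<And>m n. 1 \<le> n \<Longrightarrow> \<mu> n < (vartheta T m)\<^sup>2 \<Longrightarrow> beam_gamma T \<mu> \<le> (vartheta T m)\<^sup>2 - \<mu> n"
    "finite {(m, n). \<mu> n = (vartheta T m)\<^sup>2}"
proof -
  let ?l = "\<lambda>m n. \<mu> n - (vartheta T m)\<^sup>2"
  define s0 where "s0 = 2 * B / c"
  define F where "F = {(m::int, n::nat). (real n)\<^sup>2 + \<bar>of_int m\<bar> \<le> s0 + 1} \<inter> {(m, n). 1 \<le> n \<and> ?l m n \<noteq> 0}"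
  have finF: "finite F" unfolding F_def using finite_sublevel by blast
  have "\<exists>e>0. \<forall>(m, n)\<in>F. e \<le> \<bar>?l m n\<bar>"
  proof (cases "F = {}")
    case True then show ?thesis by (auto intro: exI[of _ 1])
  next
    case False
    define e where "e = Min ((\<lambda>(m, n). \<bar>?l m n\<bar>) ` F)"
    have "e \<in> (\<lambda>(m, n). \<bar>?l m n\<bar>) ` F" unfolding e_def using finF False by (intro Min_in) auto
    then have "0 < e" by (auto simp: F_def)
    moreover have "e \<le> \<bar>?l m n\<bar>" if "(m, n) \<in> F" for m n
      unfolding e_def using finF that by (intro Min_le) (auto intro: rev_image_eqI)
    ultimately show ?thesis by blast
  qed
  then obtain e where e: "0 < e" "\<And>m n. (m, n) \<in> F \<Longrightarrow> e \<le> \<bar>?l m n\<bar>" by blast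
  have s0: "0 \<le> s0" unfolding s0_def using c by simp
  define c' where "c' = min (c / 2) (e / (s0 + 1))"
  have c': "0 < c'" unfolding c'_def using c e s0 by simp
  have main: "c' * ((real n)\<^sup>2 + \<bar>of_int m\<bar>) \<le> \<bar>?l m n\<bar>" if n: "1 \<le> n" "\<mu> n \<noteq> (vartheta T m)\<^sup>2" for m n
  proof -
    define s where "s = (real n)\<^sup>2 + \<bar>of_int m :: real\<bar>"
    have s: "0 \<le> s" unfolding s_def by simp
    show ?thesis
    proof (cases "s \<le> s0 + 1")
      case True
      then have "(m, n) \<in> F" using n by (simp add: F_def s_def)
      then have "e \<le> \<bar>?l m n\<bar>" by (rule e(2))
      moreover have "c' * s \<le> e / (s0 + 1) * (s0 + 1)"
        unfolding c'_def using True e s s0 by (intro mult_mono) auto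
      ultimately show ?thesis using s0 by (simp add: s_def)
    next
      case False
      then have "2 * B / c \<le> s" by (simp add: s0_def)
      then have "2 * B \<le> c * s" using c by (simp add: field_simps)
      moreover have "c' * s \<le> c / 2 * s" unfolding c'_def by (rule mult_right_mono[OF min.cobounded1 s])
      moreover have "c * s - B \<le> \<bar>?l m n\<bar>" using gap[of n m] by (simp add: s_def)
      ultimately show ?thesis by (simp add: s_def[symmetric])
    qed
  qed
  have one: "c' \<le> \<bar>?l m n\<bar>" if n: "1 \<le> n" "\<mu> n \<noteq> (vartheta T m)\<^sup>2" for m n
  proof -
    have "1 \<le> (real n)\<^sup>2 + \<bar>of_int m :: real\<bar>" using n(1) one_le_power[of "real n" 2] by linarith
    then have "c' * 1 \<le> c' * ((real n)\<^sup>2 + \<bar>of_int m\<bar>)" using c' by (intro mult_left_mono) auto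
    then show ?thesis using main[OF n] by linarith
  qed
  \<comment> \<open>A large frequency exceeds \<open>\<mu> 1\<close>, so the sets under both infima
    are nonempty; the infimum of an empty set of reals would carry no information.\<close>
  obtain m1 :: int where m1: "\<mu> 1 < (vartheta T m1)\<^sup>2"
  proof -
    define w where "w = 2 * pi / T"
    have w: "0 < w" unfolding w_def using T by simp
    obtain k :: nat where k: "(\<bar>\<mu> 1\<bar> + 1) / w < real k" using reals_Archimedean2 by blast
    then have k': "\<bar>\<mu> 1\<bar> + 1 < w * real k" using w by (simp add: field_simps)
    then have "1 * (w * real k) \<le> (w * real k) * (w * real k)" by (intro mult_right_mono) linarith+
    then have "\<mu> 1 < (w * real k)\<^sup>2" using k' by (simp add: power2_eq_square)
    then show ?thesis using that[of "int k"] by (simp add: vartheta_def w_def)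
  qed
  have "\<bar>?l m1 1\<bar> \<in> {\<bar>?l m n\<bar> | m n. 1 \<le> n \<and> \<mu> n \<noteq> (vartheta T m)\<^sup>2}"
    using m1 by (intro CollectI exI[of _ m1] exI[of _ "1::nat"]) auto
  then have dne: "{\<bar>?l m n\<bar> | m n. 1 \<le> n \<and> \<mu> n \<noteq> (vartheta T m)\<^sup>2} \<noteq> {}" by blast
  have "(vartheta T m1)\<^sup>2 - \<mu> 1 \<in> {(vartheta T m)\<^sup>2 - \<mu> n | m n. 1 \<le> n \<and> (vartheta T m)\<^sup>2 > \<mu> n}"
    using m1 by (intro CollectI exI[of _ m1] exI[of _ "1::nat"]) auto
  then have gne: "{(vartheta T m)\<^sup>2 - \<mu> n | m n. 1 \<le> n \<and> (vartheta T m)\<^sup>2 > \<mu> n} \<noteq> {}" by blast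
  have dpos: "c' \<le> beam_delta T \<mu>" unfolding beam_delta_def
    by (rule cInf_greatest[OF dne]) (use one in auto)
  have gone: "c' \<le> (vartheta T m)\<^sup>2 - \<mu> n" if "1 \<le> n" "\<mu> n < (vartheta T m)\<^sup>2" for m n
    using one[of n m] that by auto
  have gpos: "c' \<le> beam_gamma T \<mu>" unfolding beam_gamma_def
    by (rule cInf_greatest[OF gne]) (use gone in auto)
  have fz: "finite {(m, n). \<mu> n = (vartheta T m)\<^sup>2}"
  proof (rule finite_subset[OF _ finite_sublevel[of "B / c"]], clarify)
    fix m n assume "\<mu> n = (vartheta T m)\<^sup>2"
    then have "c * ((real n)\<^sup>2 + \<bar>of_int m\<bar>) \<le> B" using gap[of n m] by simp
    then show "(real n)\<^sup>2 + \<bar>of_int m\<bar> \<le> B / c" using c by (simp add: field_simps)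
  qed
  show thesis
  proof (rule that[OF c' main _ _ _ _ fz])
    show "0 < beam_delta T \<mu>" "0 < beam_gamma T \<mu>" using c' dpos gpos by linarith+
    show "beam_delta T \<mu> \<le> \<bar>?l m n\<bar>" if "1 \<le> n" "\<mu> n \<noteq> (vartheta T m)\<^sup>2" for m n
      unfolding beam_delta_def by (rule cInf_lower) (use that in \<open>auto intro!: bdd_belowI[of _ 0]\<close>)
    show "beam_gamma T \<mu> \<le> (vartheta T m)\<^sup>2 - \<mu> n" if "1 \<le> n" "\<mu> n < (vartheta T m)\<^sup>2" for m n
      unfolding beam_gamma_def by (rule cInf_lower) (use that in \<open>auto intro!: bdd_belowI[of _ 0]\<close>)
  qed
qed

section \<open>Sums over pairs of indices\<close>

lemma sum_inverse_square_shift: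
  fixes x :: real assumes "1 \<le> x"
  shows "(\<Sum>m<K. 1 / (x + real m)\<^sup>2) \<le> 2 / x - 2 / (x + real K)"
proof (induction K)
  case (Suc K)
  define z where "z = x + real K"
  have z: "1 \<le> z" unfolding z_def using assms by simp
  have "1 / z\<^sup>2 \<le> 2 / (z * (z + 1))"
  proof -
    have "2 * z\<^sup>2 \<ge> z * (z + 1)" using z mult_left_mono[OF z, of z] by (simp add: power2_eq_square algebra_simps)
    then have "2 / (2 * z\<^sup>2) \<le> 2 / (z * (z + 1))" using z by (intro divide_left_mono mult_pos_pos) auto
    then show ?thesis by simp
  qed
  also have "\<dots> = 2 / z - 2 / (z + 1)" using z by (simp add: field_simps)
  finally show ?case using Suc by (simp add: z_def algebra_simps)
qed simp

text \<open>The range is covered by two copies of its nonnegative half, with \<open>0\<close>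
  counted twice; each copy obeys the telescoping estimate.\<close>

lemma sum_inverse_square_int:
  fixes x :: real assumes "1 \<le> x"
  shows "(\<Sum>m\<in>{- int K..int K}. 1 / (x + \<bar>of_int m\<bar>)\<^sup>2) \<le> 4 / x"
proof -
  let ?f = "\<lambda>m::int. 1 / (x + \<bar>of_int m\<bar>)\<^sup>2"
  have s: "{- int K..int K} = int ` {..<Suc K} \<union> (\<lambda>k. - int k) ` {..<Suc K}"
  proof (intro set_eqI iffI)
    fix m assume "m \<in> {- int K..int K}"
    then show "m \<in> int ` {..<Suc K} \<union> (\<lambda>k. - int k) ` {..<Suc K}"
      by (cases "0 \<le> m") (auto intro!: image_eqI[of _ _ "nat \<bar>m\<bar>"])
  qed auto
  have half: "(\<Sum>m<Suc K. 1 / (x + real m)\<^sup>2) \<le> 2 / x"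
  proof -
    have "0 \<le> 2 / (x + real (Suc K))" using assms by simp
    then show ?thesis using sum_inverse_square_shift[OF assms, of "Suc K"] by linarith
  qed
  have "sum ?f {- int K..int K} \<le> sum ?f (int ` {..<Suc K}) + sum ?f ((\<lambda>k. - int k) ` {..<Suc K})"
    unfolding s by (subst sum.union_inter[symmetric]) (auto intro!: sum_nonneg)
  also have "sum ?f (int ` {..<Suc K}) = (\<Sum>m<Suc K. 1 / (x + real m)\<^sup>2)"
    by (subst sum.reindex) (auto simp: inj_on_def)
  also have "sum ?f ((\<lambda>k. - int k) ` {..<Suc K}) = (\<Sum>m<Suc K. 1 / (x + real m)\<^sup>2)"
    by (subst sum.reindex) (auto simp: inj_on_def)
  finally show ?thesis using half by simp
qed

text \<open>Summing over \<open>m\<close> first turns \<open>1 / (n ^ 2 + |m|) ^ 2\<close> into at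
  most \<open>4 / n ^ 2\<close>, exactly the weight of \<open>basis_weighted_bound\<close>.\<close>

lemma double_sum_bound:
  fixes s :: "nat \<Rightarrow> real"
  assumes s: "\<And>n. 0 \<le> s n" and D: "\<And>N. (\<Sum>n=1..N. s n / (real n)\<^sup>2) \<le> D"
    and F: "finite F" "F \<subseteq> UNIV \<times> {1..}"
  shows "(\<Sum>(m::int, n)\<in>F. s n / ((real n)\<^sup>2 + \<bar>of_int m\<bar>)\<^sup>2) \<le> 4 * D"
proof -
  define K where "K = Max (insert 0 ((\<lambda>(m, n). nat \<bar>m\<bar>) ` F))"
  define N where "N = Max (insert 0 (snd ` F))"
  have sub: "F \<subseteq> {- int K..int K} \<times> {1..N}"
  proof clarify
    fix m n assume mn: "(m, n) \<in> F"
    have "nat \<bar>m\<bar> \<le> K" unfolding K_def using F(1) mn by (intro Max_ge) (auto intro: rev_image_eqI)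
    moreover have "n \<le> N" unfolding N_def using F(1) mn by (intro Max_ge) (auto intro: rev_image_eqI)
    moreover have "1 \<le> n" using F(2) mn by auto
    ultimately show "m \<in> {- int K..int K} \<and> n \<in> {1..N}" by auto
  qed
  have "(\<Sum>(m, n)\<in>F. s n / ((real n)\<^sup>2 + \<bar>of_int m\<bar>)\<^sup>2) \<le>
     (\<Sum>(m, n)\<in>{- int K..int K} \<times> {1..N}. s n / ((real n)\<^sup>2 + \<bar>of_int m\<bar>)\<^sup>2)"
    by (rule sum_mono2) (use sub s in auto)
  also have "\<dots> = (\<Sum>m\<in>{- int K..int K}. \<Sum>n=1..N. s n / ((real n)\<^sup>2 + \<bar>of_int m\<bar>)\<^sup>2)"
    by (simp add: sum.cartesian_product)
  also have "\<dots> = (\<Sum>n=1..N. \<Sum>m\<in>{- int K..int K}. s n * (1 / ((real n)\<^sup>2 + \<bar>of_int m\<bar>)\<^sup>2))"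
    by (subst sum.swap) simp
  also have "\<dots> \<le> (\<Sum>n=1..N. s n * (4 / (real n)\<^sup>2))"
    unfolding sum_distrib_left[symmetric]
    by (intro sum_mono mult_left_mono s sum_inverse_square_int) auto
  also have "\<dots> = 4 * (\<Sum>n=1..N. s n / (real n)\<^sup>2)" by (simp add: sum_distrib_left mult.commute)
  also have "\<dots> \<le> 4 * D" using D by simp
  finally show ?thesis .
qed

section \<open>Integrable functions annihilated by trigonometric and algebraic polynomials\<close>

lemma weierstrass_real:
  fixes f :: "real \<Rightarrow> real"
  assumes "continuous_on {lo..hi} f" "0 < e"
  obtains a :: "nat \<Rightarrow> real" and n where "\<And>s. s \<in> {lo..hi} \<Longrightarrow> \<bar>f s - (\<Sum>i\<le>n. a i * s ^ i)\<bar> < e"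
proof -
  obtain g where g: "polynomial_function g" "\<forall>x\<in>{lo..hi}. norm (f x - g x) < e"
    using Stone_Weierstrass_polynomial_function[OF _ assms(1) assms(2)] by auto
  then obtain a n where "g = (\<lambda>x. \<Sum>i\<le>n. a i * x ^ i)"
    unfolding real_polynomial_function_eq[symmetric] real_polynomial_function_iff_sum by blast
  then show thesis using g(2) that[of a n] by auto
qed

text \<open>\<open>min 1 (max 0 (k * q))\<close> tends to the indicator of \<open>q > 0\<close>, and
  Weierstrass approximates it within \<open>1 / (k + 1)\<close>. The uniform bound \<open>2\<close>
  prepares dominated convergence.\<close>

lemma positivity_poly_approx:
  fixes q :: "real \<Rightarrow> real"
  assumes q: "continuous_on {lo..hi} q"
  obtains a :: "nat \<Rightarrow> nat \<Rightarrow> real" and n :: "nat \<Rightarrow> nat" where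
    "\<And>k s. s \<in> {lo..hi} \<Longrightarrow> \<bar>\<Sum>i\<le>n k. a k i * s ^ i\<bar> \<le> 2"
    "\<And>s. s \<in> {lo..hi} \<Longrightarrow> (\<lambda>k. \<Sum>i\<le>n k. a k i * s ^ i) \<longlonglongrightarrow> (if 0 < q s then 1 else 0)"
proof -
  define g where "g k s = min 1 (max 0 (real k * q s))" for k s
  have "\<forall>k. \<exists>an. \<forall>s\<in>{lo..hi}. \<bar>g k s - (\<Sum>i\<le>snd an. fst an i * s ^ i)\<bar> < 1 / real (Suc k)"
  proof
    fix k
    have "continuous_on {lo..hi} (g k)" unfolding g_def by (intro continuous_intros q)
    then obtain a n where "\<And>s. s \<in> {lo..hi} \<Longrightarrow> \<bar>g k s - (\<Sum>i\<le>n. a i * s ^ i)\<bar> < 1 / real (Suc k)"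
      using weierstrass_real[of lo hi "g k" "1 / real (Suc k)"] by (metis of_nat_0_less_iff zero_less_Suc zero_less_divide_1_iff)
    then show "\<exists>an. \<forall>s\<in>{lo..hi}. \<bar>g k s - (\<Sum>i\<le>snd an. fst an i * s ^ i)\<bar> < 1 / real (Suc k)"
      by (intro exI[of _ "(a, n)"]) auto
  qed
  from choice[OF this] obtain an where an: "\<And>k s. s \<in> {lo..hi} \<Longrightarrow> \<bar>g k s - (\<Sum>i\<le>snd (an k). fst (an k) i * s ^ i)\<bar> < 1 / real (Suc k)"
    by blast
  have lim: "(\<lambda>k. \<Sum>i\<le>snd (an k). fst (an k) i * s ^ i) \<longlonglongrightarrow> (if 0 < q s then 1 else 0)" if s: "s \<in> {lo..hi}" for s
  proof -
    have g: "(\<lambda>k. g k s) \<longlonglongrightarrow> (if 0 < q s then 1 else 0)"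
    proof (rule tendsto_eventually)
      show "\<forall>\<^sub>F k in sequentially. g k s = (if 0 < q s then 1 else 0)"
      proof (cases "0 < q s")
        case True
        obtain K :: nat where K: "1 / q s < real K" using reals_Archimedean2 by blast
        show ?thesis unfolding eventually_sequentially
        proof (intro exI[of _ K] allI impI)
          fix k assume "K \<le> k"
          then have "1 / q s \<le> real k" using K by linarith
          then have "1 \<le> real k * q s" using True by (simp add: field_simps)
          then show "g k s = (if 0 < q s then 1 else 0)" using True by (simp add: g_def)
        qed
      next
        case False
        then have "real k * q s \<le> 0" for k by (simp add: mult_nonneg_nonpos)
        then have "g k s = 0" for k by (simp add: g_def max_absorb1)
        then show ?thesis using False by simp
      qed
    qed
    have d: "(\<lambda>k. (\<Sum>i\<le>snd (an k). fst (an k) i * s ^ i) - g k s) \<longlonglongrightarrow> 0"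
    proof (rule Lim_null_comparison[OF always_eventually[OF allI] LIMSEQ_inverse_real_of_nat])
      show "norm ((\<Sum>i\<le>snd (an k). fst (an k) i * s ^ i) - g k s) \<le> inverse (real (Suc k))" for k
        using an[OF s, of k] by (simp add: inverse_eq_divide abs_minus_commute del: of_nat_Suc)
    qed
    show ?thesis using tendsto_add[OF d g] by simp
  qed
  show thesis
  proof (rule that[of "\<lambda>k. fst (an k)" "\<lambda>k. snd (an k)", OF _ lim])
    fix k s assume s: "s \<in> {lo..hi}"
    have "\<bar>g k s\<bar> \<le> 1" by (simp add: g_def)
    moreover have "1 / real (Suc k) \<le> 1" by simp
    ultimately show "\<bar>\<Sum>i\<le>snd (an k). fst (an k) i * s ^ i\<bar> \<le> 2" using an[OF s, of k] by linarith
  qed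
qed

text \<open>Vanishing moments in \<open>s\<close> pass, by dominated convergence along
  \<open>positivity_poly_approx\<close>, to the indicator of \<open>0 < q (s z)\<close>. Points with
  \<open>F z = 0\<close> contribute nothing, so the range condition is imposed elsewhere
  only.\<close>

lemma integral_positivity_zero:
  fixes F :: "'a \<Rightarrow> complex" and s :: "'a \<Rightarrow> real" and q :: "real \<Rightarrow> real"
  assumes F: "integrable M F" and s: "s \<in> borel_measurable M" and q: "continuous_on {lo..hi} q"
    and ran: "\<And>z. F z \<noteq> 0 \<Longrightarrow> s z \<in> {lo..hi}"
    and z: "\<And>i. (LINT z|M. F z * of_real (s z ^ i)) = 0"
  shows "integrable M (\<lambda>z. F z * (if 0 < q (s z) then 1 else 0))"
    "(LINT z|M. F z * (if 0 < q (s z) then 1 else 0)) = 0"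
proof -
  have [measurable]: "F \<in> borel_measurable M" "s \<in> borel_measurable M" using F s by auto
  obtain a n where b: "\<And>k s. s \<in> {lo..hi} \<Longrightarrow> \<bar>\<Sum>i\<le>n k. a k i * s ^ i\<bar> \<le> (2::real)"
    and l: "\<And>s. s \<in> {lo..hi} \<Longrightarrow> (\<lambda>k. \<Sum>i\<le>n k. a k i * s ^ i) \<longlonglongrightarrow> (if 0 < q s then 1 else 0)"
    using positivity_poly_approx[OF q] by blast
  define P where "P k z = F z * of_real (\<Sum>i\<le>n k. a k i * s z ^ i)" for k z
  define G where "G z = F z * (if 0 < q (s z) then 1 else 0)" for z
  have Pm: "P k \<in> borel_measurable M" for k unfolding P_def by measurable
  have lim: "(\<lambda>k. P k z) \<longlonglongrightarrow> G z" for z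
  proof (cases "F z = 0")
    case True then show ?thesis by (simp add: P_def G_def)
  next
    case False
    have "(\<lambda>k. P k z) \<longlonglongrightarrow> F z * of_real (if 0 < q (s z) then 1 else 0)"
      unfolding P_def by (intro tendsto_intros l ran False)
    then show ?thesis by (cases "0 < q (s z)") (simp_all add: G_def)
  qed
  have Gm: "G \<in> borel_measurable M" by (rule borel_measurable_LIMSEQ_metric[OF Pm lim])
  have bd: "norm (P k z) \<le> 2 * norm (F z)" for k z
  proof (cases "F z = 0")
    case True then show ?thesis by (simp add: P_def)
  next
    case False
    have "norm (P k z) = norm (F z) * \<bar>\<Sum>i\<le>n k. a k i * s z ^ i\<bar>" unfolding P_def norm_mult norm_of_real ..
    also have "\<dots> \<le> norm (F z) * 2" by (intro mult_left_mono b ran False) auto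
    finally show ?thesis by simp
  qed
  have i2: "integrable M (\<lambda>z. 2 * norm (F z))" using F by (intro integrable_mult_right integrable_norm)
  have D: "integrable M G" "(\<lambda>k. LINT z|M. P k z) \<longlonglongrightarrow> (LINT z|M. G z)"
    using integrable_dominated_convergence[OF Gm Pm i2 AE_I2[OF lim] AE_I2[OF bd]]
      integral_dominated_convergence[OF Gm Pm i2 AE_I2[OF lim] AE_I2[OF bd]] by auto
  have si: "integrable M (\<lambda>z. F z * of_real (s z ^ i))" for i
  proof (rule Bochner_Integration.integrable_bound[where f = "\<lambda>z. (\<bar>lo\<bar> + \<bar>hi\<bar>) ^ i * norm (F z)"])
    show "integrable M (\<lambda>z. (\<bar>lo\<bar> + \<bar>hi\<bar>) ^ i * norm (F z))" using F by (intro integrable_mult_right integrable_norm)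
    show "AE z in M. norm (F z * of_real (s z ^ i)) \<le> norm ((\<bar>lo\<bar> + \<bar>hi\<bar>) ^ i * norm (F z))"
    proof (rule AE_I2)
      fix z show "norm (F z * of_real (s z ^ i)) \<le> norm ((\<bar>lo\<bar> + \<bar>hi\<bar>) ^ i * norm (F z))"
      proof (cases "F z = 0")
        case False
        then have "\<bar>s z\<bar> \<le> \<bar>lo\<bar> + \<bar>hi\<bar>" using ran[OF False] by auto
        then have "\<bar>s z\<bar> ^ i \<le> (\<bar>lo\<bar> + \<bar>hi\<bar>) ^ i" by (intro power_mono) auto
        from mult_left_mono[OF this norm_ge_zero[of "F z"]]
        show ?thesis by (simp add: norm_mult norm_power mult.commute[of "(\<bar>lo\<bar> + \<bar>hi\<bar>) ^ i"])
      qed simp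
    qed
  qed measurable
  have "(LINT z|M. P k z) = 0" for k
  proof -
    have "(LINT z|M. P k z) = (LINT z|M. (\<Sum>i\<le>n k. of_real (a k i) * (F z * of_real (s z ^ i))))"
      unfolding P_def by (simp add: sum_distrib_left mult_ac)
    also have "\<dots> = (\<Sum>i\<le>n k. (LINT z|M. of_real (a k i) * (F z * of_real (s z ^ i))))"
      by (intro Bochner_Integration.integral_sum integrable_mult_right si)
    also have "\<dots> = 0" using z by simp
    finally show ?thesis .
  qed
  then have "(LINT z|M. G z) = 0" using D(2) LIMSEQ_unique[of "\<lambda>_. 0::complex" 0] tendsto_const by simp
  then show "integrable M (\<lambda>z. F z * (if 0 < q (s z) then 1 else 0))"
    "(LINT z|M. F z * (if 0 < q (s z) then 1 else 0)) = 0" using D(1) unfolding G_def by auto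
qed

text \<open>As densities, \<open>f\<close> and \<open>- f\<close> stand for the positive and the
  negative part, since \<open>ennreal\<close> truncates at zero. The two measures agree on boxes, a
  generator stable under intersection, hence everywhere.\<close>

lemma zero_on_boxes_real:
  fixes f :: "real \<times> real \<Rightarrow> real"
  assumes f: "integrable lborel f" and z: "\<And>a b. (LINT z|lborel. indicator (box a b) z * f z) = 0"
  shows "AE z in lborel. f z = 0"
proof -
  have fm[measurable]: "f \<in> borel_measurable lborel" using f by simp
  have e: "emeasure (density lborel (\<lambda>z. ennreal (g z))) (box a b) = ennreal (LINT z|lborel. indicator (box a b) z * max 0 (g z))"
    if g: "integrable lborel g" for g :: "real \<times> real \<Rightarrow> real" and a b
  proof -
    have [measurable]: "g \<in> borel_measurable lborel" using g by simp
    have "emeasure (density lborel (\<lambda>z. ennreal (g z))) (box a b) = (\<integral>\<^sup>+ z. ennreal (g z) * indicator (box a b) z \<partial>lborel)"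
      by (subst emeasure_density) auto
    also have "\<dots> = (\<integral>\<^sup>+ z. ennreal (indicator (box a b) z * max 0 (g z)) \<partial>lborel)"
      by (intro nn_integral_cong) (auto simp: indicator_def max_def ennreal_neg)
    also have "\<dots> = ennreal (LINT z|lborel. indicator (box a b) z * max 0 (g z))"
    proof (rule nn_integral_eq_integral)
      show "integrable lborel (\<lambda>z. indicator (box a b) z * max 0 (g z))"
        using integrable_mult_indicator[of "box a b" lborel "\<lambda>z. max 0 (g z)"] g by simp
    qed (auto intro!: AE_I2)
    finally show ?thesis .
  qed
  have nf: "integrable lborel (\<lambda>z. - f z)" using f by simp
  have "density lborel (\<lambda>z. ennreal (f z)) = density lborel (\<lambda>z. ennreal (- f z))"
  proof (rule measure_eqI_generator_eq[where E = "range (\<lambda>(a, b). box a b)" and \<Omega> = UNIV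
        and A = "\<lambda>n. box (- real n *\<^sub>R One) (real n *\<^sub>R One)"])
    show "Int_stable (range (\<lambda>(a, b). box a b :: (real \<times> real) set))"
      by (auto simp: Int_stable_def box_Int_box)
    show "sets (density lborel (\<lambda>z. ennreal (f z))) = sigma_sets UNIV (range (\<lambda>(a, b). box a b))"
      "sets (density lborel (\<lambda>z. ennreal (- f z))) = sigma_sets UNIV (range (\<lambda>(a, b). box a b))"
      by (simp_all add: borel_eq_box)
    show "(\<Union>i. box (- real i *\<^sub>R One) (real i *\<^sub>R One)) = (UNIV :: (real \<times> real) set)"
      using UN_box_eq_UNIV by simp
    show "emeasure (density lborel (\<lambda>z. ennreal (f z))) (box (- real i *\<^sub>R One) (real i *\<^sub>R One)) \<noteq> \<infinity>" for i
      unfolding e[OF f] by simp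
    fix X :: "(real \<times> real) set" assume "X \<in> range (\<lambda>(a, b). box a b)"
    then obtain a b where X: "X = box a b" by auto
    have i: "integrable lborel (\<lambda>z. indicator (box a b) z * max 0 (f z))"
      "integrable lborel (\<lambda>z. indicator (box a b) z * max 0 (- f z))"
      using integrable_mult_indicator[of "box a b" lborel "\<lambda>z. max 0 (f z)"]
        integrable_mult_indicator[of "box a b" lborel "\<lambda>z. max 0 (- f z)"] f by simp_all
    have "(LINT z|lborel. indicator (box a b) z * max 0 (f z)) - (LINT z|lborel. indicator (box a b) z * max 0 (- f z))
       = (LINT z|lborel. indicator (box a b) z * f z)"
      unfolding Bochner_Integration.integral_diff[OF i, symmetric] right_diff_distrib[symmetric]
      by (intro Bochner_Integration.integral_cong) (auto simp: max_def)
    then show "emeasure (density lborel (\<lambda>z. ennreal (f z))) X = emeasure (density lborel (\<lambda>z. ennreal (- f z))) X"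
      unfolding X e[OF f] e[OF nf] z by simp
  qed auto
  then have "AE z in lborel. ennreal (f z) = ennreal (- f z)"
    by (subst (asm) sigma_finite_measure.density_unique_iff[OF sigma_finite_lborel]) auto
  then show ?thesis
  proof eventually_elim
    case (elim z)
    show ?case
    proof (cases "0 \<le> f z")
      case True
      then have "ennreal (f z) = 0" using elim by (simp add: ennreal_neg)
      then show ?thesis using True by simp
    next
      case False
      then have "ennreal (- f z) = 0" using elim by (simp add: ennreal_neg)
      then show ?thesis using False by (simp add: ennreal_eq_0_iff)
    qed
  qed
qed

lemma zero_on_boxes:
  fixes f :: "real \<times> real \<Rightarrow> complex"
  assumes f: "integrable lborel f" and z: "\<And>a b. (LINT z|lborel. indicator (box a b) z * f z) = 0"
  shows "AE z in lborel. f z = 0"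
proof -
  have i: "integrable lborel (\<lambda>z. indicator (box a b) z * f z)" for a b
  proof -
    have "(\<lambda>z. indicator (box a b) z * f z) = (\<lambda>z. indicator (box a b) z *\<^sub>R f z)" by (auto simp: indicator_def)
    then show ?thesis using integrable_mult_indicator[of "box a b" lborel f] f by simp
  qed
  have r: "indicator A z * Re w = Re (indicator A z * w)" "indicator A z * Im w = Im (indicator A z * w)" for A and z :: "real \<times> real" and w
    by (auto simp: indicator_def)
  have "AE z in lborel. Re (f z) = 0"
  proof (rule zero_on_boxes_real)
    show "(LINT z|lborel. indicator (box a b) z * Re (f z)) = 0" for a b
      unfolding r integral_Re[OF i] z by simp
  qed (use f in simp)
  moreover have "AE z in lborel. Im (f z) = 0"
  proof (rule zero_on_boxes_real)
    show "(LINT z|lborel. indicator (box a b) z * Im (f z)) = 0" for a b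
      unfolding r integral_Im[OF i] z by simp
  qed (use f in simp)
  ultimately show ?thesis by eventually_elim (simp add: complex_eq_iff)
qed

text \<open>Makes the indicator of a time interval the positivity set of a trigonometric polynomial:
  a cosine centred at the midpoint, minus its value at the ends. Monotonicity of the cosine on
  \<open>{0..pi}\<close> decides the case of small arguments, reflection \<open>2 * pi - x\<close>
  the case beyond \<open>pi\<close>.\<close>

lemma cos_arc:
  assumes T: "0 < T" and ab: "0 \<le> a" "a < b" "b \<le> T" and t: "t \<in> {0<..<T}"
  shows "0 < cos (2 * pi / T * (t - (a + b) / 2)) - cos (2 * pi / T * ((b - a) / 2)) \<longleftrightarrow> a < t \<and> t < b"
proof -
  define \<omega> where "\<omega> = 2 * pi / T"
  have w: "0 < \<omega>" "\<omega> * T = 2 * pi" unfolding \<omega>_def using T by auto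
  define d where "d = \<bar>t - (a + b) / 2\<bar>"
  define l where "l = (b - a) / 2"
  have c: "cos (\<omega> * (t - (a + b) / 2)) = cos (\<omega> * d)"
    using cos_abs_real[of "\<omega> * (t - (a + b) / 2)"] w by (simp add: d_def abs_mult)
  have dl: "a < t \<and> t < b \<longleftrightarrow> d < l" unfolding d_def l_def by (auto simp: field_simps abs_if)
  have l: "0 < l" "l \<le> T / 2" "d \<le> T - l" "0 \<le> d" unfolding l_def d_def using ab t by (auto simp: field_simps abs_if)
  have wl: "\<omega> * l \<le> pi"
  proof -
    have "\<omega> * l \<le> \<omega> * (T / 2)" using w l by (intro mult_left_mono) auto
    then show ?thesis using w by simp
  qed
  have "d < l \<longleftrightarrow> cos (\<omega> * l) < cos (\<omega> * d)"
  proof (cases "\<omega> * d \<le> pi")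
    case True
    have "cos (\<omega> * l) < cos (\<omega> * d) \<longleftrightarrow> \<omega> * d < \<omega> * l"
      by (rule cos_mono_less_eq) (use w l wl True in auto)
    then show ?thesis using w by simp
  next
    case False
    have "\<omega> * l \<le> 2 * pi - \<omega> * d"
    proof -
      have "\<omega> * l \<le> \<omega> * (T - d)" using w l by (intro mult_left_mono) auto
      then show ?thesis using w by (simp add: algebra_simps)
    qed
    then have "cos (2 * pi - \<omega> * d) \<le> cos (\<omega> * l)"
      using False w l by (intro cos_monotone_0_pi_le) auto
    moreover have "cos (2 * pi - \<omega> * d) = cos (\<omega> * d)" by (simp add: cos_diff)
    moreover have "\<not> d < l"
    proof
      assume "d < l"
      then have "\<omega> * d < \<omega> * l" using w by simp
      then show False using False wl by linarith
    qed
    ultimately show ?thesis by auto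
  qed
  then show ?thesis using dl c unfolding \<omega>_def l_def by simp
qed

text \<open>Powers of a shifted cosine, times the exponentials, are again combinations of
  exponentials. Hence \<open>integral_positivity_zero\<close> localises first in time, through
  \<open>cos_arc\<close>, and then in space, through the quadratic \<open>q2\<close>, until all
  integrals over boxes vanish.\<close>

lemma annihilated_zero:
  fixes U :: "real \<times> real \<Rightarrow> complex"
  assumes T: "0 < T" and U: "integrable lborel U" and out: "\<And>z. z \<notin> beam_domain T \<Longrightarrow> U z = 0"
    and z: "\<And>j m. (LINT z|lborel. U z * of_real (snd z ^ j) * cis (- (vartheta T m * fst z))) = 0"
  shows "AE z in lborel. U z = 0"
proof (rule zero_on_boxes[OF U])
  have [measurable]: "U \<in> borel_measurable borel" using U by simp
  define \<omega> where "\<omega> = 2 * pi / T"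
  have th: "vartheta T m = \<omega> * of_int m" for m by (simp add: vartheta_def \<omega>_def)
  have mf[measurable]: "(fst :: real \<times> real \<Rightarrow> real) \<in> borel_measurable borel" "(snd :: real \<times> real \<Rightarrow> real) \<in> borel_measurable borel"
    by (auto intro!: borel_measurable_continuous_onI continuous_intros)
  have cism: "(\<lambda>z :: real \<times> real. cis (- (r * fst z))) \<in> borel_measurable borel" for r
    by (intro borel_measurable_continuous_onI) (auto simp: cis_conv_exp intro!: continuous_intros)
  have Uj: "integrable lborel (\<lambda>z. U z * of_real (snd z ^ j))" for j
  proof (rule Bochner_Integration.integrable_bound[where f = "\<lambda>z. pi ^ j * norm (U z)"])
    show "integrable lborel (\<lambda>z. pi ^ j * norm (U z))" using U by (intro integrable_mult_right integrable_norm)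
    show "AE z in lborel. norm (U z * of_real (snd z ^ j)) \<le> norm (pi ^ j * norm (U z))"
    proof (rule AE_I2)
      fix z show "norm (U z * of_real (snd z ^ j)) \<le> norm (pi ^ j * norm (U z))"
      proof (cases "z \<in> beam_domain T")
        case True
        then have "\<bar>snd z\<bar> ^ j \<le> pi ^ j" by (intro power_mono) (auto simp: beam_domain_def)
        from mult_left_mono[OF this norm_ge_zero[of "U z"]]
        show ?thesis by (simp add: norm_mult norm_power mult.commute[of "pi ^ j"])
      qed (simp add: out)
    qed
  qed measurable
  \<comment> \<open>Multiplication by the cosine splits into shifts of \<open>m\<close> by one in
    either direction, hence the induction with \<open>m\<close> arbitrary.\<close>
  have tr: "(LINT z|lborel. U z * of_real (snd z ^ j) * of_real (cos (\<omega> * (fst z - c)) ^ i) * cis (- (vartheta T m * fst z))) = 0"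
    for i j m c
  proof (induction i arbitrary: m)
    case 0 then show ?case using z by simp
  next
    case (Suc i)
    let ?F = "\<lambda>m z. U z * of_real (snd z ^ j) * of_real (cos (\<omega> * (fst z - c)) ^ i) * cis (- (vartheta T m * fst z))"
    have Fi: "integrable lborel (?F m)" for m
    proof (rule Bochner_Integration.integrable_bound[OF Uj[of j]])
      show "?F m \<in> borel_measurable lborel" using cism by simp measurable
      show "AE z in lborel. norm (?F m z) \<le> norm (U z * of_real (snd z ^ j))"
        by (intro AE_I2) (auto simp: norm_mult norm_power power_le_one intro!: mult_right_le_one_le)
    qed
    have e: "?F m z * of_real (cos (\<omega> * (fst z - c))) = cis (- \<omega> * c) / 2 * ?F (m - 1) z + cis (\<omega> * c) / 2 * ?F (m + 1) z" for z
    proof -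
      have "of_real (cos (\<omega> * (fst z - c))) * cis (- (vartheta T m * fst z)) =
        (cis (\<omega> * (fst z - c)) + cis (- (\<omega> * (fst z - c)))) / 2 * cis (- (vartheta T m * fst z))"
        by (simp add: complex_eq_iff)
      also have "\<dots> = (cis (- \<omega> * c) * cis (- (vartheta T (m - 1) * fst z)) + cis (\<omega> * c) * cis (- (vartheta T (m + 1) * fst z))) / 2"
        by (simp add: distrib_right cis_mult th) (simp add: algebra_simps)
      finally have k: "of_real (cos (\<omega> * (fst z - c))) * cis (- (vartheta T m * fst z)) = \<dots>" .
      have "?F m z * of_real (cos (\<omega> * (fst z - c))) = (U z * of_real (snd z ^ j) * of_real (cos (\<omega> * (fst z - c)) ^ i)) *
          (of_real (cos (\<omega> * (fst z - c))) * cis (- (vartheta T m * fst z)))" by (simp only: mult_ac)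
      then show ?thesis unfolding k by (simp only: add_divide_distrib distrib_left times_divide_eq_left times_divide_eq_right mult_ac)
    qed
    have "(LINT z|lborel. ?F m z * of_real (cos (\<omega> * (fst z - c)))) = 0"
      unfolding e using Suc Fi
      by (subst Bochner_Integration.integral_add) (auto intro!: integrable_mult_right)
    then show ?case by (simp add: mult_ac)
  qed
  have tr0: "(LINT z|lborel. (U z * of_real (snd z ^ j)) * of_real (cos (\<omega> * (fst z - c)) ^ i)) = 0" for i j c
    using tr[of j c i 0] by (simp add: th)
  fix a b :: "real \<times> real"
  \<comment> \<open>The box is clipped to the time domain, since \<open>cos_arc\<close> covers a
    single period; \<open>U\<close> vanishes outside.\<close>
  define lo where "lo = max (fst a) 0"
  define hi where "hi = min (fst b) T"
  show "(LINT z|lborel. indicator (box a b) z * U z) = 0"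
  proof (cases "lo < hi \<and> snd a < snd b")
    case False
    then have bz: "indicator (box a b) z * U z = 0" for z
      using out[of z] unfolding lo_def hi_def
      by (cases "z \<in> beam_domain T") (auto simp: beam_domain_def indicator_def mem_box Basis_prod_def inner_prod_def)
    show ?thesis unfolding bz by simp
  next
    case True
    define c where "c = (lo + hi) / 2"
    define q1 where "q1 s = s - cos (\<omega> * ((hi - lo) / 2))" for s
    define q2 where "q2 s = (s - snd a) * (snd b - s)" for s
    define s1 where "s1 z = cos (\<omega> * (fst z - c))" for z :: "real \<times> real"
    have s1m: "s1 \<in> borel_measurable lborel" unfolding s1_def by measurable
    have 1: "(LINT z|lborel. (U z * of_real (snd z ^ j)) * (if 0 < q1 (s1 z) then 1 else 0)) = 0"
      "integrable lborel (\<lambda>z. (U z * of_real (snd z ^ j)) * (if 0 < q1 (s1 z) then 1 else 0))" for j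
    proof -
      have q: "continuous_on {-1..1} q1" unfolding q1_def by (intro continuous_intros)
      have r: "s1 z \<in> {-1..1}" for z by (simp add: s1_def)
      have t0: "(LINT z|lborel. (U z * of_real (snd z ^ j)) * of_real (s1 z ^ i)) = 0" for i
        using tr0[of j c i] by (simp only: s1_def)
      show "(LINT z|lborel. (U z * of_real (snd z ^ j)) * (if 0 < q1 (s1 z) then 1 else 0)) = 0"
        by (rule integral_positivity_zero(2)[OF Uj s1m q r t0])
      show "integrable lborel (\<lambda>z. (U z * of_real (snd z ^ j)) * (if 0 < q1 (s1 z) then 1 else 0))"
        by (rule integral_positivity_zero(1)[OF Uj s1m q r t0])
    qed
    define V where "V z = U z * (if 0 < q1 (s1 z) then 1 else 0)" for z
    have Vi: "integrable lborel V" using 1(2)[of 0] unfolding V_def by simp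
    have Vz: "(LINT z|lborel. V z * of_real (snd z ^ j)) = 0" for j
      using 1(1)[of j] unfolding V_def by (simp add: mult_ac)
    have "(LINT z|lborel. V z * (if 0 < q2 (snd z) then 1 else 0)) = 0"
    proof (rule integral_positivity_zero(2)[OF Vi _ _ _ Vz])
      show "continuous_on {0..pi} q2" unfolding q2_def by (intro continuous_intros)
      show "snd z \<in> {0..pi}" if "V z \<noteq> 0" for z
        using out[of z] that by (cases "z \<in> beam_domain T") (auto simp: V_def beam_domain_def)
    qed simp
    also have "(\<lambda>z. V z * (if 0 < q2 (snd z) then 1 else 0)) = (\<lambda>z. indicator (box a b) z * U z)"
    proof
      fix z
      show "V z * (if 0 < q2 (snd z) then 1 else 0) = indicator (box a b) z * U z"
      proof (cases "z \<in> beam_domain T")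
        case False then show ?thesis using out by (simp add: V_def)
      next
        case zD: True
        then have t: "fst z \<in> {0<..<T}" by (auto simp: beam_domain_def)
        have "0 < q1 (s1 z) \<longleftrightarrow> lo < fst z \<and> fst z < hi"
          unfolding q1_def s1_def c_def \<omega>_def
          by (rule cos_arc[OF T _ _ _ t]) (use True in \<open>auto simp: lo_def hi_def\<close>)
        moreover have "0 < q2 (snd z) \<longleftrightarrow> snd a < snd z \<and> snd z < snd b"
          unfolding q2_def zero_less_mult_iff using True by auto
        moreover have "z \<in> box a b \<longleftrightarrow> (lo < fst z \<and> fst z < hi) \<and> (snd a < snd z \<and> snd z < snd b)"
          using t by (auto simp: lo_def hi_def mem_box Basis_prod_def inner_prod_def)
        ultimately show ?thesis by (simp add: V_def indicator_def)
      qed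
    qed
    finally show ?thesis .
  qed
qed

section \<open>The weighted space over the space-time domain\<close>

text \<open>Two derivatives of \<open>\<eta>\<close> are what the pointwise expression
  \<open>(\<eta> \<psi>'')''\<close> requires for smooth \<open>\<psi>\<close>. The equations for
  \<open>c0\<close> and \<open>cp\<close> express the end conditions multiplied by
  \<open>\<eta>\<close>.\<close>

locale beam_setting = beam_ode \<rho> \<eta> c0 cp for \<rho> \<eta> :: "real \<Rightarrow> real" and c0 cp :: real +
  fixes T :: real and \<alpha> \<beta> \<eta>1 \<eta>2 :: "real \<Rightarrow> real"
  assumes T_pos: "0 < T"
    and eta_d1: "\<And>x. x \<in> {0..pi} \<Longrightarrow> (\<eta> has_real_derivative \<eta>1 x) (at x within {0..pi})"
    and eta_d2: "\<And>x. x \<in> {0..pi} \<Longrightarrow> (\<eta>1 has_real_derivative \<eta>2 x) (at x within {0..pi})"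
    and eta2_cont: "continuous_on {0..pi} \<eta>2"
    and c0_eq: "c0 = 2 * (\<alpha> 0 + \<beta> 0) * \<eta> 0" and cp_eq: "cp = 2 * (\<alpha> pi + \<beta> pi) * \<eta> pi"
begin

abbreviation Om :: "(real \<times> real) set" where "Om \<equiv> beam_domain T"
abbreviation Rc :: "(real \<times> real) set" where "Rc \<equiv> {0..T} \<times> {0..pi}"
abbreviation MM :: "(real \<times> real) measure" where "MM \<equiv> beam_measure T \<rho>"

lemma Om_box: "Om = box (0, 0) (T, pi)"
  by (auto simp: beam_domain_def mem_box Basis_prod_def inner_prod_def)

lemma Rc_cbox: "Rc = cbox (0, 0) (T, pi)"
  by (simp add: cbox_Pair_eq)

lemma Om_sub: "z \<in> Om \<Longrightarrow> z \<in> Rc" by (auto simp: beam_domain_def)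

lemma Om_sets: "Om \<in> sets lborel" "Om \<in> sets borel" unfolding Om_box by auto

lemma cont_set_integrable:
  fixes F :: "real \<times> real \<Rightarrow> 'b :: euclidean_space"
  assumes "continuous_on Rc F" shows "set_integrable lborel Om F"
proof (rule set_integrable_subset)
  show "set_integrable lborel Rc F"
    unfolding set_integrable_def
    by (rule borel_integrable_compact[OF _ assms]) (auto intro: compact_Times)
qed (use Om_sets Om_sub in auto)

lemma fubini_tx:
  fixes F :: "real \<times> real \<Rightarrow> complex"
  assumes "continuous_on Rc F"
  shows "(LINT z:Om|lborel. F z) = integral {0..T} (\<lambda>t. integral {0..pi} (\<lambda>x. F (t, x)))"
proof -
  have "(LINT z:Om|lborel. F z) = integral (box (0, 0) (T, pi)) F"
    using set_borel_integral_eq_integral(2)[OF cont_set_integrable[OF assms]] by (simp add: Om_box)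
  also have "\<dots> = integral (cbox (0, 0) (T, pi)) F" by (rule integral_open_interval)
  also have "\<dots> = integral (cbox 0 T) (\<lambda>t. integral (cbox 0 pi) (\<lambda>x. F (t, x)))"
    by (rule integral_prod_continuous) (use assms in \<open>simp add: Rc_cbox\<close>)
  finally show ?thesis by simp
qed

lemma fubini_xt:
  fixes F :: "real \<times> real \<Rightarrow> complex"
  assumes "continuous_on Rc F"
  shows "(LINT z:Om|lborel. F z) = integral {0..pi} (\<lambda>x. integral {0..T} (\<lambda>t. F (t, x)))"
  unfolding fubini_tx[OF assms]
  using integral_swap_continuous[of 0 0 T pi "\<lambda>t x. F (t, x)"] assms by (simp add: Rc_cbox)

lemma rho_snd_cont: "continuous_on Rc (\<lambda>z. \<rho> (snd z))"
  by (rule continuous_on_compose2[OF rho_cont]) (auto intro: continuous_intros)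

lemma restrict_meas: "continuous_on Om f \<Longrightarrow> f \<in> borel_measurable (restrict_space lborel Om)"
  for f :: "real \<times> real \<Rightarrow> 'b :: topological_space"
  using borel_measurable_continuous_on_restrict[of Om f]
  by (subst measurable_cong_sets[OF sets_restrict_space_cong[OF sets_lborel] refl])

lemma rho_meas: "(\<lambda>z. \<rho> (snd z)) \<in> borel_measurable (restrict_space lborel Om)"
  by (rule restrict_meas, rule continuous_on_subset[OF rho_snd_cont]) (use Om_sub in auto)

lemma MM_eq: "MM = density (restrict_space lborel Om) (\<lambda>z. ennreal (\<rho> (snd z)))"
  unfolding beam_measure_def by (simp add: case_prod_beta')

lemma space_MM: "space MM = Om" by (simp add: MM_eq space_restrict_space)

lemma meas_MM: "borel_measurable MM = borel_measurable (restrict_space lborel Om)"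
  unfolding MM_eq by (rule measurable_cong_sets) simp_all

lemma cont_meas: "continuous_on Rc f \<Longrightarrow> f \<in> borel_measurable MM"
  for f :: "real \<times> real \<Rightarrow> 'b :: topological_space"
  unfolding meas_MM by (rule restrict_meas, erule continuous_on_subset) (use Om_sub in auto)

lemma rho_AE_nonneg: "AE z in restrict_space lborel Om. 0 \<le> \<rho> (snd z)"
proof (rule AE_I2)
  fix z assume "z \<in> space (restrict_space lborel Om)"
  then have "z \<in> Rc" by (intro Om_sub) (simp add: space_restrict_space)
  then have "snd z \<in> {0..pi}" by (simp add: mem_Times_iff)
  then show "0 \<le> \<rho> (snd z)" using rho_gt by force
qed

lemma integrable_MM:
  fixes f :: "real \<times> real \<Rightarrow> 'b :: {banach, second_countable_topology}"
  assumes "f \<in> borel_measurable MM"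
  shows "integrable MM f \<longleftrightarrow> set_integrable lborel Om (\<lambda>z. \<rho> (snd z) *\<^sub>R f z)"
  unfolding MM_eq using assms Om_sets
  by (subst integrable_density[OF _ rho_meas rho_AE_nonneg])
    (auto simp: meas_MM integrable_restrict_space set_integrable_def)

lemma integral_MM:
  fixes f :: "real \<times> real \<Rightarrow> complex"
  assumes "f \<in> borel_measurable MM"
  shows "(LINT z|MM. f z) = (LINT z:Om|lborel. of_real (\<rho> (snd z)) * f z)"
  unfolding MM_eq using assms Om_sets
  by (subst integral_density[OF _ rho_meas rho_AE_nonneg])
    (auto simp: meas_MM integral_restrict_space set_lebesgue_integral_def scaleR_conv_of_real)

lemma AE_MM: "(AE z in MM. P z) \<longleftrightarrow> (AE z in lborel. z \<in> Om \<longrightarrow> P z)"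
proof -
  have "(AE z in MM. P z) \<longleftrightarrow> (AE z in lborel. z \<in> Om \<longrightarrow> 0 < ennreal (\<rho> (snd z)) \<longrightarrow> P z)"
    unfolding MM_eq using rho_meas Om_sets
    by (subst AE_density) (auto simp: AE_restrict_space_iff)
  also have "\<dots> \<longleftrightarrow> (AE z in lborel. z \<in> Om \<longrightarrow> P z)"
  proof (rule arg_cong[where f = "\<lambda>Q. eventually Q (ae_filter lborel)"], rule ext)
    fix z
    show "(z \<in> Om \<longrightarrow> 0 < ennreal (\<rho> (snd z)) \<longrightarrow> P z) = (z \<in> Om \<longrightarrow> P z)"
      using rho_gt[of "snd z"] Om_sub[of z] by auto
  qed
  finally show ?thesis .
qed

lemma finite_MM: "finite_measure MM"
proof -
  have "integrable MM (\<lambda>_. 1 :: real)"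
    using cont_set_integrable[OF rho_snd_cont] by (subst integrable_MM) simp_all
  then have "emeasure MM (space MM) < \<infinity>" by (simp add: integrable_iff_bounded)
  then show ?thesis by (intro finite_measureI) simp
qed

lemma cont_L2: 
  fixes f :: "real \<times> real \<Rightarrow> complex"
  assumes "continuous_on Rc f" shows "f \<in> L2_space MM"
proof -
  have m: "f \<in> borel_measurable MM" by (rule cont_meas[OF assms])
  have "integrable MM (\<lambda>z. (cmod (f z))\<^sup>2)"
    using m by (subst integrable_MM)
      (auto intro!: cont_set_integrable continuous_intros rho_snd_cont assms borel_measurable_power borel_measurable_norm)
  then show ?thesis using m by (simp add: L2_space_def)
qed

text \<open>Unweighted integrability from the weighted space: \<open>F\<close> divided by the weight
  is continuous on the closed rectangle, hence square integrable.\<close>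

lemma L2_set_integrable:
  assumes u: "u \<in> L2_space MM" and F: "continuous_on Rc F"
  shows "set_integrable lborel Om (\<lambda>z. u z * F z)"
proof -
  have um: "u \<in> borel_measurable MM" using u by (simp add: L2_space_def)
  have Fr: "continuous_on Rc (\<lambda>z. cnj (F z) / of_real (\<rho> (snd z)))"
    using rho_gt by (intro continuous_intros F rho_snd_cont) force
  have "integrable MM (\<lambda>z. u z * cnj (cnj (F z) / of_real (\<rho> (snd z))))"
    by (rule L2_space_integrable_mult[OF u cont_L2[OF Fr]])
  then have "set_integrable lborel Om (\<lambda>z. \<rho> (snd z) *\<^sub>R (u z * cnj (cnj (F z) / of_real (\<rho> (snd z)))))"
    using integrable_MM borel_measurable_integrable by blast
  then show ?thesis
  proof (rule set_integrable_cong[OF refl refl, THEN iffD1, rotated])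
    fix z assume "z \<in> Om"
    then have "\<rho> (snd z) \<noteq> 0" using rho_gt[of "snd z"] Om_sub[of z] by auto
    then show "\<rho> (snd z) *\<^sub>R (u z * cnj (cnj (F z) / of_real (\<rho> (snd z)))) = u z * F z"
      by (simp add: scaleR_conv_of_real)
  qed
qed

lemma pairing_le:
  assumes u: "u \<in> L2_space MM" and F: "continuous_on Rc F" and b: "\<And>z. z \<in> Rc \<Longrightarrow> cmod (F z) \<le> e"
  shows "cmod (LINT z:Om|lborel. u z * F z) \<le> e * (LINT z:Om|lborel. cmod (u z))"
proof -
  have i: "integrable lborel (\<lambda>z. indicator Om z *\<^sub>R (u z * F z))"
    using L2_set_integrable[OF u F] by (simp add: set_integrable_def)
  have "integrable lborel (\<lambda>z. indicator Om z *\<^sub>R (u z * 1))"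
    using L2_set_integrable[OF u continuous_on_const] unfolding set_integrable_def .
  then have "integrable lborel (\<lambda>z. norm (indicator Om z *\<^sub>R (u z * 1)))" by (rule integrable_norm)
  then have i2: "integrable lborel (\<lambda>z. indicator Om z *\<^sub>R cmod (u z))" by simp
  have "cmod (LINT z:Om|lborel. u z * F z) \<le> (LINT z|lborel. norm (indicator Om z *\<^sub>R (u z * F z)))"
    unfolding set_lebesgue_integral_def by (rule integral_norm_bound)
  also have "\<dots> \<le> (LINT z|lborel. e * (indicator Om z *\<^sub>R cmod (u z)))"
  proof (rule integral_mono)
    show "integrable lborel (\<lambda>z. norm (indicator Om z *\<^sub>R (u z * F z)))" using i by (rule integrable_norm)
    show "integrable lborel (\<lambda>z. e * (indicator Om z *\<^sub>R cmod (u z)))" using i2 by (rule integrable_mult_right)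
    fix z
    show "norm (indicator Om z *\<^sub>R (u z * F z)) \<le> e * (indicator Om z *\<^sub>R cmod (u z))"
    proof (cases "z \<in> Om")
      case True
      from mult_right_mono[OF b[OF Om_sub[OF True]], of "cmod (u z)"] True
      show ?thesis by (simp add: norm_mult mult.commute)
    qed simp
  qed
  also have "\<dots> = e * (LINT z:Om|lborel. cmod (u z))" unfolding set_lebesgue_integral_def by simp
  finally show ?thesis .
qed

lemma inner_MM:
  assumes "u \<in> L2_space MM" "v \<in> L2_space MM"
  shows "L2_inner MM u v = (LINT z:Om|lborel. u z * (of_real (\<rho> (snd z)) * cnj (v z)))"
  unfolding L2_inner_def
  using integral_MM[OF borel_measurable_integrable[OF L2_space_integrable_mult[OF assms]]] by (simp add: mult_ac)

lemma set_integral_diff: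
  assumes u: "u \<in> L2_space MM" and F: "continuous_on Rc F" "continuous_on Rc G"
  shows "(LINT z:Om|lborel. u z * F z) - (LINT z:Om|lborel. u z * G z) = (LINT z:Om|lborel. u z * (F z - G z))"
  using set_integral_diff(2)[OF L2_set_integrable[OF u F(1)] L2_set_integrable[OF u F(2)]]
  by (simp add: right_diff_distrib)

text \<open>By \<open>pairing_le\<close> both pairings are continuous for uniform convergence of the
  continuous factor, so an identity known for approximants passes to the limit. It serves both the
  polynomial approximation of eigenfunctions and the expansion of polynomials in
  eigenfunctions.\<close>

lemma pairing_approx_eq:
  assumes u: "u \<in> L2_space MM" "h \<in> L2_space MM" and F: "continuous_on Rc F" "continuous_on Rc G"
    and ap: "\<And>e. 0 < e \<Longrightarrow> \<exists>F' G'. continuous_on Rc F' \<and> continuous_on Rc G' \<and>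
      (\<forall>z\<in>Rc. cmod (F z - F' z) \<le> e) \<and> (\<forall>z\<in>Rc. cmod (G z - G' z) \<le> e) \<and>
      (LINT z:Om|lborel. u z * F' z) = (LINT z:Om|lborel. h z * G' z)"
  shows "(LINT z:Om|lborel. u z * F z) = (LINT z:Om|lborel. h z * G z)"
proof -
  define N where "N = (LINT z:Om|lborel. cmod (u z)) + (LINT z:Om|lborel. cmod (h z))"
  have N0: "0 \<le> N" unfolding N_def set_lebesgue_integral_def by (intro add_nonneg_nonneg integral_nonneg_AE AE_I2) auto
  have "cmod ((LINT z:Om|lborel. u z * F z) - (LINT z:Om|lborel. h z * G z)) \<le> e * N" if e: "0 < e" for e
  proof -
    obtain F' G' where c: "continuous_on Rc F'" "continuous_on Rc G'"
      and b: "\<forall>z\<in>Rc. cmod (F z - F' z) \<le> e" "\<forall>z\<in>Rc. cmod (G z - G' z) \<le> e"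
      and eq: "(LINT z:Om|lborel. u z * F' z) = (LINT z:Om|lborel. h z * G' z)" using ap[OF e] by blast
    have 1: "cmod ((LINT z:Om|lborel. u z * F z) - (LINT z:Om|lborel. u z * F' z)) \<le> e * (LINT z:Om|lborel. cmod (u z))"
      unfolding set_integral_diff[OF u(1) F(1) c(1)]
      by (rule pairing_le[OF u(1)]) (use b in \<open>auto intro!: continuous_intros F c\<close>)
    have 2: "cmod ((LINT z:Om|lborel. h z * G z) - (LINT z:Om|lborel. h z * G' z)) \<le> e * (LINT z:Om|lborel. cmod (h z))"
      unfolding set_integral_diff[OF u(2) F(2) c(2)]
      by (rule pairing_le[OF u(2)]) (use b in \<open>auto intro!: continuous_intros F c\<close>)
    show ?thesis
      using norm_triangle_mono[OF 1 2] norm_triangle_ineq4[of "(LINT z:Om|lborel. u z * F z) - (LINT z:Om|lborel. u z * F' z)"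
          "(LINT z:Om|lborel. h z * G z) - (LINT z:Om|lborel. h z * G' z)"] 1 2
      unfolding eq N_def by (simp add: algebra_simps)
  qed
  note le = this
  have "cmod ((LINT z:Om|lborel. u z * F z) - (LINT z:Om|lborel. h z * G z)) \<le> 0"
  proof (rule field_le_epsilon)
    fix e :: real assume e: "0 < e"
    have "cmod ((LINT z:Om|lborel. u z * F z) - (LINT z:Om|lborel. h z * G z)) \<le> e / (N + 1) * N"
      by (rule le) (use e N0 in simp)
    also have "\<dots> \<le> e / (N + 1) * (N + 1)" using e N0 by (intro mult_left_mono) auto
    also have "\<dots> = e" using N0 by simp
    finally show "cmod ((LINT z:Om|lborel. u z * F z) - (LINT z:Om|lborel. h z * G z)) \<le> 0 + e" by simp
  qed
  then show ?thesis by simp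
qed

end

section \<open>Test functions\<close>

lemma has_vd_cong_on:
  assumes "\<And>y. y \<in> S \<Longrightarrow> f y = g y" "x \<in> S"
  shows "(f has_vector_derivative d) (at x within S) \<longleftrightarrow> (g has_vector_derivative d) (at x within S)"
proof
  assume "(f has_vector_derivative d) (at x within S)"
  then show "(g has_vector_derivative d) (at x within S)"
    by (rule has_vector_derivative_transform[OF assms(2), rotated]) (use assms in auto)
next
  assume "(g has_vector_derivative d) (at x within S)"
  then show "(f has_vector_derivative d) (at x within S)"
    by (rule has_vector_derivative_transform[OF assms(2), rotated]) (use assms in auto)
qed

lemma vd_cong_on:
  assumes "\<And>y. y \<in> S \<Longrightarrow> f y = g y" "x \<in> S"
  shows "vector_derivative f (at x within S) = vector_derivative g (at x within S)"
    "f differentiable (at x within S) \<longleftrightarrow> g differentiable (at x within S)"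
proof -
  show v: "vector_derivative f (at x within S) = vector_derivative g (at x within S)"
    unfolding vector_derivative_def using has_vd_cong_on[of S f g x, OF assms] by simp
  show "f differentiable (at x within S) \<longleftrightarrow> g differentiable (at x within S)"
    unfolding vector_derivative_works v using has_vd_cong_on[of S f g x, OF assms] by simp
qed

lemma vd_eq:
  assumes "(f has_vector_derivative d) (at x within {a..b})" "a < b" "x \<in> {a..b}"
  shows "vector_derivative f (at x within {a..b}) = d"
proof -
  have "(f has_vector_derivative vector_derivative f (at x within {a..b})) (at x within {a..b})"
    using differentiableI_vector[OF assms(1)] by (simp only: vector_derivative_works)
  then show ?thesis
    using vector_derivative_unique_within_closed_interval[of a b x f _ d] assms by auto
qed

lemma dx_pair: "dx f (t, x) = vector_derivative (\<lambda>y. f (t, y)) (at x within {0..pi})"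
  by (simp add: dx_def D_pi_def)

lemma dt_cong:
  assumes "\<And>z. z \<in> {0..T} \<times> {0..pi} \<Longrightarrow> f z = g z" "z \<in> {0..T} \<times> {0..pi}"
  shows "dt T f z = dt T g z"
  unfolding dt_def using assms by (cases z) (auto intro!: vd_cong_on)

lemma dx_cong:
  assumes "\<And>z. z \<in> {0..T} \<times> {0..pi} \<Longrightarrow> f z = g z" "z \<in> {0..T} \<times> {0..pi}"
  shows "dx f z = dx g z"
  unfolding dx_def D_pi_def using assms by (cases z) (auto intro!: vd_cong_on)

text \<open>Formulas for \<open>dt\<close> and \<open>dx\<close> are available on the closed
  rectangle only; the induction relies on iterated derivatives there depending on values there
  alone.\<close>

lemma Ck_rect_cong:
  assumes "\<And>z. z \<in> {0..T} \<times> {0..pi} \<Longrightarrow> f z = g z"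
  shows "Ck_rect k T f \<Longrightarrow> Ck_rect k T g"
  using assms
proof (induction k arbitrary: f g)
  case 0
  then show ?case using continuous_on_cong[of "{0..T} \<times> {0..pi}" _ f g] by auto
next
  case (Suc k)
  have 1: "continuous_on ({0..T} \<times> {0..pi}) g"
    using Suc.prems continuous_on_cong[of "{0..T} \<times> {0..pi}" _ f g] by auto
  have 2: "(\<lambda>s. g (s, x)) differentiable (at t within {0..T}) \<and> (\<lambda>y. g (t, y)) differentiable (at x within {0..pi})"
    if "t \<in> {0..T}" "x \<in> {0..pi}" for t x
    using Suc.prems that vd_cong_on(2)[of "{0..T}" "\<lambda>s. f (s, x)" "\<lambda>s. g (s, x)" t]
      vd_cong_on(2)[of "{0..pi}" "\<lambda>y. f (t, y)" "\<lambda>y. g (t, y)" x] by auto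
  have 3: "Ck_rect k T (dt T g)"
    by (rule Suc.IH[of "dt T f"]) (use Suc.prems(1) in simp, rule dt_cong[OF Suc.prems(2)])
  have 4: "Ck_rect k T (dx g)"
    by (rule Suc.IH[of "dx f"]) (use Suc.prems(1) in simp, rule dx_cong[OF Suc.prems(2)])
  show ?case using 1 2 3 4 by simp
qed

definition smooth_rect :: "real \<Rightarrow> (real \<times> real \<Rightarrow> complex) \<Rightarrow> bool" where
  "smooth_rect T \<psi> \<longleftrightarrow> (\<forall>k. Ck_rect k T \<psi>)"

lemma smooth_rectD:
  assumes "smooth_rect T \<psi>"
  shows "continuous_on ({0..T} \<times> {0..pi}) \<psi>" "smooth_rect T (dt T \<psi>)" "smooth_rect T (dx \<psi>)"
    "t \<in> {0..T} \<Longrightarrow> x \<in> {0..pi} \<Longrightarrow> ((\<lambda>s. \<psi> (s, x)) has_vector_derivative dt T \<psi> (t, x)) (at t within {0..T})"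
    "t \<in> {0..T} \<Longrightarrow> x \<in> {0..pi} \<Longrightarrow> ((\<lambda>y. \<psi> (t, y)) has_vector_derivative dx \<psi> (t, x)) (at x within {0..pi})"
proof -
  have k: "Ck_rect (Suc k) T \<psi>" for k using assms by (simp add: smooth_rect_def del: Ck_rect.simps)
  show "continuous_on ({0..T} \<times> {0..pi}) \<psi>" using k[of 0] by simp
  show "smooth_rect T (dt T \<psi>)" "smooth_rect T (dx \<psi>)" using k by (auto simp: smooth_rect_def)
  show "((\<lambda>s. \<psi> (s, x)) has_vector_derivative dt T \<psi> (t, x)) (at t within {0..T})"
    "((\<lambda>y. \<psi> (t, y)) has_vector_derivative dx \<psi> (t, x)) (at x within {0..pi})"
    if "t \<in> {0..T}" "x \<in> {0..pi}"
    using k[of 0] that unfolding dt_def dx_def D_pi_def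
    by (simp_all only: case_prod_conv vector_derivative_works[symmetric]) (simp_all add: that)
qed

text \<open>A family closed under both derivatives on the rectangle, which makes smoothness an easy
  induction. With suitable \<open>P\<close> it supplies all concrete test functions.\<close>

definition pcis :: "real \<Rightarrow> complex poly \<Rightarrow> real \<times> real \<Rightarrow> complex" where
  "pcis \<theta> P z = poly P (of_real (snd z)) * cis (\<theta> * fst z)"

lemma poly_vd:
  fixes P :: "complex poly"
  shows "((\<lambda>x. poly P (of_real x)) has_vector_derivative poly (pderiv P) (of_real x)) (at x within S)"
  by (rule has_vector_derivative_real_field) (rule poly_DERIV)

lemma cis_vd: "((\<lambda>t. cis (\<theta> * t)) has_vector_derivative (\<i> * of_real \<theta>) * cis (\<theta> * t)) (at t within S)"
proof -
  have "((\<lambda>z. exp (\<i> * of_real \<theta> * z)) has_field_derivative exp (\<i> * of_real \<theta> * of_real t) * (\<i> * of_real \<theta>)) (at (of_real t))"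
    by (auto intro!: derivative_eq_intros)
  from has_vector_derivative_real_field[OF this, of S] show ?thesis
    by (simp add: cis_conv_exp mult_ac)
qed

lemma pcis_vd:
  "((\<lambda>s. pcis \<theta> P (s, x)) has_vector_derivative pcis \<theta> (smult (\<i> * of_real \<theta>) P) (t, x)) (at t within S)"
  "((\<lambda>y. pcis \<theta> P (t, y)) has_vector_derivative pcis \<theta> (pderiv P) (t, x)) (at x within S)"
proof -
  show "((\<lambda>s. pcis \<theta> P (s, x)) has_vector_derivative pcis \<theta> (smult (\<i> * of_real \<theta>) P) (t, x)) (at t within S)"
    using has_vector_derivative_mult_right[OF cis_vd[of \<theta> t S], of "poly P (of_real x)"]
    by (simp add: pcis_def mult_ac)
  show "((\<lambda>y. pcis \<theta> P (t, y)) has_vector_derivative pcis \<theta> (pderiv P) (t, x)) (at x within S)"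
    using has_vector_derivative_mult_left[OF poly_vd[of P x S], of "cis (\<theta> * t)"]
    by (simp add: pcis_def)
qed

lemma pcis_derivs:
  assumes "0 < T" "z \<in> {0..T} \<times> {0..pi}"
  shows "dt T (pcis \<theta> P) z = pcis \<theta> (smult (\<i> * of_real \<theta>) P) z" "dx (pcis \<theta> P) z = pcis \<theta> (pderiv P) z"
  using assms vd_eq[OF pcis_vd(1)] vd_eq[OF pcis_vd(2)]
  by (cases z; auto simp: dt_def dx_def D_pi_def)+

lemma pcis_cont: "continuous_on S (pcis \<theta> P)"
  unfolding pcis_def[abs_def] by (intro continuous_intros)

lemma pcis_Ck:
  assumes "0 < T" shows "Ck_rect k T (pcis \<theta> P)"
proof (induction k arbitrary: P)
  case 0 show ?case by (simp add: pcis_cont)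
next
  case (Suc k)
  have "Ck_rect k T (dt T (pcis \<theta> P))"
    by (rule Ck_rect_cong[OF _ Suc[of "smult (\<i> * of_real \<theta>) P"]]) (simp add: pcis_derivs[OF assms])
  moreover have "Ck_rect k T (dx (pcis \<theta> P))"
    by (rule Ck_rect_cong[OF _ Suc[of "pderiv P"]]) (simp add: pcis_derivs[OF assms])
  moreover have "(\<lambda>s. pcis \<theta> P (s, x)) differentiable (at t within {0..T})"
    "(\<lambda>y. pcis \<theta> P (t, y)) differentiable (at x within {0..pi})" for t x
    by (rule differentiableI_vector[OF pcis_vd(1)], rule differentiableI_vector[OF pcis_vd(2)])
  ultimately show ?case using pcis_cont by simp
qed

lemma pcis_smooth: "0 < T \<Longrightarrow> smooth_rect T (pcis \<theta> P)"
  by (simp add: smooth_rect_def pcis_Ck)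

section \<open>The operator on test functions\<close>

context beam_setting
begin

definition opx :: "(real \<times> real \<Rightarrow> complex) \<Rightarrow> real \<times> real \<Rightarrow> complex" where
  "opx \<psi> = dx (dx (\<lambda>w. of_real (\<eta> (snd w)) * dx (dx \<psi>) w))"

lemma of_real_vd: "(f has_real_derivative d) F \<Longrightarrow> ((\<lambda>x. complex_of_real (f x)) has_vector_derivative of_real d) F"
  unfolding has_real_derivative_iff_has_vector_derivative
  by (rule bounded_linear.has_vector_derivative[OF bounded_linear_of_real])

lemma eta1_cont: "continuous_on {0..pi} \<eta>1" using eta_d2 by (rule DERIV_continuous_on)

lemma eta_mult_vd:
  fixes a :: "real \<Rightarrow> complex"
  assumes "(a has_vector_derivative d) (at x within {0..pi})" "x \<in> {0..pi}"
  shows "((\<lambda>x. of_real (\<eta> x) * a x) has_vector_derivative of_real (\<eta>1 x) * a x + of_real (\<eta> x) * d) (at x within {0..pi})"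
  using has_vector_derivative_mult[OF of_real_vd[OF eta_d1[OF assms(2)]] assms(1)] by (simp add: add.commute)

lemma eta_mult_vd2:
  fixes a a1 a2 :: "real \<Rightarrow> complex"
  assumes "\<And>x. x \<in> {0..pi} \<Longrightarrow> (a has_vector_derivative a1 x) (at x within {0..pi})"
    "\<And>x. x \<in> {0..pi} \<Longrightarrow> (a1 has_vector_derivative a2 x) (at x within {0..pi})" "x \<in> {0..pi}"
  shows "((\<lambda>x. of_real (\<eta>1 x) * a x + of_real (\<eta> x) * a1 x) has_vector_derivative
       of_real (\<eta>2 x) * a x + 2 * (of_real (\<eta>1 x) * a1 x) + of_real (\<eta> x) * a2 x) (at x within {0..pi})"
proof -
  note e1 = of_real_vd[OF eta_d1[OF assms(3)]] and e2 = of_real_vd[OF eta_d2[OF assms(3)]]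
  show "((\<lambda>x. of_real (\<eta>1 x) * a x + of_real (\<eta> x) * a1 x) has_vector_derivative
       of_real (\<eta>2 x) * a x + 2 * (of_real (\<eta>1 x) * a1 x) + of_real (\<eta> x) * a2 x) (at x within {0..pi})"
    using has_vector_derivative_add[OF has_vector_derivative_mult[OF e2 assms(1)[OF assms(3)]]
      has_vector_derivative_mult[OF e1 assms(2)[OF assms(3)]]] by (simp add: algebra_simps)
qed

lemma chain_C4:
  assumes "\<And>x. x \<in> {0..pi} \<Longrightarrow> (a has_vector_derivative a1 x) (at x within {0..pi})"
    "\<And>x. x \<in> {0..pi} \<Longrightarrow> (a1 has_vector_derivative a2 x) (at x within {0..pi})"
    "\<And>x. x \<in> {0..pi} \<Longrightarrow> (a2 has_vector_derivative a3 x) (at x within {0..pi})"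
    "\<And>x. x \<in> {0..pi} \<Longrightarrow> (a3 has_vector_derivative a4 x) (at x within {0..pi})"
    "a4 \<in> VC"
  shows "chain a a1 (\<lambda>x. of_real (\<eta> x) * a2 x) (\<lambda>x. of_real (\<eta>1 x) * a2 x + of_real (\<eta> x) * a3 x)
    (\<lambda>x. of_real (\<eta>2 x) * a2 x + 2 * (of_real (\<eta>1 x) * a3 x) + of_real (\<eta> x) * a4 x)"
proof -
  have c: "continuous_on {0..pi} a2" "continuous_on {0..pi} a3" "continuous_on {0..pi} a4"
    using continuous_on_vector_derivative[OF assms(3)] continuous_on_vector_derivative[OF assms(4)] assms(5)
    by (auto simp: VC_def)
  have nz: "\<eta> x \<noteq> 0" if "x \<in> {0..pi}" for x using eta_pos[OF that] by simp

  show ?thesis unfolding chain_def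
  proof (intro conjI ballI)
    fix x assume x: "x \<in> {0..pi}"
    show "(a has_vector_derivative a1 x) (at x within {0..pi})" by (rule assms(1)[OF x])
    show "(a1 has_vector_derivative of_real (\<eta> x) * a2 x / of_real (\<eta> x)) (at x within {0..pi})"
      using assms(2)[OF x] nz[OF x] by simp
    show "((\<lambda>x. of_real (\<eta> x) * a2 x) has_vector_derivative of_real (\<eta>1 x) * a2 x + of_real (\<eta> x) * a3 x) (at x within {0..pi})"
      by (rule eta_mult_vd[OF assms(3)[OF x] x])
  next
    fix x assume x: "x \<in> {0<..<pi}"
    show "((\<lambda>x. of_real (\<eta>1 x) * a2 x + of_real (\<eta> x) * a3 x) has_vector_derivative
       of_real (\<eta>2 x) * a2 x + 2 * (of_real (\<eta>1 x) * a3 x) + of_real (\<eta> x) * a4 x) (at x)"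
      by (rule within_interior[OF x], rule eta_mult_vd2[OF assms(3,4)]) (use x in auto)
  qed (use c eta_cont eta1_cont eta2_cont in \<open>auto simp: VC_def intro!: continuous_intros\<close>)
qed

lemma opx_eq:
  assumes s: "smooth_rect T \<psi>" and z: "z \<in> Rc"
  shows "opx \<psi> z = of_real (\<eta>2 (snd z)) * dx (dx \<psi>) z + 2 * (of_real (\<eta>1 (snd z)) * dx (dx (dx \<psi>)) z)
    + of_real (\<eta> (snd z)) * dx (dx (dx (dx \<psi>))) z"
proof -
  note s1 = smooth_rectD(3)[OF s] note s2 = smooth_rectD(3)[OF s1] note s3 = smooth_rectD(3)[OF s2]
  have e1: "dx (\<lambda>w. of_real (\<eta> (snd w)) * dx (dx \<psi>) w) w =
      of_real (\<eta>1 (snd w)) * dx (dx \<psi>) w + of_real (\<eta> (snd w)) * dx (dx (dx \<psi>)) w" if "w \<in> Rc" for w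
  proof -
    define t x where "t = fst w" and "x = snd w"
    have w: "w = (t, x)" "t \<in> {0..T}" "x \<in> {0..pi}" using that by (auto simp: t_def x_def)
    show ?thesis
      unfolding w(1) dx_pair[of "\<lambda>w. of_real (\<eta> (snd w)) * dx (dx \<psi>) w"] snd_conv
      by (rule vd_eq[OF eta_mult_vd[OF smooth_rectD(5)[OF s2 w(2,3)] w(3)] pi_gt_zero w(3)])
  qed
  define t x where "t = fst z" and "x = snd z"
  have w: "z = (t, x)" "t \<in> {0..T}" "x \<in> {0..pi}" using z by (auto simp: t_def x_def)
  have "opx \<psi> z = dx (\<lambda>w. of_real (\<eta>1 (snd w)) * dx (dx \<psi>) w + of_real (\<eta> (snd w)) * dx (dx (dx \<psi>)) w) z"
    unfolding opx_def by (rule dx_cong[OF e1 z])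
  also have "\<dots> = vector_derivative (\<lambda>x. of_real (\<eta>1 x) * dx (dx \<psi>) (t, x) + of_real (\<eta> x) * dx (dx (dx \<psi>)) (t, x)) (at x within {0..pi})"
    unfolding w(1) dx_pair[of "\<lambda>w. of_real (\<eta>1 (snd w)) * dx (dx \<psi>) w + of_real (\<eta> (snd w)) * dx (dx (dx \<psi>)) w"] snd_conv ..
  also have "\<dots> = of_real (\<eta>2 (snd z)) * dx (dx \<psi>) z + 2 * (of_real (\<eta>1 (snd z)) * dx (dx (dx \<psi>)) z)
    + of_real (\<eta> (snd z)) * dx (dx (dx (dx \<psi>))) z"
    unfolding w(1) snd_conv
    by (rule vd_eq, rule eta_mult_vd2) (use w smooth_rectD(5)[OF s2] smooth_rectD(5)[OF s3] in auto)
  finally show ?thesis .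
qed

lemma snd_cont: "continuous_on {0..pi} f \<Longrightarrow> continuous_on Rc (\<lambda>z. f (snd z))" for f :: "real \<Rightarrow> 'b :: topological_space"
  by (rule continuous_on_compose2[of "{0..pi}" f]) (auto intro: continuous_intros)

lemma opx_cont:
  assumes s: "smooth_rect T \<psi>" shows "continuous_on Rc (opx \<psi>)"
proof -
  note s1 = smooth_rectD(3)[OF s] note s2 = smooth_rectD(3)[OF s1] note s3 = smooth_rectD(3)[OF s2]
  note s4 = smooth_rectD(3)[OF s3]
  have "continuous_on Rc (\<lambda>z. of_real (\<eta>2 (snd z)) * dx (dx \<psi>) z + 2 * (of_real (\<eta>1 (snd z)) * dx (dx (dx \<psi>)) z)
    + of_real (\<eta> (snd z)) * dx (dx (dx (dx \<psi>))) z)"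
    by (intro continuous_intros snd_cont eta_cont eta1_cont eta2_cont smooth_rectD(1)[OF s2] smooth_rectD(1)[OF s3] smooth_rectD(1)[OF s4])
  then show ?thesis by (rule continuous_on_eq) (simp add: opx_eq[OF s])
qed

lemma sect_cont:
  assumes "continuous_on Rc (F :: real \<times> real \<Rightarrow> complex)" "t \<in> {0..T}" shows "continuous_on {0..pi} (\<lambda>x. F (t, x))"
  by (rule continuous_on_compose2[OF assms(1)]) (use assms in \<open>auto intro!: continuous_intros\<close>)

lemma sect_cont_t:
  assumes "continuous_on Rc (F :: real \<times> real \<Rightarrow> complex)" "x \<in> {0..pi}" shows "continuous_on {0..T} (\<lambda>t. F (t, x))"
  by (rule continuous_on_compose2[OF assms(1)]) (use assms in \<open>auto intro!: continuous_intros\<close>)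

lemma beam_test_smooth: "\<psi> \<in> beam_test T \<alpha> \<beta> \<Longrightarrow> smooth_rect T \<psi>"
  by (simp add: beam_test_def smooth_rect_def)

text \<open>Every time slice of a test function solves the first-order system, its end conditions
  being multiplied by \<open>\<eta>\<close>. The symmetry proved for \<open>bvp\<close> thus applies
  to test functions.\<close>

lemma test_bvp:
  assumes "\<psi> \<in> beam_test T \<alpha> \<beta>" and t: "t \<in> {0..T}"
  shows "bvp (\<lambda>x. \<psi> (t, x)) (\<lambda>x. dx \<psi> (t, x)) (\<lambda>x. of_real (\<eta> x) * dx (dx \<psi>) (t, x))
    (\<lambda>x. of_real (\<eta>1 x) * dx (dx \<psi>) (t, x) + of_real (\<eta> x) * dx (dx (dx \<psi>)) (t, x)) (\<lambda>x. opx \<psi> (t, x))"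
proof -
  have s: "smooth_rect T \<psi>" by (rule beam_test_smooth[OF assms(1)])
  note s1 = smooth_rectD(3)[OF s] note s2 = smooth_rectD(3)[OF s1] note s3 = smooth_rectD(3)[OF s2]
  note s4 = smooth_rectD(3)[OF s3]
  have bc: "\<psi> (t, x) = 0" "2 * complex_of_real (\<alpha> x + \<beta> x) * dx \<psi> (t, x) + dx (dx \<psi>) (t, x) = 0" if "x \<in> {0, pi}" for x
    using assms that unfolding beam_test_def by auto
  have m: "of_real (\<eta> x) * dx (dx \<psi>) (t, x) = - (of_real (2 * (\<alpha> x + \<beta> x) * \<eta> x) * dx \<psi> (t, x))" if "x \<in> {0, pi}" for x
  proof -
    have "dx (dx \<psi>) (t, x) = - (2 * complex_of_real (\<alpha> x + \<beta> x) * dx \<psi> (t, x))"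
      using bc(2)[OF that] by (simp only: eq_neg_iff_add_eq_0 add.commute)
    then show ?thesis by simp
  qed
  have ch: "chain (\<lambda>x. \<psi> (t, x)) (\<lambda>x. dx \<psi> (t, x)) (\<lambda>x. of_real (\<eta> x) * dx (dx \<psi>) (t, x))
    (\<lambda>x. of_real (\<eta>1 x) * dx (dx \<psi>) (t, x) + of_real (\<eta> x) * dx (dx (dx \<psi>)) (t, x))
    (\<lambda>x. of_real (\<eta>2 x) * dx (dx \<psi>) (t, x) + 2 * (of_real (\<eta>1 x) * dx (dx (dx \<psi>)) (t, x)) + of_real (\<eta> x) * dx (dx (dx (dx \<psi>))) (t, x))"
    by (rule chain_C4) (use smooth_rectD(5)[OF s t] smooth_rectD(5)[OF s1 t] smooth_rectD(5)[OF s2 t] smooth_rectD(5)[OF s3 t]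
      sect_cont[OF smooth_rectD(1)[OF s4] t] in \<open>auto simp: VC_def\<close>)
  have "bvp (\<lambda>x. \<psi> (t, x)) (\<lambda>x. dx \<psi> (t, x)) (\<lambda>x. of_real (\<eta> x) * dx (dx \<psi>) (t, x))
    (\<lambda>x. of_real (\<eta>1 x) * dx (dx \<psi>) (t, x) + of_real (\<eta> x) * dx (dx (dx \<psi>)) (t, x))
    (\<lambda>x. of_real (\<eta>2 x) * dx (dx \<psi>) (t, x) + 2 * (of_real (\<eta>1 x) * dx (dx (dx \<psi>)) (t, x)) + of_real (\<eta> x) * dx (dx (dx (dx \<psi>))) (t, x))"
    unfolding bvp_def using ch bc(1) m[of 0] m[of pi] unfolding c0_eq cp_eq by simp
  then show ?thesis by (rule bvp_cong) (use opx_eq[OF s] t in auto)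
qed

lemma bvp_cnj:
  assumes "bvp \<phi> \<phi>1 m m1 w"
  shows "bvp (\<lambda>x. cnj (\<phi> x)) (\<lambda>x. cnj (\<phi>1 x)) (\<lambda>x. cnj (m x)) (\<lambda>x. cnj (m1 x)) (\<lambda>x. cnj (w x))"
proof -
  have ch: "chain \<phi> \<phi>1 m m1 w" using assms by (simp add: bvp_def)
  note a = chainD[OF ch]
  have "((\<lambda>x. cnj (\<phi>1 x)) has_vector_derivative cnj (m x) / of_real (\<eta> x)) (at x within {0..pi})" if "x \<in> {0..pi}" for x
    using has_vector_derivative_cnj'[OF a(8)[OF that]] by simp
  then have "chain (\<lambda>x. cnj (\<phi> x)) (\<lambda>x. cnj (\<phi>1 x)) (\<lambda>x. cnj (m x)) (\<lambda>x. cnj (m1 x)) (\<lambda>x. cnj (w x))"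
    unfolding chain_def using a by (auto simp: VC_def intro!: has_vector_derivative_cnj' cont_cnj)
  then show ?thesis using assms unfolding bvp_def by simp
qed

text \<open>The weak equation pairs without conjugation whereas \<open>ipw\<close> conjugates its
  second argument; conjugate eigenfunctions mediate between the two.\<close>

lemma eig_cnj: "eig \<nu> \<phi> \<Longrightarrow> eig \<nu> (\<lambda>x. cnj (\<phi> x))"
  unfolding eig_def
proof (elim conjE exE, intro conjI)
  fix \<phi>1 m m1 assume "bvp \<phi> \<phi>1 m m1 (\<lambda>x. of_real (\<rho> x) * (of_real \<nu> * \<phi> x))"
  from bvp_cnj[OF this] show "\<exists>\<phi>1 m m1. bvp (\<lambda>x. cnj (\<phi> x)) \<phi>1 m m1 (\<lambda>x. of_real (\<rho> x) * (of_real \<nu> * cnj (\<phi> x)))"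
    by auto
qed auto

lemma cis_theta_T: "cis (vartheta T m * T) = 1"
proof -
  have "vartheta T m * T = 2 * pi * of_int m" using T_pos by (simp add: vartheta_def)
  then show ?thesis using cis_multiple_2pi[of "of_int m"] by simp
qed

lemma cis_cont: "continuous_on S (\<lambda>z. cis (r * fst z))" for S :: "(real \<times> real) set"
  by (auto simp: cis_conv_exp intro!: continuous_intros)

text \<open>Two integrations by parts at once, through the antiderivative \<open>?H\<close>. Its end
  values agree because \<open>\<psi>\<close> and its time derivative match at \<open>0\<close> and
  \<open>T\<close> and the exponential has period \<open>T\<close>.\<close>

lemma time_ibp:
  assumes \<psi>: "\<psi> \<in> beam_test T \<alpha> \<beta>" and x: "x \<in> {0..pi}"
  shows "integral {0..T} (\<lambda>t. dt T (dt T \<psi>) (t, x) * cis (vartheta T m * t)) =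
    - of_real ((vartheta T m)\<^sup>2) * integral {0..T} (\<lambda>t. \<psi> (t, x) * cis (vartheta T m * t))"
proof -
  have s: "smooth_rect T \<psi>" by (rule beam_test_smooth[OF \<psi>])
  note s1 = smooth_rectD(2)[OF s] note s2 = smooth_rectD(2)[OF s1]
  define \<theta> where "\<theta> = vartheta T m"
  let ?H = "\<lambda>t. dt T \<psi> (t, x) * cis (\<theta> * t) - \<i> * of_real \<theta> * (\<psi> (t, x) * cis (\<theta> * t))"
  let ?h = "\<lambda>t. dt T (dt T \<psi>) (t, x) * cis (\<theta> * t) + of_real (\<theta>\<^sup>2) * (\<psi> (t, x) * cis (\<theta> * t))"
  have "(?h has_integral (?H T - ?H 0)) {0..T}"
  proof (rule fundamental_theorem_of_calculus)
    fix t assume t: "t \<in> {0..T}"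
    note d0 = has_vector_derivative_mult[OF smooth_rectD(4)[OF s t x] cis_vd[of \<theta> t "{0..T}"]]
    note d1 = has_vector_derivative_mult[OF smooth_rectD(4)[OF s1 t x] cis_vd[of \<theta> t "{0..T}"]]
    have "(?H has_vector_derivative (dt T \<psi> (t, x) * (\<i> * of_real \<theta> * cis (\<theta> * t)) + dt T (dt T \<psi>) (t, x) * cis (\<theta> * t))
      - \<i> * of_real \<theta> * (\<psi> (t, x) * (\<i> * of_real \<theta> * cis (\<theta> * t)) + dt T \<psi> (t, x) * cis (\<theta> * t))) (at t within {0..T})"
      by (intro has_vector_derivative_diff has_vector_derivative_mult_right d0 d1)
    also have "(dt T \<psi> (t, x) * (\<i> * of_real \<theta> * cis (\<theta> * t)) + dt T (dt T \<psi>) (t, x) * cis (\<theta> * t))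
      - \<i> * of_real \<theta> * (\<psi> (t, x) * (\<i> * of_real \<theta> * cis (\<theta> * t)) + dt T \<psi> (t, x) * cis (\<theta> * t)) = ?h t"
      by (simp add: algebra_simps power2_eq_square)
    finally show "(?H has_vector_derivative ?h t) (at t within {0..T})" .
  qed (use T_pos in simp)
  moreover have "?H T - ?H 0 = 0"
    using \<psi> x cis_theta_T[of m] unfolding beam_test_def by (simp add: \<theta>_def)
  ultimately have "integral {0..T} ?h = 0" by (simp add: integral_unique)
  moreover have cc: "continuous_on {0..T} (\<lambda>t. cis (\<theta> * t))" by (auto simp: cis_conv_exp intro!: continuous_intros)
  have "(\<lambda>t. dt T (dt T \<psi>) (t, x) * cis (\<theta> * t)) integrable_on {0..T}"
    "(\<lambda>t. of_real (\<theta>\<^sup>2) * (\<psi> (t, x) * cis (\<theta> * t))) integrable_on {0..T}"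
    by (intro integrable_continuous_interval continuous_on_mult continuous_on_const cc
      sect_cont_t[OF smooth_rectD(1)[OF s2] x] sect_cont_t[OF smooth_rectD(1)[OF s] x])+
  ultimately show ?thesis
    unfolding \<theta>_def[symmetric] by (simp add: integral_add eq_neg_iff_add_eq_0)
qed

text \<open>Fubini in both orders: the time derivatives are treated with \<open>x\<close> fixed by
  \<open>time_ibp\<close>, the space derivatives with \<open>t\<close> fixed by
  \<open>bvp_symmetric\<close>.\<close>

lemma test_coefficient:
  assumes \<psi>: "\<psi> \<in> beam_test T \<alpha> \<beta>" and e: "eig \<nu> \<phi>"
  shows "(LINT z:Om|lborel. (of_real (\<rho> (snd z)) * dt T (dt T \<psi>) z + opx \<psi> z) * (\<phi> (snd z) * cis (vartheta T m * fst z)))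
   = of_real (\<nu> - (vartheta T m)\<^sup>2) * (LINT z:Om|lborel. of_real (\<rho> (snd z)) * (\<psi> z * (\<phi> (snd z) * cis (vartheta T m * fst z))))"
proof -
  have s: "smooth_rect T \<psi>" by (rule beam_test_smooth[OF \<psi>])
  note s2 = smooth_rectD(2)[OF smooth_rectD(2)[OF s]]
  define \<theta> where "\<theta> = vartheta T m"
  have fc: "continuous_on Rc (\<lambda>z. \<phi> (snd z))" using eig_VC[OF e] by (intro snd_cont) (simp add: VC_def)
  have rc: "continuous_on Rc (\<lambda>z. complex_of_real (\<rho> (snd z)))" by (intro continuous_intros rho_snd_cont)
  let ?A = "\<lambda>z. (of_real (\<rho> (snd z)) * \<phi> (snd z)) * (dt T (dt T \<psi>) z * cis (\<theta> * fst z))"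
  let ?B = "\<lambda>z. cis (\<theta> * fst z) * (opx \<psi> z * \<phi> (snd z))"
  let ?C = "\<lambda>z. of_real (\<rho> (snd z)) * (\<psi> z * (\<phi> (snd z) * cis (\<theta> * fst z)))"
  have cA: "continuous_on Rc ?A" and cB: "continuous_on Rc ?B" and cC: "continuous_on Rc ?C"
    by (intro continuous_on_mult fc rc cis_cont smooth_rectD(1)[OF s2] smooth_rectD(1)[OF s] opx_cont[OF s])+
  have "(LINT z:Om|lborel. ?A z) = integral {0..pi} (\<lambda>x. of_real (\<rho> x) * \<phi> x * integral {0..T} (\<lambda>t. dt T (dt T \<psi>) (t, x) * cis (\<theta> * t)))"
    unfolding fubini_xt[OF cA] by simp
  also have "\<dots> = integral {0..pi} (\<lambda>x. of_real (- (\<theta>\<^sup>2)) * (integral {0..T} (\<lambda>t. ?C (t, x))))"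
  proof (rule integral_cong)
    fix x assume x: "x \<in> {0..pi}"
    have "integral {0..T} (\<lambda>t. ?C (t, x)) = integral {0..T} (\<lambda>t. (of_real (\<rho> x) * \<phi> x) * (\<psi> (t, x) * cis (\<theta> * t)))"
      by (simp add: mult_ac)
    also have "\<dots> = (of_real (\<rho> x) * \<phi> x) * integral {0..T} (\<lambda>t. \<psi> (t, x) * cis (\<theta> * t))" by simp
    finally show "of_real (\<rho> x) * \<phi> x * integral {0..T} (\<lambda>t. dt T (dt T \<psi>) (t, x) * cis (\<theta> * t)) =
       of_real (- (\<theta>\<^sup>2)) * (integral {0..T} (\<lambda>t. ?C (t, x)))"
      unfolding time_ibp[OF \<psi> x, of m, folded \<theta>_def] by (simp add: mult_ac)
  qed
  also have "\<dots> = of_real (- (\<theta>\<^sup>2)) * (LINT z:Om|lborel. ?C z)" unfolding fubini_xt[OF cC] by (rule integral_mult_right)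
  finally have A: "(LINT z:Om|lborel. ?A z) = of_real (- (\<theta>\<^sup>2)) * (LINT z:Om|lborel. ?C z)" .
  obtain f1 k k1 where b: "bvp (\<lambda>x. cnj (\<phi> x)) f1 k k1 (\<lambda>x. of_real (\<rho> x) * (of_real \<nu> * cnj (\<phi> x)))"
    using eig_cnj[OF e] unfolding eig_def by blast
  have "(LINT z:Om|lborel. ?B z) = integral {0..T} (\<lambda>t. cis (\<theta> * t) * integral {0..pi} (\<lambda>x. opx \<psi> (t, x) * \<phi> x))"
    unfolding fubini_tx[OF cB] by simp
  also have "\<dots> = integral {0..T} (\<lambda>t. of_real \<nu> * (integral {0..pi} (\<lambda>x. ?C (t, x))))"
  proof (rule integral_cong)
    fix t assume t: "t \<in> {0..T}"
    have "integral {0..pi} (\<lambda>x. opx \<psi> (t, x) * \<phi> x) = ipw (\<lambda>_. 1) (\<lambda>x. opx \<psi> (t, x)) (\<lambda>x. cnj (\<phi> x))"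
      by (simp add: ipw_def)
    also have "\<dots> = ipw (\<lambda>_. 1) (\<lambda>x. \<psi> (t, x)) (\<lambda>x. of_real (\<rho> x) * (of_real \<nu> * cnj (\<phi> x)))"
      by (rule bvp_symmetric[OF test_bvp[OF \<psi> t] b])
    also have "\<dots> = integral {0..pi} (\<lambda>x. of_real \<nu> * (of_real (\<rho> x) * (\<psi> (t, x) * \<phi> x)))"
      by (simp add: ipw_def mult_ac)
    finally have 1: "integral {0..pi} (\<lambda>x. opx \<psi> (t, x) * \<phi> x) = of_real \<nu> * integral {0..pi} (\<lambda>x. of_real (\<rho> x) * (\<psi> (t, x) * \<phi> x))"
      by simp
    have "integral {0..pi} (\<lambda>x. ?C (t, x)) = integral {0..pi} (\<lambda>x. cis (\<theta> * t) * (of_real (\<rho> x) * (\<psi> (t, x) * \<phi> x)))"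
      by (simp add: mult_ac)
    also have "\<dots> = cis (\<theta> * t) * integral {0..pi} (\<lambda>x. of_real (\<rho> x) * (\<psi> (t, x) * \<phi> x))" by (rule integral_mult_right)
    finally show "cis (\<theta> * t) * integral {0..pi} (\<lambda>x. opx \<psi> (t, x) * \<phi> x) = of_real \<nu> * (integral {0..pi} (\<lambda>x. ?C (t, x)))"
      unfolding 1 by (simp add: mult_ac)
  qed
  also have "\<dots> = of_real \<nu> * (LINT z:Om|lborel. ?C z)" unfolding fubini_tx[OF cC] by (rule integral_mult_right)
  finally have B: "(LINT z:Om|lborel. ?B z) = of_real \<nu> * (LINT z:Om|lborel. ?C z)" .
  have "(LINT z:Om|lborel. (of_real (\<rho> (snd z)) * dt T (dt T \<psi>) z + opx \<psi> z) * (\<phi> (snd z) * cis (\<theta> * fst z)))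
    = (LINT z:Om|lborel. ?A z + ?B z)" by (simp add: algebra_simps)
  also have "\<dots> = (LINT z:Om|lborel. ?A z) + (LINT z:Om|lborel. ?B z)"
    by (rule set_integral_add(2)[OF cont_set_integrable[OF cA] cont_set_integrable[OF cB]])
  also have "\<dots> = of_real (\<nu> - \<theta>\<^sup>2) * (LINT z:Om|lborel. ?C z)"
    unfolding A B by (simp add: algebra_simps)
  finally show ?thesis unfolding \<theta>_def .
qed

end

section \<open>Polynomial approximation of eigenfunctions\<close>

lemma pderiv_sum: "pderiv (sum f A) = (\<Sum>i\<in>A. pderiv (f i))"
  by (induction A rule: infinite_finite_induct) (auto simp: pderiv_add)

lemma divide_real_vd:
  fixes f :: "real \<Rightarrow> complex"
  assumes f: "(f has_vector_derivative f') F" and g: "(g has_real_derivative g') (at x within S)" and F: "F = at x within S"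
    and nz: "g x \<noteq> 0"
  shows "((\<lambda>x. f x / of_real (g x)) has_vector_derivative
    (f' * of_real (g x) - f x * of_real g') / (of_real (g x) * of_real (g x))) F"
proof -
  have "((\<lambda>x. 1 / g x) has_real_derivative - g' / (g x * g x)) (at x within S)"
    using g nz by (auto intro!: derivative_eq_intros)
  then have i: "((\<lambda>x. complex_of_real (1 / g x)) has_vector_derivative of_real (- g' / (g x * g x))) F"
    unfolding F has_real_derivative_iff_has_vector_derivative
    by (rule bounded_linear.has_vector_derivative[OF bounded_linear_of_real])
  have "((\<lambda>x. f x * of_real (1 / g x)) has_vector_derivative f x * of_real (- g' / (g x * g x)) + f' * of_real (1 / g x)) F"
    using has_vector_derivative_mult[OF f[unfolded F] i[unfolded F]] unfolding F .
  moreover have "f x * of_real (- g' / (g x * g x)) + f' * of_real (1 / g x) =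
    (f' * of_real (g x) - f x * of_real g') / (of_real (g x) * of_real (g x))"
    using nz by (simp add: field_simps)
  ultimately show ?thesis by (simp add: divide_inverse)
qed

lemma poly_antideriv_exists:
  fixes Q :: "complex poly"
  obtains R where "pderiv R = Q" "poly R 0 = c"
proof -
  define R where "R = [:c:] + (\<Sum>i\<le>degree Q. monom (coeff Q i / of_nat (Suc i)) (Suc i))"
  have "pderiv R = (\<Sum>i\<le>degree Q. monom (coeff Q i) i)"
    unfolding R_def pderiv_add pderiv_sum by (simp add: pderiv_monom del: of_nat_Suc)
  also have "\<dots> = Q" by (rule poly_as_sum_of_monoms)
  finally have "pderiv R = Q" .
  moreover have "poly R 0 = c" unfolding R_def by (simp add: poly_sum poly_monom)
  ultimately show thesis using that by blast
qed

lemma weierstrass_complex: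
  assumes f: "f \<in> VC" and e: "0 < e"
  obtains Q where "\<And>x. x \<in> {0..pi} \<Longrightarrow> cmod (f x - poly Q (of_real x)) \<le> e"
proof -
  have c: "continuous_on {0..pi} (\<lambda>x. Re (f x))" "continuous_on {0..pi} (\<lambda>x. Im (f x))"
    using f by (auto simp: VC_def intro!: continuous_intros)
  obtain a n where a: "\<And>s. s \<in> {0..pi} \<Longrightarrow> \<bar>Re (f s) - (\<Sum>i\<le>n. a i * s ^ i)\<bar> < e / 2"
    using weierstrass_real[OF c(1), of "e / 2"] e by (metis half_gt_zero)
  obtain b m where b: "\<And>s. s \<in> {0..pi} \<Longrightarrow> \<bar>Im (f s) - (\<Sum>i\<le>m. b i * s ^ i)\<bar> < e / 2"
    using weierstrass_real[OF c(2), of "e / 2"] e by (metis half_gt_zero)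
  define Q where "Q = (\<Sum>i\<le>n. monom (complex_of_real (a i)) i) + smult \<i> (\<Sum>i\<le>m. monom (complex_of_real (b i)) i)"
  have Q: "poly Q (of_real x) = Complex (\<Sum>i\<le>n. a i * x ^ i) (\<Sum>i\<le>m. b i * x ^ i)" for x
  proof -
    have "poly Q (of_real x) = of_real (\<Sum>i\<le>n. a i * x ^ i) + \<i> * of_real (\<Sum>i\<le>m. b i * x ^ i)"
      by (simp add: Q_def poly_sum poly_monom)
    then show ?thesis by (simp only: Complex_eq)
  qed
  show thesis
  proof (rule that[of Q])
    fix x assume x: "x \<in> {0..pi}"
    have "cmod (f x - poly Q (of_real x)) \<le> \<bar>Re (f x - poly Q (of_real x))\<bar> + \<bar>Im (f x - poly Q (of_real x))\<bar>"
      by (rule cmod_le)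
    also have "\<dots> \<le> e / 2 + e / 2" using a[OF x] b[OF x] unfolding Q by simp
    finally show "cmod (f x - poly Q (of_real x)) \<le> e" by simp
  qed
qed

lemma primitive_close:
  fixes f g f' g' :: "real \<Rightarrow> complex"
  assumes c: "continuous_on {0..pi} f" "continuous_on {0..pi} g"
    and d: "\<And>x. x \<in> {0<..<pi} \<Longrightarrow> (f has_vector_derivative f' x) (at x)"
      "\<And>x. x \<in> {0<..<pi} \<Longrightarrow> (g has_vector_derivative g' x) (at x)"
    and e: "0 \<le> e" "\<And>x. x \<in> {0..pi} \<Longrightarrow> cmod (f' x - g' x) \<le> e" and z: "f 0 = g 0" and x: "x \<in> {0..pi}"
  shows "cmod (f x - g x) \<le> e * pi"
proof -
  have "((\<lambda>x. f' x - g' x) has_integral (f x - g x) - (f 0 - g 0)) {0..x}"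
  proof (rule fundamental_theorem_of_calculus_interior)
    show "continuous_on {0..x} (\<lambda>x. f x - g x)"
      using x by (intro continuous_on_diff continuous_on_subset[OF c(1)] continuous_on_subset[OF c(2)]) auto
    show "((\<lambda>x. f x - g x) has_vector_derivative f' y - g' y) (at y)" if "y \<in> {0<..<x}" for y
      using that x by (intro has_vector_derivative_diff d) auto
  qed (use x in simp)
  from has_integral_bound_real[OF e(1) finite.emptyI this] have "cmod (f x - g x) \<le> e * x"
    using e(2) x z by auto
  also have "\<dots> \<le> e * pi" using x e(1) by (intro mult_left_mono) auto
  finally show ?thesis .
qed

context beam_setting
begin

text \<open>The product rule for \<open>(\<eta> P'')''\<close>, in the form that matches
  \<open>opx_eq\<close>.\<close>

definition WP :: "complex poly \<Rightarrow> real \<Rightarrow> complex" where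
  "WP P x = of_real (\<eta>2 x) * poly (pderiv (pderiv P)) (of_real x)
    + 2 * (of_real (\<eta>1 x) * poly (pderiv (pderiv (pderiv P))) (of_real x))
    + of_real (\<eta> x) * poly (pderiv (pderiv (pderiv (pderiv P)))) (of_real x)"

lemma poly_VC: "(\<lambda>x. poly P (complex_of_real x)) \<in> VC"
  unfolding VC_def by (auto intro!: continuous_intros)

lemma WP_VC: "WP P \<in> VC"
  unfolding WP_def[abs_def] VC_def by (auto intro!: continuous_intros eta_cont eta1_cont eta2_cont)

lemma WP_diff: "WP (P - smult a R - smult b S) x = WP P x - a * WP R x - b * WP S x"
  unfolding WP_def by (simp add: pderiv_diff pderiv_smult pderiv_add algebra_simps)

lemma VC_bounded: "f \<in> VC \<Longrightarrow> \<exists>M\<ge>0. \<forall>x\<in>{0..pi}. cmod (f x) \<le> M"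
proof -
  assume "f \<in> VC"
  then have "bounded (f ` {0..pi})" by (intro compact_imp_bounded compact_continuous_image) (auto simp: VC_def)
  then obtain M where "\<forall>y\<in>f ` {0..pi}. norm y \<le> M" unfolding bounded_iff by blast
  then show ?thesis by (intro exI[of _ "max M 0"]) (auto simp: le_max_iff_disj)
qed

lemma real_bounded:
  assumes "continuous_on {0..pi} f" shows "\<exists>M\<ge>0. \<forall>x\<in>{0..pi}. \<bar>f x\<bar> \<le> (M::real)"
  using VC_bounded[of "\<lambda>x. of_real (f x)"] assms by (auto simp: VC_def intro!: continuous_intros)

definition poly_bc :: "complex poly \<Rightarrow> bool" where
  "poly_bc P \<longleftrightarrow> poly P 0 = 0 \<and> poly P (of_real pi) = 0 \<and>
     of_real (\<eta> 0) * poly (pderiv (pderiv P)) 0 = - of_real c0 * poly (pderiv P) 0 \<and>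
     of_real (\<eta> pi) * poly (pderiv (pderiv P)) (of_real pi) = - of_real cp * poly (pderiv P) (of_real pi)"

text \<open>
  The fourth derivative is approximated by Weierstrass and integrated back from the data at \<open>0\<close>;
  multiples of \<open>x^3\<close> and \<open>x^3 (x - pi)^2\<close>, which vanish to third order at \<open>0\<close>, then restore
  the boundary conditions at \<open>pi\<close>.
\<close>

lemma bvp_poly_approx_linear:
  assumes b: "bvp g g1 m m1 w"
  obtains K where "0 \<le> K" "\<And>d. 0 < d \<Longrightarrow> \<exists>P. poly_bc P \<and>
     (\<forall>x\<in>{0..pi}. cmod (g x - poly P (of_real x)) \<le> K * d \<and> cmod (w x - WP P x) \<le> K * d)"
proof -
  have ch: "chain g g1 m m1 w" and bc: "g 0 = 0" "g pi = 0" "m 0 = - of_real c0 * g1 0" "m pi = - of_real cp * g1 pi"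
    using b by (auto simp: bvp_def)
  note a = chainD[OF ch]
  have nz: "\<eta> x \<noteq> 0" if "x \<in> {0..pi}" for x using eta_pos[OF that] by simp
  \<comment> \<open>\<open>g2\<close>, \<open>g3\<close> and \<open>v\<close> are the second, third
    and fourth derivatives of \<open>g\<close>, solved for from the system.\<close>
  define g2 where "g2 x = m x / of_real (\<eta> x)" for x
  define g3 where "g3 x = (m1 x - of_real (\<eta>1 x) * g2 x) / of_real (\<eta> x)" for x
  define v where "v x = (w x - 2 * (of_real (\<eta>1 x) * g3 x) - of_real (\<eta>2 x) * g2 x) / of_real (\<eta> x)" for x
  have g2V: "g2 \<in> VC" unfolding g2_def by (rule a(6))
  have g3V: "g3 \<in> VC" unfolding g3_def VC_def using a(4) g2V eta_cont eta1_cont nz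
    by (auto simp: VC_def intro!: continuous_intros)
  have vV: "v \<in> VC" unfolding v_def VC_def using a(5) g2V g3V eta_cont eta1_cont eta2_cont nz
    by (auto simp: VC_def intro!: continuous_intros)
  have m_eq: "m x = of_real (\<eta> x) * g2 x" and m1_eq: "m1 x = of_real (\<eta>1 x) * g2 x + of_real (\<eta> x) * g3 x"
    and w_eq: "w x = of_real (\<eta>2 x) * g2 x + 2 * (of_real (\<eta>1 x) * g3 x) + of_real (\<eta> x) * v x" if "x \<in> {0..pi}" for x
    using nz[OF that] by (auto simp: g2_def g3_def v_def field_simps)
  have d2: "(g2 has_vector_derivative g3 x) (at x)" if x: "x \<in> {0<..<pi}" for x
  proof -
    have x': "x \<in> {0..pi}" using x by auto
    have "((\<lambda>x. m x / of_real (\<eta> x)) has_vector_derivative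
        (m1 x * of_real (\<eta> x) - m x * of_real (\<eta>1 x)) / (of_real (\<eta> x) * of_real (\<eta> x))) (at x)"
      by (rule within_interior[OF x divide_real_vd[OF a(9)[OF x'] eta_d1[OF x'] refl nz[OF x']]])
    also have "(m1 x * of_real (\<eta> x) - m x * of_real (\<eta>1 x)) / (of_real (\<eta> x) * of_real (\<eta> x)) = g3 x"
      unfolding g3_def g2_def using nz[OF x'] by (simp add: field_simps)
    finally show ?thesis unfolding g2_def[abs_def] .
  qed
  have d3: "(g3 has_vector_derivative v x) (at x)" if x: "x \<in> {0<..<pi}" for x
  proof -
    have x': "x \<in> {0..pi}" using x by auto
    have e: "(\<eta> has_real_derivative \<eta>1 x) (at x)"
      using eta_d1[OF x'] at_within_interior[of x "{0..pi}"] x by simp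
    have e1: "((\<lambda>x. complex_of_real (\<eta>1 x)) has_vector_derivative of_real (\<eta>2 x)) (at x)"
      by (rule within_interior[OF x of_real_vd[OF eta_d2[OF x']]])
    have n: "((\<lambda>x. m1 x - of_real (\<eta>1 x) * g2 x) has_vector_derivative
        w x - (of_real (\<eta>1 x) * g3 x + of_real (\<eta>2 x) * g2 x)) (at x)"
      by (intro has_vector_derivative_diff has_vector_derivative_mult a(10)[OF x] e1 d2[OF x])
    have "((\<lambda>x. (m1 x - of_real (\<eta>1 x) * g2 x) / of_real (\<eta> x)) has_vector_derivative
        ((w x - (of_real (\<eta>1 x) * g3 x + of_real (\<eta>2 x) * g2 x)) * of_real (\<eta> x) - (m1 x - of_real (\<eta>1 x) * g2 x) * of_real (\<eta>1 x))
          / (of_real (\<eta> x) * of_real (\<eta> x))) (at x)"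
      by (rule divide_real_vd[OF n e refl nz[OF x']])
    also have "((w x - (of_real (\<eta>1 x) * g3 x + of_real (\<eta>2 x) * g2 x)) * of_real (\<eta> x) - (m1 x - of_real (\<eta>1 x) * g2 x) * of_real (\<eta>1 x))
          / (of_real (\<eta> x) * of_real (\<eta> x)) = v x"
      unfolding m1_eq[OF x'] v_def using nz[OF x'] by (simp add: field_simps)
    finally show ?thesis unfolding g3_def[abs_def] .
  qed
  obtain H0 H1 H2 where H: "0 \<le> H0" "0 \<le> H1" "0 \<le> H2" "\<forall>x\<in>{0..pi}. \<bar>\<eta> x\<bar> \<le> H0" "\<forall>x\<in>{0..pi}. \<bar>\<eta>1 x\<bar> \<le> H1" "\<forall>x\<in>{0..pi}. \<bar>\<eta>2 x\<bar> \<le> H2"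
    using real_bounded[OF eta_cont] real_bounded[OF eta1_cont] real_bounded[OF eta2_cont] by blast
  define R1 :: "complex poly" where "R1 = [:0, 0, 0, 1:]"
  define R2 :: "complex poly" where "R2 = [:0, 0, 0, of_real (pi\<^sup>2), - 2 * of_real pi, 1:]"
  obtain M1 M2 N1 N2 where M: "0 \<le> M1" "0 \<le> M2" "0 \<le> N1" "0 \<le> N2"
    "\<forall>x\<in>{0..pi}. cmod (poly R1 (of_real x)) \<le> M1" "\<forall>x\<in>{0..pi}. cmod (poly R2 (of_real x)) \<le> M2"
    "\<forall>x\<in>{0..pi}. cmod (WP R1 x) \<le> N1" "\<forall>x\<in>{0..pi}. cmod (WP R2 x) \<le> N2"
    using VC_bounded[OF poly_VC[of R1]] VC_bounded[OF poly_VC[of R2]] VC_bounded[OF WP_VC[of R1]] VC_bounded[OF WP_VC[of R2]] by blast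
  \<comment> \<open>The residual of the second-order condition at \<open>pi\<close>.
    \<open>R1\<close> corrects the value at \<open>pi\<close>; \<open>R2\<close> has zero value and
    slope there, so it can remove the residual afterwards without disturbing the value.\<close>
  define BC where "BC P = of_real (\<eta> pi) * poly (pderiv (pderiv P)) (of_real pi) + of_real cp * poly (pderiv P) (of_real pi)"
    for P :: "complex poly"
  have ep: "0 < \<eta> pi" by (rule eta_pos) simp
  define s where "s = 2 * \<eta> pi * pi ^ 3"
  have s: "0 < s" unfolding s_def using ep by simp
  have R1z: "poly R1 0 = 0" "poly (pderiv R1) 0 = 0" "poly (pderiv (pderiv R1)) 0 = 0" "poly R1 (of_real pi) = of_real (pi ^ 3)"
    by (simp_all add: R1_def pderiv_pCons power3_eq_cube)
  have R2z: "poly R2 0 = 0" "poly (pderiv R2) 0 = 0" "poly (pderiv (pderiv R2)) 0 = 0" "poly R2 (of_real pi) = 0"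
    "poly (pderiv R2) (of_real pi) = 0" "poly (pderiv (pderiv R2)) (of_real pi) = of_real (2 * pi ^ 3)"
    by (simp_all add: R2_def pderiv_pCons power3_eq_cube power2_eq_square algebra_simps)
  have BR2: "BC R2 = of_real s" unfolding BC_def R2z s_def by simp
  \<comment> \<open>Collects the residual of the uncorrected polynomial and the contribution of
    \<open>ca * R1\<close>, divided by \<open>BC R2 = s\<close>; this is the bound for
    \<open>cmod cb / d\<close>.\<close>
  define Kb where "Kb = (H0 * pi ^ 2 + \<bar>cp\<bar> * pi ^ 3 + pi * cmod (BC R1)) / s"
  have Kb: "0 \<le> Kb" unfolding Kb_def using H s by simp
  define K1 where "K1 = pi ^ 4 + pi * M1 + Kb * M2"
  define K2 where "K2 = H2 * pi ^ 2 + 2 * (H1 * pi) + H0 + pi * N1 + Kb * N2"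
  have K12: "0 \<le> K1" "0 \<le> K2" unfolding K1_def K2_def using H M Kb by simp_all
  have main: "\<exists>P. poly_bc P \<and>
     (\<forall>x\<in>{0..pi}. cmod (g x - poly P (of_real x)) \<le> K1 * d \<and> cmod (w x - WP P x) \<le> K2 * d)" if d: "0 < d" for d
  proof -
    have d0: "0 \<le> d" using d by simp
    obtain Q where Q: "\<And>x. x \<in> {0..pi} \<Longrightarrow> cmod (v x - poly Q (of_real x)) \<le> d"
      using weierstrass_complex[OF vV d] by blast
    obtain P3 where P3: "pderiv P3 = Q" "poly P3 0 = g3 0" using poly_antideriv_exists by blast
    obtain P2 where P2: "pderiv P2 = P3" "poly P2 0 = g2 0" using poly_antideriv_exists by blast
    obtain P1 where P1: "pderiv P1 = P2" "poly P1 0 = g1 0" using poly_antideriv_exists by blast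
    obtain P0 where P0: "pderiv P0 = P1" "poly P0 0 = 0" using poly_antideriv_exists by blast
    have pv: "((\<lambda>x. poly P (complex_of_real x)) has_vector_derivative poly (pderiv P) (of_real x)) (at x)" for P x
      by (rule poly_vd)
    have E3: "cmod (g3 x - poly P3 (of_real x)) \<le> d * pi" if "x \<in> {0..pi}" for x
      by (rule primitive_close[OF VC_D[OF g3V] VC_D[OF poly_VC] d3 pv d0 _ _ that]) (use Q P3 in auto)
    have E2: "cmod (g2 x - poly P2 (of_real x)) \<le> d * pi * pi" if "x \<in> {0..pi}" for x
      by (rule primitive_close[OF VC_D[OF g2V] VC_D[OF poly_VC] d2 pv _ _ _ that]) (use E3 P2 d0 in auto)
    have E1: "cmod (g1 x - poly P1 (of_real x)) \<le> d * pi * pi * pi" if "x \<in> {0..pi}" for x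
      by (rule primitive_close[OF VC_D[OF a(2)] VC_D[OF poly_VC] within_interior[OF _ a(8)] pv _ _ _ that])
        (use E2 P1 d0 in \<open>auto simp: g2_def\<close>)
    have E0: "cmod (g x - poly P0 (of_real x)) \<le> d * pi * pi * pi * pi" if "x \<in> {0..pi}" for x
      by (rule primitive_close[OF VC_D[OF a(1)] VC_D[OF poly_VC] within_interior[OF _ a(7)] pv _ _ _ that])
        (use E1 P0 bc d0 in auto)
    define ca where "ca = poly P0 (of_real pi) / of_real (pi ^ 3)"
    define cb where "cb = (BC P0 - ca * BC R1) / of_real s"
    define P where "P = P0 - smult ca R1 - smult cb R2"
    have ca: "cmod ca \<le> d * pi"
    proof -
      have "cmod ca = cmod (poly P0 (of_real pi)) / pi ^ 3" unfolding ca_def by (simp add: norm_divide norm_power)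
      also have "\<dots> \<le> (d * pi * pi * pi * pi) / pi ^ 3"
        using E0[of pi] bc(2) by (intro divide_right_mono) (simp_all add: norm_minus_commute)
      also have "\<dots> = d * pi" by (simp add: power3_eq_cube)
      finally show ?thesis .
    qed
    have BP0: "cmod (BC P0) \<le> (H0 * pi ^ 2 + \<bar>cp\<bar> * pi ^ 3) * d"
    proof -
      have "of_real (\<eta> pi) * g2 pi + of_real cp * g1 pi = 0" using bc(4) m_eq[of pi] by simp
      then have "BC P0 = - (of_real (\<eta> pi) * (g2 pi - poly P2 (of_real pi)) + of_real cp * (g1 pi - poly P1 (of_real pi)))"
        unfolding BC_def P0 P1 by (simp add: algebra_simps)
      then have "cmod (BC P0) \<le> \<bar>\<eta> pi\<bar> * cmod (g2 pi - poly P2 (of_real pi)) + \<bar>cp\<bar> * cmod (g1 pi - poly P1 (of_real pi))"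
        by (simp only: norm_minus_cancel) (rule order_trans[OF norm_triangle_ineq], simp add: norm_mult)
      also have "\<dots> \<le> H0 * (d * pi * pi) + \<bar>cp\<bar> * (d * pi * pi * pi)"
        using E1[of pi] E2[of pi] H by (intro add_mono mult_mono) auto
      also have "\<dots> = (H0 * pi ^ 2 + \<bar>cp\<bar> * pi ^ 3) * d"
        by (simp add: power2_eq_square power3_eq_cube algebra_simps)
      finally show ?thesis .
    qed
    have cb: "cmod cb \<le> Kb * d"
    proof -
      have "cmod cb = cmod (BC P0 - ca * BC R1) / s" unfolding cb_def using s by (simp add: norm_divide)
      also have "cmod (BC P0 - ca * BC R1) \<le> cmod (BC P0) + cmod ca * cmod (BC R1)"
        using norm_triangle_ineq4[of "BC P0" "ca * BC R1"] by (simp add: norm_mult)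
      also have "\<dots> \<le> (H0 * pi ^ 2 + \<bar>cp\<bar> * pi ^ 3) * d + d * pi * cmod (BC R1)"
        using BP0 ca by (intro add_mono mult_right_mono) auto
      also have "\<dots> / s = Kb * d" unfolding Kb_def by (simp add: algebra_simps)
      finally show ?thesis using s by (simp add: divide_right_mono)
    qed
    have "poly_bc P"
    proof -
      have "poly P 0 = 0" unfolding P_def using P0 R1z R2z by simp
      moreover have "poly P (of_real pi) = 0" unfolding P_def ca_def using R1z R2z by simp
      moreover have "of_real (\<eta> 0) * poly (pderiv (pderiv P)) 0 = - of_real c0 * poly (pderiv P) 0"
        unfolding P_def using R1z R2z P0 P1 P2 bc(3) m_eq[of 0] by (simp add: pderiv_diff pderiv_smult)
      moreover have "BC P = 0"
      proof -
        have "BC P = BC P0 - ca * BC R1 - cb * BC R2"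
          unfolding P_def BC_def by (simp add: pderiv_diff pderiv_add pderiv_smult algebra_simps)
        then show ?thesis unfolding BR2 cb_def using s by simp
      qed
      ultimately show ?thesis unfolding poly_bc_def BC_def by (simp add: add_eq_0_iff2)
    qed
    moreover have "cmod (g x - poly P (of_real x)) \<le> K1 * d" if x: "x \<in> {0..pi}" for x
    proof -
      have "g x - poly P (of_real x) = (g x - poly P0 (of_real x)) + (ca * poly R1 (of_real x) + cb * poly R2 (of_real x))"
        unfolding P_def by simp
      also have "cmod \<dots> \<le> cmod (g x - poly P0 (of_real x)) + (cmod ca * cmod (poly R1 (of_real x)) + cmod cb * cmod (poly R2 (of_real x)))"
        unfolding norm_mult[symmetric] by (intro order_trans[OF norm_triangle_ineq] add_left_mono norm_triangle_ineq)
      also have "\<dots> \<le> d * pi * pi * pi * pi + (d * pi * M1 + Kb * d * M2)"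
        using E0[OF x] ca cb M x Kb d0 by (intro add_mono mult_mono) auto
      also have "\<dots> = K1 * d" unfolding K1_def by (simp add: algebra_simps eval_nat_numeral)
      finally show ?thesis .
    qed
    moreover have "cmod (w x - WP P x) \<le> K2 * d" if x: "x \<in> {0..pi}" for x
    proof -
      have eq: "w x - WP P x = (of_real (\<eta>2 x) * (g2 x - poly P2 (of_real x)) + 2 * (of_real (\<eta>1 x) * (g3 x - poly P3 (of_real x)))
          + of_real (\<eta> x) * (v x - poly Q (of_real x))) + (ca * WP R1 x + cb * WP R2 x)"
        unfolding P_def WP_diff w_eq[OF x] WP_def[of P0] P0 P1 P2 P3 by (simp add: algebra_simps)
      have "cmod (w x - WP P x) \<le> (\<bar>\<eta>2 x\<bar> * cmod (g2 x - poly P2 (of_real x)) + 2 * (\<bar>\<eta>1 x\<bar> * cmod (g3 x - poly P3 (of_real x)))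
          + \<bar>\<eta> x\<bar> * cmod (v x - poly Q (of_real x))) + (cmod ca * cmod (WP R1 x) + cmod cb * cmod (WP R2 x))"
      proof -
        have t5: "cmod (A + B + C + (D + E)) \<le> (cmod A + cmod B + cmod C) + (cmod D + cmod E)" for A B C D E
          using norm_triangle_ineq[of "A + B + C" "D + E"] norm_triangle_ineq[of "A + B" C] norm_triangle_ineq[of A B]
            norm_triangle_ineq[of D E] by linarith
        show ?thesis unfolding eq
          using t5[of "of_real (\<eta>2 x) * (g2 x - poly P2 (of_real x))" "2 * (of_real (\<eta>1 x) * (g3 x - poly P3 (of_real x)))"
            "of_real (\<eta> x) * (v x - poly Q (of_real x))" "ca * WP R1 x" "cb * WP R2 x"]
          unfolding norm_mult norm_of_real norm_numeral .
      qed
      also have "\<dots> \<le> (H2 * (d * pi * pi) + 2 * (H1 * (d * pi)) + H0 * d) + (d * pi * N1 + Kb * d * N2)"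
      proof (intro add_mono)
        show "\<bar>\<eta>2 x\<bar> * cmod (g2 x - poly P2 (of_real x)) \<le> H2 * (d * pi * pi)"
          using E2[OF x] H(3,6) x by (intro mult_mono) auto
        have "\<bar>\<eta>1 x\<bar> * cmod (g3 x - poly P3 (of_real x)) \<le> H1 * (d * pi)"
          using E3[OF x] H(2,5) x by (intro mult_mono) auto
        then show "2 * (\<bar>\<eta>1 x\<bar> * cmod (g3 x - poly P3 (of_real x))) \<le> 2 * (H1 * (d * pi))" by simp
        show "\<bar>\<eta> x\<bar> * cmod (v x - poly Q (of_real x)) \<le> H0 * d"
          using Q[OF x] H(1,4) x by (intro mult_mono) auto
        show "cmod ca * cmod (WP R1 x) \<le> d * pi * N1" using ca M x d0 by (intro mult_mono) auto
        show "cmod cb * cmod (WP R2 x) \<le> Kb * d * N2" using cb M x Kb d0 by (intro mult_mono) auto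
      qed
      also have "\<dots> = K2 * d" unfolding K2_def by (simp add: algebra_simps power2_eq_square)
      finally show ?thesis .
    qed
    ultimately show ?thesis by blast
  qed
  show thesis
  proof (rule that[of "K1 + K2"])
    show "0 \<le> K1 + K2" using K12 by simp
    fix d :: real assume d: "0 < d"
    obtain P where P: "poly_bc P" "\<forall>x\<in>{0..pi}. cmod (g x - poly P (of_real x)) \<le> K1 * d \<and> cmod (w x - WP P x) \<le> K2 * d"
      using main[OF d] by blast
    have "K1 * d \<le> (K1 + K2) * d" "K2 * d \<le> (K1 + K2) * d" using K12 d by (auto intro!: mult_right_mono)
    then show "\<exists>P. poly_bc P \<and> (\<forall>x\<in>{0..pi}. cmod (g x - poly P (of_real x)) \<le> (K1 + K2) * d \<and> cmod (w x - WP P x) \<le> (K1 + K2) * d)"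
      using P by (intro exI[of _ P]) (auto intro: order_trans)
  qed
qed

lemma bvp_poly_approx:
  assumes "bvp g g1 m m1 w" "0 < e"
  obtains P where "poly_bc P" "\<And>x. x \<in> {0..pi} \<Longrightarrow> cmod (g x - poly P (of_real x)) \<le> e"
    "\<And>x. x \<in> {0..pi} \<Longrightarrow> cmod (w x - WP P x) \<le> e"
proof -
  obtain K where K: "0 \<le> K" "\<And>d. 0 < d \<Longrightarrow> \<exists>P. poly_bc P \<and>
     (\<forall>x\<in>{0..pi}. cmod (g x - poly P (of_real x)) \<le> K * d \<and> cmod (w x - WP P x) \<le> K * d)"
    using bvp_poly_approx_linear[OF assms(1)] by blast
  have d: "0 < e / (K + 1)" using K assms(2) by simp
  obtain P where P: "poly_bc P" "\<forall>x\<in>{0..pi}. cmod (g x - poly P (of_real x)) \<le> K * (e / (K + 1)) \<and> cmod (w x - WP P x) \<le> K * (e / (K + 1))"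
    using K(2)[OF d] by blast
  have "K * (e / (K + 1)) \<le> (K + 1) * (e / (K + 1))" using d by (intro mult_right_mono) auto
  also have "\<dots> = e" using K(1) by simp
  finally show thesis using that P by (meson order_trans)
qed

lemma pcis_test:
  assumes "poly_bc P" shows "pcis (vartheta T m) P \<in> beam_test T \<alpha> \<beta>"
proof -
  let ?\<psi> = "pcis (vartheta T m) P"
  have d1: "dx ?\<psi> z = pcis (vartheta T m) (pderiv P) z" if "z \<in> Rc" for z by (rule pcis_derivs(2)[OF T_pos that])
  have d2: "dx (dx ?\<psi>) z = pcis (vartheta T m) (pderiv (pderiv P)) z" if "z \<in> Rc" for z
    using dx_cong[OF d1 that] pcis_derivs(2)[OF T_pos that] by simp
  have t1: "dt T ?\<psi> z = pcis (vartheta T m) (smult (\<i> * of_real (vartheta T m)) P) z" if "z \<in> Rc" for z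
    by (rule pcis_derivs(1)[OF T_pos that])
  have bc: "2 * complex_of_real (\<alpha> x + \<beta> x) * poly (pderiv P) (of_real x) + poly (pderiv (pderiv P)) (of_real x) = 0"
    if x: "x \<in> {0, pi}" for x
  proof -
    have e: "\<eta> x \<noteq> 0" using eta_pos[of x] x by auto
    have "of_real (\<eta> x) * poly (pderiv (pderiv P)) (of_real x) = - of_real (2 * (\<alpha> x + \<beta> x) * \<eta> x) * poly (pderiv P) (of_real x)"
    proof (cases "x = 0")
      case True
      then show ?thesis using assms c0_eq unfolding poly_bc_def by simp
    next
      case False
      then have "x = pi" using x by simp
      then show ?thesis using assms cp_eq unfolding poly_bc_def by simp
    qed
    then have "of_real (\<eta> x) * (2 * complex_of_real (\<alpha> x + \<beta> x) * poly (pderiv P) (of_real x) + poly (pderiv (pderiv P)) (of_real x)) = 0"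
      by (simp add: algebra_simps add_eq_0_iff2)
    then show ?thesis using e by simp
  qed
  show ?thesis unfolding beam_test_def
  proof (intro CollectI conjI ballI allI)
    show "Ck_rect k T ?\<psi>" for k by (rule pcis_Ck[OF T_pos])
    fix t x assume t: "t \<in> {0..T}" and x: "x \<in> {0, pi}"
    have z: "(t, x) \<in> Rc" using t x by auto
    show "?\<psi> (t, x) = 0" using assms x by (auto simp: pcis_def poly_bc_def)
    have "2 * complex_of_real (\<alpha> x + \<beta> x) * dx ?\<psi> (t, x) + dx (dx ?\<psi>) (t, x) =
      (2 * complex_of_real (\<alpha> x + \<beta> x) * poly (pderiv P) (of_real x) + poly (pderiv (pderiv P)) (of_real x)) * cis (vartheta T m * t)"
      unfolding d1[OF z] d2[OF z] pcis_def by (simp add: algebra_simps)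
    then show "2 * complex_of_real (\<alpha> x + \<beta> x) * dx ?\<psi> (t, x) + dx (dx ?\<psi>) (t, x) = 0" using bc[OF x] by simp
  next
    fix x assume x: "x \<in> {0..pi}"
    show "?\<psi> (0, x) = ?\<psi> (T, x)" using cis_theta_T[of m] by (simp add: pcis_def)
    show "dt T ?\<psi> (0, x) = dt T ?\<psi> (T, x)"
      using t1[of "(0, x)"] t1[of "(T, x)"] x T_pos cis_theta_T[of m] by (simp add: pcis_def)
  qed
qed

text \<open>An eigenfunction times an exponential is not known to be smooth, so the weak equation is
  tested with \<open>pcis\<close> for approximating polynomials. \<open>bvp_poly_approx\<close>
  makes the functions and their images under the spatial operator converge uniformly.\<close>

lemma graph_coefficient:
  assumes uh: "(u, h) \<in> beam_graph T \<alpha> \<beta> \<rho> \<eta>" and e: "eig \<nu> \<phi>"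
  shows "(LINT z:Om|lborel. u z * (of_real (\<nu> - (vartheta T m)\<^sup>2) * (of_real (\<rho> (snd z)) * (\<phi> (snd z) * cis (vartheta T m * fst z)))))
    = (LINT z:Om|lborel. h z * (of_real (\<rho> (snd z)) * (\<phi> (snd z) * cis (vartheta T m * fst z))))"
proof -
  define \<theta> where "\<theta> = vartheta T m"
  have u: "u \<in> L2_space MM" and h: "h \<in> L2_space MM" using uh by (auto simp: beam_graph_def)
  have id: "(LINT z:Om|lborel. u z * (of_real (\<rho> (snd z)) * dt T (dt T \<psi>) z + opx \<psi> z))
      = (LINT z:Om|lborel. h z * \<psi> z * of_real (\<rho> (snd z)))" if "\<psi> \<in> beam_test T \<alpha> \<beta>" for \<psi>
    using uh that unfolding beam_graph_def opx_def by blast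
  have fc: "continuous_on Rc (\<lambda>z. \<phi> (snd z))" using eig_VC[OF e] by (intro snd_cont) (simp add: VC_def)
  have rc: "continuous_on Rc (\<lambda>z. complex_of_real (\<rho> (snd z)))" by (intro continuous_intros rho_snd_cont)
  obtain g1 k k1 where b: "bvp \<phi> g1 k k1 (\<lambda>x. of_real (\<rho> x) * (of_real \<nu> * \<phi> x))" using e unfolding eig_def by blast
  let ?F = "\<lambda>z. of_real (\<nu> - \<theta>\<^sup>2) * (of_real (\<rho> (snd z)) * (\<phi> (snd z) * cis (\<theta> * fst z)))"
  let ?G = "\<lambda>z. of_real (\<rho> (snd z)) * (\<phi> (snd z) * cis (\<theta> * fst z))"
  have "(LINT z:Om|lborel. u z * ?F z) = (LINT z:Om|lborel. h z * ?G z)"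
  proof (rule pairing_approx_eq[OF u h, of ?F ?G])
    show "continuous_on Rc ?F" "continuous_on Rc ?G"
      by (intro continuous_on_mult continuous_on_const fc rc cis_cont)+
    fix r :: real assume r: "0 < r"
    \<comment> \<open>The denominator collects the amplification of the error:
      \<open>\<theta> ^ 2 * rhi\<close> from the time derivatives and \<open>rhi\<close> from the
      weight.\<close>
    define e' where "e' = r / (1 + \<theta>\<^sup>2 * rhi + rhi)"
    have den: "0 < 1 + \<theta>\<^sup>2 * rhi + rhi" using rhi(1) by (intro add_pos_nonneg add_pos_nonneg) auto
    have e': "0 < e'" unfolding e'_def using r den by simp
    obtain P where P: "poly_bc P" "\<And>x. x \<in> {0..pi} \<Longrightarrow> cmod (\<phi> x - poly P (of_real x)) \<le> e'"
      "\<And>x. x \<in> {0..pi} \<Longrightarrow> cmod (of_real (\<rho> x) * (of_real \<nu> * \<phi> x) - WP P x) \<le> e'"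
      using bvp_poly_approx[OF b e'] by blast
    let ?\<psi> = "pcis \<theta> P"
    have t: "?\<psi> \<in> beam_test T \<alpha> \<beta>" unfolding \<theta>_def by (rule pcis_test[OF P(1)])
    have sm: "smooth_rect T ?\<psi>" by (rule pcis_smooth[OF T_pos])
    have tt: "dt T (dt T ?\<psi>) z = - of_real (\<theta>\<^sup>2) * ?\<psi> z" if z: "z \<in> Rc" for z
    proof -
      have "dt T (dt T ?\<psi>) z = dt T (pcis \<theta> (smult (\<i> * of_real \<theta>) P)) z"
        by (rule dt_cong[OF pcis_derivs(1)[OF T_pos] z])
      also have "\<dots> = pcis \<theta> (smult (\<i> * of_real \<theta>) (smult (\<i> * of_real \<theta>) P)) z" by (rule pcis_derivs(1)[OF T_pos z])
      also have "\<dots> = - of_real (\<theta>\<^sup>2) * ?\<psi> z" by (simp add: pcis_def power2_eq_square mult_ac)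
      finally show ?thesis .
    qed
    have xx: "opx ?\<psi> z = WP P (snd z) * cis (\<theta> * fst z)" if z: "z \<in> Rc" for z
    proof -
      note d = pcis_derivs(2)[OF T_pos]
      have 1: "dx ?\<psi> w = pcis \<theta> (pderiv P) w" if "w \<in> Rc" for w by (rule d[OF that])
      have 2: "dx (dx ?\<psi>) w = pcis \<theta> (pderiv (pderiv P)) w" if "w \<in> Rc" for w
        using dx_cong[OF 1 that] d[OF that] by simp
      have 3: "dx (dx (dx ?\<psi>)) w = pcis \<theta> (pderiv (pderiv (pderiv P))) w" if "w \<in> Rc" for w
        using dx_cong[OF 2 that] d[OF that] by simp
      have 4: "dx (dx (dx (dx ?\<psi>))) w = pcis \<theta> (pderiv (pderiv (pderiv (pderiv P)))) w" if "w \<in> Rc" for w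
        using dx_cong[OF 3 that] d[OF that] by simp
      show ?thesis unfolding opx_eq[OF sm z] 2[OF z] 3[OF z] 4[OF z]
        by (simp add: pcis_def WP_def algebra_simps)
    qed
    let ?F' = "\<lambda>z. of_real (\<rho> (snd z)) * dt T (dt T ?\<psi>) z + opx ?\<psi> z"
    let ?G' = "\<lambda>z. ?\<psi> z * of_real (\<rho> (snd z))"
    show "\<exists>F' G'. continuous_on Rc F' \<and> continuous_on Rc G' \<and> (\<forall>z\<in>Rc. cmod (?F z - F' z) \<le> r) \<and>
        (\<forall>z\<in>Rc. cmod (?G z - G' z) \<le> r) \<and> (LINT z:Om|lborel. u z * F' z) = (LINT z:Om|lborel. h z * G' z)"
    proof (rule exI[of _ ?F'], rule exI[of _ ?G'], intro conjI ballI)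
      show "continuous_on Rc ?F'"
        by (intro continuous_on_add continuous_on_mult rc opx_cont[OF sm] smooth_rectD(1)[OF smooth_rectD(2)[OF smooth_rectD(2)[OF sm]]])
      show "continuous_on Rc ?G'" by (intro continuous_on_mult rc pcis_cont)
      show "(LINT z:Om|lborel. u z * ?F' z) = (LINT z:Om|lborel. h z * ?G' z)" using id[OF t] by (simp add: mult.assoc)
      fix z assume z: "z \<in> Rc"
      then have x: "snd z \<in> {0..pi}" by auto
      have rb: "\<bar>\<rho> (snd z)\<bar> \<le> rhi" using rhi(2)[OF x] rho_gt[OF x] by simp
      have "?F z - ?F' z = ((of_real (\<rho> (snd z)) * (of_real \<nu> * \<phi> (snd z)) - WP P (snd z))
         - of_real (\<theta>\<^sup>2) * (of_real (\<rho> (snd z)) * (\<phi> (snd z) - poly P (of_real (snd z))))) * cis (\<theta> * fst z)"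
        unfolding tt[OF z] xx[OF z] by (simp add: pcis_def algebra_simps)
      also have "cmod \<dots> = cmod ((of_real (\<rho> (snd z)) * (of_real \<nu> * \<phi> (snd z)) - WP P (snd z))
         - of_real (\<theta>\<^sup>2) * (of_real (\<rho> (snd z)) * (\<phi> (snd z) - poly P (of_real (snd z)))))" by (simp add: norm_mult)
      also have "\<dots> \<le> cmod (of_real (\<rho> (snd z)) * (of_real \<nu> * \<phi> (snd z)) - WP P (snd z))
         + \<theta>\<^sup>2 * (\<bar>\<rho> (snd z)\<bar> * cmod (\<phi> (snd z) - poly P (of_real (snd z))))"
        by (rule order_trans[OF norm_triangle_ineq4]) (simp add: norm_mult norm_power)
      also have "\<dots> \<le> e' + \<theta>\<^sup>2 * (rhi * e')"
        using P(2)[OF x] P(3)[OF x] rb rhi(1) by (intro add_mono mult_left_mono mult_mono) auto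
      also have "\<dots> \<le> e' * (1 + \<theta>\<^sup>2 * rhi + rhi)" using e' rhi(1) by (simp add: algebra_simps)
      also have "\<dots> = r" unfolding e'_def using den by simp
      finally show "cmod (?F z - ?F' z) \<le> r" .
      have "?G z - ?G' z = of_real (\<rho> (snd z)) * (\<phi> (snd z) - poly P (of_real (snd z))) * cis (\<theta> * fst z)"
        by (simp add: pcis_def algebra_simps)
      also have "cmod \<dots> = \<bar>\<rho> (snd z)\<bar> * cmod (\<phi> (snd z) - poly P (of_real (snd z)))" by (simp add: norm_mult)
      also have "\<dots> \<le> rhi * e'" using P(2)[OF x] rb rhi(1) by (intro mult_mono) auto
      also have "\<dots> \<le> e' * (1 + \<theta>\<^sup>2 * rhi + rhi)" using e' rhi(1) by (simp add: algebra_simps)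
      also have "\<dots> = r" unfolding e'_def using den by simp
      finally show "cmod (?G z - ?G' z) \<le> r" .
    qed
  qed
  then show ?thesis unfolding \<theta>_def .
qed

end

section \<open>The beam operator is diagonal\<close>

lemma vartheta_minus: "vartheta T (- m) = - vartheta T m" by (simp add: vartheta_def)

text \<open>Vanishing value, slope and second derivative make the end conditions hold for any
  coefficients \<open>c0\<close> and \<open>cp\<close>.\<close>

lemma triple_root:
  fixes R :: "complex poly"
  assumes P: "P = [:- a, 1:] ^ 3 * R"
  shows "poly P a = 0" "poly (pderiv P) a = 0" "poly (pderiv (pderiv P)) a = 0"
proof -
  define q where "q = [:- a, 1:]"
  have q: "poly q a = 0" by (simp add: q_def)
  have "P = q * (q * (q * R))" unfolding P q_def by (simp only: power3_eq_cube mult.assoc)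
  then show "poly P a = 0" "poly (pderiv P) a = 0" "poly (pderiv (pderiv P)) a = 0"
    using q by (simp_all add: pderiv_mult pderiv_add)
qed

text \<open>Numbers all pairs of an integer and a positive natural number; \<open>Suc\<close>
  matches the eigenvalue indices, which start at \<open>1\<close>.\<close>

definition idx :: "nat \<Rightarrow> int \<times> nat" where
  "idx k = (int_decode (fst (prod_decode k)), Suc (snd (prod_decode k)))"

lemma idx_inj: "inj idx"
proof (rule injI)
  fix j k assume "idx j = idx k"
  then have "fst (prod_decode j) = fst (prod_decode k)" "snd (prod_decode j) = snd (prod_decode k)"
    using inj_int_decode[of UNIV] by (auto simp: idx_def dest: injD)
  then have "prod_decode j = prod_decode k" by (rule prod_eqI)
  then show "j = k" using inj_prod_decode[of UNIV] by (auto dest: injD)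
qed

lemma idx_surj: "1 \<le> n \<Longrightarrow> \<exists>k. idx k = (m, n)"
  by (rule exI[of _ "prod_encode (int_encode m, n - 1)"]) (simp add: idx_def)

lemma idx_snd: "1 \<le> snd (idx k)" by (simp add: idx_def)

locale beam_spectral = beam_setting \<rho> \<eta> c0 cp T \<alpha> \<beta> \<eta>1 \<eta>2 + beam_basis \<rho> \<eta> c0 cp \<phi> \<mu> n0 Cm
  for \<rho> \<eta> :: "real \<Rightarrow> real" and c0 cp T :: real and \<alpha> \<beta> \<eta>1 \<eta>2 :: "real \<Rightarrow> real"
    and \<phi> :: "nat \<Rightarrow> real \<Rightarrow> complex" and \<mu> :: "nat \<Rightarrow> real" and n0 :: nat and Cm :: real +
  fixes gc :: real
  assumes gc_pos: "0 < gc"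
    and gap: "\<And>m n. 1 \<le> n \<Longrightarrow> \<mu> n \<noteq> (vartheta T m)\<^sup>2 \<Longrightarrow>
      gc * ((real n)\<^sup>2 + \<bar>of_int m\<bar>) \<le> \<bar>\<mu> n - (vartheta T m)\<^sup>2\<bar>"
    and resonances_finite: "finite {(m, n). \<mu> n = (vartheta T m)\<^sup>2}"
begin

text \<open>\<open>\<phi> n\<close> has norm one in space, so \<open>sqrt T\<close> normalises the
  exponential in time.\<close>

definition EE :: "int \<Rightarrow> nat \<Rightarrow> real \<times> real \<Rightarrow> complex" where
  "EE m n z = \<phi> n (snd z) * cis (vartheta T m * fst z) / of_real (sqrt T)"

lemma sqrtT: "sqrt T \<noteq> 0" "complex_of_real (sqrt T) * complex_of_real (sqrt T) = of_real T"
  using T_pos by (simp_all flip: of_real_mult)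

lemma phi_cont: "1 \<le> n \<Longrightarrow> continuous_on Rc (\<lambda>z. \<phi> n (snd z))"
  using basis_VC by (intro snd_cont) (simp add: VC_def)

lemma rho_cont_c: "continuous_on Rc (\<lambda>z. complex_of_real (\<rho> (snd z)))"
  by (intro continuous_intros rho_snd_cont)

lemma EE_cont: "1 \<le> n \<Longrightarrow> continuous_on Rc (EE m n)"
  unfolding EE_def[abs_def] using sqrtT(1)
  by (intro continuous_on_divide continuous_on_mult phi_cont cis_cont continuous_on_const) auto

lemma EE_L2: "1 \<le> n \<Longrightarrow> EE m n \<in> L2_space MM" by (rule cont_L2[OF EE_cont])

lemma cnj_EE: "cnj (EE m n z) = cnj (\<phi> n (snd z)) * cis (vartheta T (- m) * fst z) / of_real (sqrt T)"
  by (simp add: EE_def vartheta_minus cis_cnj)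

lemma coefficient:
  assumes "u \<in> L2_space MM" "1 \<le> n"
  shows "L2_inner MM u (EE m n) =
    (LINT z:Om|lborel. u z * (of_real (\<rho> (snd z)) * (cnj (\<phi> n (snd z)) * cis (vartheta T (- m) * fst z)))) / of_real (sqrt T)"
  unfolding inner_MM[OF assms(1) EE_L2[OF assms(2)]] cnj_EE times_divide_eq_right
  by (rule set_integral_divide_zero)

lemma int_cis: "integral {0..T} (\<lambda>t. cis (vartheta T j * t)) = (if j = 0 then of_real T else 0)"
proof (cases "j = 0")
  case True
  then show ?thesis using T_pos by (simp add: vartheta_def scaleR_conv_of_real)
next
  case False
  define \<theta> where "\<theta> = vartheta T j"
  have th: "\<theta> \<noteq> 0" unfolding \<theta>_def vartheta_def using False T_pos by simp
  have "((\<lambda>t. \<i> * of_real \<theta> * cis (\<theta> * t)) has_integral (cis (\<theta> * T) - cis (\<theta> * 0))) {0..T}"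
    by (rule fundamental_theorem_of_calculus) (use T_pos cis_vd in auto)
  from integral_unique[OF this] have "\<i> * of_real \<theta> * integral {0..T} (\<lambda>t. cis (\<theta> * t)) = 0"
    using cis_theta_T[of j] by (simp add: \<theta>_def)
  then show ?thesis using th False unfolding \<theta>_def[symmetric] by simp
qed

lemma EE_ortho:
  assumes n: "1 \<le> n" "1 \<le> n'"
  shows "L2_inner MM (EE m n) (EE m' n') = (if m = m' \<and> n = n' then 1 else 0)"
proof -
  let ?f = "\<lambda>z. EE m n z * (of_real (\<rho> (snd z)) * cnj (EE m' n' z))"
  have c: "continuous_on Rc ?f"
    by (intro continuous_on_mult EE_cont n rho_cont_c continuous_on_cnj)
  have eq: "?f (t, x) = cis (vartheta T (m - m') * t) / of_real T * (of_real (\<rho> x) * (\<phi> n x * cnj (\<phi> n' x)))" for t x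
  proof -
    have "cis (vartheta T (m - m') * t) = cis (vartheta T m * t) * cis (vartheta T (- m') * t)"
      by (simp add: cis_mult vartheta_def field_simps diff_divide_distrib)
    then show ?thesis unfolding cnj_EE using sqrtT(2) by (simp add: EE_def)
  qed
  have "L2_inner MM (EE m n) (EE m' n') = integral {0..T} (\<lambda>t. integral {0..pi} (\<lambda>x. ?f (t, x)))"
    unfolding inner_MM[OF EE_L2[OF n(1)] EE_L2[OF n(2)]] by (rule fubini_tx[OF c])
  also have "\<dots> = integral {0..T} (\<lambda>t. cis (vartheta T (m - m') * t) / of_real T * ipw \<rho> (\<phi> n) (\<phi> n'))"
    unfolding eq ipw_def by simp
  also have "\<dots> = integral {0..T} (\<lambda>t. cis (vartheta T (m - m') * t)) / of_real T * ipw \<rho> (\<phi> n) (\<phi> n')"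
    by (simp add: divide_inverse)
  also have "\<dots> = (if m = m' \<and> n = n' then 1 else 0)"
    using IR.ortho_famD(2)[OF basis_ortho, of n n'] n T_pos unfolding int_cis by simp
  finally show ?thesis .
qed

lemma poly_bvp:
  assumes "poly_bc P"
  shows "bvp (\<lambda>x. poly P (of_real x)) (\<lambda>x. poly (pderiv P) (of_real x))
    (\<lambda>x. of_real (\<eta> x) * poly (pderiv (pderiv P)) (of_real x))
    (\<lambda>x. of_real (\<eta>1 x) * poly (pderiv (pderiv P)) (of_real x) + of_real (\<eta> x) * poly (pderiv (pderiv (pderiv P))) (of_real x))
    (WP P)"
proof -
  have "chain (\<lambda>x. poly P (of_real x)) (\<lambda>x. poly (pderiv P) (of_real x))
    (\<lambda>x. of_real (\<eta> x) * poly (pderiv (pderiv P)) (of_real x))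
    (\<lambda>x. of_real (\<eta>1 x) * poly (pderiv (pderiv P)) (of_real x) + of_real (\<eta> x) * poly (pderiv (pderiv (pderiv P))) (of_real x))
    (WP P)"
    unfolding WP_def[abs_def] by (rule chain_C4) (rule poly_vd poly_VC)+
  then show ?thesis using assms unfolding bvp_def poly_bc_def by simp
qed

text \<open>For a polynomial with the end conditions, \<open>basis_expansion\<close> with
  \<open>h = WP P / \<rho>\<close> converges uniformly, and each partial sum times the exponential
  is a combination of the \<open>EE m n\<close>.\<close>

lemma EE_annihilates_poly:
  assumes u: "u \<in> L2_space MM" and z: "\<And>m n. 1 \<le> n \<Longrightarrow> L2_inner MM u (EE m n) = 0"
    and P: "poly_bc P"
  shows "(LINT z:Om|lborel. u z * (of_real (\<rho> (snd z)) * cnj (poly P (of_real (snd z)) * cis (vartheta T m * fst z)))) = 0"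
proof -
  define g where "g x = poly P (complex_of_real x)" for x
  define h where "h x = WP P x / of_real (\<rho> x)" for x
  have rnz: "\<rho> x \<noteq> 0" if "x \<in> {0..pi}" for x using rho_gt[OF that] by simp
  have hV: "h \<in> VC" unfolding h_def VC_def using WP_VC[of P] rho_cont rnz by (auto simp: VC_def intro!: continuous_intros)
  have ul: "uniform_limit {0..pi} (\<lambda>N x. \<Sum>n=1..N. ipw \<rho> g (\<phi> n) * \<phi> n x) g sequentially"
    unfolding g_def by (rule basis_expansion[OF poly_bvp[OF P] _ hV]) (use rnz in \<open>auto simp: h_def\<close>)
  have gc: "continuous_on Rc (\<lambda>z. g (snd z))" unfolding g_def using poly_VC by (intro snd_cont) (simp add: VC_def)
  let ?F = "\<lambda>z. of_real (\<rho> (snd z)) * cnj (g (snd z) * cis (vartheta T m * fst z))"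
  have "(LINT z:Om|lborel. u z * ?F z) = (LINT z:Om|lborel. (\<lambda>_. 0) z * ?F z)"
  proof (rule pairing_approx_eq[OF u L2.zero_mem, of ?F ?F])
    show F: "continuous_on Rc ?F" "continuous_on Rc ?F"
      by (intro continuous_on_mult continuous_on_cnj rho_cont_c gc cis_cont)+
    fix e :: real assume e: "0 < e"
    have "0 < e / rhi" using e rhi(1) by simp
    from eventually_happens'[OF sequentially_bot uniform_limitD[OF ul this]] obtain N
      where N: "\<And>x. x \<in> {0..pi} \<Longrightarrow> cmod ((\<Sum>n=1..N. ipw \<rho> g (\<phi> n) * \<phi> n x) - g x) < e / rhi"
      unfolding dist_norm by blast
    define S where "S z = (\<Sum>n=1..N. (ipw \<rho> g (\<phi> n) * of_real (sqrt T)) * EE m n z)" for z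
    have S: "S z = (\<Sum>n=1..N. ipw \<rho> g (\<phi> n) * \<phi> n (snd z)) * cis (vartheta T m * fst z)" for z
      unfolding S_def EE_def sum_distrib_right using sqrtT(1) by (intro sum.cong) auto
    have Sc: "continuous_on Rc S" unfolding S_def[abs_def]
      by (intro continuous_on_sum continuous_on_mult continuous_on_const EE_cont) auto
    let ?F' = "\<lambda>z. of_real (\<rho> (snd z)) * cnj (S z)"
    show "\<exists>F' G'. continuous_on Rc F' \<and> continuous_on Rc G' \<and> (\<forall>z\<in>Rc. cmod (?F z - F' z) \<le> e) \<and>
      (\<forall>z\<in>Rc. cmod (?F z - G' z) \<le> e) \<and> (LINT z:Om|lborel. u z * F' z) = (LINT z:Om|lborel. 0 * G' z)"
    proof (rule exI[of _ ?F'], rule exI[of _ ?F], intro conjI ballI F)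
      show "continuous_on Rc ?F'" by (intro continuous_on_mult continuous_on_cnj rho_cont_c Sc)
      have "(LINT z:Om|lborel. u z * ?F' z) = L2_inner MM u S" by (rule inner_MM[OF u cont_L2[OF Sc], symmetric])
      also have "\<dots> = 0" unfolding S_def[abs_def]
        by (subst L2.ip_sum2) (use z EE_L2 u in auto)
      finally show "(LINT z:Om|lborel. u z * ?F' z) = (LINT z:Om|lborel. 0 * ?F z)"
        by (simp add: set_lebesgue_integral_def)
      fix w assume w: "w \<in> Rc"
      then have x: "snd w \<in> {0..pi}" by auto
      have "?F w - ?F' w = of_real (\<rho> (snd w)) * cnj ((g (snd w) - (\<Sum>n=1..N. ipw \<rho> g (\<phi> n) * \<phi> n (snd w))) * cis (vartheta T m * fst w))"
        unfolding S by (simp only: complex_cnj_mult complex_cnj_diff left_diff_distrib right_diff_distrib)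
      then have "cmod (?F w - ?F' w) = \<bar>\<rho> (snd w)\<bar> * cmod ((\<Sum>n=1..N. ipw \<rho> g (\<phi> n) * \<phi> n (snd w)) - g (snd w))"
        by (simp only: norm_mult norm_of_real complex_mod_cnj norm_cis mult_1_right norm_minus_commute)
      also have "\<dots> \<le> rhi * (e / rhi)"
        using rhi(2)[OF x] rho_gt[OF x] N[OF x] by (intro mult_mono) (auto intro: less_imp_le)
      finally show "cmod (?F w - ?F' w) \<le> e" using rhi(1) by simp
      show "cmod (?F w - ?F w) \<le> e" using e by simp
    qed
  qed
  then show ?thesis unfolding g_def by (simp add: set_lebesgue_integral_def)
qed

text \<open>Multiplication by \<open>x ^ 3 * (x - pi) ^ 3\<close> turns every monomial into a
  polynomial satisfying the end conditions. The weighted \<open>u\<close> is therefore annihilated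
  by all monomials times exponentials and vanishes by \<open>annihilated_zero\<close>; the weight
  has no zero inside the domain.\<close>

lemma EE_total:
  assumes u: "u \<in> L2_space MM" and z: "\<And>m n. 1 \<le> n \<Longrightarrow> L2_inner MM u (EE m n) = 0"
  shows "AE z in MM. u z = 0"
proof -
  define w where "w z = \<rho> (snd z) * (snd z ^ 3 * (snd z - pi) ^ 3)" for z :: "real \<times> real"
  define U where "U z = indicator Om z *\<^sub>R (u z * of_real (w z))" for z
  have "AE z in lborel. U z = 0"
  proof (rule annihilated_zero[OF T_pos])
    have "set_integrable lborel Om (\<lambda>z. u z * of_real (w z))"
      unfolding w_def by (rule L2_set_integrable[OF u]) (intro continuous_intros rho_snd_cont)
    then show "integrable lborel U" unfolding set_integrable_def U_def[abs_def] .
    show "U z = 0" if "z \<notin> beam_domain T" for z using that by (simp add: U_def)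
    fix j m
    define P where "P = [:- 0, 1:] ^ 3 * ([:- complex_of_real pi, 1:] ^ 3 * monom 1 j)"
    have P2: "P = [:- complex_of_real pi, 1:] ^ 3 * ([:- 0, 1:] ^ 3 * monom 1 j)" unfolding P_def by (simp only: mult_ac)
    have Pv: "poly P (of_real x) = of_real (x ^ 3 * (x - pi) ^ 3 * x ^ j)" for x
      unfolding P_def by (simp add: poly_monom)
    have "poly_bc P" unfolding poly_bc_def using triple_root[OF P_def] triple_root[OF P2] by simp
    from EE_annihilates_poly[OF u z this, of m]
    have "(LINT z:Om|lborel. u z * (of_real (\<rho> (snd z)) * cnj (poly P (of_real (snd z)) * cis (vartheta T m * fst z)))) = 0" by simp
    also have "(\<lambda>z. u z * (of_real (\<rho> (snd z)) * cnj (poly P (of_real (snd z)) * cis (vartheta T m * fst z))))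
      = (\<lambda>z. u z * of_real (w z) * of_real (snd z ^ j) * cis (- (vartheta T m * fst z)))"
      unfolding Pv w_def by (simp add: fun_eq_iff cis_cnj)
    finally show "(LINT z|lborel. U z * of_real (snd z ^ j) * cis (- (vartheta T m * fst z))) = 0"
      unfolding set_lebesgue_integral_def U_def by (simp add: mult_ac)
  qed
  then show ?thesis unfolding AE_MM
  proof eventually_elim
    case (elim z)
    show ?case
    proof
      assume z: "z \<in> Om"
      then have x: "0 < snd z" "snd z < pi" by (auto simp: beam_domain_def)
      then have "w z \<noteq> 0" using rho_gt[of "snd z"] by (simp add: w_def)
      then show "u z = 0" using elim z by (simp add: U_def)
    qed
  qed
qed

definition ek :: "nat \<Rightarrow> real \<times> real \<Rightarrow> complex" where
  "ek k = EE (fst (idx k)) (snd (idx k))"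

definition lam :: "nat \<Rightarrow> real" where
  "lam k = \<mu> (snd (idx k)) - (vartheta T (fst (idx k)))\<^sup>2"

text \<open>Origin of the constant: \<open>T\<close> from the normalisation in time,
  \<open>gc ^ 2\<close> from the gap, \<open>4\<close> from the sum over \<open>m\<close>, and
  \<open>3 * CB\<close> from the sum over \<open>n\<close>.\<close>

lemma ek_bound:
  assumes z: "z \<in> Om"
  shows "(\<Sum>k<N. (cmod (ek k z))\<^sup>2 / (lam k)\<^sup>2) \<le> 12 * CB / (T * gc\<^sup>2)"
proof -
  have x: "snd z \<in> {0..pi}" using Om_sub[OF z] by auto
  let ?s = "\<lambda>n. (cmod (\<phi> n (snd z)))\<^sup>2"
  let ?t = "\<lambda>(m::int, n). ?s n / ((real n)\<^sup>2 + \<bar>of_int m\<bar>)\<^sup>2"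
  have le: "(cmod (ek k z))\<^sup>2 / (lam k)\<^sup>2 \<le> 1 / (T * gc\<^sup>2) * ?t (idx k)" for k
  proof -
    obtain m n where mn: "idx k = (m, n)" by (cases "idx k")
    have n: "1 \<le> n" using idx_snd[of k] mn by simp
    define d where "d = (real n)\<^sup>2 + \<bar>of_int m\<bar>"
    have d: "0 < d" unfolding d_def using n by (intro add_pos_nonneg) auto
    have e: "(cmod (ek k z))\<^sup>2 = ?s n / T"
      using T_pos unfolding ek_def mn EE_def by (simp add: norm_mult norm_divide power_mult_distrib power_divide)
    show ?thesis
    proof (cases "lam k = 0")
      \<comment> \<open>Resonant terms count as zero through division by zero, in agreement with
        their omission from \<open>ser\<close>.\<close>
      case True
      then show ?thesis using T_pos by (simp add: mn)
    next
      case False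
      then have "gc * d \<le> \<bar>lam k\<bar>" unfolding lam_def mn d_def using gap[OF n] by simp
      then have "(gc * d)\<^sup>2 \<le> (lam k)\<^sup>2" using gc_pos d by (metis abs_of_pos mult_pos_pos abs_le_square_iff)
      then have "?s n / T / (lam k)\<^sup>2 \<le> ?s n / T / (gc * d)\<^sup>2"
        using gc_pos d T_pos by (intro divide_left_mono) (auto intro!: mult_pos_pos simp: False)
      then show ?thesis unfolding e mn by (simp add: d_def power_mult_distrib mult_ac)
    qed
  qed
  have "(\<Sum>k<N. ?t (idx k)) = (\<Sum>i\<in>idx ` {..<N}. ?t i)"
    by (subst sum.reindex[OF inj_on_subset[OF idx_inj]]) auto
  also have "\<dots> \<le> 4 * (3 * CB)"
  proof (rule double_sum_bound)
    show "(\<Sum>n=1..N. ?s n / (real n)\<^sup>2) \<le> 3 * CB" for N using basis_weighted_bound[OF x, of 1 N] by simp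
    show "idx ` {..<N} \<subseteq> UNIV \<times> {1..}" by (auto simp: idx_def)
  qed auto
  finally have t: "(\<Sum>k<N. ?t (idx k)) \<le> 4 * (3 * CB)" .
  have "(\<Sum>k<N. (cmod (ek k z))\<^sup>2 / (lam k)\<^sup>2) \<le> (\<Sum>k<N. 1 / (T * gc\<^sup>2) * ?t (idx k))"
    by (rule sum_mono) (rule le)
  also have "\<dots> = 1 / (T * gc\<^sup>2) * (\<Sum>k<N. ?t (idx k))" by (rule sum_distrib_left[symmetric])
  also have "\<dots> \<le> 1 / (T * gc\<^sup>2) * (4 * (3 * CB))" by (rule mult_left_mono[OF t]) (use T_pos in simp)
  finally show ?thesis by simp
qed

sublocale D: diag_system MM ek lam "12 * CB / (T * gc\<^sup>2)"
proof (rule diag_system.intro)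
  show "finite_measure MM" by (rule finite_MM)
  show "L2_ortho MM UNIV ek"
    unfolding L2.ortho_fam_def ek_def using EE_L2[OF idx_snd] EE_ortho[OF idx_snd idx_snd] injD[OF idx_inj]
    by (auto simp: prod_eq_iff)
  show "AE z in MM. u z = 0" if "u \<in> L2_space MM" "\<And>k. L2_inner MM u (ek k) = 0" for u
  proof (rule EE_total[OF that(1)])
    fix m :: int and n :: nat assume "1 \<le> n"
    then obtain k where "idx k = (m, n)" using idx_surj by blast
    then show "L2_inner MM u (EE m n) = 0" using that(2)[of k] by (simp add: ek_def)
  qed
  show "(\<Sum>k<N. (cmod (ek k z))\<^sup>2 / (lam k)\<^sup>2) \<le> 12 * CB / (T * gc\<^sup>2)" if "z \<in> space MM" for z N
    using that ek_bound by (simp add: space_MM)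
  have "{k. lam k = 0} = idx -` {(m, n). \<mu> n = (vartheta T m)\<^sup>2}" by (auto simp: lam_def case_prod_beta')
  then show "finite {k. lam k = 0}" using finite_vimageI[OF resonances_finite idx_inj] by simp
qed

end

section \<open>Identification of the weak operator with the diagonal one\<close>

context beam_spectral
begin

text \<open>One inclusion reads off coefficients through \<open>graph_coefficient\<close>. For the
  other, a conjugated test function and its image also form a pair in \<open>D.G\<close>, and
  Parseval for this pair and for \<open>(u, h)\<close> gives the weak equation; each of the two
  inner products has a factor in the domain.\<close>

lemma beam_graph_eq: "beam_graph T \<alpha> \<beta> \<rho> \<eta> = D.G"
proof (rule set_eqI)
  fix p :: "(real \<times> real \<Rightarrow> complex) \<times> (real \<times> real \<Rightarrow> complex)"
  obtain u h where p: "p = (u, h)" by (cases p)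
  have "(u, h) \<in> D.G" if uh: "(u, h) \<in> beam_graph T \<alpha> \<beta> \<rho> \<eta>"
  proof -
    have u: "u \<in> L2_space MM" and h: "h \<in> L2_space MM" using uh by (auto simp: beam_graph_def)
    have "D.co h k = of_real (lam k) * D.co u k" for k
    proof -
      obtain m n where mn: "idx k = (m, n)" by (cases "idx k")
      have n: "1 \<le> n" using idx_snd[of k] mn by simp
      \<comment> \<open>The coefficient conjugates \<open>EE m n\<close>, which turns
        \<open>m\<close> into \<open>- m\<close>; the square of the frequency is unchanged.\<close>
      have "(\<lambda>z. u z * (of_real (\<mu> n - (vartheta T (- m))\<^sup>2) * (of_real (\<rho> (snd z)) * (cnj (\<phi> n (snd z)) * cis (vartheta T (- m) * fst z)))))
        = (\<lambda>z. of_real (lam k) * (u z * (of_real (\<rho> (snd z)) * (cnj (\<phi> n (snd z)) * cis (vartheta T (- m) * fst z)))))"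
        by (simp only: lam_def mn fst_conv snd_conv vartheta_minus power2_minus mult.left_commute)
      with graph_coefficient[OF uh eig_cnj[OF basis_eig[OF n]], of "- m"]
      show ?thesis
        unfolding ek_def mn fst_conv snd_conv coefficient[OF u n] coefficient[OF h n]
        by (simp del: of_real_diff)
    qed
    then show ?thesis using u h by (simp add: D.G_def)
  qed
  moreover have "(u, h) \<in> beam_graph T \<alpha> \<beta> \<rho> \<eta>" if uh: "(u, h) \<in> D.G"
  proof -
    have u: "u \<in> L2_space MM" and h: "h \<in> L2_space MM" and c: "\<And>k. D.co h k = of_real (lam k) * D.co u k"
      using uh by (auto simp: D.G_def)
    have "(LINT z:Om|lborel. u z * (of_real (\<rho> (snd z)) * dt T (dt T \<psi>) z + opx \<psi> z))
      = (LINT z:Om|lborel. h z * \<psi> z * of_real (\<rho> (snd z)))" if \<psi>: "\<psi> \<in> beam_test T \<alpha> \<beta>" for \<psi>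
    proof -
      have s: "smooth_rect T \<psi>" by (rule beam_test_smooth[OF \<psi>])
      note s2 = smooth_rectD(2)[OF smooth_rectD(2)[OF s]]
      define A where "A z = of_real (\<rho> (snd z)) * dt T (dt T \<psi>) z + opx \<psi> z" for z
      \<comment> \<open>\<open>v\<close> and \<open>w\<close> rewrite the unconjugated integrals of
        the weak equation as weighted inner products with \<open>h\<close> and \<open>u\<close>; the
        division by \<open>\<rho>\<close> in \<open>w\<close> compensates the weight.\<close>
      define v where "v z = cnj (\<psi> z)" for z
      define w where "w z = cnj (A z / of_real (\<rho> (snd z)))" for z
      have rnz: "\<rho> (snd z) \<noteq> 0" if "z \<in> Rc" for z using rho_gt[of "snd z"] that by auto
      have Ac: "continuous_on Rc A" unfolding A_def[abs_def]
        by (intro continuous_on_add continuous_on_mult rho_cont_c opx_cont[OF s] smooth_rectD(1)[OF s2])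
      have vm: "v \<in> L2_space MM" unfolding v_def[abs_def]
        by (intro cont_L2 continuous_on_cnj smooth_rectD(1)[OF s])
      have wm: "w \<in> L2_space MM" unfolding w_def[abs_def]
        by (intro cont_L2 continuous_on_cnj continuous_on_divide Ac rho_cont_c) (use rnz in auto)
      have wA: "of_real (\<rho> (snd z)) * cnj (w z) = A z" if "z \<in> Om" for z
        using rnz[OF Om_sub[OF that]] by (simp add: w_def)
      have vw: "D.co w k = of_real (lam k) * D.co v k" for k
      proof -
        obtain m n where mn: "idx k = (m, n)" by (cases "idx k")
        have n: "1 \<le> n" using idx_snd[of k] mn by simp
        have coef: "cnj (L2_inner MM f (EE m n)) =
          (LINT z:Om|lborel. (of_real (\<rho> (snd z)) * cnj (f z)) * (\<phi> n (snd z) * cis (vartheta T m * fst z))) / of_real (sqrt T)"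
          if f: "f \<in> L2_space MM" for f
        proof -
          have "cnj (L2_inner MM f (EE m n)) = L2_inner MM (EE m n) f"
            by (rule L2.ip_cnj[OF f EE_L2[OF n], symmetric])
          also have "\<dots> = (LINT z:Om|lborel. ((of_real (\<rho> (snd z)) * cnj (f z)) * (\<phi> n (snd z) * cis (vartheta T m * fst z))) / of_real (sqrt T))"
            unfolding inner_MM[OF EE_L2[OF n] f] by (simp add: EE_def mult_ac)
          finally show ?thesis by simp
        qed
        have "(LINT z:Om|lborel. (of_real (\<rho> (snd z)) * cnj (w z)) * (\<phi> n (snd z) * cis (vartheta T m * fst z)))
          = (LINT z:Om|lborel. A z * (\<phi> n (snd z) * cis (vartheta T m * fst z)))"
          by (rule set_lebesgue_integral_cong) (use Om_sets wA in auto)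
        also have "\<dots> = of_real (lam k) * (LINT z:Om|lborel. of_real (\<rho> (snd z)) * (\<psi> z * (\<phi> n (snd z) * cis (vartheta T m * fst z))))"
          unfolding A_def lam_def mn fst_conv snd_conv by (rule test_coefficient[OF \<psi> basis_eig[OF n]])
        finally have "cnj (L2_inner MM w (EE m n)) = of_real (lam k) * cnj (L2_inner MM v (EE m n))"
          unfolding coef[OF wm] coef[OF vm] by (simp add: v_def mult.assoc)
        then have "cnj (cnj (L2_inner MM w (EE m n))) = cnj (of_real (lam k) * cnj (L2_inner MM v (EE m n)))" by (rule arg_cong)
        then show ?thesis unfolding ek_def mn by simp
      qed
      have "(\<lambda>k. D.co u k * cnj (D.co w k)) sums L2_inner MM u w" by (rule D.G_parseval[OF uh wm])
      moreover have "(\<lambda>k. D.co h k * cnj (D.co v k)) sums cnj (L2_inner MM v h)"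
      proof -
        have "(v, w) \<in> D.G" using vm wm vw by (simp add: D.G_def)
        from sums_cnj[THEN iffD2, OF D.G_parseval[OF this h]] show ?thesis by (simp add: mult.commute)
      qed
      moreover have "cnj (L2_inner MM v h) = L2_inner MM h v" by (rule L2.ip_cnj[OF vm h, symmetric])
      moreover have "(\<lambda>k. D.co u k * cnj (D.co w k)) = (\<lambda>k. D.co h k * cnj (D.co v k))"
        by (simp add: c vw mult_ac)
      ultimately have "L2_inner MM u w = L2_inner MM h v" using sums_unique2 by metis
      moreover have "L2_inner MM u w = (LINT z:Om|lborel. u z * A z)"
        unfolding inner_MM[OF u wm] by (rule set_lebesgue_integral_cong) (use Om_sets wA in auto)
      moreover have "L2_inner MM h v = (LINT z:Om|lborel. h z * \<psi> z * of_real (\<rho> (snd z)))"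
        unfolding inner_MM[OF h vm] by (simp add: v_def mult_ac)
      ultimately show ?thesis by (simp add: A_def)
    qed
    then show ?thesis using u h unfolding beam_graph_def opx_def by blast
  qed
  ultimately show "p \<in> beam_graph T \<alpha> \<beta> \<rho> \<eta> \<longleftrightarrow> p \<in> D.G" unfolding p by blast
qed

lemma beam_null_eq: "beam_null T \<alpha> \<beta> \<rho> \<eta> = D.nulls"
  unfolding beam_null_def D.nulls_def beam_graph_eq ..

lemma beam_range_eq: "beam_range T \<alpha> \<beta> \<rho> \<eta> = L2_orthogonal MM D.nulls"
  unfolding beam_range_def beam_graph_eq by (rule D.range_G)

lemma beam_inverse_eq: "beam_inverse_graph T \<alpha> \<beta> \<rho> \<eta> = D.inv_graph"
  unfolding beam_inverse_graph_def D.inv_graph_def beam_graph_eq beam_null_eq ..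

end

section \<open>Eigenspaces of the definition and solutions of the first-order system\<close>

context beam_setting
begin

text \<open>Continuity of \<open>w\<close> up to the ends upgrades the interior equation, because
  \<open>m1\<close> is a primitive of \<open>w\<close>. The definition of the eigenspace asks for
  exactly this one-sided differentiability.\<close>

lemma chain_end_deriv:
  assumes "chain \<phi> \<phi>1 m m1 w" "x \<in> {0..pi}"
  shows "(m1 has_vector_derivative w x) (at x within {0..pi})"
proof -
  note a = chainD[OF assms(1)]
  have "m1 y = m1 0 + prim w y" if y: "y \<in> {0..pi}" for y
  proof -
    have "(w has_integral m1 y - m1 0) {0..y}"
    proof (rule fundamental_theorem_of_calculus_interior)
      show "continuous_on {0..y} m1" by (rule continuous_on_subset[OF VC_D[OF a(4)]]) (use y in auto)
    qed (use y a(10) in auto)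
    then show ?thesis by (simp add: prim_def integral_unique)
  qed
  moreover have "((\<lambda>y. m1 0 + prim w y) has_vector_derivative w x) (at x within {0..pi})"
    using prim_deriv[OF a(5) assms(2)] by (auto intro!: derivative_eq_intros)
  ultimately show ?thesis using has_vd_cong_on[of "{0..pi}" m1 "\<lambda>y. m1 0 + prim w y" x "w x"] assms(2) by blast
qed

lemma D_pi_eq: "(f has_vector_derivative d) (at x within {0..pi}) \<Longrightarrow> x \<in> {0..pi} \<Longrightarrow> D_pi f x = d"
  unfolding D_pi_def by (rule vd_eq) simp_all

lemma D_pi_works:
  "f differentiable_on {0..pi} \<Longrightarrow> x \<in> {0..pi} \<Longrightarrow> (f has_vector_derivative D_pi f x) (at x within {0..pi})"
  by (simp add: D_pi_def differentiable_on_def vector_derivative_works[symmetric])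

lemma vd_differentiable_on:
  assumes "\<And>x. x \<in> {0..pi} \<Longrightarrow> (f has_vector_derivative d x) (at x within {0..pi})"
    and "\<And>x. x \<in> {0..pi} \<Longrightarrow> g x = f x"
  shows "g differentiable_on {0..pi}" "x \<in> {0..pi} \<Longrightarrow> D_pi g x = d x"
proof -
  have g: "(g has_vector_derivative d x) (at x within {0..pi})" if "x \<in> {0..pi}" for x
    using assms(1)[OF that] has_vd_cong_on[of "{0..pi}" g f x "d x"] assms(2) that by simp
  then show "g differentiable_on {0..pi}" unfolding differentiable_on_def by (blast intro: differentiableI_vector)
  show "x \<in> {0..pi} \<Longrightarrow> D_pi g x = d x" using g by (blast intro: D_pi_eq)
qed

lemma boundary_iff:
  assumes "x \<in> {0, pi}" "m = of_real (\<eta> x) * d2"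
  shows "2 * complex_of_real (\<alpha> x + \<beta> x) * d1 + d2 = 0 \<longleftrightarrow> m = - of_real (2 * (\<alpha> x + \<beta> x) * \<eta> x) * d1"
proof -
  have "\<eta> x \<noteq> 0" using eta_pos[of x] assms(1) by auto
  moreover have "m + of_real (2 * (\<alpha> x + \<beta> x) * \<eta> x) * d1 = of_real (\<eta> x) * (2 * complex_of_real (\<alpha> x + \<beta> x) * d1 + d2)"
    unfolding assms(2) by (simp add: algebra_simps)
  ultimately show ?thesis by (simp add: eq_neg_iff_add_eq_0)
qed

lemma eig_iff: "eig \<nu> \<phi> \<longleftrightarrow> \<phi> \<in> beam_eigenspace \<alpha> \<beta> \<rho> \<eta> \<nu>"
proof
  assume e: "eig \<nu> \<phi>"
  then obtain \<phi>1 m m1 where b: "bvp \<phi> \<phi>1 m m1 (\<lambda>x. of_real (\<rho> x) * (of_real \<nu> * \<phi> x))" unfolding eig_def by blast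
  then have ch: "chain \<phi> \<phi>1 m m1 (\<lambda>x. of_real (\<rho> x) * (of_real \<nu> * \<phi> x))" by (simp add: bvp_def)
  note a = chainD[OF ch]
  have bc: "\<phi> 0 = 0" "\<phi> pi = 0" "m 0 = - of_real c0 * \<phi>1 0" "m pi = - of_real cp * \<phi>1 pi"
    using b by (auto simp: bvp_def)
  define M where "M = (\<lambda>x. complex_of_real (\<eta> x) * D_pi (D_pi \<phi>) x)"
  have d1: "\<phi> differentiable_on {0..pi}" "\<And>x. x \<in> {0..pi} \<Longrightarrow> D_pi \<phi> x = \<phi>1 x"
    by (rule vd_differentiable_on[where f = \<phi> and d = \<phi>1]; use a(7) in blast)+
  have d2: "D_pi \<phi> differentiable_on {0..pi}" "\<And>x. x \<in> {0..pi} \<Longrightarrow> D_pi (D_pi \<phi>) x = m x / of_real (\<eta> x)"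
    by (rule vd_differentiable_on[where f = \<phi>1 and d = "\<lambda>x. m x / of_real (\<eta> x)"]; use a(8) d1(2) in blast)+
  have M: "M x = m x" if "x \<in> {0..pi}" for x unfolding M_def d2(2)[OF that] using eta_pos[OF that] by simp
  have d3: "M differentiable_on {0..pi}" "\<And>x. x \<in> {0..pi} \<Longrightarrow> D_pi M x = m1 x"
    by (rule vd_differentiable_on[where f = m and d = m1]; use a(9) M in blast)+
  have d4: "D_pi M differentiable_on {0..pi}" "\<And>x. x \<in> {0..pi} \<Longrightarrow> D_pi (D_pi M) x = of_real (\<rho> x) * (of_real \<nu> * \<phi> x)"
    by (rule vd_differentiable_on[where f = m1 and d = "\<lambda>x. of_real (\<rho> x) * (of_real \<nu> * \<phi> x)"];
      use chain_end_deriv[OF ch] d3(2) in blast)+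
  have eq: "1 / complex_of_real (\<rho> x) * D_pi (D_pi M) x = of_real \<nu> * \<phi> x" if x: "x \<in> {0<..<pi}" for x
    using d4(2)[of x] rho_gt[of x] x by (simp add: greaterThanLessThan_iff)
  have ends: "\<phi> x = 0" "2 * complex_of_real (\<alpha> x + \<beta> x) * D_pi \<phi> x + D_pi (D_pi \<phi>) x = 0" if x: "x \<in> {0, pi}" for x
  proof -
    have x': "x \<in> {0..pi}" using x by auto
    have "m x = of_real (\<eta> x) * D_pi (D_pi \<phi>) x" using M[OF x'] by (simp add: M_def)
    moreover have "m x = - of_real (2 * (\<alpha> x + \<beta> x) * \<eta> x) * D_pi \<phi> x" "\<phi> x = 0"
      using bc x unfolding d1(2)[OF x'] c0_eq cp_eq by auto
    ultimately show "\<phi> x = 0" "2 * complex_of_real (\<alpha> x + \<beta> x) * D_pi \<phi> x + D_pi (D_pi \<phi>) x = 0"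
      using boundary_iff[OF x] by blast+
  qed
  have out: "\<phi> x = 0" if "x \<notin> {0..pi}" for x using e that unfolding eig_def by blast
  show "\<phi> \<in> beam_eigenspace \<alpha> \<beta> \<rho> \<eta> \<nu>"
    unfolding beam_eigenspace_def Let_def
    by (intro CollectI conjI ballI allI impI;
      (rule d1(1) d2(1) d3(1)[unfolded M_def] d4(1)[unfolded M_def] |
      (rule eq[unfolded M_def] ends(2), assumption) | (rule ends(1), assumption) | (rule out, assumption)))
next
  assume e: "\<phi> \<in> beam_eigenspace \<alpha> \<beta> \<rho> \<eta> \<nu>"
  define M where "M = (\<lambda>x. complex_of_real (\<eta> x) * D_pi (D_pi \<phi>) x)"
  have d: "\<phi> differentiable_on {0..pi}" "D_pi \<phi> differentiable_on {0..pi}" "M differentiable_on {0..pi}" "D_pi M differentiable_on {0..pi}"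
    and eq: "\<And>x. x \<in> {0<..<pi} \<Longrightarrow> 1 / complex_of_real (\<rho> x) * D_pi (D_pi M) x = of_real \<nu> * \<phi> x"
    and bc: "\<And>x. x \<in> {0, pi} \<Longrightarrow> \<phi> x = 0 \<and> 2 * complex_of_real (\<alpha> x + \<beta> x) * D_pi \<phi> x + D_pi (D_pi \<phi>) x = 0"
    and out: "\<And>x. x \<notin> {0..pi} \<Longrightarrow> \<phi> x = 0"
    using e unfolding beam_eigenspace_def Let_def M_def by blast+
  let ?w = "\<lambda>x. of_real (\<rho> x) * (of_real \<nu> * \<phi> x)"
  have phiV: "\<phi> \<in> VC" "D_pi M \<in> VC" using differentiable_imp_continuous_on[OF d(1)] differentiable_imp_continuous_on[OF d(4)] by (auto simp: VC_def)
  have "(D_pi \<phi> has_vector_derivative M x / of_real (\<eta> x)) (at x within {0..pi})" if x: "x \<in> {0..pi}" for x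
    using D_pi_works[OF d(2) x] eta_pos[OF x] by (simp add: M_def)
  moreover have "(D_pi M has_vector_derivative ?w x) (at x)" if x: "x \<in> {0<..<pi}" for x
  proof -
    have x': "x \<in> {0..pi}" using x by auto
    have "D_pi (D_pi M) x = of_real (\<rho> x) * (1 / complex_of_real (\<rho> x) * D_pi (D_pi M) x)" using rho_gt[OF x'] by simp
    also have "\<dots> = ?w x" unfolding eq[OF x] ..
    finally show ?thesis using within_interior[OF x D_pi_works[OF d(4) x']] by simp
  qed
  moreover have "?w \<in> VC" using phiV(1) by (intro rho_VC) (auto simp: VC_def intro!: continuous_intros)
  ultimately have ch: "chain \<phi> (D_pi \<phi>) M (D_pi M) ?w"
    unfolding chain_def using D_pi_works[OF d(1)] D_pi_works[OF d(3)] phiV(2) by blast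
  have "M x = - of_real (2 * (\<alpha> x + \<beta> x) * \<eta> x) * D_pi \<phi> x" if "x \<in> {0, pi}" for x
    using boundary_iff[OF that, of "M x" "D_pi (D_pi \<phi>) x"] bc[OF that] unfolding M_def by blast
  from this[of 0] this[of pi] have "M 0 = - of_real c0 * D_pi \<phi> 0" "M pi = - of_real cp * D_pi \<phi> pi"
    unfolding c0_eq cp_eq by simp_all
  then have "bvp \<phi> (D_pi \<phi>) M (D_pi M) ?w"
    unfolding bvp_def using ch bc[of 0] bc[of pi] by simp
  then show "eig \<nu> \<phi>" unfolding eig_def using out by blast
qed

end

lemma exp_primitive:
  fixes f F :: "real \<Rightarrow> real"
  assumes f: "continuous_on {0..pi} f" and F: "\<And>x. x \<in> {0..pi} \<Longrightarrow> F x = k * exp (4 * (LBINT s:{0..x}. f s))"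
    and x: "x \<in> {0..pi}"
  shows "(F has_real_derivative 4 * f x * F x) (at x within {0..pi})"
proof -
  have eq: "F y = k * exp (4 * integral {0..y} f)" if y: "y \<in> {0..pi}" for y
  proof -
    have "set_integrable lborel {0..y} f"
      by (intro borel_integrable_atLeastAtMost' continuous_on_subset[OF f]) (use y in auto)
    from set_borel_integral_eq_integral(2)[OF this] show ?thesis using F[OF y] by simp
  qed
  have "((\<lambda>y. k * exp (4 * integral {0..y} f)) has_real_derivative 4 * f x * F x) (at x within {0..pi})"
    using eq[OF x] by (auto intro!: derivative_eq_intros integral_has_real_derivative[OF f x])
  then show ?thesis
    unfolding has_field_derivative_def by (rule has_derivative_transform[OF x, rotated]) (rule eq)
qed

theorem proposition2p2:
  fixes p q :: nat
    and T a :: real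
    and \<alpha> \<beta> \<rho> \<eta> :: "real \<Rightarrow> real"
    and \<mu> b :: "nat \<Rightarrow> real"
  defines "M \<equiv> beam_measure T \<rho>"
    and "R \<equiv> beam_range T \<alpha> \<beta> \<rho> \<eta>"
    and "N \<equiv> beam_null T \<alpha> \<beta> \<rho> \<eta>"
    and "Linv \<equiv> beam_inverse_graph T \<alpha> \<beta> \<rho> \<eta>"
    and "\<delta> \<equiv> beam_delta T \<mu>"
    and "\<gamma> \<equiv> beam_gamma T \<mu>"
  assumes period: "p > 0" "q > 0" "coprime p q" "T = 2 * pi * real p / real q"
    and A1: "\<alpha> \<in> W3" "\<beta> \<in> W3" "continuous_on {0..pi} \<alpha>" "continuous_on {0..pi} \<beta>"
    and A2: "\<eta> 0 = 1"
      "\<And>x. x \<in> {0..pi} \<Longrightarrow> \<rho> x = \<rho> 0 * exp (4 * (LBINT s:{0..x}. \<beta> s))"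
      "\<And>x. x \<in> {0..pi} \<Longrightarrow> \<rho> x > 1"
      "\<And>x. x \<in> {0..pi} \<Longrightarrow> \<eta> x = exp (4 * (LBINT s:{0..x}. \<alpha> s))"
      "(LBINT x:{0..pi}. (\<rho> x / \<eta> x) powr (1 / 4)) = pi"
    and eigenvalues: "beam_eigenvalues \<alpha> \<beta> \<rho> \<eta> \<mu>"
    and asymptotics: "bounded (range b)"
      "(\<lambda>n. \<mu> n - (real n ^ 4 + 2 * (real n)\<^sup>2 * a + b n)) \<in> o(\<lambda>n. 1 / real n)"
    and irrational: "a \<notin> \<rat>"
  shows "L2_closed M R \<and>
    L2_orthogonal M N = R \<and>
    L2_direct_sum M R N \<and>
    L2_bounded_linear_graph M R R Linv \<and>
    L2_compact_graph M R Linv \<and>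
    0 < \<delta> \<and> 0 < \<gamma> \<and>
    (\<forall>(h, u) \<in> Linv. L2_norm M u \<le> 1 / \<delta> * L2_norm M h) \<and>
    (\<forall>(h, u) \<in> Linv. L2_inner M u h \<in> \<real> \<and>
       Re (L2_inner M u h) \<ge> - (1 / \<gamma>) * (L2_norm M h)\<^sup>2) \<and>
    (\<exists>C::real. \<forall>(h, u) \<in> Linv. Linfty_norm M u \<le> ereal (C * L2_norm M h))"
proof -
  have T: "0 < T" using period by simp
  obtain \<alpha>' where \<alpha>': "continuous_on {0..pi} \<alpha>'" "\<And>x. x \<in> {0..pi} \<Longrightarrow> (\<alpha> has_real_derivative \<alpha>' x) (at x within {0..pi})"
    using W3_C1[OF A1(1,3)] by blast
  have rd: "(\<rho> has_real_derivative 4 * \<beta> x * \<rho> x) (at x within {0..pi})" if "x \<in> {0..pi}" for x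
    by (rule exp_primitive[OF A1(4) A2(2) that])
  have ed: "(\<eta> has_real_derivative 4 * \<alpha> x * \<eta> x) (at x within {0..pi})" if "x \<in> {0..pi}" for x
    by (rule exp_primitive[OF A1(3) _ that, of _ 1]) (use A2(4) in simp)
  have \<rho>c: "continuous_on {0..pi} \<rho>" and \<eta>c: "continuous_on {0..pi} \<eta>"
    by (rule DERIV_continuous_on, erule rd) (rule DERIV_continuous_on, erule ed)
  \<comment> \<open>The first two derivatives of the exponential formula for \<open>\<eta>\<close>;
    the second one uses \<open>\<alpha>'\<close> from \<open>W3_C1\<close>.\<close>
  define \<eta>1 where "\<eta>1 x = 4 * \<alpha> x * \<eta> x" for x
  define \<eta>2 where "\<eta>2 x = 4 * (\<alpha>' x * \<eta> x + \<alpha> x * \<eta>1 x)" for x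
  define c0 cp where "c0 = 2 * (\<alpha> 0 + \<beta> 0) * \<eta> 0" and "cp = 2 * (\<alpha> pi + \<beta> pi) * \<eta> pi"
  have setting: "beam_setting \<rho> \<eta> c0 cp T \<alpha> \<beta> \<eta>1 \<eta>2"
  proof
    show "0 < \<eta> x" if "x \<in> {0..pi}" for x using A2(4)[OF that] by simp
    show "(\<eta> has_real_derivative \<eta>1 x) (at x within {0..pi})" if "x \<in> {0..pi}" for x
      using ed[OF that] by (simp add: \<eta>1_def)
    show "(\<eta>1 has_real_derivative \<eta>2 x) (at x within {0..pi})" if "x \<in> {0..pi}" for x
      unfolding \<eta>1_def[abs_def] \<eta>2_def using \<alpha>'(2)[OF that] ed[OF that]
      by (auto intro!: derivative_eq_intros simp: algebra_simps \<eta>1_def)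
    show "continuous_on {0..pi} \<eta>2" unfolding \<eta>2_def[abs_def] \<eta>1_def by (intro continuous_intros \<alpha>'(1) \<eta>c A1(3))
  qed (use T \<rho>c \<eta>c A2(3) in \<open>simp_all add: c0_def cp_def\<close>)
  interpret S: beam_setting \<rho> \<eta> c0 cp T \<alpha> \<beta> \<eta>1 \<eta>2 by (rule setting)
  obtain B where B: "0 \<le> B" "\<And>n. \<bar>\<mu> n - (real n ^ 4 + 2 * (real n)\<^sup>2 * a)\<bar> \<le> B"
    using remainder_bounded[OF asymptotics] by blast
  obtain Cm n0 where growth: "0 < Cm" "\<And>n. 1 \<le> n \<Longrightarrow> \<mu> n \<le> Cm * real n ^ 4" "\<And>n. n0 \<le> n \<Longrightarrow> (real n)\<^sup>2 \<le> \<mu> n"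
    using eigenvalue_growth[OF B] by blast
  obtain c1 B1 where c1: "0 < c1" "0 \<le> B1" "\<And>m n. c1 * ((real n)\<^sup>2 + \<bar>of_int m\<bar>) - B1 \<le> \<bar>\<mu> n - (vartheta T m)\<^sup>2\<bar>"
    using eigenvalue_gap[OF B irrational period(1,2,4)] by blast
  obtain gc where gc: "0 < gc"
    "\<And>m n. 1 \<le> n \<Longrightarrow> \<mu> n \<noteq> (vartheta T m)\<^sup>2 \<Longrightarrow> gc * ((real n)\<^sup>2 + \<bar>of_int m\<bar>) \<le> \<bar>\<mu> n - (vartheta T m)\<^sup>2\<bar>"
    and \<delta>: "0 < \<delta>" "\<And>m n. 1 \<le> n \<Longrightarrow> \<mu> n \<noteq> (vartheta T m)\<^sup>2 \<Longrightarrow> \<delta> \<le> \<bar>\<mu> n - (vartheta T m)\<^sup>2\<bar>"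
    and \<gamma>: "0 < \<gamma>" "\<And>m n. 1 \<le> n \<Longrightarrow> \<mu> n < (vartheta T m)\<^sup>2 \<Longrightarrow> \<gamma> \<le> (vartheta T m)\<^sup>2 - \<mu> n"
    and fin: "finite {(m, n). \<mu> n = (vartheta T m)\<^sup>2}"
    by (rule eigenvalue_gap_consequences[OF c1 T, folded \<delta>_def \<gamma>_def]) (rule that; blast)
  \<comment> \<open>This equality transfers the counting condition of
    \<open>beam_eigenvalues\<close> to the eigenspaces of the spectral construction.\<close>
  have "Collect (S.eig \<nu>) = beam_eigenspace \<alpha> \<beta> \<rho> \<eta> \<nu>" for \<nu> using S.eig_iff by blast
  then have cnt: "finite {n. 1 \<le> n \<and> \<mu> n = \<nu>} \<and>
      card {n. 1 \<le> n \<and> \<mu> n = \<nu>} = vector_space.dim (\<lambda>(c::complex) \<phi> x. c * \<phi> x) (Collect (S.eig \<nu>))" for \<nu>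
    using eigenvalues by (simp add: beam_eigenvalues_def)
  obtain \<phi> where \<phi>: "S.IR.ortho_fam {1..} \<phi>" "\<And>n. 1 \<le> n \<Longrightarrow> S.eig (\<mu> n) (\<phi> n)"
    "\<And>f x. f \<in> VC \<Longrightarrow> (\<And>n. 1 \<le> n \<Longrightarrow> ipw \<rho> f (\<phi> n) = 0) \<Longrightarrow> x \<in> {0..pi} \<Longrightarrow> f x = 0" 
  proof (rule S.eigenbasis_exists)
    show "finite {n. 1 \<le> n \<and> \<mu> n = \<nu>} \<and>
      card {n. 1 \<le> n \<and> \<mu> n = \<nu>} = vector_space.dim (\<lambda>(c::complex) \<phi> x. c * \<phi> x) (Collect (S.eig \<nu>))" for \<nu>
      by (rule cnt)
    fix \<phi> assume a: "S.IR.ortho_fam {1..} \<phi>" "\<And>n. 1 \<le> n \<Longrightarrow> S.eig (\<mu> n) (\<phi> n)"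
      "\<And>f x. f \<in> VC \<Longrightarrow> (\<And>n. 1 \<le> n \<Longrightarrow> ipw \<rho> f (\<phi> n) = 0) \<Longrightarrow> x \<in> {0..pi} \<Longrightarrow> f x = 0"
    show thesis
      by (rule that[OF a(1)], erule a(2), rule a(3); simp)
  qed
  interpret P: beam_spectral \<rho> \<eta> c0 cp T \<alpha> \<beta> \<eta>1 \<eta>2 \<phi> \<mu> n0 Cm gc
    by unfold_locales (use \<phi> growth gc fin in blast)+
  have lam: "\<delta> \<le> \<bar>P.lam k\<bar>" if "P.lam k \<noteq> 0" for k
    using that \<delta>(2)[OF idx_snd[of k]] by (simp add: P.lam_def)
  have lam': "\<gamma> \<le> - P.lam k" if "P.lam k < 0" for k
    using that \<gamma>(2)[OF idx_snd[of k]] by (simp add: P.lam_def)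
  have N: "N = P.D.nulls" and R: "R = L2_orthogonal M P.D.nulls" and L: "Linv = P.D.inv_graph"
    unfolding N_def R_def Linv_def M_def by (rule P.beam_null_eq P.beam_range_eq P.beam_inverse_eq)+
  have norm: "L2_norm M u \<le> 1 / \<delta> * L2_norm M h" if "(h, u) \<in> P.D.inv_graph" for h u
    unfolding M_def by (rule P.D.inv_norm_le[OF \<delta>(1) lam that])
  have inner: "L2_inner M u h \<in> \<real>" "Re (L2_inner M u h) \<ge> - (1 / \<gamma>) * (L2_norm M h)\<^sup>2" if "(h, u) \<in> P.D.inv_graph" for h u
    unfolding M_def by (rule P.D.inv_inner[OF \<gamma>(1) _ that], erule lam')+
  have "\<exists>C::real. \<forall>(h, u) \<in> P.D.inv_graph. Linfty_norm M u \<le> ereal (C * L2_norm M h)"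
    unfolding M_def by (intro exI ballI, clarify) (rule P.D.inv_Linfty)
  moreover have "L2_closed M (L2_orthogonal M P.D.nulls)" "L2_direct_sum M (L2_orthogonal M P.D.nulls) P.D.nulls"
    "L2_compact_graph M (L2_orthogonal M P.D.nulls) P.D.inv_graph"
    unfolding M_def by (rule P.D.closed_ortho P.D.direct_sum P.D.inv_compact)+
  moreover have "L2_bounded_linear_graph M (L2_orthogonal M P.D.nulls) (L2_orthogonal M P.D.nulls) P.D.inv_graph"
    unfolding M_def by (rule P.D.inv_bounded_linear[OF \<delta>(1) lam])
  ultimately show ?thesis unfolding N R L using \<delta>(1) \<gamma>(1) norm inner by blast
qed

end
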